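(* Let $(\mathcal{A},\phi)$ be a non-degenerated $W^*$-probability space and let $(x_i)_{i\in\mathbb{Z}}$ be a bilateral infinite sequence of selfadjoint random variables in $\mathcal{A}$ which generate $\mathcal{A}$ as a von Neumann algebra, the unit of $\mathcal{A}$ being contained in the WOT-closure of the non-unital algebra generated by $(x_i)_{i\in\mathbb{Z}}$. Let $\mathcal{A}^+_{tail}=\bigcap_{k>0}\mathcal{A}^+_k$, where $\mathcal{A}^+_k$ is the WOT closure of the non-unital algebra generated by $\{x_i : i\geq k\}$. Then the following are equivalent: (a) The joint distribution of $(x_i)_{i\in\mathbb{Z}}$ is boolean spreadable. (b) There is a $\phi$-preserving conditional expectation $E:\mathcal{A}\to\mathcal{A}^+_{tail}$ onto the (non-unital) tail algebra such that the sequence $(x_i)_{i\in\mathbb{Z}}$ is identically distributed and boolean independent with respect to $E$.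
   Context: **Non-degenerated $W^*$-probability space.** A pair $(\mathcal{A},\phi)$ with $\mathcal{A}$ a von Neumann algebra and $\phi$ a normal state such that $x=0$ whenever $\phi(axb)=0$ for all $a,b\in\mathcal{A}$ ($\phi$ is not assumed faithful). The GNS representation of $\phi$ is then faithful; $\mathcal{A}$ is identified with its image, and WOT refers to it. **Boolean spreadability.** $\mathbb{C}\langle X_1,\dots,X_n\rangle$ is the algebra of noncommutative polynomials. The joint distribution of $x_1,\dots,x_n\in\mathcal{A}$ is $\mu_{x_1,\dots,x_n}(p)=\phi(p(x_1,\dots,x_n))$. For $k\le n$ in $\mathbb{N}$, $B_i(n,k)$ is the universal unital $C^*$-algebra generated by elements $u_{i,j}$ ($1\le i\le n$, $1\le j\le k$) and a projection $\mathbf{P}$ such that: (1) each $u_{i,j}$ is an orthogonal projection; (2) $\sum_{i=1}^nu_{i,j}\mathbf{P}=\mathbf{P}$ for $1\le j\le k$; (3) $u_{i,j}u_{i',j'}=0$ if $j<j'$ and $i\ge i'$. Let $\alpha^{(b)}_{n,k}:\mathbb{C}\langle X_1,\dots,X_k\rangle\to\mathbb{C}\langle X_1,\dots,X_n\rangle\otimes B_i(n,k)$ be the unital homomorphism with $X_j\mapsto\sum_{i=1}^nX_i\otimes u_{i,j}$. The sequence $(x_1,\dots,x_n)$ is $B_i(n,k)$-spreadable if $\mu_{x_1,\dots,x_n}(p)\mathbf{P}=\mathbf{P}\,\big[(\mu_{x_1,\dots,x_n}\otimes id)(\alpha^{(b)}_{n,k}(p))\big]\,\mathbf{P}$ for all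 $p\in\mathbb{C}\langle X_1,\dots,X_k\rangle$; it is boolean spreadable if this holds for all $k=1,\dots,n-1$. A sequence indexed by an ordered infinite set is boolean spreadable if all its finite subsequences $(x_{i_1},\dots,x_{i_l})$, $i_1<\dots<i_l$, are. **Conditional expectations and independence.** Algebras need not be unital or share units. For a subalgebra $\mathcal{B}$ of an algebra $\mathcal{C}$, a conditional expectation $E:\mathcal{C}\to\mathcal{B}$ is a surjective linear map with $E[b_1ab_2]=b_1E[a]b_2$ and $E[b]=b$ for $a\in\mathcal{C}$, $b,b_1,b_2\in\mathcal{B}$; $\phi$-preserving means $\phi\circ E=\phi$. $\mathcal{B}\langle X\rangle_0$ is the linear span of monomials $b_0Xb_1X\cdots Xb_n$, $n\ge1$, where each $b_j$ is in $\mathcal{B}$ or a scalar. $(x_i)$ is identically distributed w.r.t. $E$ if $E[p(x_i)]=E[p(x_j)]$ for all $i,j$ and all $p\in\mathcal{B}\langle X\rangle_0$. It is boolean independent w.r.t. $E$ if $E[p_1(x_{i_1})\cdots p_n(x_{i_n})]=E[p_1(x_{i_1})]\cdots E[p_n(x_{i_n})]$ whenever $i_1\neq i_2\ne\cdots\neq i_n$ (consecutive indices distinct) and $p_1,\dots,p_n\in\mathcal{B}\langle X\rangle_0$. *)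

theory Defs
  imports "HOL-Analysis.Analysis" "HOL-Library.Poly_Mapping" "HOL-Library.Nonpos_Ints"
begin

section \<open>Complex Hilbert spaces and bounded operators\<close>

class scaleC =
  fixes scaleC :: "complex \<Rightarrow> 'a \<Rightarrow> 'a"  (infixr \<open>*\<^sub>C\<close> 75)

class complex_vector = scaleC + ab_group_add +
  assumes scaleC_add_right: "c *\<^sub>C (x + y) = c *\<^sub>C x + c *\<^sub>C y"
    and scaleC_add_left: "(c + d) *\<^sub>C x = c *\<^sub>C x + d *\<^sub>C x"
    and scaleC_scaleC: "c *\<^sub>C d *\<^sub>C x = (c * d) *\<^sub>C x"
    and scaleC_one: "1 *\<^sub>C x = x"

text \<open>The complex inner product is linear in its first argument.  Its real part is the inner
  product of the library, so the norm and the topology are the usual ones.\<close>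

class complex_hilbert = complex_vector + real_inner + complete_space +
  fixes cinner :: "'a \<Rightarrow> 'a \<Rightarrow> complex"
  assumes scaleC_of_real: "complex_of_real r *\<^sub>C x = r *\<^sub>R x"
    and cinner_commute: "cinner x y = cnj (cinner y x)"
    and cinner_add_left: "cinner (x + y) z = cinner x z + cinner y z"
    and cinner_scaleC_left: "cinner (c *\<^sub>C x) y = c * cinner x y"
    and Re_cinner: "Re (cinner x y) = inner x y"

instantiation complex :: complex_hilbert
begin

definition scaleC_complex :: "complex \<Rightarrow> complex \<Rightarrow> complex"
  where "scaleC_complex c x = c * x"

definition cinner_complex :: "complex \<Rightarrow> complex \<Rightarrow> complex"
  where "cinner_complex x y = x * cnj y"

instance
  by standard (auto simp: scaleC_complex_def cinner_complex_def algebra_simps inner_complex_def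
      scaleR_conv_of_real)

end

typedef (overloaded) 'h bop =
  "{T :: 'h :: complex_hilbert \<Rightarrow> 'h. bounded_linear T \<and> (\<forall>c v. T (c *\<^sub>C v) = c *\<^sub>C T v)}"
  morphisms bop_apply Bop
  by (rule exI [of _ "\<lambda>x. x"]) simp

setup_lifting type_definition_bop

lemma scaleC_zero_right [simp]: "c *\<^sub>C (0 :: 'a :: complex_vector) = 0"
  using scaleC_add_right [of c 0 "0 :: 'a"] by simp

lemma scaleC_minus_right [simp]: "c *\<^sub>C (- x) = - (c *\<^sub>C (x :: 'a :: complex_vector))"
  using scaleC_add_right [of c x "- x"] by (simp add: eq_neg_iff_add_eq_0 add.commute)

lemma bounded_linear_scaleC:
  "bounded_linear (\<lambda>v :: 'h :: complex_hilbert. c *\<^sub>C v)"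
proof (rule bounded_linear_intro [where K = "cmod c"])
  fix x y :: 'h and r :: real
  show "c *\<^sub>C (x + y) = c *\<^sub>C x + c *\<^sub>C y"
    by (rule scaleC_add_right)
  show "c *\<^sub>C (r *\<^sub>R x) = r *\<^sub>R (c *\<^sub>C x)"
    by (simp add: scaleC_of_real [symmetric] scaleC_scaleC mult.commute)
  have "cinner (c *\<^sub>C x) (c *\<^sub>C x) = c * cnj (c * cinner x x)"
    by (metis cinner_commute cinner_scaleC_left)
  also have "\<dots> = (c * cnj c) * cinner x x"
    by (metis cinner_commute complex_cnj_mult mult.assoc)
  also have "\<dots> = of_real ((cmod c)\<^sup>2) * cinner x x"
    by (simp add: complex_norm_square [symmetric])
  finally have "inner (c *\<^sub>C x) (c *\<^sub>C x) = (cmod c)\<^sup>2 * inner x x"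
    by (metis Re_cinner times_complex.simps(1) Re_complex_of_real Im_complex_of_real
        mult_zero_left diff_zero)
  then show "norm (c *\<^sub>C x) \<le> norm x * cmod c"
    by (simp add: norm_eq_sqrt_inner real_sqrt_mult)
qed

instantiation bop :: (complex_hilbert) "{complex_vector, ring, monoid_mult}"
begin

lift_definition zero_bop :: "'a bop" is "\<lambda>v. 0"
  by simp

lift_definition one_bop :: "'a bop" is "\<lambda>v. v"
  by simp

lift_definition plus_bop :: "'a bop \<Rightarrow> 'a bop \<Rightarrow> 'a bop" is "\<lambda>S T v. S v + T v"
  by (simp add: bounded_linear_add scaleC_add_right)

lift_definition uminus_bop :: "'a bop \<Rightarrow> 'a bop" is "\<lambda>S v. - S v"
  by (simp add: bounded_linear_minus)

lift_definition minus_bop :: "'a bop \<Rightarrow> 'a bop \<Rightarrow> 'a bop" is "\<lambda>S T v. S v - T v"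
  by (simp only: diff_conv_add_uminus)
    (simp del: add_uminus_conv_diff add: bounded_linear_add bounded_linear_minus scaleC_add_right)

lift_definition times_bop :: "'a bop \<Rightarrow> 'a bop \<Rightarrow> 'a bop" is "\<lambda>S T v. S (T v)"
  by (simp add: bounded_linear_compose)

lift_definition scaleC_bop :: "complex \<Rightarrow> 'a bop \<Rightarrow> 'a bop" is "\<lambda>c S v. c *\<^sub>C S v"
  by (simp add: bounded_linear_compose [OF bounded_linear_scaleC] scaleC_scaleC mult.commute)

instance
proof
  fix a b d :: "'a bop" and c e :: complex
  show "a + b + d = a + (b + d)" by transfer (simp add: add.assoc)
  show "a + b = b + a" by transfer (simp add: add.commute)
  show "0 + a = a" by transfer simp
  show "- a + a = 0" by transfer simp
  show "a - b = a + - b" by transfer simp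
  show "c *\<^sub>C (a + b) = c *\<^sub>C a + c *\<^sub>C b" by transfer (simp add: scaleC_add_right)
  show "(c + e) *\<^sub>C a = c *\<^sub>C a + e *\<^sub>C a" by transfer (simp add: scaleC_add_left)
  show "c *\<^sub>C e *\<^sub>C a = (c * e) *\<^sub>C a" by transfer (simp add: scaleC_scaleC)
  show "1 *\<^sub>C a = a" by transfer (simp add: scaleC_one)
  show "a * b * d = a * (b * d)" by transfer simp
  show "1 * a = a" "a * 1 = a" by (transfer, simp)+
  show "(a + b) * d = a * d + b * d" by transfer simp
  show "a * (b + d) = a * b + a * d"
    by transfer (simp add: linear_simps(1))
qed

end

text \<open>The adjoint exists for every bounded operator by the Riesz representation theorem.\<close>

definition adj :: "'h :: complex_hilbert bop \<Rightarrow> 'h bop" where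
  "adj T = (THE S. \<forall>v w. cinner (bop_apply T v) w = cinner v (bop_apply S w))"

definition weak_operator_topology :: "'h :: complex_hilbert bop topology" where
  "weak_operator_topology = topology_generated_by
     {{T. cinner (bop_apply T v) w \<in> U} | v w U. open U}"

definition ultraweak_topology :: "'h :: complex_hilbert bop topology" where
  "ultraweak_topology = topology_generated_by
     {{T. suminf (\<lambda>n. cinner (bop_apply T (v n)) (w n)) \<in> U} | (v :: nat \<Rightarrow> 'h) (w :: nat \<Rightarrow> 'h) U.
        summable (\<lambda>n. (norm (v n))\<^sup>2) \<and> summable (\<lambda>n. (norm (w n))\<^sup>2) \<and> open U}"


section \<open>Von Neumann algebras and \<open>W\<^sup>*\<close>-probability spaces\<close>

definition complex_linear_on ::
  "'a :: complex_vector set \<Rightarrow> ('a \<Rightarrow> 'b :: complex_vector) \<Rightarrow> bool" where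
  "complex_linear_on A f \<longleftrightarrow>
     (\<forall>a\<in>A. \<forall>b\<in>A. f (a + b) = f a + f b) \<and> (\<forall>c. \<forall>a\<in>A. f (c *\<^sub>C a) = c *\<^sub>C f a)"

definition nonunital_algebra :: "'h :: complex_hilbert bop set \<Rightarrow> bool" where
  "nonunital_algebra B \<longleftrightarrow> 0 \<in> B \<and> (\<forall>a\<in>B. \<forall>b\<in>B. a + b \<in> B) \<and>
     (\<forall>c. \<forall>a\<in>B. c *\<^sub>C a \<in> B) \<and> (\<forall>a\<in>B. \<forall>b\<in>B. a * b \<in> B)"

definition von_neumann_algebra :: "'h :: complex_hilbert bop set \<Rightarrow> bool" where
  "von_neumann_algebra A \<longleftrightarrow> nonunital_algebra A \<and> 1 \<in> A \<and> (\<forall>a\<in>A. adj a \<in> A) \<and>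
     closedin weak_operator_topology A"

text \<open>A normal functional is one that is continuous in the ultraweak (\<open>\<sigma>\<close>-weak) topology.\<close>

definition normal_state :: "'h :: complex_hilbert bop set \<Rightarrow> ('h bop \<Rightarrow> complex) \<Rightarrow> bool" where
  "normal_state A \<phi> \<longleftrightarrow> complex_linear_on A \<phi> \<and> (\<forall>a\<in>A. \<phi> (adj a * a) \<in> \<real>\<^sub>\<ge>\<^sub>0) \<and> \<phi> 1 = 1 \<and>
     continuous_map (subtopology ultraweak_topology A) euclidean \<phi>"

definition nondegenerate_W_prob_space ::
  "'h :: complex_hilbert bop set \<Rightarrow> ('h bop \<Rightarrow> complex) \<Rightarrow> bool" where
  "nondegenerate_W_prob_space A \<phi> \<longleftrightarrow> von_neumann_algebra A \<and> normal_state A \<phi> \<and>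
     (\<forall>x\<in>A. (\<forall>a\<in>A. \<forall>b\<in>A. \<phi> (a * x * b) = 0) \<longrightarrow> x = 0)"

text \<open>A GNS triple of \<open>\<phi>\<close> is unique up to unitary equivalence, so nothing that is stated below in terms of
  \<open>\<pi>\<close> depends on its choice.\<close>

definition gns_representation ::
  "'h :: complex_hilbert bop set \<Rightarrow> ('h bop \<Rightarrow> complex) \<Rightarrow>
   ('h bop \<Rightarrow> 'k :: complex_hilbert bop) \<Rightarrow> 'k \<Rightarrow> bool" where
  "gns_representation A \<phi> \<pi> \<Omega> \<longleftrightarrow>
     complex_linear_on A \<pi> \<and> \<pi> 1 = 1 \<and>
     (\<forall>a\<in>A. \<forall>b\<in>A. \<pi> (a * b) = \<pi> a * \<pi> b) \<and> (\<forall>a\<in>A. \<pi> (adj a) = adj (\<pi> a)) \<and>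
     (\<forall>a\<in>A. \<phi> a = cinner (bop_apply (\<pi> a) \<Omega>) \<Omega>) \<and>
     closure ((\<lambda>a. bop_apply (\<pi> a) \<Omega>) ` A) = UNIV"

text \<open>The closure of \<open>S \<subseteq> A\<close> in the weak operator topology that \<open>A\<close> carries as an algebra of
  operators on the GNS space.\<close>

definition gns_wot_closure ::
  "'h :: complex_hilbert bop set \<Rightarrow> ('h bop \<Rightarrow> 'k :: complex_hilbert bop) \<Rightarrow>
   'h bop set \<Rightarrow> 'h bop set" where
  "gns_wot_closure A \<pi> S = {a \<in> A. \<pi> a \<in> weak_operator_topology closure_of (\<pi> ` S)}"

definition tail_algebra ::
  "'h :: complex_hilbert bop set \<Rightarrow> ('h bop \<Rightarrow> 'k :: complex_hilbert bop) \<Rightarrow>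
   (int \<Rightarrow> 'h bop) \<Rightarrow> 'h bop set" where
  "tail_algebra A \<pi> x = (\<Inter>k\<in>{0<..}. gns_wot_closure A \<pi> (nonunital_algebra hull (x ` {k..})))"


section \<open>Noncommutative polynomials\<close>

datatype 'v word = Word (letters: "'v list")

instantiation word :: (type) monoid_add
begin

definition zero_word :: "'a word" where "zero_word = Word []"

definition plus_word :: "'a word \<Rightarrow> 'a word \<Rightarrow> 'a word" where
  "plus_word u v = Word (letters u @ letters v)"

instance
  by standard (simp_all add: zero_word_def plus_word_def)

end

text \<open>Finitely supported functions on words, with the convolution product, are the noncommutative
  polynomials.  If the coefficients form an algebra \<open>C\<close>, they are the elements of
  \<open>\<complex>\<langle>X\<rangle> \<otimes> C\<close>, a monomial \<open>w \<otimes> c\<close> being \<^term>\<open>Poly_Mapping.single w c\<close>.\<close>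

type_synonym ('v, 'c) ncpoly = "'v word \<Rightarrow>\<^sub>0 'c"

definition nc_const :: "'c \<Rightarrow> ('v, 'c :: zero) ncpoly" where
  "nc_const c = Poly_Mapping.single 0 c"

definition nc_vars :: "('v, 'c :: zero) ncpoly \<Rightarrow> 'v set" where
  "nc_vars p = (\<Union>w\<in>Poly_Mapping.keys p. set (letters w))"

text \<open>The value at \<open>f\<close> of the unital homomorphism with \<open>X\<^sub>v \<mapsto> f v\<close>, where \<open>\<iota>\<close> is the embedding of the
  scalars into the target algebra.\<close>

definition nc_eval ::
  "('c \<Rightarrow> 'b) \<Rightarrow> ('v \<Rightarrow> 'b) \<Rightarrow> ('v, 'c :: zero) ncpoly \<Rightarrow> 'b :: {ring, monoid_mult}" where
  "nc_eval \<iota> f p =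
     (\<Sum>w\<in>Poly_Mapping.keys p. \<iota> (Poly_Mapping.lookup p w) * prod_list (map f (letters w)))"

definition joint_distribution ::
  "('h :: complex_hilbert bop \<Rightarrow> complex) \<Rightarrow> ('v \<Rightarrow> 'h bop) \<Rightarrow> ('v, complex) ncpoly \<Rightarrow> complex" where
  "joint_distribution \<phi> x p = \<phi> (nc_eval (\<lambda>c. c *\<^sub>C 1) x p)"


section \<open>Universal \<open>C\<^sup>*\<close>-algebras\<close>

text \<open>The universal unital \<open>C\<^sup>*\<close>-algebra with generators \<open>G\<close> and relations \<open>r = 0\<close>, \<open>r \<in> R\<close>, is the
  Hausdorff completion of the free unital \<open>*\<close>-algebra on \<open>G\<close> with respect to the largest
  \<open>C\<^sup>*\<close>-seminorm that vanishes on \<open>R\<close>.  The letters \<open>(g, False)\<close> and \<open>(g, True)\<close> stand for \<open>g\<close> and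
  \<open>g\<^sup>*\<close>.  Only elements that come from the free \<open>*\<close>-algebra are needed below; two of these have the
  same image in the universal algebra iff their difference has norm zero.\<close>

type_synonym 'g star_poly = "('g \<times> bool, complex) ncpoly"

definition free_star_algebra :: "'g set \<Rightarrow> 'g star_poly set" where
  "free_star_algebra G = {a. nc_vars a \<subseteq> G \<times> UNIV}"

definition gen :: "'g \<Rightarrow> 'g star_poly" where
  "gen g = Poly_Mapping.single (Word [(g, False)]) 1"

definition star :: "'g star_poly \<Rightarrow> 'g star_poly" where
  "star a = (\<Sum>w\<in>Poly_Mapping.keys a.
     Poly_Mapping.single (Word (rev (map (\<lambda>(g, s). (g, \<not> s)) (letters w))))
       (cnj (Poly_Mapping.lookup a w)))"

definition C_star_seminorm :: "'g set \<Rightarrow> ('g star_poly \<Rightarrow> real) \<Rightarrow> bool" where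
  "C_star_seminorm G p \<longleftrightarrow>
     (\<forall>a \<in> free_star_algebra G. p a \<ge> 0 \<and> (\<forall>c. p (nc_const c * a) = cmod c * p a) \<and>
        p (star a * a) = (p a)\<^sup>2) \<and>
     (\<forall>a \<in> free_star_algebra G. \<forall>b \<in> free_star_algebra G.
        p (a + b) \<le> p a + p b \<and> p (a * b) \<le> p a * p b)"

definition universal_C_star_norm ::
  "'g set \<Rightarrow> 'g star_poly set \<Rightarrow> 'g star_poly \<Rightarrow> ereal" where
  "universal_C_star_norm G R a = (SUP p \<in> {p. C_star_seminorm G p \<and> (\<forall>r\<in>R. p r = 0)}. ereal (p a))"

definition universal_C_star_eq ::
  "'g set \<Rightarrow> 'g star_poly set \<Rightarrow> 'g star_poly \<Rightarrow> 'g star_poly \<Rightarrow> bool" where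
  "universal_C_star_eq G R a b \<longleftrightarrow> universal_C_star_norm G R (a - b) = 0"

lemma universal_C_star_eq_iff:
  assumes "a - b \<in> free_star_algebra G"
  shows "universal_C_star_eq G R a b \<longleftrightarrow>
    (\<forall>p. C_star_seminorm G p \<and> (\<forall>r\<in>R. p r = 0) \<longrightarrow> p (a - b) = 0)"
proof -
  let ?S = "{p. C_star_seminorm G p \<and> (\<forall>r\<in>R. p r = 0)}"
  have nonneg: "p (a - b) \<ge> 0" if "p \<in> ?S" for p
    using that assms by (auto simp: C_star_seminorm_def)
  have zero: "(\<lambda>_. 0) \<in> ?S"
    by (simp add: C_star_seminorm_def)
  show ?thesis
  proof
    assume "universal_C_star_eq G R a b"
    then have *: "(SUP p\<in>?S. ereal (p (a - b))) = 0"
      by (simp add: universal_C_star_eq_def universal_C_star_norm_def)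
    have "p (a - b) = 0" if "p \<in> ?S" for p
    proof -
      have "ereal (p (a - b)) \<le> 0"
        unfolding * [symmetric] using that by (rule SUP_upper)
      then show ?thesis
        using nonneg [OF that] by simp
    qed
    then show "\<forall>p. C_star_seminorm G p \<and> (\<forall>r\<in>R. p r = 0) \<longrightarrow> p (a - b) = 0"
      by blast
  next
    assume "\<forall>p. C_star_seminorm G p \<and> (\<forall>r\<in>R. p r = 0) \<longrightarrow> p (a - b) = 0"
    then have "(SUP p\<in>?S. ereal (p (a - b))) = (SUP p\<in>?S. 0)"
      by (intro SUP_cong) auto
    also have "\<dots> = 0"
      using zero by (intro cSUP_const) blast
    finally show "universal_C_star_eq G R a b"
      by (simp add: universal_C_star_eq_def universal_C_star_norm_def)
  qed
qed


section \<open>Boolean spreadability\<close>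

datatype Bi_gen = Ugen nat nat | Pgen

abbreviation u_gen :: "nat \<Rightarrow> nat \<Rightarrow> Bi_gen star_poly" where "u_gen i j \<equiv> gen (Ugen i j)"

abbreviation P_gen :: "Bi_gen star_poly" where "P_gen \<equiv> gen Pgen"

definition Bi_generators :: "nat \<Rightarrow> nat \<Rightarrow> Bi_gen set" where
  "Bi_generators n k = insert Pgen {Ugen i j | i j. i \<in> {1..n} \<and> j \<in> {1..k}}"

definition Bi_relations :: "nat \<Rightarrow> nat \<Rightarrow> Bi_gen star_poly set" where
  "Bi_relations n k =
     {star (gen g) - gen g | g. g \<in> Bi_generators n k} \<union>
     {gen g * gen g - gen g | g. g \<in> Bi_generators n k} \<union>
     {(\<Sum>i=1..n. u_gen i j) * P_gen - P_gen | j. j \<in> {1..k}} \<union>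
     {u_gen i j * u_gen i' j' | i j i' j'. i \<in> {1..n} \<and> i' \<in> {1..n} \<and> j \<in> {1..k} \<and> j' \<in> {1..k} \<and>
        j < j' \<and> i \<ge> i'}"

definition Bi_eq :: "nat \<Rightarrow> nat \<Rightarrow> Bi_gen star_poly \<Rightarrow> Bi_gen star_poly \<Rightarrow> bool" where
  "Bi_eq n k = universal_C_star_eq (Bi_generators n k) (Bi_relations n k)"

definition Bi_coaction ::
  "nat \<Rightarrow> (nat, complex) ncpoly \<Rightarrow> (nat, Bi_gen star_poly) ncpoly" where
  "Bi_coaction n = nc_eval (\<lambda>c. nc_const (nc_const c))
     (\<lambda>j. \<Sum>i=1..n. Poly_Mapping.single (Word [i]) (u_gen i j))"

definition slice ::
  "((nat, complex) ncpoly \<Rightarrow> complex) \<Rightarrow> (nat, 'g star_poly) ncpoly \<Rightarrow> 'g star_poly" where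
  "slice \<mu> q = (\<Sum>w\<in>Poly_Mapping.keys q.
     nc_const (\<mu> (Poly_Mapping.single w 1)) * Poly_Mapping.lookup q w)"  \<comment> \<open>\<open>(\<mu> \<otimes> id) q\<close>\<close>

definition Bi_spreadable ::
  "('h :: complex_hilbert bop \<Rightarrow> complex) \<Rightarrow> nat \<Rightarrow> nat \<Rightarrow> (nat \<Rightarrow> 'h bop) \<Rightarrow> bool" where
  "Bi_spreadable \<phi> n k x \<longleftrightarrow>
     (\<forall>p. nc_vars p \<subseteq> {1..k} \<longrightarrow>
        Bi_eq n k (nc_const (joint_distribution \<phi> x p) * P_gen)
          (P_gen * slice (joint_distribution \<phi> x) (Bi_coaction n p) * P_gen))"

text \<open>Of \<open>x\<close> only \<open>(x\<^sub>1, \<dots>, x\<^sub>n)\<close> matters.\<close>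

definition boolean_spreadable ::
  "('h :: complex_hilbert bop \<Rightarrow> complex) \<Rightarrow> nat \<Rightarrow> (nat \<Rightarrow> 'h bop) \<Rightarrow> bool" where
  "boolean_spreadable \<phi> n x \<longleftrightarrow> (\<forall>k. 1 \<le> k \<and> k < n \<longrightarrow> Bi_spreadable \<phi> n k x)"

definition boolean_spreadable_family ::
  "('h :: complex_hilbert bop \<Rightarrow> complex) \<Rightarrow> ('i :: linorder \<Rightarrow> 'h bop) \<Rightarrow> bool" where
  "boolean_spreadable_family \<phi> x \<longleftrightarrow>
     (\<forall>l i. strict_mono_on {1..l} i \<longrightarrow> boolean_spreadable \<phi> l (\<lambda>m. x (i m)))"


section \<open>Conditional expectations and boolean independence\<close>

definition conditional_expectation ::
  "'h :: complex_hilbert bop set \<Rightarrow> 'h bop set \<Rightarrow> ('h bop \<Rightarrow> 'h bop) \<Rightarrow> bool" where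
  "conditional_expectation C B E \<longleftrightarrow> complex_linear_on C E \<and> E ` C = B \<and>
     (\<forall>a\<in>C. \<forall>b1\<in>B. \<forall>b2\<in>B. E (b1 * a * b2) = b1 * E a * b2) \<and> (\<forall>b\<in>B. E b = b)"

text \<open>An element of \<open>B\<langle>X\<rangle>\<^sub>0\<close> is written as a linear combination of monomials
  \<open>b\<^sub>0 X b\<^sub>1 X \<cdots> X b\<^sub>n\<close>, each given by its list of coefficients \<open>[b\<^sub>0, \<dots>, b\<^sub>n]\<close>.  Scalars are
  represented by multiples of the identity.\<close>

type_synonym 'a op_poly = "'a list \<Rightarrow>\<^sub>0 complex"

definition op_polys0 :: "'h :: complex_hilbert bop set \<Rightarrow> 'h bop op_poly set" where
  "op_polys0 B = {p. \<forall>bs\<in>Poly_Mapping.keys p. length bs \<ge> 2 \<and> set bs \<subseteq> B \<union> range (\<lambda>c. c *\<^sub>C 1)}"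

definition op_monomial_eval :: "'h :: complex_hilbert bop list \<Rightarrow> 'h bop \<Rightarrow> 'h bop" where
  "op_monomial_eval bs x = hd bs * prod_list (map (\<lambda>b. x * b) (tl bs))"

definition op_poly_eval :: "'h :: complex_hilbert bop op_poly \<Rightarrow> 'h bop \<Rightarrow> 'h bop" where
  "op_poly_eval p x =
     (\<Sum>bs\<in>Poly_Mapping.keys p. Poly_Mapping.lookup p bs *\<^sub>C op_monomial_eval bs x)"

definition identically_distributed ::
  "'h :: complex_hilbert bop set \<Rightarrow> ('h bop \<Rightarrow> 'h bop) \<Rightarrow> ('i \<Rightarrow> 'h bop) \<Rightarrow> bool" where
  "identically_distributed B E x \<longleftrightarrow>
     (\<forall>i j. \<forall>p\<in>op_polys0 B. E (op_poly_eval p (x i)) = E (op_poly_eval p (x j)))"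

definition boolean_independent ::
  "'h :: complex_hilbert bop set \<Rightarrow> ('h bop \<Rightarrow> 'h bop) \<Rightarrow> ('i \<Rightarrow> 'h bop) \<Rightarrow> bool" where
  "boolean_independent B E x \<longleftrightarrow>
     (\<forall>ps is. length ps = length is \<and> is \<noteq> [] \<and> distinct_adj is \<and> set ps \<subseteq> op_polys0 B \<longrightarrow>
        E (prod_list (map2 (\<lambda>p i. op_poly_eval p (x i)) ps is)) =
        prod_list (map2 (\<lambda>p i. E (op_poly_eval p (x i))) ps is))"

end

theory Submission
  imports Defs
begin

text \<open>If the sequence is spreadable, a representation of \<open>B\<^sub>i(n,k)\<close> on \<open>\<ell>\<^sup>2\<close> that maps the \<open>u\<^sub>i\<^sub>j\<close> to rank one
  projections shows that every maximal power \<open>x\<^sub>j\<^sup>m\<close> in a mixed moment may be replaced by its average over a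
  block of indices of any length.  In the GNS representation these averages converge strongly to the weak
  limit \<open>T\<^sub>m\<close> of \<open>x\<^sub>i\<^sup>m\<close> as \<open>i \<rightarrow> \<infinity>\<close>, so that the moments are
  \<open>\<langle>T\<^bsub>m\<^esub> T\<^bsub>m'\<^esub> \<cdots> \<Omega>, \<Omega>\<rangle>\<close>.  The projection \<open>e\<close> onto the closed span of the vectors
  \<open>T\<^bsub>m\<^esub> T\<^bsub>m'\<^esub> \<cdots> \<Omega>\<close> is the support of \<open>T\<^sub>2\<close>, hence belongs to the algebra, and
  \<open>E a = e a e\<close> is the conditional expectation.

  Conversely, boolean independence expresses the moments by the operators \<open>E (x\<^sub>0\<^sup>m)\<close>.  The recursion of the
  moments through boolean cumulants matches the relations \<open>\<Sum>\<^sub>i u\<^sub>i\<^sub>j P = P\<close> and \<open>u\<^sub>i\<^sub>j u\<^sub>i\<^sub>j\<^sub>' = 0\<close>,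
  \<open>j \<noteq> j'\<close>, so the coaction can be evaluated block by block from the right.\<close>

section \<open>Hilbert space preliminaries\<close>

text \<open>The limits of the powers must be found inside \<open>A\<close>, while spreadability
  bounds the powers only in the GNS space. Normality of \<open>\<phi>\<close> is used along
  sequences that are bounded on the original space, so the bound has to be carried back;
  \<open>norm_le_of_pi\<close>, a crude form of the isometry of faithful representations, does this.
  A second obstacle is that words approximate the elements of \<open>A\<close> without control of
  norms. The approximants are therefore chosen selfadjoint, so that they can be moved to either side
  of an inner product and are evaluated at fixed vectors only. The unit in the closure of the
  non-unital algebra is what makes \<open>e\<close> reachable: it forces a vector killed by all
  \<open>\<pi> (x n)\<close> to vanish. As \<open>T 2\<close> is the compression of
  \<open>X n ^ 2\<close> to the tail space for every \<open>n\<close>, it is then injective on that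
  space. The projection \<open>e\<close> may be inserted into a compressed word between any two
  runs. This single rule yields both the factorization in boolean independence and, since tail
  elements absorb \<open>e\<close>, its extension to polynomials with tail coefficients.\<close>

lemma cinner_zero_left [simp]: "cinner 0 (y :: 'a :: complex_hilbert) = 0"
  using cinner_add_left [of 0 0 y] by simp

lemma cinner_zero_right [simp]: "cinner (x :: 'a :: complex_hilbert) 0 = 0"
  by (metis cinner_commute cinner_zero_left complex_cnj_zero)

lemma cinner_add_right: "cinner (x :: 'a :: complex_hilbert) (y + z) = cinner x y + cinner x z"
  by (metis cinner_add_left cinner_commute complex_cnj_add)

lemma cinner_scaleC_right: "cinner (x :: 'a :: complex_hilbert) (c *\<^sub>C y) = cnj c * cinner x y"
  by (metis cinner_scaleC_left cinner_commute complex_cnj_mult)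

lemma cinner_minus_left [simp]: "cinner (- x :: 'a :: complex_hilbert) y = - cinner x y"
  using cinner_add_left [of x "- x" y] by (simp add: eq_neg_iff_add_eq_0 add.commute)

lemma cinner_minus_right [simp]: "cinner (x :: 'a :: complex_hilbert) (- y) = - cinner x y"
  using cinner_add_right [of x y "- y"] by (simp add: eq_neg_iff_add_eq_0 add.commute)

lemma cinner_diff_left: "cinner (x - y :: 'a :: complex_hilbert) z = cinner x z - cinner y z"
  using cinner_add_left [of x "- y" z] by simp

lemma cinner_diff_right: "cinner (x :: 'a :: complex_hilbert) (y - z) = cinner x y - cinner x z"
  using cinner_add_right [of x y "- z"] by simp

lemma cinner_sum_left: "cinner (\<Sum>i\<in>I. f i) (y :: 'a :: complex_hilbert) = (\<Sum>i\<in>I. cinner (f i) y)"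
  by (induction I rule: infinite_finite_induct) (auto simp: cinner_add_left)

lemma cinner_sum_right: "cinner (y :: 'a :: complex_hilbert) (\<Sum>i\<in>I. f i) = (\<Sum>i\<in>I. cinner y (f i))"
  by (induction I rule: infinite_finite_induct) (auto simp: cinner_add_right)

lemma cinner_self: "cinner x (x :: 'a :: complex_hilbert) = complex_of_real ((norm x)\<^sup>2)"
proof -
  have "Im (cinner x x) = 0"
    by (metis cinner_commute complex_cnj_cancel_iff cnj.sel(2) neg_equal_zero)
  then show ?thesis
    by (simp add: complex_eq_iff Re_cinner power2_norm_eq_inner)
qed

lemma scaleR_scaleC: "r *\<^sub>R (x :: 'a :: complex_hilbert) = complex_of_real r *\<^sub>C x"
  by (simp add: scaleC_of_real)

lemma cinner_scaleR_left: "cinner (r *\<^sub>R x :: 'a :: complex_hilbert) y = of_real r * cinner x y"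
  by (simp add: scaleR_scaleC cinner_scaleC_left)

lemma cinner_scaleR_right: "cinner (x :: 'a :: complex_hilbert) (r *\<^sub>R y) = of_real r * cinner x y"
  by (simp add: scaleR_scaleC cinner_scaleC_right)

lemma norm_scaleC: "norm (c *\<^sub>C x :: 'a :: complex_hilbert) = cmod c * norm x"
proof -
  have "complex_of_real ((norm (c *\<^sub>C x))\<^sup>2) = c * cnj c * cinner x x"
    by (subst cinner_self [symmetric]) (simp add: cinner_scaleC_left cinner_scaleC_right)
  also have "\<dots> = complex_of_real ((cmod c * norm x)\<^sup>2)"
    by (simp add: cinner_self power_mult_distrib complex_norm_square [symmetric] flip: of_real_power)
  finally have "(norm (c *\<^sub>C x))\<^sup>2 = (cmod c * norm x)\<^sup>2"
    using of_real_eq_iff by blast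
  then show ?thesis
    by (simp add: power2_eq_iff_nonneg)
qed

lemma cmod_cinner_le: "cmod (cinner x (y :: 'a :: complex_hilbert)) \<le> norm x * norm y"
proof (cases "cinner x y = 0")
  case False
  let ?u = "cnj (cinner x y) / of_real (cmod (cinner x y))"
  have "?u * cinner x y = of_real (cmod (cinner x y))"
    using False complex_norm_square [of "cinner x y"]
    by (simp add: field_simps power2_eq_square)
  then have "cmod (cinner x y) = inner (?u *\<^sub>C x) y"
    by (metis Re_cinner cinner_scaleC_left Re_complex_of_real)
  also have "\<dots> \<le> norm (?u *\<^sub>C x) * norm y"
    by (rule norm_cauchy_schwarz)
  also have "norm (?u *\<^sub>C x) = norm x"
    using False by (simp add: norm_scaleC norm_divide)
  finally show ?thesis .
qed simp

lemma bounded_bilinear_cinner: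
  "bounded_bilinear (cinner :: 'a :: complex_hilbert \<Rightarrow> 'a \<Rightarrow> complex)"
proof
  show "\<exists>K. \<forall>a b :: 'a. norm (cinner a b) \<le> norm a * norm b * K"
    by (rule exI [of _ 1]) (simp add: cmod_cinner_le)
qed (auto simp: cinner_add_left cinner_add_right cinner_scaleR_left cinner_scaleR_right
       scaleR_conv_of_real)

lemmas tendsto_cinner [tendsto_intros] = bounded_bilinear.tendsto [OF bounded_bilinear_cinner]

lemma cinner_eqI:
  assumes "\<And>w. cinner x w = cinner (y :: 'a :: complex_hilbert) w"
  shows "x = y"
proof -
  have "cinner (x - y) (x - y) = 0"
    using assms by (simp add: cinner_diff_left)
  then show ?thesis
    by (simp add: cinner_self)
qed

lemma scaleC_zero_left [simp]: "0 *\<^sub>C (x :: 'a :: complex_vector) = 0"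
  using scaleC_add_left [of 0 0 x] by simp

lemma scaleC_minus_left [simp]: "(- c) *\<^sub>C x = - (c *\<^sub>C (x :: 'a :: complex_vector))"
  using scaleC_add_left [of c "- c" x] by (simp add: eq_neg_iff_add_eq_0 add.commute)

lemma scaleC_diff_right: "c *\<^sub>C (x - y :: 'a :: complex_vector) = c *\<^sub>C x - c *\<^sub>C y"
  using scaleC_add_right [of c x "- y"] by simp

lemma scaleC_sum_right: "c *\<^sub>C (\<Sum>i\<in>I. f i) = (\<Sum>i\<in>I. c *\<^sub>C (f i :: 'a :: complex_vector))"
  by (induction I rule: infinite_finite_induct) (auto simp: scaleC_add_right)

lemma scaleC_sum_left: "(\<Sum>i\<in>I. f i) *\<^sub>C (v :: 'a :: complex_vector) = (\<Sum>i\<in>I. f i *\<^sub>C v)"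
  by (induction I rule: infinite_finite_induct) (auto simp: scaleC_add_left)

subsection \<open>Bounded operators\<close>

notation bop_apply (infixr "\<cdot>" 78)

lemma bop_eqI: "(\<And>v. S \<cdot> v = T \<cdot> v) \<Longrightarrow> S = T"
  by (metis bop_apply_inject ext)

lemmas bop_simps [simp] = zero_bop.rep_eq one_bop.rep_eq plus_bop.rep_eq minus_bop.rep_eq
  uminus_bop.rep_eq times_bop.rep_eq scaleC_bop.rep_eq

lemma bounded_linear_bop: "bounded_linear (\<lambda>v. T \<cdot> v)"
  using bop_apply [of T] by simp

lemma bop_scaleC: "T \<cdot> (c *\<^sub>C v) = c *\<^sub>C T \<cdot> v"
  using bop_apply [of T] by simp

lemma bop_add: "T \<cdot> (v + w) = T \<cdot> v + T \<cdot> w"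
  by (rule linear_simps(1) [OF bounded_linear_bop])

lemma bop_diff: "T \<cdot> (v - w) = T \<cdot> v - T \<cdot> w"
  by (rule linear_simps(2) [OF bounded_linear_bop])

lemma bop_zero [simp]: "T \<cdot> 0 = 0"
  by (rule linear_simps(3) [OF bounded_linear_bop])

lemma bop_sum: "T \<cdot> (\<Sum>i\<in>I. f i) = (\<Sum>i\<in>I. T \<cdot> f i)"
  by (induction I rule: infinite_finite_induct) (auto simp: bop_add)

lemma sum_bop: "(\<Sum>i\<in>I. f i) \<cdot> v = (\<Sum>i\<in>I. f i \<cdot> v)"
  by (induction I rule: infinite_finite_induct) auto

lemmas tendsto_bop [tendsto_intros] = bounded_linear.tendsto [OF bounded_linear_bop]

lemma scaleC_mult_left [simp]: "(c *\<^sub>C a) * b = c *\<^sub>C (a * b :: 'h :: complex_hilbert bop)"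
  by (rule bop_eqI) simp

lemma scaleC_mult_right [simp]: "a * (c *\<^sub>C b) = c *\<^sub>C (a * b :: 'h :: complex_hilbert bop)"
  by (rule bop_eqI) (simp add: bop_scaleC)

definition opnorm :: "'h :: complex_hilbert bop \<Rightarrow> real" where
  "opnorm T = onorm (\<lambda>v. T \<cdot> v)"

lemma opnorm: "norm (T \<cdot> v) \<le> opnorm T * norm v"
  unfolding opnorm_def by (rule onorm [OF bounded_linear_bop])

lemma opnorm_nonneg [simp]: "0 \<le> opnorm T"
  unfolding opnorm_def by (rule onorm_pos_le [OF bounded_linear_bop])

lemma opnorm_le: "0 \<le> C \<Longrightarrow> (\<And>v. norm (T \<cdot> v) \<le> C * norm v) \<Longrightarrow> opnorm T \<le> C"
  unfolding opnorm_def by (rule onorm_bound) auto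

lemma bop_of_linear:
  assumes "\<And>v w. f (v + w) = f v + f w" "\<And>c v. f (c *\<^sub>C v) = c *\<^sub>C f v"
    and "\<And>v. norm (f v) \<le> K * norm v"
  obtains T :: "'h :: complex_hilbert bop" where "\<And>v. T \<cdot> v = f v"
proof -
  have "bounded_linear f"
    by (rule bounded_linear_intro [where K = K])
      (use assms in \<open>auto simp: scaleR_scaleC mult.commute\<close>)
  then have "Bop f \<cdot> v = f v" for v
    using assms(2) by (subst Bop_inverse) auto
  then show thesis
    using that by blast
qed

subsection \<open>Orthogonal projections and the Riesz representation theorem\<close>

text \<open>A minimizing sequence in \<open>N\<close> is Cauchy by the parallelogram law, and its
  limit is the nearest point of the closure. The setting is real because it serves complex subspaces
  as well as the real space of selfadjoint approximants in
  \<open>selfadj_bicommutant_approx\<close>.\<close>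

lemma projection_exists:
  fixes N :: "'a :: {real_inner, complete_space} set"
  assumes N: "subspace N"
  obtains q where "q \<in> closure N" "\<And>n. n \<in> N \<Longrightarrow> inner (y - q) n = 0"
proof -
  define d where "d = infdist y N"
  have ne: "N \<noteq> {}"
    using N subspace_0 by blast
  have d_le: "d \<le> norm (y - n)" if "n \<in> N" for n
    using infdist_le [OF that, of y] by (simp add: d_def dist_norm)
  have d0: "0 \<le> d"
    by (simp add: d_def infdist_nonneg)
  have "\<exists>n\<in>N. norm (y - n) < d + 1 / real (Suc k)" for k
  proof (rule ccontr)
    assume "\<not> ?thesis"
    then have "d + 1 / real (Suc k) \<le> infdist y N"
      unfolding infdist_notempty [OF ne]
      by (intro cINF_greatest [OF ne]) (auto simp: dist_norm not_less)
    then show False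
      by (simp add: d_def)
  qed
  then obtain s where s: "\<And>k. s k \<in> N" "\<And>k. norm (y - s k) < d + 1 / real (Suc k)"
    by metis
  have lim_norm: "(\<lambda>k. norm (y - s k)) \<longlonglongrightarrow> d"
  proof (rule tendsto_sandwich [OF _ _ tendsto_const])
    show "(\<lambda>k. d + 1 / real (Suc k)) \<longlonglongrightarrow> d"
      using tendsto_add [OF tendsto_const [of d] LIMSEQ_inverse_real_of_nat]
      by (simp add: inverse_eq_divide)
    show "\<forall>\<^sub>F k in sequentially. norm (y - s k) \<le> d + 1 / real (Suc k)"
      using s(2) by (intro always_eventually allI less_imp_le)
  qed (use s d_le in auto)
  \<comment> \<open>Parallelogram law: the midpoint of \<open>s j\<close> and \<open>s k\<close>
    lies in \<open>N\<close>, hence at distance at least \<open>d\<close> from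
    \<open>y\<close>.\<close>
  have key: "(norm (s j - s k))\<^sup>2 \<le> 2 * (norm (y - s j))\<^sup>2 + 2 * (norm (y - s k))\<^sup>2 - 4 * d\<^sup>2" for j k
  proof -
    have "(1/2) *\<^sub>R (s j + s k) \<in> N"
      using N s(1) by (simp add: subspace_add subspace_scale)
    then have "d \<le> norm (y - (1/2) *\<^sub>R (s j + s k))"
      by (rule d_le)
    then have "d\<^sup>2 \<le> (norm (y - (1/2) *\<^sub>R (s j + s k)))\<^sup>2"
      using d0 by (rule power_mono)
    then show ?thesis
      by (simp add: power2_norm_eq_inner inner_diff_left inner_diff_right inner_add_left
          inner_add_right inner_commute field_simps)
  qed
  have "Cauchy s"
  proof (rule metric_CauchyI)
    fix e :: real assume e: "e > 0"
    have "(\<lambda>k. (norm (y - s k))\<^sup>2) \<longlonglongrightarrow> d\<^sup>2"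
      by (intro tendsto_intros lim_norm)
    then have "eventually (\<lambda>k. (norm (y - s k))\<^sup>2 < d\<^sup>2 + e\<^sup>2/4) sequentially"
      using e by (intro order_tendstoD(2)) auto
    then obtain M where M: "\<And>k. k \<ge> M \<Longrightarrow> (norm (y - s k))\<^sup>2 < d\<^sup>2 + e\<^sup>2/4"
      by (auto simp: eventually_sequentially)
    have "dist (s j) (s k) < e" if "j \<ge> M" "k \<ge> M" for j k
    proof -
      have "(norm (s j - s k))\<^sup>2 < e\<^sup>2"
        using key [of j k] M [OF that(1)] M [OF that(2)] by simp
      then show ?thesis
        using e by (simp add: dist_norm power_less_imp_less_base)
    qed
    then show "\<exists>M. \<forall>j\<ge>M. \<forall>k\<ge>M. dist (s j) (s k) < e"
      by blast
  qed
  then obtain q where q: "s \<longlonglongrightarrow> q"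
    using Cauchy_convergent convergent_def by blast
  have qN: "q \<in> closure N"
    using q s(1) closure_sequential by blast
  have yq: "norm (y - q) = d"
    by (rule LIMSEQ_unique [OF _ lim_norm]) (intro tendsto_intros q)
  have "inner (y - q) n = 0" if n: "n \<in> N" for n
  proof -
    have ge: "d \<le> norm (y - q - t *\<^sub>R n)" for t
    proof (rule LIMSEQ_le_const)
      show "(\<lambda>k. norm (y - s k - t *\<^sub>R n)) \<longlonglongrightarrow> norm (y - q - t *\<^sub>R n)"
        by (intro tendsto_intros q)
      have "d \<le> norm (y - s k - t *\<^sub>R n)" for k
        using d_le [of "s k + t *\<^sub>R n"] N s(1) n
        by (simp add: subspace_add subspace_scale diff_diff_eq)
      then show "\<exists>M. \<forall>k\<ge>M. d \<le> norm (y - s k - t *\<^sub>R n)"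
        by blast
    qed
    have ge2: "0 \<le> t\<^sup>2 * inner n n - 2 * t * inner (y - q) n" for t
    proof -
      have "d\<^sup>2 \<le> (norm (y - q - t *\<^sub>R n))\<^sup>2"
        using ge d0 by (rule power_mono)
      also have "\<dots> = (norm (y - q))\<^sup>2 - 2 * t * inner (y - q) n + t\<^sup>2 * inner n n"
        unfolding power2_norm_eq_inner
        by (simp add: inner_diff_left inner_diff_right inner_commute power2_eq_square algebra_simps)
      finally show ?thesis
        using yq by simp
    qed
    show ?thesis
    proof (cases "n = 0")
      case False
      then have pos: "inner n n > 0"
        by simp
      \<comment> \<open>This is \<open>ge2\<close> at the minimizer of its quadratic in
        \<open>t\<close>.\<close>
      have "0 \<le> - (inner (y - q) n)\<^sup>2 / inner n n"
        using ge2 [of "inner (y - q) n / inner n n"] pos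
        by (simp add: power2_eq_square field_simps)
      then have "(inner (y - q) n)\<^sup>2 \<le> 0"
        using pos by (simp add: divide_le_0_iff zero_le_divide_iff)
      then show ?thesis
        by simp
    qed simp
  qed
  with qN show thesis
    by (rule that)
qed

definition csubspace :: "'a :: complex_hilbert set \<Rightarrow> bool" where
  "csubspace N \<longleftrightarrow> 0 \<in> N \<and> (\<forall>x\<in>N. \<forall>y\<in>N. x + y \<in> N) \<and> (\<forall>c. \<forall>x\<in>N. c *\<^sub>C x \<in> N)"

lemma csubspace_imp_subspace: "csubspace N \<Longrightarrow> subspace N"
  by (auto simp: csubspace_def subspace_def scaleR_scaleC)

text \<open>The imaginary part of \<open>cinner z n\<close> is the real inner product of
  \<open>z\<close> with \<open>\<i> *\<^sub>C n\<close>, which again lies in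
  \<open>N\<close>.\<close>

lemma csubspace_orthogonal:
  assumes "csubspace N" "\<And>n. n \<in> N \<Longrightarrow> inner z n = 0" "n \<in> N"
  shows "cinner z n = 0"
proof -
  have "\<i> *\<^sub>C n \<in> N"
    using assms(1,3) by (simp add: csubspace_def)
  then have "Re (cinner z (\<i> *\<^sub>C n)) = 0" "Re (cinner z n) = 0"
    using assms(2,3) by (auto simp: Re_cinner)
  then show ?thesis
    by (simp add: cinner_scaleC_right complex_eq_iff)
qed

lemma riesz_representation:
  fixes f :: "'h :: complex_hilbert \<Rightarrow> complex"
  assumes add: "\<And>v w. f (v + w) = f v + f w" and scale: "\<And>c v. f (c *\<^sub>C v) = c * f v"
    and bound: "\<And>v. cmod (f v) \<le> K * norm v"
  obtains w where "\<And>v. f v = cinner v w"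
proof (cases "\<forall>v. f v = 0")
  case True
  then show thesis
    using that [of 0] by simp
next
  case False
  then obtain y where y: "f y \<noteq> 0"
    by blast
  have bl: "bounded_linear f"
    by (rule bounded_linear_intro [where K = K])
      (use assms in \<open>auto simp: scaleR_scaleC scaleC_complex_def mult.commute\<close>)
  let ?N = "{v. f v = 0}"
  have N: "csubspace ?N"
    using add scale linear_simps(3) [OF bl] by (auto simp: csubspace_def)
  have "closed ?N"
    by (rule closed_Collect_eq) (auto intro: linear_continuous_on bl)
  then have cl: "closure ?N = ?N"
    by simp
  obtain q where q: "q \<in> ?N" "\<And>n. n \<in> ?N \<Longrightarrow> inner (y - q) n = 0"
    using projection_exists [OF csubspace_imp_subspace [OF N], of y] cl by metis
  define z where "z = y - q"
  have diff: "f (v - w) = f v - f w" for v w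
    using linear_simps(2) [OF bl] .
  have fz: "f z \<noteq> 0"
    using y q by (simp add: z_def diff)
  have orth: "cinner z n = 0" if "f n = 0" for n
    using csubspace_orthogonal [OF N, of z n] q that by (auto simp: z_def)
  have "f v = cinner v ((cnj (f z) / of_real ((norm z)\<^sup>2)) *\<^sub>C z)" for v
  proof -
    have "f (v - (f v / f z) *\<^sub>C z) = 0"
      using fz by (simp add: diff scale)
    then have "cinner (v - (f v / f z) *\<^sub>C z) z = 0"
      using orth cinner_commute by (metis complex_cnj_zero)
    then have "cinner v z = f v / f z * of_real ((norm z)\<^sup>2)"
      by (simp add: cinner_diff_left cinner_scaleC_left cinner_self)
    moreover have "z \<noteq> 0"
      using fz linear_simps(3) [OF bl] by auto
    ultimately show ?thesis
      using fz by (simp add: cinner_scaleC_right)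
  qed
  then show thesis
    by (rule that)
qed

text \<open>Operators known only through their matrix coefficients, such as adjoints and weak
  limits, are obtained from here. Riesz representation is applied to the conjugate of
  \<open>B v\<close>, which is linear.\<close>

lemma bop_of_sesquilinear:
  fixes B :: "'h :: complex_hilbert \<Rightarrow> 'h \<Rightarrow> complex"
  assumes "\<And>u v w. B (u + v) w = B u w + B v w" "\<And>c v w. B (c *\<^sub>C v) w = c * B v w"
    and "\<And>u v w. B w (u + v) = B w u + B w v" "\<And>c v w. B v (c *\<^sub>C w) = cnj c * B v w"
    and bound: "\<And>v w. cmod (B v w) \<le> K * norm v * norm w"
  obtains T where "\<And>v w. cinner (T \<cdot> v) w = B v w" "\<And>v. norm (T \<cdot> v) \<le> K * norm v"
proof -
  have "\<exists>t. \<forall>w. B v w = cinner t w" for v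
  proof -
    obtain t where t: "\<And>w. cnj (B v w) = cinner w t"
      by (rule riesz_representation [of "\<lambda>w. cnj (B v w)" "K * norm v"]) (use assms in auto)
    have "B v w = cinner t w" for w
      by (metis t cinner_commute complex_cnj_cnj)
    then show ?thesis
      by blast
  qed
  then obtain T where T: "\<And>v w. B v w = cinner (T v) w"
    by metis
  have bd: "norm (T v) \<le> K * norm v" for v
  proof (cases "T v = 0")
    case True
    have "0 \<le> K * norm v * norm v"
      using bound [of v v] norm_ge_zero order_trans by blast
    then have "0 \<le> K * norm v"
      by (cases "v = 0") (auto simp: zero_le_mult_iff)
    then show ?thesis
      using True by simp
  next
    case False
    have "(norm (T v))\<^sup>2 = cmod (B v (T v))"
      by (simp add: T cinner_self norm_power)
    also have "\<dots> \<le> K * norm v * norm (T v)"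
      by (rule bound)
    finally show ?thesis
      using False by (simp add: power2_eq_square)
  qed
  obtain S where "\<And>v. S \<cdot> v = T v"
  proof (rule bop_of_linear [of T K])
    show "T (v + w) = T v + T w" for v w
      by (rule cinner_eqI) (simp add: T [symmetric] assms cinner_add_left)
    show "T (c *\<^sub>C v) = c *\<^sub>C T v" for c v
      by (rule cinner_eqI) (simp add: T [symmetric] assms cinner_scaleC_left)
  qed (use bd in auto)
  then show thesis
    using that [of S] T bd by simp
qed

lemma adj_eqI:
  assumes "\<And>v w. cinner (T \<cdot> v) w = cinner v (S \<cdot> w)"
  shows "adj T = S"
  unfolding adj_def
proof (rule the_equality)
  fix R assume "\<forall>v w. cinner (T \<cdot> v) w = cinner v (R \<cdot> w)"
  then have *: "cinner (R \<cdot> w) v = cinner (S \<cdot> w) v" for v w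
    using assms cinner_commute by metis
  show "R = S"
    by (rule bop_eqI, rule cinner_eqI) (rule *)
qed (use assms in blast)

text \<open>This shows that the definite description in \<open>adj\<close> denotes: the bounded form
  \<open>cinner v (T w)\<close> comes from an operator, and \<open>adj_eqI\<close> supplies
  uniqueness.\<close>

lemma cinner_adj_right: "cinner v (adj T \<cdot> w) = cinner (T \<cdot> v) w"
proof -
  obtain S where S: "\<And>v w. cinner (S \<cdot> v) w = cinner v (T \<cdot> w)"
  proof (rule bop_of_sesquilinear [of "\<lambda>v w. cinner v (T \<cdot> w)" "opnorm T"])
    fix v w
    have "cmod (cinner v (T \<cdot> w)) \<le> norm v * norm (T \<cdot> w)"
      by (rule cmod_cinner_le)
    also have "\<dots> \<le> norm v * (opnorm T * norm w)"
      by (intro mult_left_mono opnorm) auto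
    finally show "cmod (cinner v (T \<cdot> w)) \<le> opnorm T * norm v * norm w"
      by (simp add: mult_ac)
  qed (auto simp: bop_add bop_scaleC cinner_add_left cinner_add_right cinner_scaleC_left
      cinner_scaleC_right)
  have "adj T = S"
    by (rule adj_eqI) (metis S cinner_commute)
  then show ?thesis
    by (metis S cinner_commute)
qed

lemma cinner_adj_left: "cinner (adj T \<cdot> v) w = cinner v (T \<cdot> w)"
  by (metis cinner_adj_right cinner_commute)

lemma adj_adj [simp]: "adj (adj T) = T"
  by (rule adj_eqI) (simp add: cinner_adj_left)

lemma adj_mult [simp]: "adj (S * T) = adj T * adj S"
  by (rule adj_eqI) (simp add: cinner_adj_right)

lemma adj_add [simp]: "adj (S + T) = adj S + adj T"
  by (rule adj_eqI) (simp add: cinner_adj_right cinner_add_left cinner_add_right)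

lemma adj_diff [simp]: "adj (S - T) = adj S - adj T"
  by (rule adj_eqI) (simp add: cinner_adj_right cinner_diff_left cinner_diff_right)

lemma adj_scaleC [simp]: "adj (c *\<^sub>C S) = cnj c *\<^sub>C adj S"
  by (rule adj_eqI) (simp add: cinner_adj_right cinner_scaleC_left cinner_scaleC_right)

lemma adj_one [simp]: "adj 1 = 1"
  by (rule adj_eqI) simp

lemma adj_zero [simp]: "adj 0 = 0"
  by (rule adj_eqI) simp

lemma adj_power [simp]: "adj (S ^ n) = adj S ^ n"
  by (induction n) (auto simp: power_commutes)

lemma adj_sum [simp]: "adj (\<Sum>i\<in>I. f i) = (\<Sum>i\<in>I. adj (f i))"
  by (induction I rule: infinite_finite_induct) auto

lemma adj_prod_list: "adj (prod_list ts) = prod_list (map adj (rev ts))"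
  by (induction ts) auto

lemma selfadj_cinner: "adj T = T \<Longrightarrow> cinner (T \<cdot> v) w = cinner v (T \<cdot> w)"
  by (metis cinner_adj_left)

lemma norm_adj_le: "(\<And>v. norm (T \<cdot> v) \<le> C * norm v) \<Longrightarrow> norm (adj T \<cdot> v) \<le> C * norm v"
proof -
  assume C: "\<And>v. norm (T \<cdot> v) \<le> C * norm v"
  have "(norm (adj T \<cdot> v))\<^sup>2 = cmod (cinner (T \<cdot> adj T \<cdot> v) v)"
    by (metis cinner_adj_right cinner_self norm_of_real abs_of_nonneg zero_le_power2)
  also have "\<dots> \<le> norm (T \<cdot> adj T \<cdot> v) * norm v"
    by (rule cmod_cinner_le)
  also have "\<dots> \<le> C * norm (adj T \<cdot> v) * norm v"
    by (intro mult_right_mono C) auto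
  finally show ?thesis
    using C [of v] order_trans [OF norm_ge_zero C [of v]]
    by (cases "adj T \<cdot> v = 0") (auto simp: power2_eq_square mult_ac)
qed

lemma closure_csubspace:
  assumes "csubspace (N :: 'h :: complex_hilbert set)"
  shows "csubspace (closure N)"
proof -
  have "0 \<in> closure N"
    using assms closure_subset by (auto simp: csubspace_def)
  moreover have "x + y \<in> closure N" if xy: "x \<in> closure N" "y \<in> closure N" for x y
  proof -
    obtain f g where "\<And>n. f n \<in> N" "f \<longlonglongrightarrow> x" "\<And>n. g n \<in> N" "g \<longlonglongrightarrow> y"
      using xy by (auto simp: closure_sequential)
    then have "\<And>n. f n + g n \<in> N" "(\<lambda>n. f n + g n) \<longlonglongrightarrow> x + y"
      using assms by (auto simp: csubspace_def intro: tendsto_add)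
    then show ?thesis
      unfolding closure_sequential by (intro exI [of _ "\<lambda>n. f n + g n"]) simp
  qed
  moreover have "c *\<^sub>C x \<in> closure N" if x: "x \<in> closure N" for c x
  proof -
    obtain f where "\<And>n. f n \<in> N" "f \<longlonglongrightarrow> x"
      using x by (auto simp: closure_sequential)
    then have "\<And>n. c *\<^sub>C f n \<in> N" "(\<lambda>n. c *\<^sub>C f n) \<longlonglongrightarrow> c *\<^sub>C x"
      using assms bounded_linear.tendsto [OF bounded_linear_scaleC] by (auto simp: csubspace_def)
    then show ?thesis
      unfolding closure_sequential by (intro exI [of _ "\<lambda>n. c *\<^sub>C f n"]) simp
  qed
  ultimately show ?thesis
    by (simp add: csubspace_def)
qed

lemma orthogonal_projection_exists:
  assumes N: "csubspace (N :: 'h :: complex_hilbert set)"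
  obtains Q where "\<And>v. Q \<cdot> v \<in> closure N" "\<And>v. v \<in> closure N \<Longrightarrow> Q \<cdot> v = v" "adj Q = Q"
    "\<And>v n. n \<in> closure N \<Longrightarrow> cinner (v - Q \<cdot> v) n = 0"
proof -
  let ?M = "closure N"
  have M: "csubspace ?M"
    by (rule closure_csubspace [OF N])
  have "\<exists>q. q \<in> ?M \<and> (\<forall>n\<in>?M. cinner (v - q) n = 0)" for v
    using projection_exists [OF csubspace_imp_subspace [OF M], of v] csubspace_orthogonal [OF M]
    by (metis closure_closure)
  then obtain Q where Q: "\<And>v. Q v \<in> ?M" "\<And>v n. n \<in> ?M \<Longrightarrow> cinner (v - Q v) n = 0"
    by metis
  have uniq: "Q v = q" if "q \<in> ?M" "\<And>n. n \<in> ?M \<Longrightarrow> cinner (v - q) n = 0" for v q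
  proof -
    have "Q v + (- 1) *\<^sub>C q \<in> ?M"
      using M Q(1) that(1) unfolding csubspace_def by blast
    then have "Q v - q \<in> ?M"
      by (simp add: scaleC_one)
    then have "cinner (v - q) (Q v - q) - cinner (v - Q v) (Q v - q) = 0"
      using that Q(2) by simp
    then have "cinner (Q v - q) (Q v - q) = 0"
      by (simp add: cinner_diff_left)
    then show ?thesis
      by (simp add: cinner_self)
  qed
  have bound: "norm (Q v) \<le> 1 * norm v" for v
  proof -
    have "cinner v (Q v) = cinner (Q v) (Q v)"
      using Q(2) [OF Q(1), of v v] by (simp add: cinner_diff_left)
    then have "(norm (Q v))\<^sup>2 \<le> norm v * norm (Q v)"
      using cmod_cinner_le [of v "Q v"] by (simp add: cinner_self norm_power)
    then show ?thesis
      by (cases "Q v = 0") (auto simp: power2_eq_square)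
  qed
  obtain T where T: "\<And>v. T \<cdot> v = Q v"
  proof (rule bop_of_linear [of Q 1])
    show "Q (v + w) = Q v + Q w" for v w
    proof (rule uniq)
      show "Q v + Q w \<in> ?M"
        using M Q(1) by (simp add: csubspace_def)
      show "cinner (v + w - (Q v + Q w)) n = 0" if "n \<in> ?M" for n
        using Q(2) [OF that, of v] Q(2) [OF that, of w]
        by (simp add: cinner_diff_left cinner_add_left)
    qed
    show "Q (c *\<^sub>C v) = c *\<^sub>C Q v" for c v
    proof (rule uniq)
      show "c *\<^sub>C Q v \<in> ?M"
        using M Q(1) by (simp add: csubspace_def)
      show "cinner (c *\<^sub>C v - c *\<^sub>C Q v) n = 0" if "n \<in> ?M" for n
        using Q(2) [OF that, of v] by (simp add: scaleC_diff_right [symmetric] cinner_scaleC_left)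
    qed
  qed (use bound in auto)
  have "adj T = T"
  proof (rule adj_eqI)
    fix v w
    have "cinner (Q v) (w - Q w) = 0"
      using Q(2) [OF Q(1)] cinner_commute by (metis complex_cnj_zero)
    moreover have "cinner (v - Q v) (Q w) = 0"
      using Q by blast
    ultimately show "cinner (T \<cdot> v) w = cinner v (T \<cdot> w)"
      by (simp add: T cinner_diff_left cinner_diff_right)
  qed
  then show thesis
    using that [of T] T Q uniq by simp
qed

section \<open>Weak operator and ultraweak topologies\<close>

lemma bop_weak_eqI: "(\<And>v w. cinner (S \<cdot> v) w = cinner (T \<cdot> v) w) \<Longrightarrow> S = T"
  by (rule bop_eqI, rule cinner_eqI)

text \<open>Induction over the generated topology: the sets with \<open>P\<close> form a filter, so
  they include all neighbourhoods of \<open>t\<close> once they include the subbasic ones. The weak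
  and ultraweak arguments below go through this.\<close>

lemma nhd_in_generated_topology:
  assumes "openin (topology_generated_by B) U" "t \<in> U"
    and basis: "\<And>V. V \<in> B \<Longrightarrow> t \<in> V \<Longrightarrow> P V"
    and inter: "\<And>V W. P V \<Longrightarrow> P W \<Longrightarrow> P (V \<inter> W)"
    and mono: "\<And>V W. P V \<Longrightarrow> V \<subseteq> W \<Longrightarrow> P W"
  shows "P U"
proof -
  have "generate_topology_on B U"
    using assms(1) by (rule openin_topology_generated_by)
  then show ?thesis
    using \<open>t \<in> U\<close>
  proof induction
    case (UN K)
    then obtain k where "k \<in> K" "t \<in> k"
      by blast
    then show ?case
      using UN.IH mono [of k "\<Union>K"] by blast
  qed (use basis inter in auto)
qed

lemma topspace_wot [simp]: "topspace weak_operator_topology = UNIV"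
proof -
  have "T \<in> topspace weak_operator_topology" for T :: "'a bop"
    unfolding weak_operator_topology_def topology_generated_by_topspace
    by (rule UnionI [of "{T. cinner (T \<cdot> 0) 0 \<in> UNIV}"]) blast+
  then show ?thesis
    by blast
qed

lemma topspace_ultraweak [simp]: "topspace ultraweak_topology = UNIV"
proof -
  have "T \<in> topspace ultraweak_topology" for T :: "'a bop"
    unfolding ultraweak_topology_def topology_generated_by_topspace
    by (rule UnionI [of UNIV]) (auto intro!: exI [of _ "\<lambda>_. 0"] exI [of _ UNIV])
  then show ?thesis
    by blast
qed

lemma continuous_map_wot_cinner:
  "continuous_map weak_operator_topology euclidean (\<lambda>T. cinner (T \<cdot> v) w)"
proof -
  have "openin weak_operator_topology {T. cinner (T \<cdot> v) w \<in> U}" if "open U" for U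
    unfolding weak_operator_topology_def by (rule topology_generated_by_Basis) (use that in blast)
  then show ?thesis
    by (simp add: continuous_map_def flip: open_openin)
qed

lemma continuous_map_into_wot:
  fixes f :: "'a \<Rightarrow> 'b :: complex_hilbert bop"
  assumes "\<And>v w. continuous_map X euclidean (\<lambda>t. cinner (f t \<cdot> v) w)"
  shows "continuous_map X weak_operator_topology f"
  unfolding weak_operator_topology_def continuous_on_generated_topo_iff
proof (intro conjI allI impI)
  fix U :: "'b bop set" assume "U \<in> {{T. cinner (T \<cdot> v) w \<in> U} |v w U. open U}"
  then obtain v w V where U: "U = {T. cinner (T \<cdot> v) w \<in> V}" "open V"
    by blast
  have "f -` U \<inter> topspace X = {t \<in> topspace X. cinner (f t \<cdot> v) w \<in> V}"
    using U by auto
  then show "openin X (f -` U \<inter> topspace X)"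
    using openin_continuous_map_preimage [OF assms] U(2) by simp
next
  show "f ` topspace X \<subseteq> \<Union> {{T. cinner (T \<cdot> v) w \<in> U} |v w U. open U}"
    using topspace_wot [where 'a = 'b] unfolding weak_operator_topology_def by auto
qed

lemma continuous_map_wot_mult_left: "continuous_map weak_operator_topology weak_operator_topology (\<lambda>a. b * a)"
proof (rule continuous_map_into_wot)
  show "continuous_map weak_operator_topology euclidean (\<lambda>t. cinner ((b * t) \<cdot> v) w)" for v w
    using continuous_map_wot_cinner [of v "adj b \<cdot> w"] by (simp add: cinner_adj_right)
qed

lemma continuous_map_wot_mult_right: "continuous_map weak_operator_topology weak_operator_topology (\<lambda>a. a * b)"
  by (rule continuous_map_into_wot) (simp add: continuous_map_wot_cinner)

lemma continuous_map_wot_add: "continuous_map weak_operator_topology weak_operator_topology (\<lambda>a. b + a)"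
proof (rule continuous_map_into_wot)
  show "continuous_map weak_operator_topology euclidean (\<lambda>t. cinner ((b + t) \<cdot> v) w)" for v w
    by (simp add: cinner_add_left continuous_map_add continuous_map_wot_cinner)
qed

lemma continuous_map_wot_scaleC: "continuous_map weak_operator_topology weak_operator_topology (\<lambda>a. c *\<^sub>C a)"
proof (rule continuous_map_into_wot)
  show "continuous_map weak_operator_topology euclidean (\<lambda>t. cinner ((c *\<^sub>C t) \<cdot> v) w)" for v w
    using continuous_map_wot_cinner [of v "cnj c *\<^sub>C w"] by (simp add: cinner_scaleC_right cinner_scaleC_left)
qed

text \<open>Mapping \<open>S\<close> merely into its closure is enough, which permits the closure to
  be taken in one variable after another.\<close>

lemma closure_of_invariant:
  assumes "continuous_map X X f" "\<And>s. s \<in> S \<Longrightarrow> f s \<in> X closure_of S" "a \<in> X closure_of S"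
  shows "f a \<in> X closure_of S"
proof -
  have "f a \<in> X closure_of (f ` S)"
    using continuous_map_image_closure_subset [OF assms(1)] assms(3) by blast
  also have "\<dots> \<subseteq> X closure_of (X closure_of S)"
    using assms(2) by (intro closure_of_mono) blast
  finally show ?thesis
    by simp
qed

text \<open>Multiplication is only separately continuous in the weak operator topology, so each
  operation is extended in one argument at a time: \<open>mult1\<close> has its left factor in
  \<open>S\<close>, \<open>mult\<close> has both in the closure.\<close>

lemma nonunital_algebra_wot_closure:
  assumes S: "nonunital_algebra S"
  shows "nonunital_algebra (weak_operator_topology closure_of S)" (is "nonunital_algebra ?C")
proof -
  have sub: "S \<subseteq> ?C"
    by (simp add: closure_of_subset)
  have mult1: "b * a \<in> ?C" if "b \<in> S" "a \<in> ?C" for a b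
    by (rule closure_of_invariant [OF continuous_map_wot_mult_left _ that(2)])
      (use S sub that in \<open>auto simp: nonunital_algebra_def\<close>)
  have mult: "b * a \<in> ?C" if "b \<in> ?C" "a \<in> ?C" for a b
    by (rule closure_of_invariant [OF continuous_map_wot_mult_right _ that(1)]) (rule mult1 [OF _ that(2)])
  have add1: "b + a \<in> ?C" if "b \<in> S" "a \<in> ?C" for a b
    by (rule closure_of_invariant [OF continuous_map_wot_add _ that(2)])
      (use S sub that in \<open>auto simp: nonunital_algebra_def\<close>)
  have add: "a + b \<in> ?C" if "b \<in> ?C" "a \<in> ?C" for a b
    by (rule closure_of_invariant [OF continuous_map_wot_add _ that(1)])
      (metis add1 add.commute that(2))
  have scale: "c *\<^sub>C a \<in> ?C" if "a \<in> ?C" for a c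
    by (rule closure_of_invariant [OF continuous_map_wot_scaleC _ that])
      (use S sub that in \<open>auto simp: nonunital_algebra_def\<close>)
  show ?thesis
    using mult add scale sub S by (auto simp: nonunital_algebra_def)
qed

lemma wot_closure_limit:
  assumes "F \<noteq> bot" "\<And>v w. ((\<lambda>i. cinner (f i \<cdot> v) w) \<longlongrightarrow> cinner (T \<cdot> v) w) F"
    and "eventually (\<lambda>i. f i \<in> S) F"
  shows "T \<in> weak_operator_topology closure_of S"
  unfolding in_closure_of
proof (intro conjI allI impI)
  fix U assume U: "T \<in> U \<and> openin weak_operator_topology U"
  have "eventually (\<lambda>i. f i \<in> U) F"
  proof (rule nhd_in_generated_topology [where t = T and U = U and P = "\<lambda>U. eventually (\<lambda>i. f i \<in> U) F"])
    show "openin (topology_generated_by {{T. cinner (T \<cdot> v) w \<in> U} |v w U. open U}) U"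
      using U by (simp add: weak_operator_topology_def)
    fix V assume "V \<in> {{T. cinner (T \<cdot> v) w \<in> U} |v w U. open U}" "T \<in> V"
    then show "\<forall>\<^sub>F i in F. f i \<in> V"
      using topological_tendstoD [OF assms(2)] by auto
  qed (use U in \<open>auto elim: eventually_mono simp: eventually_conj_iff\<close>)
  then have "eventually (\<lambda>i. f i \<in> S \<and> f i \<in> U) F"
    using assms(3) by (simp add: eventually_conj_iff)
  then show "\<exists>y. y \<in> S \<and> y \<in> U"
    using assms(1) eventually_happens' by blast
qed simp

lemma wot_closure_approx:
  assumes T: "T \<in> weak_operator_topology closure_of S" and "finite F" "e > 0"
  obtains b where "b \<in> S" "\<And>v w. (v, w) \<in> F \<Longrightarrow> cmod (cinner ((T - b) \<cdot> v) w) < e"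
proof -
  have op: "openin weak_operator_topology {b. \<forall>p\<in>F. cmod (cinner ((T - b) \<cdot> fst p) (snd p)) < e}"
    using \<open>finite F\<close>
  proof induction
    case empty
    then show ?case
      using openin_topspace [of weak_operator_topology] by simp
  next
    case (insert p F)
    let ?c = "cinner (T \<cdot> fst p) (snd p)"
    have "{b. cmod (cinner ((T - b) \<cdot> fst p) (snd p)) < e} = {b. cinner (b \<cdot> fst p) (snd p) \<in> ball ?c e}"
      by (auto simp: cinner_diff_left dist_norm)
    also have "openin weak_operator_topology \<dots>"
      using openin_continuous_map_preimage [OF continuous_map_wot_cinner, of "ball ?c e" "fst p" "snd p"]
      by simp
    finally have "openin weak_operator_topology ({b. cmod (cinner ((T - b) \<cdot> fst p) (snd p)) < e} \<inter>
       {b. \<forall>p\<in>F. cmod (cinner ((T - b) \<cdot> fst p) (snd p)) < e})"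
      using insert.IH by (intro openin_Int)
    moreover have "{b. cmod (cinner ((T - b) \<cdot> fst p) (snd p)) < e} \<inter>
       {b. \<forall>p\<in>F. cmod (cinner ((T - b) \<cdot> fst p) (snd p)) < e} =
       {b. \<forall>p\<in>insert p F. cmod (cinner ((T - b) \<cdot> fst p) (snd p)) < e}"
      by auto
    ultimately show ?case
      by simp
  qed
  have "T \<in> {b. \<forall>p\<in>F. cmod (cinner ((T - b) \<cdot> fst p) (snd p)) < e}"
    using \<open>e > 0\<close> by simp
  then obtain b where "b \<in> S" "\<forall>p\<in>F. cmod (cinner ((T - b) \<cdot> fst p) (snd p)) < e"
    using T [unfolded in_closure_of, THEN conjunct2, rule_format, OF conjI, OF _ op] by auto
  then show thesis
    by (intro that) auto
qed

lemma closedin_wot_eq: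
  assumes "continuous_map weak_operator_topology weak_operator_topology f"
    and "continuous_map weak_operator_topology weak_operator_topology g"
  shows "closedin weak_operator_topology {T :: 'h :: complex_hilbert bop. f T = (g T :: 'k :: complex_hilbert bop)}"
proof -
  have *: "f T = g T \<longleftrightarrow> (\<forall>v w. cinner (f T \<cdot> v) w - cinner (g T \<cdot> v) w = 0)" for T
    by (auto intro: bop_weak_eqI)
  have "closedin weak_operator_topology {T \<in> topspace weak_operator_topology.
      cinner (f T \<cdot> v) w - cinner (g T \<cdot> v) w \<in> {0}}" for v w
    by (rule closedin_continuous_map_preimage [where Y = euclidean])
      (use continuous_map_compose [OF assms(1) continuous_map_wot_cinner]
         continuous_map_compose [OF assms(2) continuous_map_wot_cinner] in
         \<open>auto intro!: continuous_map_diff simp: o_def\<close>)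
  then have "closedin weak_operator_topology (\<Inter>p. {T. cinner (f T \<cdot> fst p) (snd p) - cinner (g T \<cdot> fst p) (snd p) = 0})"
    by (intro closedin_Inter) auto
  also have "(\<Inter>p. {T. cinner (f T \<cdot> fst p) (snd p) - cinner (g T \<cdot> fst p) (snd p) = 0}) = {T. f T = g T}"
    by (auto simp: *)
  finally show ?thesis .
qed

subsection \<open>Weak limits of bounded sequences\<close>

text \<open>The filter \<open>G\<close> stands for a convergent subnet. A subsequence would not do,
  since the compact space in question is a product over all pairs of vectors.\<close>

lemma compact_cluster_filter:
  fixes f :: "nat \<Rightarrow> 'a :: topological_space"
  assumes "compact K" "\<And>n. f n \<in> K"
  obtains G x where "G \<le> sequentially" "G \<noteq> bot" "(f \<longlongrightarrow> x) G"
proof -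
  have "filtermap f sequentially \<noteq> bot"
    by (simp add: filtermap_bot_iff)
  moreover have "eventually (\<lambda>x. x \<in> K) (filtermap f sequentially)"
    by (simp add: eventually_filtermap assms(2))
  ultimately obtain x where x: "inf (nhds x) (filtermap f sequentially) \<noteq> bot"
    using assms(1) unfolding compact_filter by blast
  define G where "G = inf sequentially (filtercomap f (nhds x))"
  have "G \<noteq> bot"
  proof
    assume "G = bot"
    then have "eventually (\<lambda>_. False) G"
      by simp
    then obtain P Q where PQ: "eventually P sequentially" "eventually Q (filtercomap f (nhds x))"
      "\<And>n. P n \<Longrightarrow> Q n \<Longrightarrow> False"
      unfolding G_def eventually_inf by blast
    then obtain R where R: "eventually R (nhds x)" "\<And>n. R (f n) \<Longrightarrow> Q n"
      unfolding eventually_filtercomap by blast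
    have "eventually (\<lambda>y. \<not> R y) (filtermap f sequentially)"
      unfolding eventually_filtermap using PQ(1) by (rule eventually_mono) (use PQ(3) R(2) in blast)
    then have "eventually (\<lambda>_. False) (inf (nhds x) (filtermap f sequentially))"
      unfolding eventually_inf using R(1) by blast
    then show False
      using x by (simp add: trivial_limit_def)
  qed
  moreover have "(f \<longlongrightarrow> x) G"
    unfolding filterlim_iff_le_filtercomap G_def by simp
  ultimately show thesis
    using that [of G x] by (simp add: G_def)
qed

text \<open>Weak compactness of bounded sets of operators: the matrix coefficients lie in a product
  of discs, compact by Tychonoff, and their limit along \<open>G\<close> is again a bounded
  sesquilinear form.\<close>

lemma bounded_bop_cluster:
  fixes a :: "nat \<Rightarrow> 'h :: complex_hilbert bop"
  assumes C: "\<And>n v. norm (a n \<cdot> v) \<le> C * norm v"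
  obtains G T where "G \<le> sequentially" "G \<noteq> bot"
    "\<And>v w. ((\<lambda>n. cinner (a n \<cdot> v) w) \<longlongrightarrow> cinner (T \<cdot> v) w) G"
    "\<And>v. norm (T \<cdot> v) \<le> C * norm v"
proof -
  define f where "f n p = cinner (a n \<cdot> fst p) (snd p)" for n and p :: "'h \<times> 'h"
  define K where "K = PiE UNIV (\<lambda>p :: 'h \<times> 'h. cball (0 :: complex) (C * norm (fst p) * norm (snd p)))"
  have "compactin (product_topology (\<lambda>_. euclidean) UNIV) K"
    unfolding K_def compactin_PiE by simp
  then have K: "compact K"
    by (simp add: euclidean_product_topology)
  have fK: "cmod (f n p) \<le> C * norm (fst p) * norm (snd p)" for n p
  proof -
    have "cmod (f n p) \<le> norm (a n \<cdot> fst p) * norm (snd p)"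
      unfolding f_def by (rule cmod_cinner_le)
    also have "\<dots> \<le> C * norm (fst p) * norm (snd p)"
      by (intro mult_right_mono C) simp
    finally show ?thesis .
  qed
  have "f n \<in> K" for n
    using fK by (simp add: K_def PiE_iff)
  then obtain G x where G: "G \<le> sequentially" "G \<noteq> bot" and x: "(f \<longlongrightarrow> x) G"
    using compact_cluster_filter [OF K] by blast
  have lim: "((\<lambda>n. f n p) \<longlongrightarrow> x p) G" for p
    by (rule continuous_on_tendsto_compose [OF continuous_on_product_coordinates x]) auto
  have uniq: "x p = c" if "((\<lambda>n. f n p) \<longlongrightarrow> c) G" for p c
    using tendsto_unique [OF G(2) lim that] .
  obtain T where T: "\<And>v w. cinner (T \<cdot> v) w = x (v, w)" "\<And>v. norm (T \<cdot> v) \<le> C * norm v"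
  proof (rule bop_of_sesquilinear [of "\<lambda>v w. x (v, w)" C])
    show "x (u + v, w) = x (u, w) + x (v, w)" for u v w
      by (rule uniq) (use tendsto_add [OF lim lim, of "(u, w)" "(v, w)"] in
        \<open>simp add: f_def bop_add cinner_add_left\<close>)
    show "x (w, u + v) = x (w, u) + x (w, v)" for u v w
      by (rule uniq) (use tendsto_add [OF lim lim, of "(w, u)" "(w, v)"] in
        \<open>simp add: f_def cinner_add_right\<close>)
    show "x (c *\<^sub>C v, w) = c * x (v, w)" for c v w
      by (rule uniq) (use tendsto_mult [OF tendsto_const lim, of c "(v, w)"] in
        \<open>simp add: f_def bop_scaleC cinner_scaleC_left\<close>)
    show "x (v, c *\<^sub>C w) = cnj c * x (v, w)" for c v w
      by (rule uniq) (use tendsto_mult [OF tendsto_const lim, of "cnj c" "(v, w)"] in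
        \<open>simp add: f_def cinner_scaleC_right\<close>)
    show "cmod (x (v, w)) \<le> C * norm v * norm w" for v w
      by (rule tendsto_upperbound [OF tendsto_norm [OF lim, of "(v, w)"] _ G(2)]) (use fK [of _ "(v, w)"] in auto)
  qed auto
  have "((\<lambda>n. cinner (a n \<cdot> v) w) \<longlongrightarrow> cinner (T \<cdot> v) w) G" for v w
    using lim [of "(v, w)"] by (simp add: f_def T)
  then show thesis
    using that [of G T] G T by blast
qed

section \<open>The bicommutant theorem\<close>

subsection \<open>Square summable sequences\<close>

text \<open>The infinite multiple of a Hilbert space. One vector of it encodes a square summable
  sequence as in the ultraweak topology, and \<open>complex l2\<close> will carry the representation
  of \<open>B\<^sub>i(n,k)\<close>.\<close>

typedef (overloaded) 'h l2 = "{f :: nat \<Rightarrow> 'h :: complex_hilbert. summable (\<lambda>n. (norm (f n))\<^sup>2)}"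
  morphisms l2_nth L2
  by (rule exI [of _ "\<lambda>_. 0"]) simp

setup_lifting type_definition_l2

lemma l2_summable: "summable (\<lambda>n. (norm (l2_nth v n))\<^sup>2)"
  using l2_nth [of v] by simp

lemma l2_eqI: "(\<And>n. l2_nth v n = l2_nth w n) \<Longrightarrow> v = w"
  by (metis ext l2_nth_inject)

lemma summable_norm_mult:
  fixes f :: "nat \<Rightarrow> 'a :: real_normed_vector" and g :: "nat \<Rightarrow> 'b :: real_normed_vector"
  assumes "summable (\<lambda>n. (norm (f n))\<^sup>2)" "summable (\<lambda>n. (norm (g n))\<^sup>2)"
  shows "summable (\<lambda>n. norm (f n) * norm (g n))"
proof (rule summable_comparison_test' [where N = 0])
  show "summable (\<lambda>n. (norm (f n))\<^sup>2 + (norm (g n))\<^sup>2)"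
    using assms by (rule summable_add)
  show "norm (norm (f n) * norm (g n)) \<le> (norm (f n))\<^sup>2 + (norm (g n))\<^sup>2" for n
  proof -
    have "2 * (norm (f n) * norm (g n)) \<le> (norm (f n))\<^sup>2 + (norm (g n))\<^sup>2"
      using sum_squares_bound [of "norm (f n)" "norm (g n)"] by (simp add: mult.assoc)
    moreover have "0 \<le> norm (f n) * norm (g n)"
      by simp
    ultimately have "norm (f n) * norm (g n) \<le> (norm (f n))\<^sup>2 + (norm (g n))\<^sup>2"
      by linarith
    then show ?thesis
      by simp
  qed
qed

lemma summable_norm_add_sq:
  fixes f g :: "nat \<Rightarrow> 'a :: real_normed_vector"
  assumes "summable (\<lambda>n. (norm (f n))\<^sup>2)" "summable (\<lambda>n. (norm (g n))\<^sup>2)"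
  shows "summable (\<lambda>n. (norm (f n + g n))\<^sup>2)"
proof (rule summable_comparison_test' [where N = 0])
  show "summable (\<lambda>n. (norm (f n))\<^sup>2 + 2 * (norm (f n) * norm (g n)) + (norm (g n))\<^sup>2)"
    by (intro summable_add summable_mult summable_norm_mult assms)
  show "norm ((norm (f n + g n))\<^sup>2) \<le> (norm (f n))\<^sup>2 + 2 * (norm (f n) * norm (g n)) + (norm (g n))\<^sup>2" for n
    using power_mono [OF norm_triangle_ineq [of "f n" "g n"], of 2] by (simp add: power2_sum mult_ac)
qed

lemma summable_bop_sq:
  assumes "summable (\<lambda>n. (norm (f n))\<^sup>2)"
  shows "summable (\<lambda>n. (norm (T \<cdot> f n))\<^sup>2)"
proof (rule summable_comparison_test' [where N = 0])
  show "summable (\<lambda>n. (opnorm T)\<^sup>2 * (norm (f n))\<^sup>2)"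
    using assms by (rule summable_mult)
  show "norm ((norm (T \<cdot> f n))\<^sup>2) \<le> (opnorm T)\<^sup>2 * (norm (f n))\<^sup>2" for n
    using power_mono [OF opnorm [of T "f n"], of 2] by (simp add: power_mult_distrib)
qed

lemma summable_cinner_l2: "summable (\<lambda>n. cinner (l2_nth f n) (l2_nth g n))"
  by (rule summable_comparison_test' [where N = 0, OF summable_norm_mult [OF l2_summable l2_summable]])
    (rule cmod_cinner_le)

definition l2_cinner :: "'a :: complex_hilbert l2 \<Rightarrow> 'a l2 \<Rightarrow> complex" where
  "l2_cinner f g = (suminf (\<lambda>n. cinner (l2_nth f n) (l2_nth g n)))"

lemma l2_cinner_self: "l2_cinner f f = complex_of_real (suminf (\<lambda>n. (norm (l2_nth f n))\<^sup>2))"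
  unfolding l2_cinner_def cinner_self by (rule suminf_of_real [symmetric]) (rule l2_summable)

lemma l2_cinner_commute: "l2_cinner f g = cnj (l2_cinner g f)"
proof -
  have "(\<lambda>n. cnj (cinner (l2_nth g n) (l2_nth f n))) sums cnj (l2_cinner g f)"
    unfolding l2_cinner_def sums_cnj by (rule summable_sums [OF summable_cinner_l2])
  moreover have "cnj (cinner (l2_nth g n) (l2_nth f n)) = cinner (l2_nth f n) (l2_nth g n)" for n
    by (rule cinner_commute [symmetric])
  ultimately show ?thesis
    unfolding l2_cinner_def [of f g] using sums_unique by fastforce
qed

instantiation l2 :: (complex_hilbert) complex_vector
begin

lift_definition zero_l2 :: "'a l2" is "\<lambda>_. 0"
  by simp

lift_definition plus_l2 :: "'a l2 \<Rightarrow> 'a l2 \<Rightarrow> 'a l2" is "\<lambda>f g n. f n + g n"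
  by (rule summable_norm_add_sq)

lift_definition uminus_l2 :: "'a l2 \<Rightarrow> 'a l2" is "\<lambda>f n. - f n"
  by simp

definition minus_l2 :: "'a l2 \<Rightarrow> 'a l2 \<Rightarrow> 'a l2" where
  "minus_l2 f g = f + - g"

lift_definition scaleC_l2 :: "complex \<Rightarrow> 'a l2 \<Rightarrow> 'a l2" is "\<lambda>c f n. c *\<^sub>C f n"
  by (simp add: norm_scaleC power_mult_distrib summable_mult)

instance
proof
  fix f g h :: "'a l2" and c d :: complex
  show "c *\<^sub>C (f + g) = c *\<^sub>C f + c *\<^sub>C g" by transfer (simp add: scaleC_add_right)
  show "(c + d) *\<^sub>C f = c *\<^sub>C f + d *\<^sub>C f" by transfer (simp add: scaleC_add_left)
  show "c *\<^sub>C d *\<^sub>C f = (c * d) *\<^sub>C f" by transfer (simp add: scaleC_scaleC)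
  show "1 *\<^sub>C f = f" by transfer (simp add: scaleC_one)
  show "f + g + h = f + (g + h)" by transfer (simp add: add.assoc)
  show "f + g = g + f" by transfer (simp add: add.commute)
  show "0 + f = f" by transfer simp
  show "- f + f = 0" by transfer simp
  show "f - g = f + - g" by (rule minus_l2_def)
qed

end

instantiation l2 :: (complex_hilbert) real_vector
begin

lift_definition scaleR_l2 :: "real \<Rightarrow> 'a l2 \<Rightarrow> 'a l2" is "\<lambda>r f n. r *\<^sub>R f n"
  by (simp add: power_mult_distrib summable_mult)

instance
proof
  fix f g :: "'a l2" and r s :: real
  show "r *\<^sub>R (f + g) = r *\<^sub>R f + r *\<^sub>R g" by transfer (simp add: scaleR_add_right)
  show "(r + s) *\<^sub>R f = r *\<^sub>R f + s *\<^sub>R f" by transfer (simp add: scaleR_add_left)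
  show "r *\<^sub>R s *\<^sub>R f = (r * s) *\<^sub>R f" by transfer simp
  show "1 *\<^sub>R f = f" by transfer simp
qed

end

lemma l2_cinner_add: "l2_cinner (f + g) h = l2_cinner f h + l2_cinner g h"
  by (simp add: l2_cinner_def plus_l2.rep_eq cinner_add_left suminf_add summable_cinner_l2)

lemma l2_cinner_scaleC: "l2_cinner (c *\<^sub>C f) g = c * l2_cinner f g"
  by (simp add: l2_cinner_def scaleC_l2.rep_eq cinner_scaleC_left suminf_mult summable_cinner_l2)

instantiation l2 :: (complex_hilbert) real_inner
begin

definition inner_l2 :: "'a l2 \<Rightarrow> 'a l2 \<Rightarrow> real" where
  "inner_l2 f g = Re (l2_cinner f g)"

definition norm_l2 :: "'a l2 \<Rightarrow> real" where
  "norm_l2 f = sqrt (inner f f)"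

definition sgn_l2 :: "'a l2 \<Rightarrow> 'a l2" where
  "sgn_l2 f = f /\<^sub>R norm f"

definition dist_l2 :: "'a l2 \<Rightarrow> 'a l2 \<Rightarrow> real" where
  "dist_l2 f g = norm (f - g)"

definition uniformity_l2 :: "('a l2 \<times> 'a l2) filter" where
  "uniformity_l2 = (INF e\<in>{0<..}. principal {(x, y). dist x y < e})"

definition open_l2 :: "'a l2 set \<Rightarrow> bool" where
  "open_l2 U = (\<forall>x\<in>U. eventually (\<lambda>(x', y). x' = x \<longrightarrow> y \<in> U) uniformity)"

instance
proof
  fix f g h :: "'a l2" and r :: real
  show "dist f g = norm (f - g)" by (rule dist_l2_def)
  show "sgn f = f /\<^sub>R norm f" by (rule sgn_l2_def)
  show "uniformity = (INF e\<in>{0<..}. principal {(x :: 'a l2, y). dist x y < e})"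
    by (rule uniformity_l2_def)
  show "open U = (\<forall>x\<in>U. \<forall>\<^sub>F (x', y) in uniformity. x' = x \<longrightarrow> y \<in> U)" for U :: "'a l2 set"
    by (rule open_l2_def)
  show "inner f g = inner g f" unfolding inner_l2_def by (subst l2_cinner_commute) simp
  show "inner (f + g) h = inner f h + inner g h" by (simp add: inner_l2_def l2_cinner_add)
  show "inner (r *\<^sub>R f) g = r * inner f g" by (simp add: inner_l2_def l2_cinner_def scaleR_l2.rep_eq cinner_scaleR_left suminf_mult summable_cinner_l2)
  show "0 \<le> inner f f" by (simp add: inner_l2_def l2_cinner_self suminf_nonneg l2_summable)
  show "norm f = sqrt (inner f f)" by (rule norm_l2_def)
  show "inner f f = 0 \<longleftrightarrow> f = 0"
    by (auto simp: inner_l2_def l2_cinner_self suminf_eq_zero_iff l2_summable zero_l2.rep_eq intro: l2_eqI)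
qed

end

lemma l2_scaleC_of_real: "complex_of_real r *\<^sub>C f = r *\<^sub>R (f :: 'h :: complex_hilbert l2)"
  by transfer (simp add: scaleC_of_real)

lemma l2_nth_minus: "l2_nth (f - g) n = l2_nth f n - l2_nth g n"
  unfolding minus_l2_def plus_l2.rep_eq uminus_l2.rep_eq by simp

lemma norm_l2: "(norm f)\<^sup>2 = (suminf (\<lambda>n. (norm (l2_nth f n))\<^sup>2))"
  by (simp add: norm_l2_def inner_l2_def l2_cinner_self suminf_nonneg l2_summable)

lemma norm_l2_nth_le: "norm (l2_nth f n) \<le> norm f"
proof -
  have "(norm (l2_nth f n))\<^sup>2 = (\<Sum>k\<in>{n}. (norm (l2_nth f k))\<^sup>2)"
    by simp
  also have "\<dots> \<le> (suminf (\<lambda>k. (norm (l2_nth f k))\<^sup>2))"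
    by (rule sum_le_suminf [OF l2_summable]) auto
  finally have "(norm (l2_nth f n))\<^sup>2 \<le> (norm f)\<^sup>2"
    by (simp add: norm_l2)
  then show ?thesis
    by (rule power2_le_imp_le) simp
qed

instance l2 :: (complex_hilbert) complete_space
proof
  fix X :: "nat \<Rightarrow> 'a l2"
  assume X: "Cauchy X"
  have "Cauchy (\<lambda>k. l2_nth (X k) n)" for n
  proof (rule metric_CauchyI)
    fix e :: real assume "e > 0"
    then obtain M where M: "\<And>j k. j \<ge> M \<Longrightarrow> k \<ge> M \<Longrightarrow> dist (X j) (X k) < e"
      using X unfolding Cauchy_def by blast
    have "dist (l2_nth (X j) n) (l2_nth (X k) n) < e" if "j \<ge> M" "k \<ge> M" for j k
      using norm_l2_nth_le [of "X j - X k" n] M [OF that] by (simp add: dist_norm l2_nth_minus)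
    then show "\<exists>M. \<forall>j\<ge>M. \<forall>k\<ge>M. dist (l2_nth (X j) n) (l2_nth (X k) n) < e"
      by blast
  qed
  then have "\<exists>u. (\<lambda>k. l2_nth (X k) n) \<longlonglongrightarrow> u" for n
    using Cauchy_convergent convergent_def by blast
  then obtain u where u: "\<And>n. (\<lambda>k. l2_nth (X k) n) \<longlonglongrightarrow> u n"
    by metis
  have *: "summable (\<lambda>n. (norm (l2_nth (X k) n - u n))\<^sup>2) \<and> (suminf (\<lambda>n. (norm (l2_nth (X k) n - u n))\<^sup>2)) \<le> e\<^sup>2"
    if M: "\<And>j k. j \<ge> M \<Longrightarrow> k \<ge> M \<Longrightarrow> dist (X j) (X k) < e" and k: "k \<ge> M" for e M k
  proof -
    have e: "(\<Sum>n<N. (norm (l2_nth (X k) n - u n))\<^sup>2) \<le> e\<^sup>2" for N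
    proof (rule LIMSEQ_le_const2)
      show "(\<lambda>j. \<Sum>n<N. (norm (l2_nth (X k) n - l2_nth (X j) n))\<^sup>2) \<longlonglongrightarrow>
          (\<Sum>n<N. (norm (l2_nth (X k) n - u n))\<^sup>2)"
        by (intro tendsto_intros u)
      have "(\<Sum>n<N. (norm (l2_nth (X k) n - l2_nth (X j) n))\<^sup>2) \<le> e\<^sup>2" if "j \<ge> M" for j
      proof -
        have "(\<Sum>n<N. (norm (l2_nth (X k) n - l2_nth (X j) n))\<^sup>2) \<le> (norm (X k - X j))\<^sup>2"
          unfolding norm_l2 l2_nth_minus [symmetric] by (rule sum_le_suminf [OF l2_summable]) auto
        also have "\<dots> \<le> e\<^sup>2"
          using M [OF k that] unfolding dist_norm
          by (intro power_mono) auto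
        finally show ?thesis .
      qed
      then show "\<exists>M. \<forall>j\<ge>M. (\<Sum>n<N. (norm (l2_nth (X k) n - l2_nth (X j) n))\<^sup>2) \<le> e\<^sup>2"
        by blast
    qed
    then have "summable (\<lambda>n. (norm (l2_nth (X k) n - u n))\<^sup>2)"
      by (intro summableI_nonneg_bounded [where x = "e\<^sup>2"]) auto
    moreover from this have "(suminf (\<lambda>n. (norm (l2_nth (X k) n - u n))\<^sup>2)) \<le> e\<^sup>2"
      using e by (intro suminf_le_const) auto
    ultimately show ?thesis
      by blast
  qed
  obtain M where M: "\<And>j k. j \<ge> M \<Longrightarrow> k \<ge> M \<Longrightarrow> dist (X j) (X k) < 1"
    using X unfolding Cauchy_def by (metis zero_less_one)
  have "summable (\<lambda>n. (norm (- (l2_nth (X M) n - u n) + l2_nth (X M) n))\<^sup>2)"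
    by (rule summable_norm_add_sq) (use * [OF M, of M] l2_summable in \<open>simp_all add: norm_minus_commute\<close>)
  then have sum_u: "summable (\<lambda>n. (norm (u n))\<^sup>2)"
    by simp
  define U where "U = L2 u"
  have U: "l2_nth U n = u n" for n
    unfolding U_def using sum_u by (simp add: L2_inverse)
  have "X \<longlonglongrightarrow> U"
  proof (rule metric_LIMSEQ_I)
    fix e :: real assume "e > 0"
    then obtain M where M: "\<And>j k. j \<ge> M \<Longrightarrow> k \<ge> M \<Longrightarrow> dist (X j) (X k) < e / 2"
      using X unfolding Cauchy_def by (meson half_gt_zero)
    have "dist (X k) U < e" if "k \<ge> M" for k
    proof -
      have "(norm (X k - U))\<^sup>2 \<le> (e / 2)\<^sup>2"
        unfolding norm_l2 l2_nth_minus U using * [OF M that] by simp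
      then have "norm (X k - U) \<le> e / 2"
        by (rule power2_le_imp_le) (use \<open>e > 0\<close> in simp)
      then show ?thesis
        using \<open>e > 0\<close> by (simp add: dist_norm)
    qed
    then show "\<exists>M. \<forall>k\<ge>M. dist (X k) U < e"
      by blast
  qed
  then show "convergent X"
    by (auto simp: convergent_def)
qed

instantiation l2 :: (complex_hilbert) complex_hilbert
begin

definition cinner_l2 :: "'a l2 \<Rightarrow> 'a l2 \<Rightarrow> complex" where
  "cinner_l2 = l2_cinner"

instance
  by standard (auto simp: cinner_l2_def l2_scaleC_of_real l2_cinner_add l2_cinner_scaleC
      inner_l2_def intro: l2_cinner_commute)

end

lemmas l2_nth_simps [simp] = zero_l2.rep_eq plus_l2.rep_eq uminus_l2.rep_eq l2_nth_minus
  scaleC_l2.rep_eq scaleR_l2.rep_eq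

lemma l2_nth_sum [simp]: "l2_nth (\<Sum>i\<in>I. f i) n = (\<Sum>i\<in>I. l2_nth (f i) n)"
  by (induction I rule: infinite_finite_induct) auto

lift_definition l2_single :: "nat \<Rightarrow> 'h :: complex_hilbert \<Rightarrow> 'h l2" is "\<lambda>n h m. if m = n then h else 0"
proof -
  fix n :: nat and h :: 'h
  have "finite {m. (norm (if m = n then h else 0))\<^sup>2 \<noteq> 0}"
    by (rule finite_subset [of _ "{n}"]) auto
  then show "summable (\<lambda>m. (norm (if m = n then h else 0))\<^sup>2)"
    by (intro summable_finite [of "{n}"]) auto
qed

lemma l2_nth_single [simp]: "l2_nth (l2_single n h) m = (if m = n then h else 0)"
  by (simp add: l2_single.rep_eq)

lemma cinner_l2_single [simp]: "cinner v (l2_single n h) = cinner (l2_nth v n) h"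
proof -
  have "cinner v (l2_single n h) = (suminf (\<lambda>m. if m = n then cinner (l2_nth v n) h else 0))"
    unfolding cinner_l2_def l2_cinner_def by (rule arg_cong [where f = suminf]) auto
  also have "\<dots> = (\<Sum>m\<in>{n}. if m = n then cinner (l2_nth v n) h else 0)"
    by (rule suminf_finite) auto
  finally show ?thesis
    by simp
qed

lemma cinner_l2_single_left [simp]: "cinner (l2_single n h) v = cinner h (l2_nth v n)"
  by (metis cinner_commute cinner_l2_single)

lemma norm_l2_single [simp]: "norm (l2_single n h) = norm h"
proof -
  have "complex_of_real ((norm (l2_single n h))\<^sup>2) = complex_of_real ((norm h)\<^sup>2)"
    unfolding cinner_self [symmetric] by simp
  then have "(norm (l2_single n h))\<^sup>2 = (norm h)\<^sup>2"
    unfolding of_real_eq_iff .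
  then show ?thesis
    by (simp add: power2_eq_iff_nonneg)
qed

lemma l2_truncate_tendsto: "(\<lambda>N. \<Sum>n<N. l2_single n (l2_nth v n)) \<longlonglongrightarrow> v"
proof (rule tendstoI)
  fix e :: real assume "e > 0"
  then have "e\<^sup>2 > 0"
    by simp
  from suminf_exist_split [OF this l2_summable [of v]]
  obtain M where M: "\<And>N. N \<ge> M \<Longrightarrow> norm (suminf (\<lambda>n. (norm (l2_nth v (n + N)))\<^sup>2)) < e\<^sup>2"
    by blast
  have "dist (\<Sum>n<N. l2_single n (l2_nth v n)) v < e" if "N \<ge> M" for N
  proof -
    let ?d = "v - (\<Sum>n<N. l2_single n (l2_nth v n))"
    have d: "l2_nth ?d n = (if n < N then 0 else l2_nth v n)" for n
      by simp
    have "(norm ?d)\<^sup>2 = (suminf (\<lambda>n. (norm (l2_nth ?d (n + N)))\<^sup>2)) + (\<Sum>n<N. (norm (l2_nth ?d n))\<^sup>2)"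
      unfolding norm_l2 by (rule suminf_split_initial_segment [OF l2_summable])
    also have "\<dots> = (suminf (\<lambda>n. (norm (l2_nth v (n + N)))\<^sup>2))"
      unfolding d by simp
    also have "\<dots> < e\<^sup>2"
      using M [OF that] by simp
    finally show ?thesis
      using \<open>e > 0\<close> by (simp add: dist_norm norm_minus_commute power_less_imp_less_base)
  qed
  then show "\<forall>\<^sub>F N in sequentially. dist (\<Sum>n<N. l2_single n (l2_nth v n)) v < e"
    by (auto simp: eventually_sequentially)
qed

text \<open>Packs two vectors into one, compatibly with \<open>l2_amp\<close>. Approximation at one
  vector thereby gives simultaneous approximation at two, which is how basic neighbourhoods are
  intersected.\<close>

lift_definition l2_interleave :: "'h :: complex_hilbert l2 \<Rightarrow> 'h l2 \<Rightarrow> 'h l2" is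
  "\<lambda>v w n. if even n then v (n div 2) else w ((n - 1) div 2)"
proof -
  fix v w :: "nat \<Rightarrow> 'h"
  assume "summable (\<lambda>n. (norm (v n))\<^sup>2)" "summable (\<lambda>n. (norm (w n))\<^sup>2)"
  then obtain x y where "(\<lambda>n. (norm (v n))\<^sup>2) sums x" "(\<lambda>n. (norm (w n))\<^sup>2) sums y"
    by (auto simp: summable_def)
  from sums_if [OF this(2) this(1)]
  show "summable (\<lambda>n. (norm (if even n then v (n div 2) else w ((n - 1) div 2)))\<^sup>2)"
    by (auto simp: summable_def if_distrib [of norm] if_distrib [of "\<lambda>x. x\<^sup>2"])
qed

lemma norm_l2_interleave: "(norm (l2_interleave v w))\<^sup>2 = (norm v)\<^sup>2 + (norm w)\<^sup>2"
proof -
  have "(\<lambda>n. (norm (l2_nth v n))\<^sup>2) sums (norm v)\<^sup>2" "(\<lambda>n. (norm (l2_nth w n))\<^sup>2) sums (norm w)\<^sup>2"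
    unfolding norm_l2 by (rule summable_sums [OF l2_summable])+
  from sums_if [OF this(2) this(1)]
  have "(\<lambda>n. (norm (l2_nth (l2_interleave v w) n))\<^sup>2) sums ((norm w)\<^sup>2 + (norm v)\<^sup>2)"
    by (simp add: l2_interleave.rep_eq if_distrib [of norm] if_distrib [of "\<lambda>x. x\<^sup>2"] cong: if_cong)
  then show ?thesis
    unfolding norm_l2 [of "l2_interleave v w"] by (simp add: sums_iff add.commute)
qed

subsection \<open>Amplifications\<close>

definition l2_amp :: "'h :: complex_hilbert bop \<Rightarrow> 'h l2 bop" where
  "l2_amp T = Bop (\<lambda>v. L2 (\<lambda>n. T \<cdot> l2_nth v n))"

lemma l2_nth_amp [simp]: "l2_nth (l2_amp T \<cdot> v) n = T \<cdot> l2_nth v n"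
proof -
  let ?f = "\<lambda>v. L2 (\<lambda>n. T \<cdot> l2_nth v n)"
  have nth: "l2_nth (?f v) n = T \<cdot> l2_nth v n" for v n
    by (subst L2_inverse) (auto intro: summable_bop_sq l2_summable)
  have "(norm (?f v))\<^sup>2 \<le> (opnorm T * norm v)\<^sup>2" for v
  proof -
    have "(norm (?f v))\<^sup>2 \<le> (suminf (\<lambda>n. (opnorm T)\<^sup>2 * (norm (l2_nth v n))\<^sup>2))"
      unfolding norm_l2 nth
    proof (rule suminf_le)
      show "(norm (T \<cdot> l2_nth v n))\<^sup>2 \<le> (opnorm T)\<^sup>2 * (norm (l2_nth v n))\<^sup>2" for n
        using power_mono [OF opnorm [of T "l2_nth v n"], of 2] by (simp add: power_mult_distrib)
    qed (auto intro: summable_mult summable_bop_sq l2_summable)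
    then show ?thesis
      by (simp add: suminf_mult l2_summable norm_l2 power_mult_distrib)
  qed
  then have bd: "norm (?f v) \<le> opnorm T * norm v" for v
    by (rule power2_le_imp_le) simp
  obtain S where S: "\<And>v. S \<cdot> v = ?f v"
  proof (rule bop_of_linear [of ?f "opnorm T"])
    show "?f (v + w) = ?f v + ?f w" for v w
      by (rule l2_eqI) (simp only: nth plus_l2.rep_eq [of "?f v"], simp add: bop_add)
    show "?f (c *\<^sub>C v) = c *\<^sub>C ?f v" for c v
      by (rule l2_eqI) (simp only: nth scaleC_l2.rep_eq [of c "?f v"], simp add: bop_scaleC)
  qed (use bd in auto)
  then have "bop_apply S = ?f"
    by (rule ext)
  then have "l2_amp T = S"
    unfolding l2_amp_def by (metis bop_apply_inverse)
  then show ?thesis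
    by (simp add: S nth)
qed

lemma l2_amp_diff: "l2_amp (S - T) = l2_amp S - l2_amp T"
  by (rule bop_eqI, rule l2_eqI) simp

lemma l2_amp_mult: "l2_amp (S * T) = l2_amp S * l2_amp T"
  by (rule bop_eqI, rule l2_eqI) simp

lemma adj_l2_amp: "adj (l2_amp T) = l2_amp (adj T)"
  by (rule adj_eqI) (simp add: cinner_l2_def l2_cinner_def cinner_adj_right)

lemma l2_amp_interleave: "l2_amp T \<cdot> l2_interleave v w = l2_interleave (l2_amp T \<cdot> v) (l2_amp T \<cdot> w)"
  by (rule l2_eqI) (simp add: l2_interleave.rep_eq)

lemma l2_amp_single [simp]: "l2_amp T \<cdot> l2_single n h = l2_single n (T \<cdot> h)"
  by (rule l2_eqI) simp

lemma suminf_cinner_amp: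
  assumes "summable (\<lambda>n. (norm (v n))\<^sup>2)" "summable (\<lambda>n. (norm (w n))\<^sup>2)"
  shows "(suminf (\<lambda>n. cinner (T \<cdot> v n) (w n))) = cinner (l2_amp T \<cdot> L2 v) (L2 w)"
  using assms by (simp add: cinner_l2_def l2_cinner_def L2_inverse)

subsection \<open>Density of an operator algebra in its bicommutant\<close>

definition commutant :: "'h :: complex_hilbert bop set \<Rightarrow> 'h bop set" where
  "commutant S = {T. \<forall>b\<in>S. T * b = b * T}"

text \<open>Von Neumann's argument: the projection \<open>Q\<close> onto the closure of all
  amplified \<open>b\<close> applied to \<open>v\<close> commutes with the amplification of
  \<open>a\<close>. Since \<open>v\<close> is in the range of \<open>Q\<close>, so is its image
  under the amplified \<open>a\<close>.\<close>

lemma bicommutant_approx: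
  assumes S: "nonunital_algebra S" "1 \<in> S" "\<And>b. b \<in> S \<Longrightarrow> adj b \<in> S"
    and a: "a \<in> commutant (commutant S)" and "e > 0"
  obtains b where "b \<in> S" "norm (l2_amp (a - b) \<cdot> v) < e"
proof -
  define N where "N = (\<lambda>b. l2_amp b \<cdot> v) ` S"
  have N: "csubspace N"
  proof -
    have amp: "l2_amp 0 \<cdot> v = 0" "l2_amp (b + c) \<cdot> v = l2_amp b \<cdot> v + l2_amp c \<cdot> v"
      "l2_amp (z *\<^sub>C b) \<cdot> v = z *\<^sub>C l2_amp b \<cdot> v" for b c z
      by (auto intro: l2_eqI)
    show ?thesis
      unfolding csubspace_def N_def ball_simps
    proof (intro conjI ballI allI)
      show "0 \<in> (\<lambda>b. l2_amp b \<cdot> v) ` S"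
        by (rule image_eqI [of _ _ 0]) (use S(1) amp in \<open>auto simp: nonunital_algebra_def\<close>)
      fix b c z assume "b \<in> S"
      then show "z *\<^sub>C l2_amp b \<cdot> v \<in> (\<lambda>b. l2_amp b \<cdot> v) ` S"
        by (intro image_eqI [of _ _ "z *\<^sub>C b"]) (use S(1) amp in \<open>auto simp: nonunital_algebra_def\<close>)
      assume "c \<in> S"
      with \<open>b \<in> S\<close> show "l2_amp b \<cdot> v + l2_amp c \<cdot> v \<in> (\<lambda>b. l2_amp b \<cdot> v) ` S"
        by (intro image_eqI [of _ _ "b + c"]) (use S(1) amp in \<open>auto simp: nonunital_algebra_def\<close>)
    qed
  qed
  obtain Q where Q: "\<And>u. Q \<cdot> u \<in> closure N" "\<And>u. u \<in> closure N \<Longrightarrow> Q \<cdot> u = u" "adj Q = Q"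
    "\<And>u n. n \<in> closure N \<Longrightarrow> cinner (u - Q \<cdot> u) n = 0"
    by (rule orthogonal_projection_exists [OF N]) blast
  have inv: "l2_amp b \<cdot> u \<in> closure N" if b: "b \<in> S" and u: "u \<in> closure N" for b u
  proof -
    obtain f where f: "\<And>n. f n \<in> N" "f \<longlonglongrightarrow> u"
      using u by (auto simp: closure_sequential)
    have "l2_amp b \<cdot> f n \<in> N" for n
    proof -
      obtain c where "c \<in> S" "f n = l2_amp c \<cdot> v"
        using f(1) [of n] by (auto simp: N_def)
      then have "l2_amp b \<cdot> f n = l2_amp (b * c) \<cdot> v" "b * c \<in> S"
        using S(1) b by (auto simp: l2_amp_mult nonunital_algebra_def)
      then show ?thesis
        by (auto simp: N_def)
    qed
    then show ?thesis
      unfolding closure_sequential using f(2)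
      by (intro exI [of _ "\<lambda>n. l2_amp b \<cdot> f n"] conjI allI tendsto_bop)
  qed
  have QbQ: "Q * l2_amp b * Q = l2_amp b * Q" if "b \<in> S" for b
    by (rule bop_eqI) (use inv [OF that Q(1)] Q(2) in simp)
  \<comment> \<open>Invariance of the range of \<open>Q\<close> under the amplifications of
    \<open>b\<close> and of its adjoint makes \<open>Q\<close> commute with the former.\<close>
  have comm: "Q * l2_amp b = l2_amp b * Q" if "b \<in> S" for b
  proof -
    have "adj (Q * l2_amp (adj b) * Q) = adj (l2_amp (adj b) * Q)"
      using QbQ [OF S(3) [OF that]] by simp
    then have "Q * l2_amp b * Q = Q * l2_amp b"
      by (simp add: Q(3) adj_l2_amp mult.assoc)
    then show ?thesis
      using QbQ [OF that] by simp
  qed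
  \<comment> \<open>The matrix entries of \<open>Q\<close>. They will lie in the commutant of
    \<open>S\<close>, so \<open>a\<close> commutes with each of them and the amplification of
    \<open>a\<close> commutes with \<open>Q\<close>.\<close>
  have "\<exists>R. \<forall>h. R \<cdot> h = l2_nth (Q \<cdot> l2_single n h) m" for m n
  proof -
    obtain R where "\<And>h. R \<cdot> h = l2_nth (Q \<cdot> l2_single n h) m"
    proof (rule bop_of_linear [of "\<lambda>h. l2_nth (Q \<cdot> l2_single n h) m" "opnorm Q"])
      have "l2_single n (u + w) = l2_single n u + l2_single n w" for u w :: 'a
        by (rule l2_eqI) simp
      then show "l2_nth (Q \<cdot> l2_single n (u + w)) m = l2_nth (Q \<cdot> l2_single n u) m + l2_nth (Q \<cdot> l2_single n w) m" for u w
        by (simp add: bop_add)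
      have "l2_single n (c *\<^sub>C u) = c *\<^sub>C l2_single n u" for c and u :: 'a
        by (rule l2_eqI) simp
      then show "l2_nth (Q \<cdot> l2_single n (c *\<^sub>C u)) m = c *\<^sub>C l2_nth (Q \<cdot> l2_single n u) m" for c u
        by (simp add: bop_scaleC)
      show "norm (l2_nth (Q \<cdot> l2_single n u) m) \<le> opnorm Q * norm u" for u
        using norm_l2_nth_le opnorm [of Q "l2_single n u"] order_trans by fastforce
    qed auto
    then show ?thesis
      by blast
  qed
  then have "\<forall>m. \<exists>R. \<forall>n h. R n \<cdot> h = l2_nth (Q \<cdot> l2_single n h) m"
    by (intro allI choice)
  then obtain R where R: "\<And>m n h. R m n \<cdot> h = l2_nth (Q \<cdot> l2_single n h) m"
    by (auto dest!: choice)
  have "R m n \<in> commutant S" for m n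
    unfolding commutant_def
  proof clarify
    fix b assume b: "b \<in> S"
    show "R m n * b = b * R m n"
    proof (rule bop_eqI)
      fix h
      have "(Q * l2_amp b) \<cdot> l2_single n h = (l2_amp b * Q) \<cdot> l2_single n h"
        by (simp only: comm [OF b])
      then show "(R m n * b) \<cdot> h = (b * R m n) \<cdot> h"
        by (simp add: R)
    qed
  qed
  then have aR: "a * R m n = R m n * a" for m n
    using a by (simp add: commutant_def)
  have single: "l2_amp a \<cdot> Q \<cdot> l2_single n h = Q \<cdot> l2_amp a \<cdot> l2_single n h" for n h
  proof (rule l2_eqI)
    fix m
    have "(a * R m n) \<cdot> h = (R m n * a) \<cdot> h"
      by (simp only: aR)
    then show "l2_nth (l2_amp a \<cdot> Q \<cdot> l2_single n h) m = l2_nth (Q \<cdot> l2_amp a \<cdot> l2_single n h) m"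
      by (simp add: R)
  qed
  have "l2_amp a \<cdot> Q \<cdot> v = Q \<cdot> l2_amp a \<cdot> v"
  proof (rule LIMSEQ_unique)
    let ?t = "\<lambda>N. \<Sum>n<N. l2_single n (l2_nth v n)"
    show "(\<lambda>N. l2_amp a \<cdot> Q \<cdot> ?t N) \<longlonglongrightarrow> l2_amp a \<cdot> Q \<cdot> v"
      by (intro tendsto_bop l2_truncate_tendsto)
    have "(\<lambda>N. Q \<cdot> l2_amp a \<cdot> ?t N) \<longlonglongrightarrow> Q \<cdot> l2_amp a \<cdot> v"
      by (intro tendsto_bop l2_truncate_tendsto)
    then show "(\<lambda>N. l2_amp a \<cdot> Q \<cdot> ?t N) \<longlonglongrightarrow> Q \<cdot> l2_amp a \<cdot> v"
      by (simp only: bop_sum single)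
  qed
  \<comment> \<open>Here the unit of \<open>S\<close> enters.\<close>
  moreover have "v \<in> N"
    unfolding N_def by (rule image_eqI [of _ _ 1]) (auto intro: l2_eqI S(2))
  ultimately have "l2_amp a \<cdot> v \<in> closure N"
    using Q(1,2) closure_subset by (metis subsetD)
  then obtain y where "y \<in> N" "dist y (l2_amp a \<cdot> v) < e"
    using \<open>e > 0\<close> by (meson closure_approachable)
  then show thesis
    using that by (auto simp: N_def dist_norm l2_amp_diff norm_minus_commute)
qed

subsection \<open>Ultraweak neighbourhoods\<close>

lemma norm_l2_interleave_ge:
  "norm v \<le> norm (l2_interleave v w)" "norm w \<le> norm (l2_interleave v w)"
  by (rule power2_le_imp_le; simp add: norm_l2_interleave)+

text \<open>The ultraweak coefficient of \<open>adj y * y\<close> is the inner product of the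
  amplified \<open>y\<close> at two vectors, so Cauchy-Schwarz controls it. Products of this form
  are wanted because \<open>\<phi> (adj y * y)\<close> is a squared norm in the GNS space.\<close>

lemma ultraweak_nhd_zero:
  assumes "openin ultraweak_topology U" "0 \<in> U"
  obtains v :: "'h :: complex_hilbert l2" and e where
    "e > 0" "\<And>y. norm (l2_amp y \<cdot> v) < e \<Longrightarrow> adj y * y \<in> U"
proof -
  let ?B = "{{T. suminf (\<lambda>n. cinner (T \<cdot> v n) (w n)) \<in> U} | (v :: nat \<Rightarrow> 'h) (w :: nat \<Rightarrow> 'h) U.
        summable (\<lambda>n. (norm (v n))\<^sup>2) \<and> summable (\<lambda>n. (norm (w n))\<^sup>2) \<and> open U}"
  let ?P = "\<lambda>U. \<exists>v :: 'h l2. \<exists>e > 0. \<forall>y. norm (l2_amp y \<cdot> v) < e \<longrightarrow> adj y * y \<in> U"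
  have "?P U"
  proof (rule nhd_in_generated_topology [where B = ?B and t = 0 and U = U and P = ?P])
    show "openin (topology_generated_by ?B) U"
      using assms(1) by (simp add: ultraweak_topology_def)
    show "0 \<in> U"
      by fact
  next
    fix V assume "V \<in> ?B" "0 \<in> V"
    then obtain v w W where V: "V = {T. suminf (\<lambda>n. cinner (T \<cdot> v n) (w n)) \<in> W}"
      and s: "summable (\<lambda>n. (norm (v n))\<^sup>2)" "summable (\<lambda>n. (norm (w n))\<^sup>2)" and W: "open W"
      by blast
    have "0 \<in> W"
      using \<open>0 \<in> V\<close> by (simp add: V)
    then obtain d where d: "d > 0" "ball 0 d \<subseteq> W"
      using W openE by blast
    let ?v = "L2 v" and ?w = "L2 w"
    have "adj y * y \<in> V" if y: "norm (l2_amp y \<cdot> l2_interleave ?v ?w) < sqrt d" for y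
    proof -
      have sq: "(norm (l2_amp y \<cdot> ?v))\<^sup>2 + (norm (l2_amp y \<cdot> ?w))\<^sup>2 < d"
        using power_strict_mono [OF y, of 2] d(1) by (simp add: l2_amp_interleave norm_l2_interleave)
      have "cmod (cinner (l2_amp (adj y * y) \<cdot> ?v) ?w) = cmod (cinner (l2_amp y \<cdot> ?v) (l2_amp y \<cdot> ?w))"
        by (simp add: l2_amp_mult adj_l2_amp [symmetric] cinner_adj_left)
      also have "\<dots> \<le> norm (l2_amp y \<cdot> ?v) * norm (l2_amp y \<cdot> ?w)"
        by (rule cmod_cinner_le)
      also have "\<dots> \<le> (norm (l2_amp y \<cdot> ?v))\<^sup>2 + (norm (l2_amp y \<cdot> ?w))\<^sup>2"
      proof -
        have "2 * (norm (l2_amp y \<cdot> ?v) * norm (l2_amp y \<cdot> ?w)) \<le> (norm (l2_amp y \<cdot> ?v))\<^sup>2 + (norm (l2_amp y \<cdot> ?w))\<^sup>2"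
          using sum_squares_bound [of "norm (l2_amp y \<cdot> ?v)" "norm (l2_amp y \<cdot> ?w)"] by (simp add: mult.assoc)
        moreover have "0 \<le> norm (l2_amp y \<cdot> ?v) * norm (l2_amp y \<cdot> ?w)"
          by simp
        ultimately show ?thesis
          by linarith
      qed
      also note sq
      finally have "cinner (l2_amp (adj y * y) \<cdot> ?v) ?w \<in> W"
        using d(2) by (auto simp: subset_iff)
      then show ?thesis
        unfolding V mem_Collect_eq suminf_cinner_amp [OF s] .
    qed
    moreover have "sqrt d > 0"
      using d(1) by simp
    ultimately show "?P V"
      by blast
  next
    fix V W assume "?P V" "?P W"
    then obtain v1 e1 v2 e2 where "e1 > 0" "\<And>y. norm (l2_amp y \<cdot> v1) < e1 \<Longrightarrow> adj y * y \<in> V"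
      "e2 > 0" "\<And>y. norm (l2_amp y \<cdot> v2) < e2 \<Longrightarrow> adj y * y \<in> W"
      by blast
    note * = this
    note le = norm_l2_interleave_ge
    have "adj y * y \<in> V \<inter> W" if "norm (l2_amp y \<cdot> l2_interleave v1 v2) < min e1 e2" for y
    proof -
      have "norm (l2_amp y \<cdot> v1) < e1" "norm (l2_amp y \<cdot> v2) < e2"
        using that le(1) [of "l2_amp y \<cdot> v1" "l2_amp y \<cdot> v2"] le(2) [of "l2_amp y \<cdot> v2" "l2_amp y \<cdot> v1"]
        by (auto simp: l2_amp_interleave)
      then show ?thesis
        using * by blast
    qed
    moreover have "min e1 e2 > 0"
      using * by simp
    ultimately show "?P (V \<inter> W)"
      by blast
  next
    fix V W assume "?P V" "V \<subseteq> W"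
    then show "?P W"
      by blast
  qed
  then show thesis
    using that by blast
qed

lemma norm_l2_amp_le:
  assumes "0 \<le> C" "\<And>h. norm (T \<cdot> h) \<le> C * norm h"
  shows "norm (l2_amp T \<cdot> v) \<le> C * norm v"
proof -
  have "(norm (l2_amp T \<cdot> v))\<^sup>2 \<le> suminf (\<lambda>n. C\<^sup>2 * (norm (l2_nth v n))\<^sup>2)"
    unfolding norm_l2 l2_nth_amp
  proof (rule suminf_le)
    show "(norm (T \<cdot> l2_nth v n))\<^sup>2 \<le> C\<^sup>2 * (norm (l2_nth v n))\<^sup>2" for n
      using power_mono [OF assms(2), of "l2_nth v n" 2] by (simp add: power_mult_distrib)
  qed (auto intro: summable_mult summable_bop_sq l2_summable)
  then have "(norm (l2_amp T \<cdot> v))\<^sup>2 \<le> (C * norm v)\<^sup>2"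
    by (simp add: suminf_mult l2_summable norm_l2 power_mult_distrib)
  then show ?thesis
    by (rule power2_le_imp_le) (simp add: assms(1))
qed

text \<open>On bounded sets the weak and the ultraweak topology agree: a truncation of
  \<open>v\<close> involves finitely many coefficients, and the rest contributes little, uniformly
  in \<open>n\<close>.\<close>

lemma amp_tendsto:
  fixes a :: "nat \<Rightarrow> 'h :: complex_hilbert bop"
  assumes C: "\<And>n v. norm (a n \<cdot> v) \<le> C * norm v" "\<And>v. norm (T \<cdot> v) \<le> C * norm v" "0 \<le> C"
    and lim: "\<And>v w. ((\<lambda>n. cinner (a n \<cdot> v) w) \<longlongrightarrow> cinner (T \<cdot> v) w) G"
  shows "((\<lambda>n. cinner (l2_amp (a n) \<cdot> v) w) \<longlongrightarrow> cinner (l2_amp T \<cdot> v) w) G"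
proof (rule tendstoI)
  fix e :: real assume e: "e > 0"
  let ?t = "\<lambda>N. \<Sum>n<N. l2_single n (l2_nth v n)"
  have D: "norm ((a n - T) \<cdot> h) \<le> 2 * C * norm h" for n h
    using norm_triangle_ineq4 [of "a n \<cdot> h" "T \<cdot> h"] C(1) [of n h] C(2) [of h] by simp
  \<comment> \<open>All \<open>a n - T\<close> are bounded by \<open>2 * C\<close>, so an error
    below \<open>d\<close> in \<open>v\<close> costs at most \<open>e / 2\<close>; the summand 1
    keeps the denominator positive.\<close>
  define d where "d = e / (2 * (2 * C * norm w + 1))"
  have d: "d > 0"
    using e C(3) by (simp add: d_def add_nonneg_pos)
  have "eventually (\<lambda>N. dist (?t N) v < d) sequentially"
    using l2_truncate_tendsto d by (rule tendstoD)
  then obtain N where N: "dist (?t N) v < d"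
    by (auto simp: eventually_sequentially)
  have "((\<lambda>n. \<Sum>k<N. cinner (a n \<cdot> l2_nth v k) (l2_nth w k) - cinner (T \<cdot> l2_nth v k) (l2_nth w k)) \<longlongrightarrow>
      (\<Sum>k<N. cinner (T \<cdot> l2_nth v k) (l2_nth w k) - cinner (T \<cdot> l2_nth v k) (l2_nth w k))) G"
    by (intro tendsto_intros lim)
  then have "eventually (\<lambda>n. dist (\<Sum>k<N. cinner (a n \<cdot> l2_nth v k) (l2_nth w k) - cinner (T \<cdot> l2_nth v k) (l2_nth w k)) 0 < e / 2) G"
    using e by (intro tendstoD) simp_all
  then show "eventually (\<lambda>n. dist (cinner (l2_amp (a n) \<cdot> v) w) (cinner (l2_amp T \<cdot> v) w) < e) G"
  proof (rule eventually_mono)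
    fix n assume n: "dist (\<Sum>k<N. cinner (a n \<cdot> l2_nth v k) (l2_nth w k) - cinner (T \<cdot> l2_nth v k) (l2_nth w k)) 0 < e / 2"
    have "cinner (l2_amp (a n - T) \<cdot> ?t N) w =
        (\<Sum>k<N. cinner (a n \<cdot> l2_nth v k) (l2_nth w k) - cinner (T \<cdot> l2_nth v k) (l2_nth w k))"
      by (simp add: bop_sum cinner_sum_left cinner_diff_left)
    then have 1: "cmod (cinner (l2_amp (a n - T) \<cdot> ?t N) w) < e / 2"
      using n by simp
    have "cmod (cinner (l2_amp (a n - T) \<cdot> (v - ?t N)) w) \<le> norm (l2_amp (a n - T) \<cdot> (v - ?t N)) * norm w"
      by (rule cmod_cinner_le)
    also have "\<dots> \<le> 2 * C * norm (v - ?t N) * norm w"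
      by (intro mult_right_mono norm_l2_amp_le D) (use C(3) in auto)
    also have "\<dots> \<le> 2 * C * d * norm w"
      using N C(3) by (intro mult_right_mono mult_left_mono) (auto simp: dist_norm norm_minus_commute)
    also have "\<dots> \<le> (2 * C * norm w + 1) * d"
      using d by (simp add: algebra_simps)
    also have "\<dots> = e / 2"
    proof -
      have "2 * C * norm w + 1 > 0"
        using C(3) by (simp add: add_nonneg_pos)
      then show ?thesis
        unfolding d_def by (simp add: field_simps)
    qed
    finally have 2: "cmod (cinner (l2_amp (a n - T) \<cdot> (v - ?t N)) w) \<le> e / 2" .
    have "cinner (l2_amp (a n) \<cdot> v) w - cinner (l2_amp T \<cdot> v) w =
        cinner (l2_amp (a n - T) \<cdot> (v - ?t N)) w + cinner (l2_amp (a n - T) \<cdot> ?t N) w"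
      by (simp add: l2_amp_diff bop_diff cinner_diff_left)
    then show "dist (cinner (l2_amp (a n) \<cdot> v) w) (cinner (l2_amp T \<cdot> v) w) < e"
      using norm_triangle_ineq [of "cinner (l2_amp (a n - T) \<cdot> (v - ?t N)) w" "cinner (l2_amp (a n - T) \<cdot> ?t N) w"] 1 2
      by (simp add: dist_norm)
  qed
qed

lemma ultraweak_tendsto_nhd:
  fixes a :: "nat \<Rightarrow> 'h :: complex_hilbert bop"
  assumes lim: "\<And>v w. ((\<lambda>n. cinner (l2_amp (a n) \<cdot> v) w) \<longlongrightarrow> cinner (l2_amp T \<cdot> v) w) G"
    and U: "openin ultraweak_topology U" "T \<in> U"
  shows "eventually (\<lambda>n. a n \<in> U) G"
proof (rule nhd_in_generated_topology [where t = T and U = U and P = "\<lambda>U. eventually (\<lambda>i. a i \<in> U) G"])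
  let ?B = "{{T. suminf (\<lambda>n. cinner (T \<cdot> v n) (w n)) \<in> U} | (v :: nat \<Rightarrow> 'h) (w :: nat \<Rightarrow> 'h) U.
        summable (\<lambda>n. (norm (v n))\<^sup>2) \<and> summable (\<lambda>n. (norm (w n))\<^sup>2) \<and> open U}"
  show "openin (topology_generated_by ?B) U"
    using U by (simp add: ultraweak_topology_def)
  fix V assume "V \<in> ?B" "T \<in> V"
  then obtain v w W where V: "V = {T. suminf (\<lambda>n. cinner (T \<cdot> v n) (w n)) \<in> W}"
    and s: "summable (\<lambda>n. (norm (v n))\<^sup>2)" "summable (\<lambda>n. (norm (w n))\<^sup>2)" and W: "open W"
    by blast
  show "eventually (\<lambda>n. a n \<in> V) G"
    using topological_tendstoD [OF lim W, of "L2 v" "L2 w"] \<open>T \<in> V\<close>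
    unfolding V mem_Collect_eq suminf_cinner_amp [OF s] by blast
qed (use U in \<open>auto elim: eventually_mono simp: eventually_conj_iff\<close>)

text \<open>A weak neighbourhood involves finitely many vectors, and \<open>l2_interleave\<close>
  merges them into a single one.\<close>

lemma wot_closure_amp:
  assumes approx: "\<And>(v :: 'h :: complex_hilbert l2) e. e > 0 \<Longrightarrow> \<exists>b\<in>S. norm (l2_amp (T - b) \<cdot> v) < e"
  shows "T \<in> weak_operator_topology closure_of S"
  unfolding in_closure_of
proof (intro conjI allI impI)
  fix U assume U: "T \<in> U \<and> openin weak_operator_topology U"
  let ?P = "\<lambda>U. \<exists>v :: 'h l2. \<exists>e > 0. \<forall>b. norm (l2_amp (T - b) \<cdot> v) < e \<longrightarrow> b \<in> U"
  have "?P U"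
  proof (rule nhd_in_generated_topology [where t = T and U = U and P = ?P])
    show "openin (topology_generated_by {{T. cinner (T \<cdot> v) w \<in> U} |v w U. open U}) U"
      using U by (simp add: weak_operator_topology_def)
    fix V assume "V \<in> {{T. cinner (T \<cdot> v) w \<in> U} |v w U. open U}" "T \<in> V"
    then obtain v w W where V: "V = {T. cinner (T \<cdot> v) w \<in> W}" "open W" "cinner (T \<cdot> v) w \<in> W"
      by auto
    then obtain d where d: "d > 0" "ball (cinner (T \<cdot> v) w) d \<subseteq> W"
      using openE by blast
    have "b \<in> V" if "norm (l2_amp (T - b) \<cdot> l2_single 0 v) < d / (norm w + 1)" for b
    proof -
      have "cmod (cinner ((T - b) \<cdot> v) w) \<le> norm ((T - b) \<cdot> v) * norm w"
        by (rule cmod_cinner_le)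
      also have "\<dots> \<le> norm ((T - b) \<cdot> v) * (norm w + 1)"
        by (intro mult_left_mono) auto
      also have "\<dots> < d"
        using that by (simp add: pos_less_divide_eq add_nonneg_pos)
      finally have "cinner (b \<cdot> v) w \<in> ball (cinner (T \<cdot> v) w) d"
        by (simp add: dist_norm cinner_diff_left)
      then show ?thesis
        using d(2) V(1) by blast
    qed
    moreover have "d / (norm w + 1) > 0"
      using d(1) by (simp add: add_nonneg_pos)
    ultimately show "?P V"
      by blast
  next
    fix V W assume "?P V" "?P W"
    then obtain v1 e1 v2 e2 where *: "e1 > 0" "\<And>y. norm (l2_amp (T - y) \<cdot> v1) < e1 \<Longrightarrow> y \<in> V"
      "e2 > 0" "\<And>y. norm (l2_amp (T - y) \<cdot> v2) < e2 \<Longrightarrow> y \<in> W"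
      by blast
    note le = norm_l2_interleave_ge
    have "y \<in> V \<inter> W" if "norm (l2_amp (T - y) \<cdot> l2_interleave v1 v2) < min e1 e2" for y
    proof -
      have "norm (l2_amp (T - y) \<cdot> v1) < e1" "norm (l2_amp (T - y) \<cdot> v2) < e2"
        using that le(1) [of "l2_amp (T - y) \<cdot> v1" "l2_amp (T - y) \<cdot> v2"]
          le(2) [of "l2_amp (T - y) \<cdot> v2" "l2_amp (T - y) \<cdot> v1"]
        by (auto simp: l2_amp_interleave)
      then show ?thesis
        using * by blast
    qed
    moreover have "min e1 e2 > 0"
      using * by simp
    ultimately show "?P (V \<inter> W)"
      by blast
  qed (use U in blast)+
  then show "\<exists>y. y \<in> S \<and> y \<in> U"
    using approx by blast
qed simp

text \<open>The adjoint is not strongly continuous, so real parts of strong approximants need not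
  approximate. Instead the target is projected onto the real subspace of the vectors that
  selfadjoint \<open>b\<close> produce from \<open>v\<close>. That the residual \<open>r\<close>
  vanishes needs only weak approximation, for which real parts are harmless.\<close>

lemma selfadj_bicommutant_approx:
  fixes v :: "'h :: complex_hilbert l2"
  assumes S: "nonunital_algebra S" "1 \<in> S" "\<And>b. b \<in> S \<Longrightarrow> adj b \<in> S"
    and a: "a \<in> commutant (commutant S)" "adj a = a" and "e > 0"
  obtains b where "b \<in> S" "adj b = b" "norm (l2_amp (a - b) \<cdot> v) < e"
proof -
  define M where "M = {b \<in> S. adj b = b}"
  define N where "N = (\<lambda>b. l2_amp b \<cdot> v) ` M"
  have amp: "l2_amp 0 \<cdot> v = 0" "l2_amp (b + c) \<cdot> v = l2_amp b \<cdot> v + l2_amp c \<cdot> v"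
    "l2_amp (z *\<^sub>C b) \<cdot> v = z *\<^sub>C l2_amp b \<cdot> v" for b c z and v :: "'h l2"
    by (auto intro: l2_eqI)
  have N: "subspace N"
    unfolding subspace_def N_def ball_simps
  proof (intro conjI ballI allI)
    show "0 \<in> (\<lambda>b. l2_amp b \<cdot> v) ` M"
      by (rule image_eqI [of _ _ 0]) (use S(1) amp in \<open>auto simp: M_def nonunital_algebra_def\<close>)
    fix b c and r :: real assume b: "b \<in> M"
    then show "r *\<^sub>R l2_amp b \<cdot> v \<in> (\<lambda>b. l2_amp b \<cdot> v) ` M"
      by (intro image_eqI [of _ _ "complex_of_real r *\<^sub>C b"])
        (use S(1) amp in \<open>auto simp: M_def nonunital_algebra_def scaleR_scaleC\<close>)
    assume "c \<in> M"
    with b show "l2_amp b \<cdot> v + l2_amp c \<cdot> v \<in> (\<lambda>b. l2_amp b \<cdot> v) ` M"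
      by (intro image_eqI [of _ _ "b + c"]) (use S(1) amp in \<open>auto simp: M_def nonunital_algebra_def\<close>)
  qed
  obtain q where q: "q \<in> closure N" "\<And>n. n \<in> N \<Longrightarrow> inner (l2_amp a \<cdot> v - q) n = 0"
    using projection_exists [OF N] by blast
  define r where "r = l2_amp a \<cdot> v - q"
  have r: "inner r n = 0" if "n \<in> closure N" for n
  proof -
    have "closure N \<subseteq> {n. inner r n = 0}"
      by (rule closure_minimal) (use q(2) in \<open>auto simp: r_def closed_hyperplane\<close>)
    then show ?thesis
      using that by blast
  qed
  have "inner r r \<le> 0"
  proof (rule field_le_epsilon)
    fix d :: real assume "d > 0"
    let ?d = "d / (norm r + norm v + 1)"
    have pos: "norm r + norm v + 1 > 0"
      by (simp add: add_nonneg_pos)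
    \<comment> \<open>Closeness at \<open>v\<close> controls the pairing of \<open>r\<close> with
      \<open>c\<close> applied to \<open>v\<close>; closeness at \<open>r\<close> controls the
      pairing with \<open>adj c\<close> applied to \<open>v\<close>. Together they control the real
      part \<open>b\<close>, whose pairing with \<open>r\<close> is zero.\<close>
    obtain c where c: "c \<in> S" "norm (l2_amp (a - c) \<cdot> l2_interleave v r) < ?d"
      by (rule bicommutant_approx [OF S a(1), of ?d]) (use \<open>d > 0\<close> pos in auto)
    have cv: "norm (l2_amp (a - c) \<cdot> v) < ?d" and cr: "norm (l2_amp (a - c) \<cdot> r) < ?d"
      using c(2) norm_l2_interleave_ge(1) [of "l2_amp (a - c) \<cdot> v" "l2_amp (a - c) \<cdot> r"]
        norm_l2_interleave_ge(2) [of "l2_amp (a - c) \<cdot> r" "l2_amp (a - c) \<cdot> v"]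
      unfolding l2_amp_interleave by linarith+
    define b where "b = (1/2) *\<^sub>C (c + adj c)"
    have "b \<in> S" "adj b = b"
      using S c(1) by (auto simp: b_def nonunital_algebra_def add.commute)
    then have "l2_amp b \<cdot> v \<in> closure N"
      by (intro subsetD [OF closure_subset]) (auto simp: N_def M_def)
    then have "inner r (l2_amp b \<cdot> v) = 0"
      by (rule r)
    moreover have "2 * inner r (l2_amp b \<cdot> v) = inner r (l2_amp c \<cdot> v) + inner r (l2_amp (adj c) \<cdot> v)"
    proof -
      have "l2_amp b \<cdot> v = (1/2) *\<^sub>C (l2_amp c \<cdot> v + l2_amp (adj c) \<cdot> v)"
        by (simp add: b_def amp)
      also have "\<dots> = (1/2) *\<^sub>R (l2_amp c \<cdot> v + l2_amp (adj c) \<cdot> v)"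
        by (simp add: scaleR_scaleC)
      finally show ?thesis
        by (simp add: inner_add_right)
    qed
    moreover have "inner r (l2_amp a \<cdot> v) - inner r (l2_amp c \<cdot> v) \<le> norm r * ?d"
    proof -
      have "inner r (l2_amp (a - c) \<cdot> v) \<le> norm r * norm (l2_amp (a - c) \<cdot> v)"
        by (rule norm_cauchy_schwarz)
      also have "\<dots> \<le> norm r * ?d"
        using cv by (intro mult_left_mono) auto
      finally show ?thesis
        by (simp add: l2_amp_diff inner_diff_right)
    qed
    moreover have "inner r (l2_amp a \<cdot> v) - inner r (l2_amp (adj c) \<cdot> v) \<le> ?d * norm v"
    proof -
      have "inner r (l2_amp (a - adj c) \<cdot> v) = inner (l2_amp (a - c) \<cdot> r) v"
        unfolding Re_cinner [symmetric] by (metis a(2) adj_adj adj_diff adj_l2_amp cinner_adj_right)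
      also have "\<dots> \<le> norm (l2_amp (a - c) \<cdot> r) * norm v"
        by (rule norm_cauchy_schwarz)
      also have "\<dots> \<le> ?d * norm v"
        using cr by (intro mult_right_mono) auto
      finally show ?thesis
        by (simp add: l2_amp_diff inner_diff_right)
    qed
    ultimately have "2 * inner r (l2_amp a \<cdot> v) \<le> norm r * ?d + ?d * norm v"
      by linarith
    also have "\<dots> = (norm r + norm v) * ?d"
      by (simp only: distrib_right mult.commute)
    also have "\<dots> \<le> (norm r + norm v + 1) * ?d"
      using \<open>d > 0\<close> by (intro mult_right_mono) auto
    also have "\<dots> = d"
      using pos by simp
    finally have "2 * inner r (l2_amp a \<cdot> v) \<le> d" .
    moreover have "inner r r = inner r (l2_amp a \<cdot> v)"
      using r [OF q(1)] by (simp add: r_def inner_diff_right)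
    ultimately show "inner r r \<le> 0 + d"
      using \<open>d > 0\<close> by simp
  qed
  then have "r = 0"
    using inner_ge_zero [of r] by (metis inner_eq_zero_iff order_antisym)
  then have "l2_amp a \<cdot> v \<in> closure N"
    using q(1) by (simp add: r_def)
  then obtain y where "y \<in> N" "dist y (l2_amp a \<cdot> v) < e"
    using \<open>e > 0\<close> by (meson closure_approachable)
  then show thesis
    using that by (auto simp: N_def M_def dist_norm l2_amp_diff norm_minus_commute)
qed

subsection \<open>Generated algebras\<close>

lemma nonunital_algebra_hull: "nonunital_algebra (nonunital_algebra hull X)"
  by (auto simp: hull_def nonunital_algebra_def)

lemma nonunital_algebra_hull_selfadj:
  assumes "\<And>b. b \<in> X \<Longrightarrow> adj b = b" "b \<in> nonunital_algebra hull X"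
  shows "adj b \<in> nonunital_algebra hull X"
proof -
  let ?H = "nonunital_algebra hull X"
  have "nonunital_algebra {b. adj b \<in> ?H}"
    using nonunital_algebra_hull [of X] by (auto simp: nonunital_algebra_def)
  moreover have "X \<subseteq> {b. adj b \<in> ?H}"
    using assms(1) subsetD [OF hull_subset [of X nonunital_algebra]] by auto
  ultimately have "?H \<subseteq> {b. adj b \<in> ?H}"
    by (rule hull_minimal [rotated])
  then show ?thesis
    using assms(2) by blast
qed

lemma von_neumann_algebra_bicommutant:
  assumes S: "\<And>b. b \<in> S \<Longrightarrow> adj b \<in> S"
  shows "von_neumann_algebra (commutant (commutant S))"
proof -
  have adj_comm: "adj T \<in> commutant S" if "T \<in> commutant S" for T
    unfolding commutant_def
  proof clarify
    fix b assume "b \<in> S"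
    then have "T * adj b = adj b * T"
      using that S by (simp add: commutant_def)
    then have "adj (T * adj b) = adj (adj b * T)"
      by simp
    then show "adj T * b = b * adj T"
      by simp
  qed
  have "adj a \<in> commutant (commutant S)" if "a \<in> commutant (commutant S)" for a
    unfolding commutant_def [of "commutant S"]
  proof clarify
    fix T assume "T \<in> commutant S"
    then have "a * adj T = adj T * a"
      using that adj_comm by (simp add: commutant_def [of "commutant S"])
    then have "adj (a * adj T) = adj (adj T * a)"
      by simp
    then show "adj a * T = T * adj a"
      by simp
  qed
  moreover have "closedin weak_operator_topology (commutant (commutant S))"
  proof -
    have "closedin weak_operator_topology (topspace weak_operator_topology \<inter> (\<Inter>R\<in>commutant S. {T. T * R = R * T}))"
    proof (cases "commutant S = {}")
      case False
      then have "closedin weak_operator_topology (\<Inter>R\<in>commutant S. {T. T * R = R * T})"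
        by (intro closedin_Inter) (auto intro: closedin_wot_eq
            [OF continuous_map_wot_mult_right continuous_map_wot_mult_left])
      then show ?thesis
        by simp
    qed (use closedin_topspace [of weak_operator_topology] in simp)
    also have "topspace weak_operator_topology \<inter> (\<Inter>R\<in>commutant S. {T. T * R = R * T}) = commutant (commutant S)"
      by (auto simp: commutant_def [of "commutant S"])
    finally show ?thesis .
  qed
  moreover have "nonunital_algebra (commutant (commutant S))"
  proof -
    have "(a * b) * R = R * (a * b)" if "a * R = R * a" "b * R = R * b" for a b R :: "'a bop"
      by (metis that mult.assoc)
    then show ?thesis
      by (simp add: nonunital_algebra_def commutant_def [of "commutant S"] distrib_left distrib_right)
  qed
  ultimately show ?thesis
    by (auto simp: von_neumann_algebra_def commutant_def [of "commutant S"])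
qed

section \<open>Positive operators\<close>

definition bpos :: "'h :: complex_hilbert bop \<Rightarrow> bool" where
  "bpos T \<longleftrightarrow> adj T = T \<and> (\<forall>v. 0 \<le> Re (cinner (T \<cdot> v) v))"

lemma bpos_add: "bpos S \<Longrightarrow> bpos T \<Longrightarrow> bpos (S + T)"
  by (simp add: bpos_def cinner_add_left)

lemma bpos_scale: "0 \<le> r \<Longrightarrow> bpos T \<Longrightarrow> bpos (complex_of_real r *\<^sub>C T)"
  by (simp add: bpos_def cinner_scaleC_left)

lemma bpos_zero: "bpos 0"
  by (simp add: bpos_def)

lemma bpos_one: "bpos 1"
  by (simp add: bpos_def cinner_self)

lemma bpos_conj: "bpos T \<Longrightarrow> bpos (adj q * T * q)"
  by (simp add: bpos_def cinner_adj_left mult.assoc)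

lemma bpos_conj': "bpos T \<Longrightarrow> adj q = q \<Longrightarrow> bpos (q * T * q)"
  using bpos_conj [of T q] by simp

lemma bpos_square: "bpos (adj q * q)"
  using bpos_conj [OF bpos_one, of q] by simp

text \<open>Conjugation by \<open>T\<close> raises the exponent by two, hence the two base
  cases.\<close>

lemma bpos_power:
  assumes "bpos T"
  shows "bpos (T ^ n)"
proof (induction n rule: induct_nat_012)
  case (ge2 n)
  have "T * T ^ n * T = T ^ Suc (Suc n)"
    by (simp add: power_commutes mult.assoc)
  then show ?case
    using bpos_conj' [OF ge2(1), of T] assms by (simp add: bpos_def)
qed (use assms bpos_one in auto)

definition pos_contraction :: "'h :: complex_hilbert bop \<Rightarrow> bool" where
  "pos_contraction s \<longleftrightarrow> bpos s \<and> bpos (1 - s)"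

lemma pos_contraction_compl: "pos_contraction s \<Longrightarrow> pos_contraction (1 - s)"
  by (simp add: pos_contraction_def)

lemma pos_contraction_commutes: "s * (1 - s) ^ j = (1 - s) ^ j * (s :: 'h :: complex_hilbert bop)"
  by (induction j) (simp_all add: algebra_simps, metis mult.assoc)

text \<open>The product is the sum of \<open>1 - s\<close> conjugated by \<open>s\<close> and
  \<open>s\<close> conjugated by \<open>1 - s\<close>, each of which is visibly positive.\<close>

lemma bpos_mult_compl:
  assumes "pos_contraction s"
  shows "bpos (s * (1 - s))"
proof -
  have "s * (1 - s) = s * (1 - s) * s + (1 - s) * s * (1 - s)"
    by (simp add: algebra_simps)
  moreover have "bpos (s * (1 - s) * s + (1 - s) * s * (1 - s))"
  proof (rule bpos_add)
    show "bpos (s * (1 - s) * s)" "bpos ((1 - s) * s * (1 - s))"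
      by (rule bpos_conj'; use assms in \<open>simp add: pos_contraction_def bpos_def\<close>)+
  qed
  ultimately show ?thesis
    by (simp only:)
qed

lemma pos_contraction_norm_sq:
  assumes "pos_contraction s"
  shows "(norm (s \<cdot> v))\<^sup>2 \<le> Re (cinner (s \<cdot> v) v)"
proof -
  have s: "adj s = s"
    using assms by (simp add: pos_contraction_def bpos_def)
  have "0 \<le> Re (cinner ((s * (1 - s)) \<cdot> v) v)"
    using bpos_mult_compl [OF assms] by (simp add: bpos_def)
  also have "cinner ((s * (1 - s)) \<cdot> v) v = cinner (s \<cdot> v) v - cinner (s \<cdot> v) (s \<cdot> v)"
    by (simp add: bop_diff cinner_diff_left selfadj_cinner [OF s])
  finally show ?thesis
    by (simp add: cinner_self)
qed

lemma pos_contraction_norm: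
  assumes "pos_contraction s"
  shows "norm (s \<cdot> v) \<le> norm v"
proof -
  have "(norm (s \<cdot> v))\<^sup>2 \<le> Re (cinner (s \<cdot> v) v)"
    by (rule pos_contraction_norm_sq [OF assms])
  also have "\<dots> \<le> norm (s \<cdot> v) * norm v"
    using cmod_cinner_le complex_Re_le_cmod order_trans by blast
  finally show ?thesis
    by (cases "s \<cdot> v = 0") (auto simp: power2_eq_square)
qed

lemma bpos_mult_power_compl:
  assumes "pos_contraction s"
  shows "bpos (s * (1 - s) ^ j)"
proof (induction j rule: induct_nat_012)
  case (ge2 n)
  have "(1 - s) * (s * (1 - s) ^ n) * (1 - s) = ((1 - s) * s) * ((1 - s) ^ n * (1 - s))"
    by (simp only: mult.assoc)
  also have "\<dots> = (s * (1 - s)) * ((1 - s) ^ n * (1 - s))"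
    by (simp only: left_diff_distrib right_diff_distrib mult_1_left mult_1_right)
  also have "\<dots> = s * ((1 - s) * ((1 - s) ^ n * (1 - s)))"
    by (rule mult.assoc)
  also have "\<dots> = s * (1 - s) ^ Suc (Suc n)"
    by (simp only: power_Suc [symmetric] power_Suc2 [symmetric])
  finally have "(1 - s) * (s * (1 - s) ^ n) * (1 - s) = s * (1 - s) ^ Suc (Suc n)" .
  then show ?case
    using bpos_conj' [OF ge2(1), of "1 - s"] assms by (simp add: pos_contraction_def bpos_def)
qed (use assms bpos_mult_compl in \<open>auto simp: pos_contraction_def\<close>)

lemma one_minus_power_compl: "1 - (1 - s) ^ Suc k = (1 - (1 - s) ^ k) + s * (1 - s) ^ k"
  for s :: "'h :: complex_hilbert bop"
  by (simp add: algebra_simps)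

lemma pos_contraction_power:
  assumes "pos_contraction s"
  shows "pos_contraction ((1 - s) ^ k)" "pos_contraction (1 - (1 - s) ^ k)"
proof -
  have "bpos ((1 - s) ^ k)"
    using assms by (simp add: pos_contraction_def bpos_power)
  moreover have "bpos (1 - (1 - s) ^ k)"
  proof (induction k)
    case (Suc k)
    show ?case
      unfolding one_minus_power_compl by (rule bpos_add [OF Suc bpos_mult_power_compl [OF assms]])
  qed (simp add: bpos_zero)
  ultimately show "pos_contraction ((1 - s) ^ k)" "pos_contraction (1 - (1 - s) ^ k)"
    by (auto simp: pos_contraction_def)
qed

lemma bpos_mult_power_decr:
  assumes "pos_contraction s"
  shows "bpos (s * (1 - s) ^ j - s * (1 - s) ^ Suc j)"
proof -
  have "s * (1 - s) ^ j * s = s * (1 - s) ^ j - s * (1 - s) ^ Suc j"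
    by (simp add: algebra_simps pos_contraction_commutes [symmetric])
  then show ?thesis
    using bpos_conj' [OF bpos_power, of "1 - s" s j] assms by (auto simp: pos_contraction_def bpos_def)
qed

lemma scaleC_of_nat_Suc: "of_nat (Suc k) *\<^sub>C (a :: 'a :: complex_vector) = of_nat k *\<^sub>C a + a"
  by (simp add: scaleC_add_left scaleC_one add.commute)

text \<open>Bernoulli's inequality for operators: \<open>1 - (1 - s) ^ k\<close> is the sum of
  \<open>s * (1 - s) ^ j\<close> over \<open>j < k\<close>, and every summand is at most
  \<open>s\<close>.\<close>

lemma bpos_bernoulli:
  assumes "pos_contraction s"
  shows "bpos (complex_of_nat k *\<^sub>C s - (1 - (1 - s) ^ k))"
proof (induction k)
  case (Suc k)
  have "bpos (s - s * (1 - s) ^ k)"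
  proof (induction k)
    case (Suc k)
    have "s - s * (1 - s) ^ Suc k = (s - s * (1 - s) ^ k) + (s * (1 - s) ^ k - s * (1 - s) ^ Suc k)"
      by simp
    then show ?case
      using bpos_add [OF Suc bpos_mult_power_decr [OF assms, of k]] by metis
  qed (simp add: bpos_zero)
  moreover have "complex_of_nat (Suc k) *\<^sub>C s - (1 - (1 - s) ^ Suc k) =
      (complex_of_nat k *\<^sub>C s - (1 - (1 - s) ^ k)) + (s - s * (1 - s) ^ k)"
    unfolding one_minus_power_compl scaleC_of_nat_Suc by simp
  ultimately show ?case
    using bpos_add [OF Suc] by metis
qed (simp add: bpos_zero)

text \<open>The summands \<open>s * (1 - s) ^ j\<close> of \<open>1 - (1 - s) ^ Suc k\<close>
  decrease in \<open>j\<close>, so \<open>Suc k\<close> times the last one is at most their sum,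
  hence at most 1.\<close>

lemma pos_contraction_Suc_mult_power:
  assumes "pos_contraction s"
  shows "pos_contraction (complex_of_nat (Suc k) *\<^sub>C (s * (1 - s) ^ k))"
proof -
  have D: "bpos ((1 - (1 - s) ^ Suc k) - complex_of_nat (Suc k) *\<^sub>C (s * (1 - s) ^ k))"
  proof (induction k)
    case 0
    then show ?case
      by (simp add: scaleC_one bpos_zero)
  next
    case (Suc k)
    have "(1 - (1 - s) ^ Suc (Suc k)) - complex_of_nat (Suc (Suc k)) *\<^sub>C (s * (1 - s) ^ Suc k) =
      ((1 - (1 - s) ^ Suc k) - complex_of_nat (Suc k) *\<^sub>C (s * (1 - s) ^ k)) +
      complex_of_nat (Suc k) *\<^sub>C (s * (1 - s) ^ k - s * (1 - s) ^ Suc k)"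
      unfolding one_minus_power_compl [of s "Suc k"] scaleC_of_nat_Suc [of "Suc k"] scaleC_diff_right
      by simp
    moreover have "bpos (complex_of_nat (Suc k) *\<^sub>C (s * (1 - s) ^ k - s * (1 - s) ^ Suc k))"
      using bpos_scale [OF _ bpos_mult_power_decr [OF assms], of "real (Suc k)"] by simp
    ultimately show ?case
      using bpos_add [OF Suc] by metis
  qed
  have "bpos (1 - complex_of_nat (Suc k) *\<^sub>C (s * (1 - s) ^ k))"
    using bpos_add [OF D, of "(1 - s) ^ Suc k"] pos_contraction_power(1) [OF assms, of "Suc k"]
    by (simp add: pos_contraction_def algebra_simps)
  moreover have "bpos (complex_of_nat (Suc k) *\<^sub>C (s * (1 - s) ^ k))"
    using bpos_scale [OF _ bpos_mult_power_compl [OF assms], of "real (Suc k)"] by simp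
  ultimately show ?thesis
    by (simp add: pos_contraction_def)
qed

text \<open>The squared norm of \<open>h ^ j\<close> at \<open>u\<close> is the coefficient of
  \<open>h ^ (2 * j)\<close> at \<open>u\<close>, so the bound descends from exponent
  \<open>2 ^ Suc m\<close> to \<open>2 ^ m\<close>. This is why powers of two occur in
  \<open>pi_contraction_imp_contraction\<close>.\<close>

lemma norm_selfadj_power_le:
  assumes h: "adj h = h" and u: "norm u \<le> M" and "norm (h ^ (2 ^ m) \<cdot> u) \<le> M"
  shows "norm (h \<cdot> u) \<le> M"
  using assms(3)
proof (induction m)
  case (Suc m)
  have "norm (h ^ (2 ^ m) \<cdot> u) \<le> M"
  proof (rule power2_le_imp_le)
    have "complex_of_real ((norm (h ^ (2 ^ m) \<cdot> u))\<^sup>2) = cinner (h ^ (2 ^ Suc m) \<cdot> u) u"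
    proof -
      have a: "adj (h ^ (2 ^ m)) = h ^ (2 ^ m)"
        by (simp add: h)
      have "h ^ (2 ^ Suc m) = h ^ (2 ^ m) * h ^ (2 ^ m)"
        by (simp add: power_add [symmetric] mult_2)
      then show ?thesis
        by (simp add: cinner_self [symmetric] selfadj_cinner [OF a] del: of_real_power)
    qed
    then have "(norm (h ^ (2 ^ m) \<cdot> u))\<^sup>2 \<le> cmod (cinner (h ^ (2 ^ Suc m) \<cdot> u) u)"
      by (metis abs_ge_self norm_of_real)
    also have "\<dots> \<le> norm (h ^ (2 ^ Suc m) \<cdot> u) * norm u"
      by (rule cmod_cinner_le)
    also have "\<dots> \<le> M * M"
      using Suc.prems u by (intro mult_mono order_trans [OF norm_ge_zero u]) auto
    finally show "(norm (h ^ (2 ^ m) \<cdot> u))\<^sup>2 \<le> M\<^sup>2"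
      by (simp add: power2_eq_square)
    show "0 \<le> M"
      using u norm_ge_zero order_trans by blast
  qed
  then show ?case
    by (rule Suc.IH)
qed simp

section \<open>The GNS representation of a normal state\<close>

locale gns_space =
  fixes A :: "'h :: complex_hilbert bop set" and \<phi> :: "'h bop \<Rightarrow> complex"
    and \<pi> :: "'h bop \<Rightarrow> 'k :: complex_hilbert bop" and \<Omega> :: 'k
  assumes W: "nondegenerate_W_prob_space A \<phi>"
    and GNS: "gns_representation A \<phi> \<pi> \<Omega>"
begin

lemma vN: "von_neumann_algebra A" and normal: "normal_state A \<phi>"
  using W by (auto simp: nondegenerate_W_prob_space_def)

lemma alg_A: "nonunital_algebra A" and A_one [simp]: "1 \<in> A"
  and A_adj [simp]: "a \<in> A \<Longrightarrow> adj a \<in> A"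
  and A_closed: "closedin weak_operator_topology A"
  using vN by (auto simp: von_neumann_algebra_def)

lemma A_zero [simp]: "0 \<in> A" and A_add [simp]: "a \<in> A \<Longrightarrow> b \<in> A \<Longrightarrow> a + b \<in> A"
  and A_scale [simp]: "a \<in> A \<Longrightarrow> c *\<^sub>C a \<in> A" and A_mult [simp]: "a \<in> A \<Longrightarrow> b \<in> A \<Longrightarrow> a * b \<in> A"
  using alg_A by (auto simp: nonunital_algebra_def)

lemma A_diff [simp]: "a \<in> A \<Longrightarrow> b \<in> A \<Longrightarrow> a - b \<in> A"
  using A_add [OF _ A_scale [of b "- 1"], of a] by (simp add: scaleC_one)

lemma A_power [simp]: "a \<in> A \<Longrightarrow> a ^ n \<in> A"
  by (induction n) auto

lemma A_sum [simp]: "(\<And>i. i \<in> I \<Longrightarrow> f i \<in> A) \<Longrightarrow> (\<Sum>i\<in>I. f i) \<in> A"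
  by (induction I rule: infinite_finite_induct) auto

lemma A_prod_list [simp]: "set ts \<subseteq> A \<Longrightarrow> prod_list ts \<in> A"
  by (induction ts) auto

lemma pi_add [simp]: "a \<in> A \<Longrightarrow> b \<in> A \<Longrightarrow> \<pi> (a + b) = \<pi> a + \<pi> b"
  and pi_scale [simp]: "a \<in> A \<Longrightarrow> \<pi> (c *\<^sub>C a) = c *\<^sub>C \<pi> a"
  and pi_one [simp]: "\<pi> 1 = 1"
  and pi_mult [simp]: "a \<in> A \<Longrightarrow> b \<in> A \<Longrightarrow> \<pi> (a * b) = \<pi> a * \<pi> b"
  and pi_adj [simp]: "a \<in> A \<Longrightarrow> \<pi> (adj a) = adj (\<pi> a)"
  and phi_eq: "a \<in> A \<Longrightarrow> \<phi> a = cinner (\<pi> a \<cdot> \<Omega>) \<Omega>"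
  and cyclic: "closure ((\<lambda>a. \<pi> a \<cdot> \<Omega>) ` A) = UNIV"
  using GNS by (auto simp: gns_representation_def complex_linear_on_def)

lemma pi_zero [simp]: "\<pi> 0 = 0"
  using pi_scale [of 0 0] by simp

lemma pi_diff [simp]: "a \<in> A \<Longrightarrow> b \<in> A \<Longrightarrow> \<pi> (a - b) = \<pi> a - \<pi> b"
  using pi_add [OF _ A_scale [of b "- 1"], of a] pi_scale [of b "- 1"] by (simp add: scaleC_one)

lemma pi_power [simp]: "a \<in> A \<Longrightarrow> \<pi> (a ^ n) = \<pi> a ^ n"
  by (induction n) auto

lemma pi_sum: "(\<And>i. i \<in> I \<Longrightarrow> f i \<in> A) \<Longrightarrow> \<pi> (\<Sum>i\<in>I. f i) = (\<Sum>i\<in>I. \<pi> (f i))"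
  by (induction I rule: infinite_finite_induct) auto

lemma phi_add: "a \<in> A \<Longrightarrow> b \<in> A \<Longrightarrow> \<phi> (a + b) = \<phi> a + \<phi> b"
  and phi_scale: "a \<in> A \<Longrightarrow> \<phi> (c *\<^sub>C a) = c * \<phi> a"
  by (simp_all add: phi_eq cinner_add_left cinner_scaleC_left)

lemma phi_mult3: "a \<in> A \<Longrightarrow> c \<in> A \<Longrightarrow> d \<in> A \<Longrightarrow> \<phi> (d * a * c) = cinner (\<pi> a \<cdot> \<pi> c \<cdot> \<Omega>) (\<pi> (adj d) \<cdot> \<Omega>)"
  by (simp add: phi_eq cinner_adj_right)

text \<open>The coefficients in the assumption are the values \<open>\<phi> (adj d * a * c)\<close>,
  so this is the nondegeneracy of \<open>\<phi>\<close>.\<close>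

lemma pi_faithful:
  assumes "a \<in> A" "\<And>c d. c \<in> A \<Longrightarrow> d \<in> A \<Longrightarrow> cinner (\<pi> a \<cdot> \<pi> c \<cdot> \<Omega>) (\<pi> d \<cdot> \<Omega>) = 0"
  shows "a = 0"
proof -
  have "\<phi> (d * a * c) = 0" if "c \<in> A" "d \<in> A" for c d
    using phi_mult3 [OF assms(1) that] assms(2) [of c "adj d"] that by simp
  then show ?thesis
    using W assms(1) by (auto simp: nondegenerate_W_prob_space_def)
qed

lemma pi_inj: "a \<in> A \<Longrightarrow> b \<in> A \<Longrightarrow> \<pi> a = \<pi> b \<Longrightarrow> a = b"
  using pi_faithful [of "a - b"] by simp

text \<open>Normality is ultraweak continuity, and \<open>amp_tendsto\<close> makes weak convergence
  of a bounded sequence ultraweak.\<close>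

lemma phi_tendsto:
  fixes a :: "nat \<Rightarrow> 'h bop"
  assumes "\<And>n. a n \<in> A" "b \<in> A" "\<And>n v. norm (a n \<cdot> v) \<le> C * norm v" "\<And>v. norm (b \<cdot> v) \<le> C * norm v" "0 \<le> C"
    and lim: "\<And>v w. ((\<lambda>n. cinner (a n \<cdot> v) w) \<longlongrightarrow> cinner (b \<cdot> v) w) G"
  shows "((\<lambda>n. \<phi> (a n)) \<longlongrightarrow> \<phi> b) G"
proof (rule topological_tendstoI)
  fix U assume U: "open U" "\<phi> b \<in> U"
  have "continuous_map (subtopology ultraweak_topology A) euclidean \<phi>"
    using normal by (simp add: normal_state_def)
  then have "openin (subtopology ultraweak_topology A) {a \<in> topspace (subtopology ultraweak_topology A). \<phi> a \<in> U}"
    using U(1) by (intro openin_continuous_map_preimage) (auto simp flip: open_openin)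
  then obtain V where V: "openin ultraweak_topology V" "{a \<in> A. \<phi> a \<in> U} = V \<inter> A"
    unfolding openin_subtopology by auto
  then have "b \<in> V"
    using U(2) assms(2) by blast
  have "eventually (\<lambda>n. a n \<in> V) G"
    by (rule ultraweak_tendsto_nhd [OF amp_tendsto V(1) \<open>b \<in> V\<close>]) (use assms in auto)
  then show "eventually (\<lambda>n. \<phi> (a n) \<in> U) G"
    by (rule eventually_mono) (use V(2) assms(1) in blast)
qed

text \<open>The limit serves both Hilbert spaces at once: the GNS coefficients are the values of
  \<open>\<phi>\<close> at \<open>adj d * a n * c\<close>, to which \<open>phi_tendsto\<close>
  applies. The bound \<open>C\<close> refers to the original space.\<close>

lemma cluster:
  assumes a: "\<And>n. a n \<in> A" "\<And>n v. norm (a n \<cdot> v) \<le> C * norm v" "0 \<le> C"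
  obtains G b where "G \<le> sequentially" "G \<noteq> bot" "b \<in> A"
    "\<And>v w. ((\<lambda>n. cinner (a n \<cdot> v) w) \<longlongrightarrow> cinner (b \<cdot> v) w) G"
    "\<And>v. norm (b \<cdot> v) \<le> C * norm v"
    "\<And>c d. c \<in> A \<Longrightarrow> d \<in> A \<Longrightarrow> ((\<lambda>n. cinner (\<pi> (a n) \<cdot> \<pi> c \<cdot> \<Omega>) (\<pi> d \<cdot> \<Omega>)) \<longlongrightarrow> cinner (\<pi> b \<cdot> \<pi> c \<cdot> \<Omega>) (\<pi> d \<cdot> \<Omega>)) G"
proof -
  obtain G b where G: "G \<le> sequentially" "G \<noteq> bot"
    and lim: "\<And>v w. ((\<lambda>n. cinner (a n \<cdot> v) w) \<longlongrightarrow> cinner (b \<cdot> v) w) G"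
    and b: "\<And>v. norm (b \<cdot> v) \<le> C * norm v"
    by (rule bounded_bop_cluster [of a C, OF a(2)]) (rule that; assumption)
  have "b \<in> weak_operator_topology closure_of A"
    by (rule wot_closure_limit [OF G(2) lim]) (simp add: a(1))
  then have bA: "b \<in> A"
    by (simp only: closure_of_closedin [OF A_closed])
  have "((\<lambda>n. cinner (\<pi> (a n) \<cdot> \<pi> c \<cdot> \<Omega>) (\<pi> d \<cdot> \<Omega>)) \<longlongrightarrow> cinner (\<pi> b \<cdot> \<pi> c \<cdot> \<Omega>) (\<pi> d \<cdot> \<Omega>)) G"
    if cd: "c \<in> A" "d \<in> A" for c d
  proof -
    let ?C = "opnorm (adj d) * (C * opnorm c)"
    have bd: "norm ((adj d * e * c) \<cdot> v) \<le> ?C * norm v" if e: "\<And>v. norm (e \<cdot> v) \<le> C * norm v" for e v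
    proof -
      have "norm (adj d \<cdot> e \<cdot> c \<cdot> v) \<le> opnorm (adj d) * norm (e \<cdot> c \<cdot> v)"
        by (rule opnorm)
      also have "\<dots> \<le> opnorm (adj d) * (C * norm (c \<cdot> v))"
        by (intro mult_left_mono e) simp
      also have "\<dots> \<le> opnorm (adj d) * (C * (opnorm c * norm v))"
        by (intro mult_left_mono opnorm a(3)) simp
      finally show ?thesis
        by (simp add: mult_ac)
    qed
    have "((\<lambda>n. \<phi> (adj d * a n * c)) \<longlongrightarrow> \<phi> (adj d * b * c)) G"
    proof (rule phi_tendsto [where C = ?C])
      show "((\<lambda>n. cinner ((adj d * a n * c) \<cdot> v) w) \<longlongrightarrow> cinner ((adj d * b * c) \<cdot> v) w) G" for v w
        using lim [of "c \<cdot> v" "d \<cdot> w"] by (simp add: cinner_adj_left)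
    qed (use cd a b bA bd in auto)
    then show ?thesis
      using cd a(1) bA by (simp add: phi_eq cinner_adj_left)
  qed
  then show thesis
    by (rule that [OF G bA lim b])
qed

text \<open>A spectral gap of \<open>h = a\<^sup>* a\<close> above the norm of \<open>\<pi> h\<close> would be detected by the bounded
  polynomials \<open>1 - (1 - g\<^sup>n)\<^sup>k\<close> in \<open>g = h/c\<close> with \<open>k \<approx> c\<^sup>n\<close>: they tend to the spectral projection of
  \<open>h\<close> for \<open>(1, \<infinity>)\<close>, while their images under \<open>\<pi>\<close> tend to zero.\<close>

lemma pi_contraction_imp_contraction:
  assumes a: "a \<in> A" and \<rho>: "\<And>\<xi>. norm (\<pi> a \<cdot> \<xi>) \<le> \<rho> * norm \<xi>" "0 \<le> \<rho>" "\<rho> < 1"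
  shows "norm (a \<cdot> v) \<le> norm v"
proof -
  define h where "h = adj a * a"
  \<comment> \<open>This \<open>c\<close> exceeds 1 and dominates the squared norms of
    \<open>a\<close> and of \<open>\<pi> a\<close>, so \<open>h\<close> divided by \<open>c\<close>
    and its image are both positive contractions.\<close>
  define c where "c = (opnorm a)\<^sup>2 + 2"
  have c: "c > 1"
    unfolding c_def using zero_le_power2 [of "opnorm a"] by linarith
  define g where "g = complex_of_real (1 / c) *\<^sub>C h"
  have h: "h \<in> A" "adj h = h" "bpos h"
    using a bpos_square by (auto simp: h_def)
  have gA: "g \<in> A"
    using h by (simp add: g_def)
  have posc: "pos_contraction (complex_of_real (1 / c) *\<^sub>C (adj T * T))"
    if T: "\<And>v. (norm (T \<cdot> v))\<^sup>2 \<le> c * (norm v)\<^sup>2" for T :: "'x :: complex_hilbert bop"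
  proof -
    have "bpos (1 - complex_of_real (1 / c) *\<^sub>C (adj T * T))"
      unfolding bpos_def
    proof (intro conjI allI)
      fix v
      have "Re (cinner ((complex_of_real (1 / c) *\<^sub>C (adj T * T)) \<cdot> v) v) = (norm (T \<cdot> v))\<^sup>2 / c"
        by (simp add: cinner_scaleC_left cinner_adj_left cinner_self flip: of_real_divide of_real_power)
      also have "\<dots> \<le> (norm v)\<^sup>2"
        using T [of v] c by (simp add: divide_le_eq mult.commute)
      finally show "0 \<le> Re (cinner ((1 - complex_of_real (1 / c) *\<^sub>C (adj T * T)) \<cdot> v) v)"
        by (simp add: cinner_diff_left cinner_self flip: of_real_power)
    qed simp
    then show ?thesis
      using bpos_scale [OF _ bpos_square, of "1 / c" T] c by (simp add: pos_contraction_def)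
  qed
  have g: "pos_contraction g"
    unfolding g_def h_def
  proof (rule posc)
    fix v
    have "(norm (a \<cdot> v))\<^sup>2 \<le> (opnorm a)\<^sup>2 * (norm v)\<^sup>2"
      using power_mono [OF opnorm [of a v], of 2] by (simp add: power_mult_distrib)
    also have "\<dots> \<le> c * (norm v)\<^sup>2"
      by (intro mult_right_mono) (auto simp: c_def)
    finally show "(norm (a \<cdot> v))\<^sup>2 \<le> c * (norm v)\<^sup>2" .
  qed
  have pig: "\<pi> g = complex_of_real (1 / c) *\<^sub>C (adj (\<pi> a) * \<pi> a)"
    using a by (simp add: g_def h_def)
  have g': "pos_contraction (\<pi> g)"
    unfolding pig
  proof (rule posc)
    fix \<xi>
    have "(norm (\<pi> a \<cdot> \<xi>))\<^sup>2 \<le> \<rho>\<^sup>2 * (norm \<xi>)\<^sup>2"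
      using power_mono [OF \<rho>(1) [of \<xi>], of 2] by (simp add: power_mult_distrib)
    also have "\<dots> \<le> c * (norm \<xi>)\<^sup>2"
      using power_mono [of \<rho> 1 2] \<rho> c by (intro mult_right_mono) auto
    finally show "(norm (\<pi> a \<cdot> \<xi>))\<^sup>2 \<le> c * (norm \<xi>)\<^sup>2" .
  qed
  have g'n: "norm (\<pi> g ^ n \<cdot> \<xi>) \<le> (\<rho>\<^sup>2 / c) ^ n * norm \<xi>" for n \<xi>
  proof (induction n)
    case (Suc n)
    have "norm (\<pi> g \<cdot> \<eta>) \<le> \<rho>\<^sup>2 / c * norm \<eta>" for \<eta>
    proof -
      have "norm (adj (\<pi> a) \<cdot> \<pi> a \<cdot> \<eta>) \<le> \<rho> * norm (\<pi> a \<cdot> \<eta>)"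
        by (rule norm_adj_le [OF \<rho>(1)])
      also have "\<dots> \<le> \<rho> * (\<rho> * norm \<eta>)"
        by (intro mult_left_mono \<rho>)
      finally show ?thesis
        using c by (simp add: pig norm_scaleC norm_divide power2_eq_square divide_right_mono mult.assoc)
    qed
    then have "norm (\<pi> g ^ Suc n \<cdot> \<xi>) \<le> \<rho>\<^sup>2 / c * norm (\<pi> g ^ n \<cdot> \<xi>)"
      by simp
    also have "\<dots> \<le> \<rho>\<^sup>2 / c * ((\<rho>\<^sup>2 / c) ^ n * norm \<xi>)"
      using c by (intro mult_left_mono Suc) auto
    finally show ?case
      by simp
  qed simp
  \<comment> \<open>Rounding \<open>c ^ 2 ^ m\<close> up makes \<open>k m\<close> large enough for
    \<open>hy\<close>, where \<open>c ^ 2 ^ m\<close> must not exceed \<open>Suc (k m)\<close>, and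
    keeps it small enough that \<open>k m\<close> times \<open>(\<rho>\<^sup>2 / c) ^ 2 ^ m\<close>
    tends to zero in \<open>piz_bound\<close>.\<close>
  define k where "k m = nat \<lceil>c ^ 2 ^ m\<rceil>" for m :: nat
  have k: "c ^ 2 ^ m \<le> real (k m)" "real (k m) \<le> 2 * c ^ 2 ^ m" for m
  proof -
    have "1 \<le> c ^ 2 ^ m"
      using c by (intro one_le_power) auto
    then show "c ^ 2 ^ m \<le> real (k m)" "real (k m) \<le> 2 * c ^ 2 ^ m"
      unfolding k_def by linarith+
  qed
  have powc: "pos_contraction (s ^ n)" if "pos_contraction s" for s :: "'x :: complex_hilbert bop" and n
    using pos_contraction_power(1) [OF pos_contraction_compl [OF that], of n] by simp
  define y where "y m = (1 - g ^ 2 ^ m) ^ k m" for m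
  define z where "z m = 1 - y m" for m
  have zA: "z m \<in> A" for m
    by (simp add: z_def y_def gA)
  have y: "pos_contraction (y m)" and z: "pos_contraction (z m)" for m
    unfolding y_def z_def by (rule pos_contraction_power [OF powc [OF g]])+
  have piz: "\<pi> (z m) = 1 - (1 - \<pi> g ^ 2 ^ m) ^ k m" for m
    by (simp add: z_def y_def gA)
  have piz_bound: "(norm (\<pi> (z m) \<cdot> \<xi>))\<^sup>2 \<le> 2 * (\<rho>\<^sup>2) ^ m * (norm \<xi>)\<^sup>2" for m \<xi>
  proof -
    let ?s = "\<pi> g ^ 2 ^ m"
    have s: "pos_contraction ?s"
      by (rule powc [OF g'])
    have "(norm (\<pi> (z m) \<cdot> \<xi>))\<^sup>2 \<le> Re (cinner (\<pi> (z m) \<cdot> \<xi>) \<xi>)"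
      unfolding piz by (rule pos_contraction_norm_sq [OF pos_contraction_power(2) [OF s]])
    also have "\<dots> \<le> Re (cinner ((complex_of_nat (k m) *\<^sub>C ?s) \<cdot> \<xi>) \<xi>)"
      using bpos_bernoulli [OF s, of "k m"] by (auto simp: bpos_def piz cinner_diff_left simp del: bop_simps(7))
    also have "\<dots> = real (k m) * Re (cinner (?s \<cdot> \<xi>) \<xi>)"
      by (simp add: cinner_scaleC_left)
    also have "\<dots> \<le> real (k m) * ((\<rho>\<^sup>2 / c) ^ 2 ^ m * norm \<xi> * norm \<xi>)"
    proof -
      have "Re (cinner (?s \<cdot> \<xi>) \<xi>) \<le> norm (?s \<cdot> \<xi>) * norm \<xi>"
        using cmod_cinner_le complex_Re_le_cmod order_trans by blast
      also have "\<dots> \<le> (\<rho>\<^sup>2 / c) ^ 2 ^ m * norm \<xi> * norm \<xi>"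
        by (intro mult_right_mono g'n) simp
      finally show ?thesis
        by (intro mult_left_mono) auto
    qed
    also have "\<dots> \<le> (2 * c ^ 2 ^ m) * ((\<rho>\<^sup>2 / c) ^ 2 ^ m * norm \<xi> * norm \<xi>)"
      using c by (intro mult_right_mono k) auto
    also have "\<dots> = 2 * (\<rho>\<^sup>2) ^ 2 ^ m * (norm \<xi>)\<^sup>2"
      using c by (simp add: power_divide power2_eq_square)
    also have "\<dots> \<le> 2 * (\<rho>\<^sup>2) ^ m * (norm \<xi>)\<^sup>2"
      using \<rho> power_mono [of \<rho> 1 2] less_imp_le [OF less_exp [of m]]
      by (intro mult_right_mono mult_left_mono power_decreasing) auto
    finally show ?thesis .
  qed
  have piz_lim: "(\<lambda>m. \<pi> (z m) \<cdot> \<xi>) \<longlonglongrightarrow> 0" for \<xi>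
  proof -
    have "\<rho>\<^sup>2 < 1"
      using \<rho> by (simp add: power_less_one_iff abs_square_less_1)
    then have "(\<lambda>m. (\<rho>\<^sup>2) ^ m) \<longlonglongrightarrow> 0"
      by (simp add: LIMSEQ_power_zero)
    then have "(\<lambda>m. 2 * (\<rho>\<^sup>2) ^ m * (norm \<xi>)\<^sup>2) \<longlonglongrightarrow> 2 * 0 * (norm \<xi>)\<^sup>2"
      by (intro tendsto_mult tendsto_const)
    then have "(\<lambda>m. 2 * (\<rho>\<^sup>2) ^ m * (norm \<xi>)\<^sup>2) \<longlonglongrightarrow> 0"
      by simp
    then have "(\<lambda>m. (norm (\<pi> (z m) \<cdot> \<xi>))\<^sup>2) \<longlonglongrightarrow> 0"
      by (rule Lim_null_comparison [rotated]) (simp add: piz_bound)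
    then have "(\<lambda>m. sqrt ((norm (\<pi> (z m) \<cdot> \<xi>))\<^sup>2)) \<longlonglongrightarrow> sqrt 0"
      by (rule tendsto_real_sqrt)
    then show ?thesis
      by (simp add: tendsto_norm_zero_iff)
  qed
  obtain G b where G: "G \<le> sequentially" "G \<noteq> bot" and bA: "b \<in> A"
    and lim: "\<And>v w. ((\<lambda>m. cinner (z m \<cdot> v) w) \<longlongrightarrow> cinner (b \<cdot> v) w) G"
    and pilim: "\<And>c d. c \<in> A \<Longrightarrow> d \<in> A \<Longrightarrow> ((\<lambda>m. cinner (\<pi> (z m) \<cdot> \<pi> c \<cdot> \<Omega>) (\<pi> d \<cdot> \<Omega>)) \<longlongrightarrow> cinner (\<pi> b \<cdot> \<pi> c \<cdot> \<Omega>) (\<pi> d \<cdot> \<Omega>)) G"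
    by (rule cluster [of z 1]) (use zA pos_contraction_norm [OF z] in auto)
  \<comment> \<open>Faithfulness transports the vanishing of the limit of the images
    \<open>\<pi> (z m)\<close> back to \<open>A\<close>.\<close>
  have "b = 0"
  proof (rule pi_faithful [OF bA])
    fix c d assume cd: "c \<in> A" "d \<in> A"
    have "(\<lambda>m. cinner (\<pi> (z m) \<cdot> \<pi> c \<cdot> \<Omega>) (\<pi> d \<cdot> \<Omega>)) \<longlonglongrightarrow> cinner 0 (\<pi> d \<cdot> \<Omega>)"
      by (intro tendsto_intros piz_lim)
    then show "cinner (\<pi> b \<cdot> \<pi> c \<cdot> \<Omega>) (\<pi> d \<cdot> \<Omega>) = 0"
      using tendsto_unique [OF G(2) pilim [OF cd] tendsto_mono [OF G(1)]] by simp
  qed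
  \<comment> \<open>The operator \<open>h ^ 2 ^ m * y m\<close> is \<open>c ^ 2 ^ m\<close> times
    \<open>g ^ 2 ^ m * (1 - g ^ 2 ^ m) ^ k m\<close>, which
    \<open>pos_contraction_Suc_mult_power\<close> makes a contraction.\<close>
  have hy: "norm (h \<cdot> y m \<cdot> v) \<le> norm v" for m
  proof (rule norm_selfadj_power_le [OF h(2)])
    show "norm (y m \<cdot> v) \<le> norm v"
      by (rule pos_contraction_norm [OF y])
    let ?T = "complex_of_nat (Suc (k m)) *\<^sub>C (g ^ 2 ^ m * (1 - g ^ 2 ^ m) ^ k m)"
    have hg: "h = complex_of_real c *\<^sub>C g"
      using c by (simp add: g_def scaleC_scaleC scaleC_one)
    have "h ^ n = complex_of_real (c ^ n) *\<^sub>C g ^ n" for n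
      by (induction n) (auto simp: hg scaleC_scaleC scaleC_one mult.commute)
    then have "norm (h ^ 2 ^ m \<cdot> y m \<cdot> v) = c ^ 2 ^ m * norm (g ^ 2 ^ m \<cdot> y m \<cdot> v)"
      using c by (simp add: norm_scaleC norm_power)
    also have "\<dots> \<le> real (Suc (k m)) * norm (g ^ 2 ^ m \<cdot> y m \<cdot> v)"
      using k(1) [of m] by (intro mult_right_mono) auto
    also have "\<dots> = norm (?T \<cdot> v)"
      by (simp add: norm_scaleC y_def del: of_nat_Suc)
    also have "\<dots> \<le> norm v"
      by (rule pos_contraction_norm [OF pos_contraction_Suc_mult_power [OF powc [OF g]]])
    finally show "norm (h ^ 2 ^ m \<cdot> y m \<cdot> v) \<le> norm v" .
  qed
  \<comment> \<open>As \<open>b = 0\<close>, the \<open>y m\<close> tend weakly to 1 along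
    \<open>G\<close>, and \<open>hy\<close> passes to the limit.\<close>
  have "norm (h \<cdot> v) \<le> norm v"
  proof -
    let ?w = "h \<cdot> v"
    have "((\<lambda>m. cinner v (h \<cdot> ?w) - cinner (z m \<cdot> v) (h \<cdot> ?w)) \<longlongrightarrow> cinner v (h \<cdot> ?w) - cinner (b \<cdot> v) (h \<cdot> ?w)) G"
      by (intro tendsto_intros lim)
    moreover have "cinner v (h \<cdot> ?w) - cinner (z m \<cdot> v) (h \<cdot> ?w) = cinner (h \<cdot> y m \<cdot> v) ?w" for m
      by (simp add: z_def cinner_diff_left selfadj_cinner [OF h(2)])
    ultimately have "((\<lambda>m. cinner (h \<cdot> y m \<cdot> v) ?w) \<longlongrightarrow> cinner ?w ?w) G"
      by (simp add: \<open>b = 0\<close> selfadj_cinner [OF h(2)])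
    then have "cmod (cinner ?w ?w) \<le> norm v * norm ?w"
    proof (rule tendsto_upperbound [OF tendsto_norm _ G(2)])
      have "cmod (cinner (h \<cdot> y m \<cdot> v) ?w) \<le> norm v * norm ?w" for m
        using cmod_cinner_le [of "h \<cdot> y m \<cdot> v" ?w] hy [of m] mult_right_mono [OF hy norm_ge_zero] order_trans by blast
      then show "eventually (\<lambda>m. cmod (cinner (h \<cdot> y m \<cdot> v) ?w) \<le> norm v * norm ?w) G"
        by simp
    qed
    then show ?thesis
      by (cases "?w = 0") (auto simp: cinner_self norm_mult power2_eq_square)
  qed
  have "(norm (a \<cdot> v))\<^sup>2 = cmod (cinner (h \<cdot> v) v)"
    by (simp add: h_def cinner_adj_left cinner_self norm_power)
  also have "\<dots> \<le> norm (h \<cdot> v) * norm v"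
    by (rule cmod_cinner_le)
  also have "\<dots> \<le> (norm v)\<^sup>2"
    using \<open>norm (h \<cdot> v) \<le> norm v\<close> by (simp add: power2_eq_square mult_right_mono)
  finally show ?thesis
    by (rule power2_le_imp_le) simp
qed

text \<open>Dividing by \<open>C + 1\<close> instead of \<open>C\<close> creates the strict
  inequality \<open>\<rho> < 1\<close> that \<open>pi_contraction_imp_contraction\<close> asks for;
  later only boundedness matters.\<close>

lemma norm_le_of_pi:
  assumes a: "a \<in> A" and C: "\<And>\<xi>. norm (\<pi> a \<cdot> \<xi>) \<le> C * norm \<xi>" "0 \<le> C"
  shows "norm (a \<cdot> v) \<le> (C + 1) * norm v"
proof -
  define r where "r = 1 / (C + 1)"
  have r: "0 < r" "r * (C + 1) = 1"
    using C(2) by (auto simp: r_def)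
  have "norm ((complex_of_real r *\<^sub>C a) \<cdot> v) \<le> norm v"
  proof (rule pi_contraction_imp_contraction [where \<rho> = "r * C"])
    show "complex_of_real r *\<^sub>C a \<in> A"
      using a by simp
    show "norm (\<pi> (complex_of_real r *\<^sub>C a) \<cdot> \<xi>) \<le> r * C * norm \<xi>" for \<xi>
      using C(1) [of \<xi>] r(1) a by (simp add: norm_scaleC mult.assoc)
    show "0 \<le> r * C" "r * C < 1"
      using r C(2) by (auto simp: distrib_left)
  qed
  then have "(C + 1) * (r * norm (a \<cdot> v)) \<le> (C + 1) * norm v"
    using C(2) r(1) by (intro mult_left_mono) (auto simp: norm_scaleC)
  moreover have "(C + 1) * (r * norm (a \<cdot> v)) = norm (a \<cdot> v)"
    using r(2) by (metis mult.assoc mult.commute mult_1)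
  ultimately show ?thesis
    by simp
qed

end

lemma bop_eq_on_dense:
  assumes "closure D = UNIV" "\<And>v w. v \<in> D \<Longrightarrow> w \<in> D \<Longrightarrow> cinner (S \<cdot> v) w = cinner (T \<cdot> v) w"
  shows "S = T"
proof (rule bop_eqI)
  have S: "S \<cdot> v = T \<cdot> v" if "v \<in> D" for v
  proof (rule cinner_eqI)
    fix w
    have "closed {w. cinner (S \<cdot> v) w = cinner (T \<cdot> v) w}"
      by (intro closed_Collect_eq bounded_linear.continuous_on [OF bounded_bilinear.bounded_linear_right
          [OF bounded_bilinear_cinner]] continuous_on_id)
    then have "closure D \<subseteq> {w. cinner (S \<cdot> v) w = cinner (T \<cdot> v) w}"
      by (intro closure_minimal) (use assms(2) that in auto)
    then show "cinner (S \<cdot> v) w = cinner (T \<cdot> v) w"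
      using assms(1) by auto
  qed
  fix v
  have "closed {v. S \<cdot> v = T \<cdot> v}"
    by (intro closed_Collect_eq bounded_linear.continuous_on [OF bounded_linear_bop] continuous_on_id)
  then have "closure D \<subseteq> {v. S \<cdot> v = T \<cdot> v}"
    by (intro closure_minimal) (use S in auto)
  then show "S \<cdot> v = T \<cdot> v"
    using assms(1) by auto
qed

lemma nonunital_algebraD:
  assumes "nonunital_algebra S"
  shows "0 \<in> S" "a \<in> S \<Longrightarrow> b \<in> S \<Longrightarrow> a + b \<in> S" "a \<in> S \<Longrightarrow> c *\<^sub>C a \<in> S" "a \<in> S \<Longrightarrow> b \<in> S \<Longrightarrow> a * b \<in> S"
  using assms by (auto simp: nonunital_algebra_def)

subsection \<open>Words in a sequence\<close>

text \<open>A concrete form of the non-unital algebra generated by the \<open>x i\<close> with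
  \<open>i\<close> in \<open>I\<close>, built by adding one scaled nonempty word at a time.
  Statements that are linear in the element thus reduce to words by induction.\<close>

inductive_set word_span :: "('i \<Rightarrow> 'h :: complex_hilbert bop) \<Rightarrow> 'i set \<Rightarrow> 'h bop set"
  for x :: "'i \<Rightarrow> 'h bop" and I :: "'i set" where
  zero: "0 \<in> word_span x I"
| add: "s \<in> word_span x I \<Longrightarrow> is \<noteq> [] \<Longrightarrow> set is \<subseteq> I \<Longrightarrow> s + c *\<^sub>C prod_list (map x is) \<in> word_span x I"

lemma word_span_add: "a \<in> word_span x I \<Longrightarrow> b \<in> word_span x I \<Longrightarrow> b + a \<in> word_span x I"
  by (induction rule: word_span.induct) (auto intro: word_span.add simp: add.assoc [symmetric])

lemma word_span_scale: "a \<in> word_span x I \<Longrightarrow> c *\<^sub>C a \<in> word_span x I"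
  by (induction rule: word_span.induct)
    (auto intro: word_span.intros simp: scaleC_add_right scaleC_scaleC)

lemma word_span_word: "is \<noteq> [] \<Longrightarrow> set is \<subseteq> I \<Longrightarrow> prod_list (map x is) \<in> word_span x I"
  using word_span.add [OF word_span.zero, of "is" I 1 x] by (simp add: scaleC_one)

lemma word_span_mult:
  assumes "a \<in> word_span x I" "b \<in> word_span x I"
  shows "a * b \<in> word_span x I"
  using assms(1)
proof induction
  case zero
  then show ?case
    by (simp add: word_span.zero)
next
  case (add s "is" c)
  have "prod_list (map x is) * b \<in> word_span x I"
    using assms(2)
  proof induction
    case zero
    then show ?case
      by (simp add: word_span.zero)
  next
    case (add t js d)
    then show ?case
      using word_span.add [OF add.IH, of "is @ js" d] \<open>set is \<subseteq> I\<close> by (simp add: distrib_left)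
  qed
  then have "c *\<^sub>C (prod_list (map x is) * b) \<in> word_span x I"
    by (rule word_span_scale)
  then show ?case
    using add.IH word_span_add by (auto simp: distrib_right)
qed

lemma alg_subset_word_span: "nonunital_algebra hull (x ` I) \<subseteq> word_span x I"
proof (rule hull_minimal)
  show "x ` I \<subseteq> word_span x I"
    using word_span_word [of "[i]" I x for i] by auto
  show "nonunital_algebra (word_span x I)"
    by (auto simp: nonunital_algebra_def intro: word_span.zero word_span_add word_span_scale word_span_mult)
qed

lemma word_in_alg:
  assumes "is \<noteq> []" "set is \<subseteq> I"
  shows "prod_list (map x is) \<in> nonunital_algebra hull (x ` I)"
  using assms
proof (induction "is" rule: list_nonempty_induct)
  case (single i)
  then show ?case
    by (auto intro: subsetD [OF hull_subset])
next
  case (cons i "is")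
  then have "x i \<in> nonunital_algebra hull (x ` I)"
    by (auto intro: subsetD [OF hull_subset])
  then show ?case
    using cons nonunital_algebraD(4) [OF nonunital_algebra_hull] by auto
qed

locale gns_sequence = gns_space A \<phi> \<pi> \<Omega>
  for A :: "'h :: complex_hilbert bop set" and \<phi> and \<pi> :: "'h bop \<Rightarrow> 'k :: complex_hilbert bop" and \<Omega> +
  fixes x :: "int \<Rightarrow> 'h bop"
  assumes xA [simp]: "x i \<in> A" and x_adj [simp]: "adj (x i) = x i"
    and generates: "von_neumann_algebra hull (range x) = A"
    and one_closure: "1 \<in> gns_wot_closure A \<pi> (nonunital_algebra hull (range x))"
begin

abbreviation alg :: "int set \<Rightarrow> 'h bop set" where
  "alg I \<equiv> nonunital_algebra hull (x ` I)"

lemma alg_subset_A: "alg I \<subseteq> A"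
  by (rule hull_minimal) (auto simp: alg_A)

text \<open>The unital companion of \<open>alg UNIV\<close>, to which the bicommutant theorem
  applies.\<close>

definition alg1 :: "'h bop set" where
  "alg1 = nonunital_algebra hull (insert 1 (range x))"

lemma alg1: "nonunital_algebra alg1" "1 \<in> alg1" "x i \<in> alg1"
  unfolding alg1_def by (rule nonunital_algebra_hull, auto intro: subsetD [OF hull_subset])

lemma alg1_adj: "b \<in> alg1 \<Longrightarrow> adj b \<in> alg1"
  unfolding alg1_def by (rule nonunital_algebra_hull_selfadj) auto

lemma alg1_subset_A: "alg1 \<subseteq> A"
  unfolding alg1_def by (rule hull_minimal) (auto simp: alg_A)

lemma A_subset_bicommutant: "A \<subseteq> commutant (commutant alg1)"
  unfolding generates [symmetric]
proof (rule hull_minimal)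
  show "range x \<subseteq> commutant (commutant alg1)"
    using alg1(3) by (auto simp: commutant_def)
  show "von_neumann_algebra (commutant (commutant alg1))"
    by (rule von_neumann_algebra_bicommutant) (rule alg1_adj)
qed

text \<open>The squared norm of \<open>\<pi> y\<close> at \<open>\<Omega>\<close> is
  \<open>\<phi> (adj y * y)\<close>, so normality and \<open>ultraweak_nhd_zero\<close> bound it
  through a single vector.\<close>

lemma phi_small:
  assumes "e > 0"
  obtains v d where "d > 0" "\<And>y. y \<in> A \<Longrightarrow> norm (l2_amp y \<cdot> v) < d \<Longrightarrow> norm (\<pi> y \<cdot> \<Omega>) < e"
proof -
  have "continuous_map (subtopology ultraweak_topology A) euclidean \<phi>"
    using normal by (simp add: normal_state_def)
  then have "openin (subtopology ultraweak_topology A) {a \<in> topspace (subtopology ultraweak_topology A). \<phi> a \<in> ball 0 (e\<^sup>2)}"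
    by (intro openin_continuous_map_preimage) (auto simp flip: open_openin)
  then obtain V where V: "openin ultraweak_topology V" "{a \<in> A. \<phi> a \<in> ball 0 (e\<^sup>2)} = V \<inter> A"
    unfolding openin_subtopology by auto
  have "\<phi> 0 = 0"
    using phi_scale [of 0 0] by simp
  then have "0 \<in> {a \<in> A. \<phi> a \<in> ball 0 (e\<^sup>2)}"
    using assms by simp
  then have "0 \<in> V"
    by (simp only: V(2) Int_iff)
  obtain v :: "'h l2" and d where d: "d > 0" "\<And>y. norm (l2_amp y \<cdot> v) < d \<Longrightarrow> adj y * y \<in> V"
    by (rule ultraweak_nhd_zero [OF V(1) \<open>0 \<in> V\<close>]) (rule that; assumption)
  have "norm (\<pi> y \<cdot> \<Omega>) < e" if "y \<in> A" "norm (l2_amp y \<cdot> v) < d" for y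
  proof -
    have "adj y * y \<in> V \<inter> A"
      using d(2) that by simp
    then have "cmod (\<phi> (adj y * y)) < e\<^sup>2"
      by (simp only: V(2) [symmetric] mem_Collect_eq) simp
    then have "(norm (\<pi> y \<cdot> \<Omega>))\<^sup>2 < e\<^sup>2"
      using that(1) by (simp add: phi_eq cinner_adj_left cinner_self norm_power)
    then show ?thesis
      by (rule power_less_imp_less_base) (use assms in simp)
  qed
  then show thesis
    using that d(1) by blast
qed

text \<open>The vector \<open>v\<close> that controls \<open>\<Omega>\<close> is moved by
  \<open>c\<close> and by \<open>d\<close>; approximating \<open>a\<close> at both images gives the
  two estimates with one \<open>b\<close>.\<close>

lemma gns_approx:
  assumes a: "a \<in> A" "adj a = a" and cd: "c \<in> A" "d \<in> A" and "e > 0"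
  obtains b where "b \<in> alg1" "adj b = b"
    "norm (\<pi> (a - b) \<cdot> \<pi> c \<cdot> \<Omega>) < e" "norm (\<pi> (a - b) \<cdot> \<pi> d \<cdot> \<Omega>) < e"
proof -
  obtain v r where r: "r > 0" "\<And>y. y \<in> A \<Longrightarrow> norm (l2_amp y \<cdot> v) < r \<Longrightarrow> norm (\<pi> y \<cdot> \<Omega>) < e"
    using phi_small [OF \<open>e > 0\<close>] by blast
  obtain b where b: "b \<in> alg1" "adj b = b"
    "norm (l2_amp (a - b) \<cdot> l2_interleave (l2_amp c \<cdot> v) (l2_amp d \<cdot> v)) < r"
    by (rule selfadj_bicommutant_approx [OF alg1(1,2) alg1_adj _ a(2) r(1)]) (use A_subset_bicommutant a in auto)
  have bA: "b \<in> A"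
    using b(1) alg1_subset_A by blast
  have fin: "norm (\<pi> ((a - b) * c') \<cdot> \<Omega>) < e" if "c' = c \<or> c' = d" for c'
  proof (rule r(2))
    show "(a - b) * c' \<in> A"
      using that a cd bA by auto
    show "norm (l2_amp ((a - b) * c') \<cdot> v) < r"
      using that b(3) norm_l2_interleave_ge(1) [of "l2_amp (a - b) \<cdot> l2_amp c \<cdot> v" "l2_amp (a - b) \<cdot> l2_amp d \<cdot> v"]
        norm_l2_interleave_ge(2) [of "l2_amp (a - b) \<cdot> l2_amp d \<cdot> v" "l2_amp (a - b) \<cdot> l2_amp c \<cdot> v"]
      by (auto simp: l2_amp_mult l2_amp_interleave)
  qed
  then show thesis
    using that [OF b(1,2)] fin [of c] fin [of d] a cd bA by simp
qed

text \<open>The approximants \<open>b\<close> carry no norm bound, so \<open>a - b\<close> may only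
  be evaluated at the fixed vectors \<open>v\<close> and \<open>w\<close>. Selfadjointness permits
  this: in one term \<open>a - b\<close> is moved to \<open>w\<close>, in the other \<open>R\<close>
  is. The general case splits \<open>a\<close> into real and imaginary part.\<close>

lemma pi_commutant:
  assumes R: "R \<in> commutant (\<pi> ` alg1)" and a: "a \<in> A"
  shows "\<pi> a * R = R * \<pi> a"
proof -
  have selfadj: "\<pi> a * R = R * \<pi> a" if a: "a \<in> A" "adj a = a" for a
  proof (rule bop_eq_on_dense [OF cyclic])
    fix v w assume "v \<in> (\<lambda>a. \<pi> a \<cdot> \<Omega>) ` A" "w \<in> (\<lambda>a. \<pi> a \<cdot> \<Omega>) ` A"
    then obtain c d where v: "v = \<pi> c \<cdot> \<Omega>" "c \<in> A" and w: "w = \<pi> d \<cdot> \<Omega>" "d \<in> A"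
      by blast
    let ?D = "cinner ((\<pi> a * R) \<cdot> v) w - cinner ((R * \<pi> a) \<cdot> v) w"
    have "cmod ?D \<le> 0"
    proof (rule field_le_epsilon)
      fix e :: real assume "e > 0"
      let ?M = "norm (R \<cdot> v) + norm (adj R \<cdot> w) + 1"
      have M: "?M > 0"
        by (simp add: add_nonneg_pos)
      obtain b where b: "b \<in> alg1" "adj b = b" "norm (\<pi> (a - b) \<cdot> v) < e / ?M" "norm (\<pi> (a - b) \<cdot> w) < e / ?M"
        using gns_approx [OF a v(2) w(2), of "e / ?M"] \<open>e > 0\<close> M v w by (metis divide_pos_pos)
      have bA: "b \<in> A"
        using b(1) alg1_subset_A by blast
      have "R * \<pi> b = \<pi> b * R"
        using R b(1) by (auto simp: commutant_def)
      moreover have "adj (\<pi> (a - b)) = \<pi> (a - b)"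
        using a b bA by (simp flip: pi_adj)
      ultimately have "?D = cinner (R \<cdot> v) (\<pi> (a - b) \<cdot> w) - cinner (\<pi> (a - b) \<cdot> v) (adj R \<cdot> w)"
      proof -
        have "cinner (R \<cdot> v) (\<pi> (a - b) \<cdot> w) = cinner ((\<pi> (a - b) * R) \<cdot> v) w"
          using \<open>adj (\<pi> (a - b)) = \<pi> (a - b)\<close> selfadj_cinner by (metis times_bop.rep_eq)
        moreover have "\<pi> (a - b) * R - R * \<pi> (a - b) = \<pi> a * R - R * \<pi> a"
          using \<open>R * \<pi> b = \<pi> b * R\<close> a bA by (simp add: algebra_simps)
        ultimately show ?thesis
          by (metis cinner_adj_right cinner_diff_left minus_bop.rep_eq times_bop.rep_eq)
      qed
      also have "cmod \<dots> \<le> norm (R \<cdot> v) * norm (\<pi> (a - b) \<cdot> w) + norm (\<pi> (a - b) \<cdot> v) * norm (adj R \<cdot> w)"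
        by (intro order_trans [OF norm_triangle_ineq4] add_mono cmod_cinner_le)
      also have "\<dots> \<le> norm (R \<cdot> v) * (e / ?M) + (e / ?M) * norm (adj R \<cdot> w)"
        using b by (intro add_mono mult_left_mono mult_right_mono) auto
      also have "\<dots> = (norm (R \<cdot> v) + norm (adj R \<cdot> w)) * (e / ?M)"
        by (simp only: distrib_right mult.commute)
      also have "\<dots> \<le> ?M * (e / ?M)"
        using \<open>e > 0\<close> M by (intro mult_right_mono) auto
      also have "\<dots> = e"
        using M by simp
      finally show "cmod ?D \<le> 0 + e"
        by simp
    qed
    then show "cinner ((\<pi> a * R) \<cdot> v) w = cinner ((R * \<pi> a) \<cdot> v) w"
      by simp
  qed
  define p where "p = (1/2) *\<^sub>C (a + adj a)"
  define q where "q = (- \<i>/2) *\<^sub>C (a - adj a)"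
  have pq: "p \<in> A" "q \<in> A" "adj p = p" "adj q = q"
    using a by (auto simp: p_def q_def add.commute scaleC_diff_right)
  have "p + \<i> *\<^sub>C q = (1/2) *\<^sub>C (a + adj a) + (1/2) *\<^sub>C (a - adj a)"
    unfolding p_def q_def scaleC_scaleC by simp
  also have "\<dots> = (1/2) *\<^sub>C a + (1/2) *\<^sub>C a"
    by (simp add: scaleC_add_right scaleC_diff_right)
  also have "\<dots> = a"
    by (simp add: scaleC_add_left [symmetric] scaleC_one)
  finally have *: "\<pi> a = \<pi> p + \<i> *\<^sub>C \<pi> q"
    using pi_add [of p "\<i> *\<^sub>C q"] pq by simp
  show ?thesis
    unfolding * by (simp only: distrib_left distrib_right selfadj pq scaleC_mult_left scaleC_mult_right)
qed

lemma pi_image_algebra: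
  assumes B: "nonunital_algebra B" "B \<subseteq> A"
  shows "nonunital_algebra (\<pi> ` B)"
  unfolding nonunital_algebra_def
proof (intro conjI ballI allI)
  show "0 \<in> \<pi> ` B"
    using B by (intro image_eqI [of _ _ 0]) (auto simp: nonunital_algebra_def)
  fix u assume "u \<in> \<pi> ` B"
  then obtain a where a: "u = \<pi> a" "a \<in> B"
    by blast
  show "c *\<^sub>C u \<in> \<pi> ` B" for c
    using B a by (intro image_eqI [of _ _ "c *\<^sub>C a"]) (auto simp: nonunital_algebra_def)
  fix w assume "w \<in> \<pi> ` B"
  then obtain b where b: "w = \<pi> b" "b \<in> B"
    by blast
  show "u + w \<in> \<pi> ` B"
    using B a b by (intro image_eqI [of _ _ "a + b"]) (auto simp: nonunital_algebra_def subset_iff)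
  show "u * w \<in> \<pi> ` B"
    using B a b by (intro image_eqI [of _ _ "a * b"]) (auto simp: nonunital_algebra_def subset_iff)
qed

text \<open>By \<open>pi_commutant\<close>, \<open>\<pi> a\<close> is in the bicommutant of the
  image of \<open>alg1\<close>, hence in its weak closure; \<open>one_closure\<close> then removes
  the adjoined unit.\<close>

lemma pi_in_closure:
  assumes "a \<in> A"
  shows "\<pi> a \<in> weak_operator_topology closure_of (\<pi> ` alg UNIV)"
proof -
  let ?C = "weak_operator_topology closure_of (\<pi> ` alg UNIV)"
  have C: "nonunital_algebra ?C"
    by (intro nonunital_algebra_wot_closure pi_image_algebra nonunital_algebra_hull alg_subset_A)
  have "\<pi> a \<in> weak_operator_topology closure_of (\<pi> ` alg1)"
  proof (rule wot_closure_amp)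
    fix v :: "'k l2" and e :: real assume "e > 0"
    have "\<pi> a \<in> commutant (commutant (\<pi> ` alg1))"
      using pi_commutant [OF _ assms] by (auto simp: commutant_def [of "commutant _"])
    moreover have "adj b \<in> \<pi> ` alg1" if "b \<in> \<pi> ` alg1" for b
      using that alg1_adj alg1_subset_A by (auto simp: subset_iff simp flip: pi_adj)
    moreover have "1 \<in> \<pi> ` alg1"
      using alg1(2) by (intro image_eqI [of _ _ 1]) auto
    ultimately show "\<exists>b\<in>\<pi> ` alg1. norm (l2_amp (\<pi> a - b) \<cdot> v) < e"
      using bicommutant_approx [OF pi_image_algebra [OF alg1(1) alg1_subset_A] _ _ _ \<open>e > 0\<close>] by metis
  qed
  moreover have "\<pi> ` alg1 \<subseteq> ?C"
  proof -
    have "alg1 \<subseteq> {b \<in> A. \<pi> b \<in> ?C}"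
      unfolding alg1_def
    proof (rule hull_minimal)
      have "\<pi> ` alg UNIV \<subseteq> ?C"
        by (simp add: closure_of_subset)
      moreover have "x i \<in> alg UNIV" for i
        by (rule subsetD [OF hull_subset]) simp
      ultimately show "insert 1 (range x) \<subseteq> {b \<in> A. \<pi> b \<in> ?C}"
        using one_closure by (auto simp: gns_wot_closure_def)
      show "nonunital_algebra {b \<in> A. \<pi> b \<in> ?C}"
        using C by (auto simp: nonunital_algebra_def)
    qed
    then show ?thesis
      by blast
  qed
  then have "weak_operator_topology closure_of (\<pi> ` alg1) \<subseteq> ?C"
    by (rule closure_of_minimal) simp
  ultimately show ?thesis
    by blast
qed

text \<open>Weak approximation suffices: the residual of \<open>\<pi> a\<close> at
  \<open>\<Omega>\<close> after projection to the closed subspace pairs to zero with every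
  approximant, hence with the vector itself.\<close>

lemma alg_cyclic: "closure ((\<lambda>b. \<pi> b \<cdot> \<Omega>) ` alg UNIV) = UNIV"
proof -
  let ?N = "(\<lambda>b. \<pi> b \<cdot> \<Omega>) ` alg UNIV"
  have sub: "b \<in> A" if "b \<in> alg UNIV" for b
    using that alg_subset_A by blast
  have "csubspace ?N"
    unfolding csubspace_def ball_simps
  proof (intro conjI ballI allI)
    note H = nonunital_algebraD [OF nonunital_algebra_hull [of "range x"]]
    show "0 \<in> ?N"
      using H by (intro image_eqI [of _ _ 0]) auto
    fix b c z assume b: "b \<in> alg UNIV"
    show "z *\<^sub>C \<pi> b \<cdot> \<Omega> \<in> ?N"
      using H b sub by (intro image_eqI [of _ _ "z *\<^sub>C b"]) auto
    assume "c \<in> alg UNIV"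
    then show "\<pi> b \<cdot> \<Omega> + \<pi> c \<cdot> \<Omega> \<in> ?N"
      using H b sub by (intro image_eqI [of _ _ "b + c"]) auto
  qed
  then obtain Q where Q: "\<And>v. Q \<cdot> v \<in> closure ?N" "\<And>v n. n \<in> closure ?N \<Longrightarrow> cinner (v - Q \<cdot> v) n = 0"
    by (rule orthogonal_projection_exists) blast
  have "(\<lambda>a. \<pi> a \<cdot> \<Omega>) ` A \<subseteq> closure ?N"
  proof clarify
    fix a assume a: "a \<in> A"
    let ?u = "\<pi> a \<cdot> \<Omega>"
    let ?r = "?u - Q \<cdot> ?u"
    have "cmod (cinner ?u ?r) \<le> 0"
    proof (rule field_le_epsilon)
      fix e :: real assume "e > 0"
      obtain B where B: "B \<in> \<pi> ` alg UNIV" "\<And>v w. (v, w) \<in> {(\<Omega>, ?r)} \<Longrightarrow> cmod (cinner ((\<pi> a - B) \<cdot> v) w) < e"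
        by (rule wot_closure_approx [OF pi_in_closure [OF a], of "{(\<Omega>, ?r)}" e]) (use \<open>e > 0\<close> in auto)
      then have "B \<cdot> \<Omega> \<in> closure ?N"
        by (intro subsetD [OF closure_subset]) auto
      then have "cinner ?r (B \<cdot> \<Omega>) = 0"
        by (rule Q(2))
      then have "cinner (B \<cdot> \<Omega>) ?r = 0"
        by (metis cinner_commute complex_cnj_zero)
      then show "cmod (cinner ?u ?r) \<le> 0 + e"
        using B(2) [of \<Omega> ?r] by (simp add: cinner_diff_left)
    qed
    moreover have "cinner (Q \<cdot> ?u) ?r = 0"
      using Q(2) [OF Q(1)] by (metis cinner_commute complex_cnj_zero)
    ultimately have "cinner ?r ?r = 0"
      by (simp add: cinner_diff_left)
    then have "?u = Q \<cdot> ?u"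
      by (simp add: cinner_self)
    then show "?u \<in> closure ?N"
      using Q(1) by metis
  qed
  then have "closure ((\<lambda>a. \<pi> a \<cdot> \<Omega>) ` A) \<subseteq> closure ?N"
    by (rule closure_minimal) simp
  then show ?thesis
    using cyclic by auto
qed

end

section \<open>Noncommutative polynomials\<close>

lemma poly_mapping_expand: "p = (\<Sum>w\<in>Poly_Mapping.keys p. Poly_Mapping.single w (Poly_Mapping.lookup p w))"
proof (rule poly_mapping_eqI)
  fix k
  have "Poly_Mapping.lookup p k = (if k \<in> Poly_Mapping.keys p then Poly_Mapping.lookup p k else 0)"
    by (simp add: in_keys_iff)
  then show "Poly_Mapping.lookup p k = Poly_Mapping.lookup
      (\<Sum>w\<in>Poly_Mapping.keys p. Poly_Mapping.single w (Poly_Mapping.lookup p w)) k"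
    by (simp add: lookup_sum lookup_single when_def)
qed

lemma sum_keys_add:
  assumes "\<And>w. f w 0 = 0" "\<And>w a b. f w (a + b) = f w a + f w b"
  shows "(\<Sum>w\<in>Poly_Mapping.keys (p + q). f w (Poly_Mapping.lookup (p + q) w)) =
    (\<Sum>w\<in>Poly_Mapping.keys p. f w (Poly_Mapping.lookup p w)) +
    (\<Sum>w\<in>Poly_Mapping.keys q. f w (Poly_Mapping.lookup q w) :: 'b :: comm_monoid_add)"
proof -
  let ?K = "Poly_Mapping.keys p \<union> Poly_Mapping.keys q"
  have *: "(\<Sum>w\<in>Poly_Mapping.keys r. f w (Poly_Mapping.lookup r w)) = (\<Sum>w\<in>?K. f w (Poly_Mapping.lookup r w))"
    if "Poly_Mapping.keys r \<subseteq> ?K" for r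
    by (rule sum.mono_neutral_left) (use that assms(1) in \<open>auto simp: in_keys_iff\<close>)
  have "(\<Sum>w\<in>Poly_Mapping.keys (p + q). f w (Poly_Mapping.lookup (p + q) w)) =
      (\<Sum>w\<in>?K. f w (Poly_Mapping.lookup (p + q) w))"
    by (rule * [OF keys_add])
  then show ?thesis
    by (simp only: lookup_add assms(2) sum.distrib * [OF Un_upper1] * [OF Un_upper2])
qed

lemma nc_eval_add:
  assumes "\<iota> 0 = 0" "\<And>a b. \<iota> (a + b) = \<iota> a + \<iota> b"
  shows "nc_eval \<iota> f (p + q) = nc_eval \<iota> f p + nc_eval \<iota> f q"
  unfolding nc_eval_def by (rule sum_keys_add) (simp_all add: assms distrib_right)

lemma nc_eval_single: "\<iota> 0 = 0 \<Longrightarrow> nc_eval \<iota> f (Poly_Mapping.single w c) = \<iota> c * prod_list (map f (letters w))"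
  by (cases "c = 0") (auto simp: nc_eval_def)

lemma nc_eval_zero [simp]: "nc_eval \<iota> f 0 = 0"
  by (simp add: nc_eval_def)

lemma nc_eval_sum:
  assumes "\<iota> 0 = 0" "\<And>a b. \<iota> (a + b) = \<iota> a + \<iota> b"
  shows "nc_eval \<iota> f (\<Sum>i\<in>I. p i) = (\<Sum>i\<in>I. nc_eval \<iota> f (p i))"
  by (induction I rule: infinite_finite_induct) (auto simp: nc_eval_add [of \<iota>, OF assms])

lemma nc_eval_diff:
  fixes p q :: "('v, 'c :: ab_group_add) ncpoly"
  assumes "\<iota> 0 = 0" "\<And>a b. \<iota> (a + b) = \<iota> a + \<iota> b"
  shows "nc_eval \<iota> f (p - q) = nc_eval \<iota> f p - nc_eval \<iota> f q"
  using nc_eval_add [of \<iota> f "p - q" q, OF assms] by simp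

lemma nc_eval_mult:
  fixes p q :: "('v, 'c :: semiring_0) ncpoly"
  assumes \<iota>: "\<iota> 0 = 0" "\<And>a b. \<iota> (a + b) = \<iota> a + \<iota> b" "\<And>a b. \<iota> (a * b) = \<iota> a * \<iota> b"
    and central: "\<And>a t. \<iota> a * t = t * \<iota> a"
  shows "nc_eval \<iota> f (p * q) = nc_eval \<iota> f p * nc_eval \<iota> f q"
proof -
  note sum = nc_eval_sum [of \<iota>, OF \<iota>(1,2)] and single = nc_eval_single [of \<iota>, OF \<iota>(1)]
  have mono: "nc_eval \<iota> f (Poly_Mapping.single u a * Poly_Mapping.single v b) =
      nc_eval \<iota> f (Poly_Mapping.single u a) * nc_eval \<iota> f (Poly_Mapping.single v b)" for u v a b
  proof -
    have "\<iota> a * (\<iota> b * (prod_list (map f (letters u)) * prod_list (map f (letters v)))) =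
       \<iota> a * (prod_list (map f (letters u)) * (\<iota> b * prod_list (map f (letters v))))"
      by (metis central mult.assoc)
    then show ?thesis
      by (simp add: mult_single single \<iota>(3) plus_word_def mult.assoc)
  qed
  have "nc_eval \<iota> f (p * q) = (\<Sum>u\<in>Poly_Mapping.keys p. \<Sum>v\<in>Poly_Mapping.keys q.
      nc_eval \<iota> f (Poly_Mapping.single u (Poly_Mapping.lookup p u) * Poly_Mapping.single v (Poly_Mapping.lookup q v)))"
    by (subst poly_mapping_expand [of p], subst poly_mapping_expand [of q])
      (simp add: sum_product sum)
  also have "\<dots> = (\<Sum>u\<in>Poly_Mapping.keys p. nc_eval \<iota> f (Poly_Mapping.single u (Poly_Mapping.lookup p u))) *
      (\<Sum>v\<in>Poly_Mapping.keys q. nc_eval \<iota> f (Poly_Mapping.single v (Poly_Mapping.lookup q v)))"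
    by (simp add: mono sum_product)
  also have "\<dots> = nc_eval \<iota> f p * nc_eval \<iota> f q"
    unfolding nc_eval_def [of \<iota> f p] nc_eval_def [of \<iota> f q] single ..
  finally show ?thesis .
qed

lemma nc_const_zero [simp]: "nc_const 0 = 0"
  by (simp add: nc_const_def)

lemma nc_const_one [simp]: "nc_const (1 :: 'c :: zero_neq_one) = (1 :: ('v, 'c) ncpoly)"
  by (simp add: nc_const_def)

lemma nc_const_add: "nc_const (a + b) = nc_const a + nc_const b"
  by (simp add: nc_const_def single_add)

lemma nc_const_mult: "nc_const (a * b) = nc_const a * nc_const (b :: 'c :: semiring_0)"
  by (simp add: nc_const_def mult_single)

lemma nc_const_sum: "nc_const (\<Sum>i\<in>I. f i) = (\<Sum>i\<in>I. nc_const (f i))"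
  by (induction I rule: infinite_finite_induct) (auto simp: nc_const_add)

lemma nc_const_commute:
  fixes p :: "('v, 'c :: comm_semiring_0) ncpoly"
  shows "nc_const c * p = p * nc_const c"
proof -
  have *: "nc_const c * Poly_Mapping.single w a = Poly_Mapping.single w a * nc_const c" for w and a :: 'c
    by (simp add: nc_const_def mult_single mult.commute)
  show ?thesis
    by (subst (1 2) poly_mapping_expand [of p])
      (unfold sum_distrib_left sum_distrib_right, rule sum.cong [OF refl *])
qed

lemma nc_const_left_commute: "p * (nc_const c * r) = nc_const c * (p * (r :: ('v, 'c :: comm_semiring_0) ncpoly))"
  by (metis nc_const_commute mult.assoc)

subsection \<open>The coaction\<close>

text \<open>The slice of the coaction at the monomial with letters \<open>js\<close>, for a
  functional with values \<open>\<psi>\<close> on words; \<open>slice_words_coaction\<close>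
  identifies it. The recursion shifts each chosen letter into the argument of
  \<open>\<psi>\<close>.\<close>

fun coaction_word :: "nat \<Rightarrow> (nat list \<Rightarrow> complex) \<Rightarrow> nat list \<Rightarrow> Bi_gen star_poly" where
  "coaction_word n \<psi> [] = nc_const (\<psi> [])"
| "coaction_word n \<psi> (j # js) = (\<Sum>i=1..n. u_gen i j * coaction_word n (\<lambda>w. \<psi> (i # w)) js)"

definition slice_words :: "(nat list \<Rightarrow> complex) \<Rightarrow> (nat, 'g star_poly) ncpoly \<Rightarrow> 'g star_poly" where
  "slice_words \<psi> q = (\<Sum>w\<in>Poly_Mapping.keys q. nc_const (\<psi> (letters w)) * Poly_Mapping.lookup q w)"

lemma slice_eq_slice_words: "slice \<mu> q = slice_words (\<lambda>v. \<mu> (Poly_Mapping.single (Word v) 1)) q"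
  by (simp add: slice_def slice_words_def)

lemma slice_words_add: "slice_words \<psi> (p + q) = slice_words \<psi> p + slice_words \<psi> q"
  unfolding slice_words_def by (rule sum_keys_add) (simp_all add: distrib_left)

lemma slice_words_sum: "slice_words \<psi> (\<Sum>i\<in>I. f i) = (\<Sum>i\<in>I. slice_words \<psi> (f i))"
  by (induction I rule: infinite_finite_induct) (auto simp: slice_words_add, simp_all add: slice_words_def)

lemma slice_words_single: "slice_words \<psi> (Poly_Mapping.single w c) = nc_const (\<psi> (letters w)) * c"
  by (cases "c = 0") (auto simp: slice_words_def)

lemma slice_words_Cons:
  "slice_words \<psi> (Poly_Mapping.single (Word [i]) u * q) = u * slice_words (\<lambda>w. \<psi> (i # w)) q"
proof -
  have "slice_words \<psi> (Poly_Mapping.single (Word [i]) u * q) =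
      (\<Sum>w\<in>Poly_Mapping.keys q. nc_const (\<psi> (i # letters w)) * (u * Poly_Mapping.lookup q w))"
    by (subst poly_mapping_expand [of q])
      (simp add: sum_distrib_left slice_words_sum mult_single slice_words_single plus_word_def)
  also have "\<dots> = (\<Sum>w\<in>Poly_Mapping.keys q. u * (nc_const (\<psi> (i # letters w)) * Poly_Mapping.lookup q w))"
    by (intro sum.cong refl) (metis nc_const_commute mult.assoc)
  finally show ?thesis
    by (simp add: slice_words_def sum_distrib_left)
qed

lemma slice_words_const: "slice_words \<psi> (nc_const (nc_const c) * q) = nc_const c * slice_words \<psi> q"
proof -
  have "slice_words \<psi> (nc_const (nc_const c) * q) =
      (\<Sum>w\<in>Poly_Mapping.keys q. nc_const (\<psi> (letters w)) * (nc_const c * Poly_Mapping.lookup q w))"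
    by (subst poly_mapping_expand [of q])
      (simp add: sum_distrib_left slice_words_sum mult_single slice_words_single nc_const_def [of "nc_const c"])
  also have "\<dots> = (\<Sum>w\<in>Poly_Mapping.keys q. nc_const c * (nc_const (\<psi> (letters w)) * Poly_Mapping.lookup q w))"
    by (intro sum.cong refl) (metis nc_const_commute mult.assoc)
  finally show ?thesis
    by (simp add: slice_words_def sum_distrib_left)
qed

lemma slice_words_coaction:
  "slice_words \<psi> (prod_list (map (\<lambda>j. \<Sum>i=1..n. Poly_Mapping.single (Word [i]) (u_gen i j)) js)) = coaction_word n \<psi> js"
proof (induction js arbitrary: \<psi>)
  case Nil
  have "slice_words \<psi> (Poly_Mapping.single 0 1) = nc_const (\<psi> [])"
    unfolding slice_words_single by (simp add: zero_word_def)
  then show ?case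
    by simp
next
  case (Cons j js)
  then show ?case
    by (simp add: sum_distrib_right slice_words_sum slice_words_Cons)
qed

lemma slice_coaction:
  "slice \<mu> (Bi_coaction n p) = (\<Sum>w\<in>Poly_Mapping.keys p. nc_const (Poly_Mapping.lookup p w) *
     coaction_word n (\<lambda>v. \<mu> (Poly_Mapping.single (Word v) 1)) (letters w))"
  unfolding Bi_coaction_def nc_eval_def slice_eq_slice_words slice_words_sum slice_words_const slice_words_coaction ..

lemma joint_distribution_word: "joint_distribution \<phi> y (Poly_Mapping.single (Word v) 1) = \<phi> (prod_list (map y v))"
  by (simp add: joint_distribution_def nc_eval_single scaleC_one)

subsection \<open>Representations\<close>

lemma opnorm_eq_zero: "opnorm T = 0 \<longleftrightarrow> T = 0"
proof
  assume "opnorm T = 0"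
  then have "norm (T \<cdot> v) \<le> 0" for v
    using opnorm [of T v] by simp
  then show "T = 0"
    by (intro bop_eqI) simp
next
  assume "T = 0"
  then have "opnorm T \<le> 0"
    using opnorm_le [of 0 T] by simp
  then show "opnorm T = 0"
    using opnorm_nonneg [of T] by (rule antisym)
qed

lemma opnorm_add: "opnorm (S + T) \<le> opnorm S + opnorm T"
proof (rule opnorm_le)
  show "norm ((S + T) \<cdot> v) \<le> (opnorm S + opnorm T) * norm v" for v
    using norm_triangle_ineq [of "S \<cdot> v" "T \<cdot> v"] opnorm [of S v] opnorm [of T v] by (simp add: distrib_right)
qed simp

lemma opnorm_mult: "opnorm (S * T) \<le> opnorm S * opnorm T"
proof (rule opnorm_le)
  fix v
  have "norm (S \<cdot> T \<cdot> v) \<le> opnorm S * norm (T \<cdot> v)"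
    by (rule opnorm)
  also have "\<dots> \<le> opnorm S * (opnorm T * norm v)"
    by (intro mult_left_mono opnorm) simp
  finally show "norm ((S * T) \<cdot> v) \<le> opnorm S * opnorm T * norm v"
    by (simp add: mult.assoc)
qed simp

lemma opnorm_scale: "opnorm (c *\<^sub>C T) = cmod c * opnorm T"
proof -
  have le: "opnorm (c *\<^sub>C T) \<le> cmod c * opnorm T" for c and T :: "'a bop"
    by (rule opnorm_le) (simp_all add: norm_scaleC mult_left_mono opnorm mult.assoc)
  show ?thesis
  proof (cases "c = 0")
    case True
    then show ?thesis
      using opnorm_eq_zero [of "0 :: 'a bop"] by simp
  next
    case False
    have "T = (1 / c) *\<^sub>C c *\<^sub>C T"
      using False by (simp add: scaleC_scaleC scaleC_one)
    then have "opnorm T \<le> cmod (1 / c) * opnorm (c *\<^sub>C T)"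
      using le [of "1 / c" "c *\<^sub>C T"] by simp
    then have "cmod c * opnorm T \<le> cmod c * (cmod (1 / c) * opnorm (c *\<^sub>C T))"
      by (intro mult_left_mono) auto
    then show ?thesis
      using le [of c T] False by (simp add: norm_divide)
  qed
qed

lemma opnorm_C_star: "opnorm (adj T * T) = (opnorm T)\<^sup>2"
proof (rule antisym)
  have "opnorm (adj T) \<le> opnorm T"
    by (rule opnorm_le) (auto intro: norm_adj_le opnorm)
  then show "opnorm (adj T * T) \<le> (opnorm T)\<^sup>2"
    using opnorm_mult [of "adj T" T] mult_right_mono [of "opnorm (adj T)" "opnorm T" "opnorm T"]
    by (simp add: power2_eq_square)
  have "opnorm T \<le> sqrt (opnorm (adj T * T))"
  proof (rule opnorm_le)
    fix v
    have "(norm (T \<cdot> v))\<^sup>2 = cmod (cinner ((adj T * T) \<cdot> v) v)"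
      by (simp add: cinner_adj_left cinner_self norm_power)
    also have "\<dots> \<le> norm ((adj T * T) \<cdot> v) * norm v"
      by (rule cmod_cinner_le)
    also have "\<dots> \<le> opnorm (adj T * T) * norm v * norm v"
      by (intro mult_right_mono opnorm) simp
    also have "\<dots> = (sqrt (opnorm (adj T * T)) * norm v)\<^sup>2"
      by (simp add: power_mult_distrib power2_eq_square [of "norm v"])
    finally have "(norm (T \<cdot> v))\<^sup>2 \<le> (sqrt (opnorm (adj T * T)) * norm v)\<^sup>2" .
    then show "norm (T \<cdot> v) \<le> sqrt (opnorm (adj T * T)) * norm v"
      by (rule power2_le_imp_le) simp
  qed simp
  then show "(opnorm T)\<^sup>2 \<le> opnorm (adj T * T)"
    using power_mono [of "opnorm T" "sqrt (opnorm (adj T * T))" 2] by simp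
qed

definition star_rep :: "('g \<Rightarrow> 'h :: complex_hilbert bop) \<Rightarrow> 'g star_poly \<Rightarrow> 'h bop" where
  "star_rep \<rho> = nc_eval (\<lambda>c. c *\<^sub>C 1) (\<lambda>(g, s). if s then adj (\<rho> g) else \<rho> g)"

lemma star_rep_simps:
  "star_rep \<rho> (a + b) = star_rep \<rho> a + star_rep \<rho> b"
  "star_rep \<rho> (a - b) = star_rep \<rho> a - star_rep \<rho> b"
  "star_rep \<rho> (a * b) = star_rep \<rho> a * star_rep \<rho> b"
  "star_rep \<rho> (nc_const c) = c *\<^sub>C 1"
  "star_rep \<rho> (gen g) = \<rho> g"
  "star_rep \<rho> (\<Sum>i\<in>I. f i) = (\<Sum>i\<in>I. star_rep \<rho> (f i))"
  unfolding star_rep_def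
  by (simp_all add: nc_eval_add nc_eval_diff nc_eval_sum nc_eval_single scaleC_add_left
      nc_const_def gen_def zero_word_def scaleC_one)
    (rule nc_eval_mult, auto simp: scaleC_add_left scaleC_scaleC mult.commute)

lemma star_rep_star: "star_rep \<rho> (star a) = adj (star_rep \<rho> a)"
proof -
  let ?f = "\<lambda>(g, s). if s then adj (\<rho> g) else \<rho> g"
  have "map ?f (rev (map (\<lambda>(g, s). (g, \<not> s)) w)) = map adj (rev (map ?f w))" for w
    by (induction w) auto
  then have "star_rep \<rho> (star a) =
      (\<Sum>w\<in>Poly_Mapping.keys a. cnj (Poly_Mapping.lookup a w) *\<^sub>C adj (prod_list (map ?f (letters w))))"
    unfolding star_def star_rep_simps(6) by (simp add: star_rep_def nc_eval_single adj_prod_list)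
  also have "\<dots> = adj (star_rep \<rho> a)"
    by (simp add: star_rep_def nc_eval_def)
  finally show ?thesis .
qed

lemma C_star_seminorm_rep: "C_star_seminorm G (\<lambda>a. opnorm (star_rep \<rho> a))"
  by (auto simp: C_star_seminorm_def star_rep_simps star_rep_star opnorm_C_star opnorm_scale opnorm_add opnorm_mult)

text \<open>The operator norm of a representation that kills \<open>R\<close> is one of the
  seminorms in the supremum, so an equality in the universal algebra can be tested in any such
  representation.\<close>

lemma universal_C_star_eq_rep:
  assumes "universal_C_star_eq G R a b" "\<And>r. r \<in> R \<Longrightarrow> star_rep \<rho> r = 0"
  shows "star_rep \<rho> a = star_rep \<rho> b"
proof -
  let ?p = "\<lambda>a. opnorm (star_rep \<rho> a)"
  have "ereal (?p (a - b)) \<le> universal_C_star_norm G R (a - b)"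
    unfolding universal_C_star_norm_def
    by (rule SUP_upper) (use assms(2) C_star_seminorm_rep opnorm_eq_zero in auto)
  then have "?p (a - b) \<le> 0"
    using assms(1) by (simp add: universal_C_star_eq_def)
  then have "?p (a - b) = 0"
    using opnorm_nonneg by (rule antisym)
  then show ?thesis
    by (simp add: opnorm_eq_zero star_rep_simps)
qed

definition rank_one :: "'h :: complex_hilbert \<Rightarrow> 'h bop" where
  "rank_one e = Bop (\<lambda>v. cinner v e *\<^sub>C e)"

lemma rank_one_apply [simp]: "rank_one e \<cdot> v = cinner v e *\<^sub>C e"
proof -
  obtain T where T: "\<And>v. T \<cdot> v = cinner v e *\<^sub>C e"
  proof (rule bop_of_linear [of "\<lambda>v. cinner v e *\<^sub>C e" "norm e * norm e"])
    show "norm (cinner v e *\<^sub>C e) \<le> norm e * norm e * norm v" for v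
      using mult_right_mono [OF cmod_cinner_le [of v e] norm_ge_zero [of e]] by (simp add: norm_scaleC mult_ac)
  qed (auto simp: cinner_add_left cinner_scaleC_left scaleC_add_left scaleC_scaleC)
  have "bop_apply T = (\<lambda>v. cinner v e *\<^sub>C e)"
    using T by (rule ext)
  then have "rank_one e = T"
    unfolding rank_one_def by (metis bop_apply_inverse)
  then show ?thesis
    using T by simp
qed

lemma adj_rank_one [simp]: "adj (rank_one e) = rank_one e"
  by (rule adj_eqI) (simp add: cinner_scaleC_left cinner_scaleC_right, metis cinner_commute mult.commute)

lemma rank_one_idem: "cinner e e = 1 \<Longrightarrow> rank_one e * rank_one e = rank_one e"
  by (rule bop_eqI) (simp add: cinner_scaleC_left)

subsection \<open>Block averages\<close>

text \<open>Unit vectors with the Gram matrix that makes the rank one projections onto \<open>e\<^sub>i\<close>, \<open>i \<in> B\<close>, sum up on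
  the vacuum \<open>\<delta>\<^sub>0\<close> to \<open>\<delta>\<^sub>0\<close>, for every block \<open>B\<close> of \<open>l\<close> positive indices.\<close>

definition block_vector :: "nat set \<Rightarrow> nat \<Rightarrow> complex l2" where
  "block_vector B i = complex_of_real (1 / sqrt (card B)) *\<^sub>C l2_single 0 1 + l2_single i 1 -
     complex_of_real (1 / card B) *\<^sub>C (\<Sum>k\<in>B. l2_single k 1)"

lemma cinner_l2_basis: "cinner (l2_single i (1 :: complex)) (l2_single j 1) = (if i = j then 1 else 0)"
  by (simp add: cinner_complex_def)

text \<open>The differences of \<open>l2_single i 1\<close> and the block mean have the Gram matrix
  of the identity minus \<open>1 / l\<close> within a block, and are orthogonal across disjoint
  blocks. The vacuum component \<open>1 / sqrt l\<close> adds \<open>1 / l\<close>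
  everywhere.\<close>

lemma block_vector_cinner:
  assumes "finite B" "finite B'" "0 \<notin> B" "0 \<notin> B'" "card B = l" "card B' = l" "l > 0" "i \<in> B" "i' \<in> B'"
  shows "cinner (l2_single 0 1) (block_vector B i) = complex_of_real (1 / sqrt l)"
    and "B = B' \<Longrightarrow> cinner (block_vector B i) (block_vector B' i') = (if i = i' then 1 else 0)"
    and "B \<inter> B' = {} \<Longrightarrow> cinner (block_vector B i) (block_vector B' i') = complex_of_real (1 / l)"
proof -
  have ne: "i \<noteq> 0" "i' \<noteq> 0"
    using assms by metis+
  have one: "complex_of_real (1 / sqrt (real l)) * complex_of_real (1 / sqrt (real l)) = complex_of_real (1 / real l)"
    by (simp flip: of_real_mult)
  note expand = block_vector_def cinner_add_right cinner_diff_right cinner_scaleC_right cinner_add_left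
    cinner_diff_left cinner_scaleC_left cinner_sum_right cinner_sum_left cinner_l2_basis
  show "cinner (l2_single 0 1) (block_vector B i) = complex_of_real (1 / sqrt l)"
    unfolding expand using assms ne by simp
  show "cinner (block_vector B i) (block_vector B' i') = (if i = i' then 1 else 0)" if "B = B'"
    unfolding expand using assms ne that one
    by (simp add: algebra_simps sum.distrib sum_subtractf sum_divide_distrib [symmetric])
  show "cinner (block_vector B i) (block_vector B' i') = complex_of_real (1 / l)" if "B \<inter> B' = {}"
    unfolding expand using assms ne that one by (auto simp: algebra_simps intro!: sum.neutral)
qed

lemma block_vector_sum:
  assumes "finite B" "card B = l" "l > 0"
  shows "(\<Sum>i\<in>B. complex_of_real (1 / sqrt l) *\<^sub>C block_vector B i) = l2_single 0 1"
proof -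
  have "(\<Sum>i\<in>B. block_vector B i) = complex_of_real (real l * (1 / sqrt l)) *\<^sub>C l2_single 0 1"
  proof -
    have "(\<Sum>i\<in>B. block_vector B i) = (\<Sum>i\<in>B. complex_of_real (1 / sqrt l)) *\<^sub>C l2_single 0 1 + (\<Sum>i\<in>B. l2_single i 1) -
        (\<Sum>i\<in>B. complex_of_real (1 / l)) *\<^sub>C (\<Sum>k\<in>B. l2_single k 1)"
      by (simp only: block_vector_def sum_subtractf sum.distrib scaleC_sum_left assms(2))
    then show ?thesis
      using assms by (simp add: scaleC_one)
  qed
  then have "(\<Sum>i\<in>B. complex_of_real (1 / sqrt l) *\<^sub>C block_vector B i) =
      complex_of_real ((1 / sqrt l) * (real l * (1 / sqrt l))) *\<^sub>C l2_single 0 1"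
    by (simp only: scaleC_sum_right [symmetric] scaleC_scaleC of_real_mult)
  also have "(1 / sqrt l) * (real l * (1 / sqrt l)) = 1"
    using assms(3) by (simp add: field_simps)
  finally show ?thesis
    by (simp add: scaleC_one)
qed

section \<open>Moments of spreadable sequences\<close>

text \<open>\<open>Y\<close> is kept abstract because the same list of runs is evaluated at powers,
  at block averages and at limits.\<close>

definition run_prod :: "('i \<Rightarrow> nat \<Rightarrow> 'b :: monoid_mult) \<Rightarrow> ('i \<times> nat) list \<Rightarrow> 'b" where
  "run_prod Y rs = prod_list (map (\<lambda>(j, m). Y j m) rs)"

lemma run_prod_simps [simp]:
  "run_prod Y [] = 1" "run_prod Y ((j, m) # rs) = Y j m * run_prod Y rs"
  "run_prod Y (rs @ rs') = run_prod Y rs * run_prod Y rs'"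
  by (simp_all add: run_prod_def)

definition runs :: "('i \<times> nat) list \<Rightarrow> bool" where
  "runs rs \<longleftrightarrow> distinct_adj (map fst rs) \<and> (\<forall>(j, m)\<in>set rs. 0 < m)"

definition run_word :: "('i \<times> nat) list \<Rightarrow> 'i list" where
  "run_word rs = concat (map (\<lambda>(j, m). replicate m j) rs)"

lemma run_word_simps [simp]:
  "run_word [] = []" "run_word ((j, m) # rs) = replicate m j @ run_word rs"
  by (simp_all add: run_word_def)

lemma prod_list_run_word: "prod_list (map y (run_word rs)) = run_prod (\<lambda>j m. y j ^ m) rs"
  by (induction rs) (auto)

lemma set_run_word_subset: "set (run_word rs) \<subseteq> fst ` set rs"
  by (induction rs) auto

context gns_space
begin

lemma phi_sum: "(\<And>i. i \<in> I \<Longrightarrow> f i \<in> A) \<Longrightarrow> \<phi> (\<Sum>i\<in>I. f i) = (\<Sum>i\<in>I. \<phi> (f i))"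
proof (induction I rule: infinite_finite_induct)
  case empty
  then show ?case
    using phi_scale [of 0 0] by simp
next
  case (infinite I)
  then show ?case
    using phi_scale [of 0 0] by simp
qed (auto simp: phi_add)

lemma run_prod_in_A: "(\<And>j m. (j, m) \<in> set rs \<Longrightarrow> Y j m \<in> A) \<Longrightarrow> run_prod Y rs \<in> A"
  by (induction rs) auto

text \<open>The word acts on the vacuum \<open>d\<close> from the right. Within a run the
  orthonormality of the \<open>e j i\<close> forces one common index \<open>i\<close>; passing to
  another block multiplies by \<open>1 / l\<close> whatever the indices are, so each run becomes an
  average. The two contacts with the vacuum give \<open>s * s = 1 / l\<close> for the leftmost
  run.\<close>

lemma phi_block_average:
  fixes y :: "nat \<Rightarrow> 'h bop" and I :: "nat \<Rightarrow> nat set"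
  assumes y: "\<And>i. y i \<in> A" and spr: "Bi_spreadable \<phi> n k y" and l: "l > 0"
    and I: "\<And>j. j \<in> {1..k} \<Longrightarrow> I j \<subseteq> {1..n} \<and> card (I j) = l"
    and ordered: "\<And>j j' i i'. j \<in> {1..k} \<Longrightarrow> j' \<in> {1..k} \<Longrightarrow> j < j' \<Longrightarrow> i \<in> I j \<Longrightarrow> i' \<in> I j' \<Longrightarrow> i < i'"
    and rs: "runs rs" "fst ` set rs \<subseteq> {1..k}"
  shows "\<phi> (run_prod (\<lambda>j m. y j ^ m) rs) =
    \<phi> (run_prod (\<lambda>j m. complex_of_real (1 / l) *\<^sub>C (\<Sum>i\<in>I j. y i ^ m)) rs)"
proof -
  define e where "e j = block_vector (I j)" for j
  define d where "d = (l2_single 0 1 :: complex l2)"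
  define s where "s = complex_of_real (1 / sqrt l)"
  \<comment> \<open>Generators outside the blocks go to 0. As the blocks are ordered, every product
    in the last family of relations then has a vanishing factor, and \<open>block_vector_sum\<close>
    gives the relation with the sum.\<close>
  define \<rho> where "\<rho> g = (case g of Pgen \<Rightarrow> rank_one d | Ugen i j \<Rightarrow> if j \<in> {1..k} \<and> i \<in> I j then rank_one (e j i) else 0)" for g
  have fin: "finite (I j)" and zero: "0 \<notin> I j" if "j \<in> {1..k}" for j
    using I [OF that] finite_subset [of "I j" "{1..n}"] by auto
  have s2: "s * s = complex_of_real (1 / l)"
    by (simp add: s_def flip: of_real_mult)
  have de: "cinner d (e j i) = s" if "j \<in> {1..k}" "i \<in> I j" for i j
    unfolding d_def e_def s_def using that I fin zero l by (intro block_vector_cinner(1)) auto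
  have ed: "cinner (e j i) d = s" if "j \<in> {1..k}" "i \<in> I j" for i j
    using de [OF that] cinner_commute [of "e j i" d] by (simp add: s_def)
  have ee: "cinner (e j i) (e j i') = (if i = i' then 1 else 0)" if "j \<in> {1..k}" "i \<in> I j" "i' \<in> I j" for i i' j
    unfolding e_def using that I fin zero l by (intro block_vector_cinner(2) [where l = l]) auto
  have ee': "cinner (e j i) (e j' i') = complex_of_real (1 / l)"
    if "j \<in> {1..k}" "j' \<in> {1..k}" "j \<noteq> j'" "i \<in> I j" "i' \<in> I j'" for i i' j j'
  proof -
    have "I j \<inter> I j' = {}"
      using ordered [OF that(1,2)] ordered [OF that(2,1)] that(3) by (metis disjoint_iff linorder_neqE_nat less_irrefl)
    then show ?thesis
      unfolding e_def using that I fin zero l by (intro block_vector_cinner(3)) auto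
  qed
  have dd: "cinner d d = 1"
    unfolding d_def cinner_l2_basis by simp
  have adj: "adj (\<rho> g) = \<rho> g" for g
    by (auto simp: \<rho>_def split: Bi_gen.split)
  have idem: "\<rho> g * \<rho> g = \<rho> g" for g
    using dd ee by (auto simp: \<rho>_def rank_one_idem split: Bi_gen.split)
  have sum_U: "(\<Sum>i=1..n. \<rho> (Ugen i j) \<cdot> v) = (\<Sum>i\<in>I j. cinner v (e j i) *\<^sub>C e j i)" if "j \<in> {1..k}" for j v
    using I [OF that] that by (intro sum.mono_neutral_cong_right) (auto simp: \<rho>_def)
  have rel: "star_rep \<rho> r = 0" if "r \<in> Bi_relations n k" for r
    using that unfolding Bi_relations_def
  proof (elim UnE CollectE exE conjE)
    fix j assume r: "r = (\<Sum>i = 1..n. u_gen i j) * P_gen - P_gen" and j: "j \<in> {1..k}"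
    have "(\<Sum>i\<in>I j. s *\<^sub>C e j i) = d"
      unfolding s_def e_def d_def using I [OF j] fin [OF j] l by (intro block_vector_sum) auto
    then have "(\<Sum>i=1..n. \<rho> (Ugen i j) \<cdot> d) = d"
      using sum_U [OF j, of d] de [OF j] by simp
    then show "star_rep \<rho> r = 0"
      by (intro bop_eqI) (simp add: r star_rep_simps \<rho>_def [of Pgen] bop_scaleC sum_bop scaleC_sum_right [symmetric])
  next
    fix i j i' j' assume r: "r = u_gen i j * u_gen i' j'" and *: "j \<in> {1..k}" "j' \<in> {1..k}" "j < j'" "i' \<le> i"
    have "i \<notin> I j \<or> i' \<notin> I j'"
      using ordered [OF *(1-3), of i i'] *(4) by auto
    then show "star_rep \<rho> r = 0"
      by (auto simp: r star_rep_simps \<rho>_def)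
  qed (auto simp: star_rep_simps star_rep_star adj idem)
  \<comment> \<open>\<open>b\<close> collects the letters on the left that have been read already,
    so the induction has to vary it.\<close>
  define V where "V b js = star_rep \<rho> (coaction_word n (\<lambda>w. \<phi> (b * prod_list (map y w))) js) \<cdot> d" for b js
  have V_Nil: "V b [] = \<phi> b *\<^sub>C d" for b
    by (simp add: V_def star_rep_simps)
  have V_Cons: "V b (j # js) = (\<Sum>i\<in>I j. cinner (V (b * y i) js) (e j i) *\<^sub>C e j i)" if "j \<in> {1..k}" for b j js
  proof -
    have "V b (j # js) = (\<Sum>i=1..n. \<rho> (Ugen i j) \<cdot> V (b * y i) js)"
      by (simp add: V_def star_rep_simps sum_bop mult.assoc)
    also have "\<dots> = (\<Sum>i\<in>I j. cinner (V (b * y i) js) (e j i) *\<^sub>C e j i)"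
      using I [OF that] that by (intro sum.mono_neutral_cong_right) (auto simp: \<rho>_def)
    finally show ?thesis .
  qed
  let ?avg = "\<lambda>j m. complex_of_real (1 / l) *\<^sub>C (\<Sum>i\<in>I j. y i ^ m)"
  let ?D = "run_prod ?avg"
  have DA: "?D rs \<in> A" for rs
    by (intro run_prod_in_A A_scale A_sum A_power y)
  have phi_avg: "\<phi> (b * (?avg j m * c)) = complex_of_real (1 / l) * (\<Sum>i\<in>I j. \<phi> (b * (y i ^ m * c)))"
    if "b \<in> A" "c \<in> A" for b c j m
  proof -
    have "b * (?avg j m * c) = complex_of_real (1 / l) *\<^sub>C (\<Sum>i\<in>I j. b * (y i ^ m * c))"
      by (simp add: sum_distrib_left sum_distrib_right)
    then show ?thesis
      using that y by (simp only: phi_scale phi_sum A_sum A_mult A_power)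
  qed
  \<comment> \<open>The factor \<open>s\<close> comes from the contact of the rightmost block with
    the vacuum and is handed on from run to run. The empty list is left out because its vector is a
    multiple of \<open>d\<close>.\<close>
  have main: "(case rs of [] \<Rightarrow> True | (j, m) # rs' \<Rightarrow>
      V b (run_word rs) = (\<Sum>i\<in>I j. (s * \<phi> (b * (y i ^ m * ?D rs'))) *\<^sub>C e j i))"
    if "runs rs" "fst ` set rs \<subseteq> {1..k}" "b \<in> A" for rs b
    using that
  proof (induction rs arbitrary: b)
    case (Cons jm rs)
    obtain j m where jm: "jm = (j, m)"
      by (cases jm)
    have j: "j \<in> {1..k}" and m: "m > 0"
      using Cons.prems by (auto simp: jm runs_def)
    \<comment> \<open>Contact of the rest of the word with the block on its left. The index
      \<open>i\<close> enters only through \<open>c\<close>, because all inner products between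
      vectors of distinct blocks are equal.\<close>
    have X: "cinner (V c (run_word rs)) (e j i) = s * \<phi> (c * ?D rs)" if c: "c \<in> A" and i: "i \<in> I j" for c i
    proof (cases rs)
      case Nil
      then show ?thesis
        using de [OF j i] by (simp add: V_Nil cinner_scaleC_left)
    next
      case (Cons jm' rs')
      obtain j' m' where jm': "jm' = (j', m')"
        by (cases jm')
      have j': "j' \<in> {1..k}" "j \<noteq> j'" and ok: "runs rs" "fst ` set rs \<subseteq> {1..k}"
        using Cons.prems by (auto simp: jm jm' Cons runs_def)
      have "V c (run_word rs) = (\<Sum>i'\<in>I j'. (s * \<phi> (c * (y i' ^ m' * ?D rs'))) *\<^sub>C e j' i')"
        using Cons.IH [OF ok c] by (simp add: Cons jm')
      then have "cinner (V c (run_word rs)) (e j i) =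
          (\<Sum>i'\<in>I j'. (s * \<phi> (c * (y i' ^ m' * ?D rs'))) * complex_of_real (1 / l))"
        using ee' [OF j'(1) j _ _ i] j' by (simp add: cinner_sum_left cinner_scaleC_left)
      also have "\<dots> = s * \<phi> (c * (?avg j' m' * ?D rs'))"
        unfolding phi_avg [OF c DA] by (simp add: sum_distrib_left mult_ac sum_divide_distrib)
      finally show ?thesis
        by (simp add: Cons jm')
    qed
    have "V b (replicate m j @ run_word rs) = (\<Sum>i\<in>I j. (s * \<phi> (b * (y i ^ m * ?D rs))) *\<^sub>C e j i)" if "b \<in> A" for b
      using m that
    proof (induction m arbitrary: b)
      case (Suc m)
      show ?case
      proof (cases "m = 0")
        case True
        then show ?thesis
          using X [of "b * y _"] Suc.prems y by (simp add: V_Cons [OF j] mult.assoc)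
      next
        case False
        have "cinner (V (b * y i) (replicate m j @ run_word rs)) (e j i) = s * \<phi> (b * (y i ^ Suc m * ?D rs))"
          if i: "i \<in> I j" for i
        proof -
          have "V (b * y i) (replicate m j @ run_word rs) =
              (\<Sum>i'\<in>I j. (s * \<phi> (b * y i * (y i' ^ m * ?D rs))) *\<^sub>C e j i')"
            using Suc False y by simp
          then have "cinner (V (b * y i) (replicate m j @ run_word rs)) (e j i) =
              (\<Sum>i'\<in>I j. (s * \<phi> (b * y i * (y i' ^ m * ?D rs))) * (if i' = i then 1 else 0))"
            using ee [OF j _ i] by (simp add: cinner_sum_left cinner_scaleC_left)
          also have "\<dots> = (\<Sum>i'\<in>I j. if i' = i then s * \<phi> (b * y i * (y i' ^ m * ?D rs)) else 0)"
            by (intro sum.cong) auto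
          also have "\<dots> = s * \<phi> (b * y i * (y i ^ m * ?D rs))"
            using i fin [OF j] by simp
          finally show ?thesis
            by (simp add: mult.assoc)
        qed
        then show ?thesis
          by (simp add: V_Cons [OF j])
      qed
    qed simp
    then show ?case
      using Cons.prems by (simp add: jm)
  qed simp
  show ?thesis
  proof (cases rs)
    case (Cons jm rs')
    obtain j m where jm: "jm = (j, m)"
      by (cases jm)
    have j: "j \<in> {1..k}"
      using rs by (auto simp: Cons jm)
    define js where "js = run_word rs"
    define p where "p = (Poly_Mapping.single (Word js) 1 :: (nat, complex) ncpoly)"
    have "nc_vars p \<subseteq> {1..k}"
      using set_run_word_subset [of rs] rs(2) by (auto simp: nc_vars_def p_def js_def)
    then have "Bi_eq n k (nc_const (joint_distribution \<phi> y p) * P_gen)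
          (P_gen * slice (joint_distribution \<phi> y) (Bi_coaction n p) * P_gen)"
      using spr by (simp add: Bi_spreadable_def)
    then have "star_rep \<rho> (nc_const (joint_distribution \<phi> y p) * P_gen) =
        star_rep \<rho> (P_gen * slice (joint_distribution \<phi> y) (Bi_coaction n p) * P_gen)"
      unfolding Bi_eq_def by (rule universal_C_star_eq_rep) (rule rel)
    moreover have "slice (joint_distribution \<phi> y) (Bi_coaction n p) =
        coaction_word n (\<lambda>w. \<phi> (1 * prod_list (map y w))) js"
      by (simp add: slice_coaction joint_distribution_word p_def)
    moreover have "joint_distribution \<phi> y p = \<phi> (run_prod (\<lambda>j m. y j ^ m) rs)"
      by (simp add: p_def joint_distribution_word js_def prod_list_run_word)
    ultimately have "star_rep \<rho> (nc_const (\<phi> (run_prod (\<lambda>j m. y j ^ m) rs)) * P_gen) \<cdot> d =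
        star_rep \<rho> (P_gen * coaction_word n (\<lambda>w. \<phi> (1 * prod_list (map y w))) js * P_gen) \<cdot> d"
      by (simp only:)
    then have "\<phi> (run_prod (\<lambda>j m. y j ^ m) rs) *\<^sub>C d = cinner (V 1 js) d *\<^sub>C d"
      by (simp add: star_rep_simps \<rho>_def [of Pgen] V_def dd scaleC_one)
    then have "cinner (\<phi> (run_prod (\<lambda>j m. y j ^ m) rs) *\<^sub>C d) d = cinner (cinner (V 1 js) d *\<^sub>C d) d"
      by (rule arg_cong)
    then have "\<phi> (run_prod (\<lambda>j m. y j ^ m) rs) = cinner (V 1 js) d"
      by (simp add: cinner_scaleC_left dd)
    also have "V 1 js = (\<Sum>i\<in>I j. (s * \<phi> (1 * (y i ^ m * ?D rs'))) *\<^sub>C e j i)"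
      using main [OF rs A_one] by (simp add: js_def Cons jm)
    also have "cinner \<dots> d = (\<Sum>i\<in>I j. (s * s) * \<phi> (1 * (y i ^ m * ?D rs')))"
      by (simp add: cinner_sum_left cinner_scaleC_left ed [OF j] mult_ac)
    also have "\<dots> = \<phi> (1 * (?avg j m * ?D rs'))"
      unfolding phi_avg [OF A_one DA] s2 sum_distrib_left ..
    finally show ?thesis
      by (simp add: Cons jm)
  qed simp
qed

end

context gns_sequence
begin

text \<open>The letters of the word occupy the positions up to \<open>r\<close>, and the blocks
  follow, \<open>l\<close> positions for each letter. The averages thus live on indices beyond the
  word.\<close>

lemma spreadable_block_average:
  fixes c :: "nat \<Rightarrow> int"
  assumes spr: "boolean_spreadable_family \<phi> x" and c: "strict_mono_on {1..r + r * l} c" and l: "l > 0"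
    and rs: "runs rs" "fst ` set rs \<subseteq> {1..r}"
  shows "\<phi> (run_prod (\<lambda>j m. x (c j) ^ m) rs) = \<phi> (run_prod (\<lambda>j m. complex_of_real (1 / l) *\<^sub>C
      (\<Sum>i\<in>{r + (j - 1) * l + 1..r + j * l}. x (c i) ^ m)) rs)"
proof (cases "r = 0")
  case True
  then show ?thesis
    using rs by (cases rs) auto
next
  case False
  have "boolean_spreadable \<phi> (r + r * l) (\<lambda>m. x (c m))"
    using spr c by (auto simp: boolean_spreadable_family_def)
  then have B: "Bi_spreadable \<phi> (r + r * l) r (\<lambda>m. x (c m))"
    using False l by (auto simp: boolean_spreadable_def)
  have step: "j * l = (j - 1) * l + l" if "1 \<le> j" for j
    using that by (cases j) auto
  have mono: "j * l \<le> (j' - 1) * l" if "j < j'" for j j'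
    using that by (intro mult_right_mono) auto
  show ?thesis
  proof (rule phi_block_average [OF _ B l _ _ rs])
    fix j assume j: "j \<in> {1..r}"
    then show "{r + (j - 1) * l + 1..r + j * l} \<subseteq> {1..r + r * l} \<and> card {r + (j - 1) * l + 1..r + j * l} = l"
      using step [of j] mult_right_mono [of j r l] by auto
  next
    fix j j' i i' assume "j \<in> {1..r}" "j' \<in> {1..r}" "j < j'" "i \<in> {r + (j - 1) * l + 1..r + j * l}"
      "i' \<in> {r + (j' - 1) * l + 1..r + j' * l}"
    then have "i \<le> r + j * l" "r + (j' - 1) * l + 1 \<le> i'" "j * l \<le> (j' - 1) * l"
      using mono [of j j'] by (simp_all only: atLeastAtMost_iff)
    then show "i < i'"
      by linarith
  qed simp
qed

end

section \<open>Run decompositions of words and relabelling of their letters\<close>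

lemma runs_Cons: "runs (p # rs) \<longleftrightarrow> 0 < snd p \<and> runs rs \<and> (rs = [] \<or> fst p \<noteq> fst (hd rs))"
  by (cases rs; cases p) (auto simp: runs_def)

lemma ex_runs: "\<exists>rs. runs rs \<and> run_word rs = w \<and> fst ` set rs = set w"
proof (induction w)
  case Nil
  show ?case
    by (rule exI [of _ "[]"]) (simp add: runs_def)
next
  case (Cons i w)
  then obtain rs where rs: "runs rs" "run_word rs = w" "fst ` set rs = set w"
    by blast
  show ?case
  proof (cases "rs \<noteq> [] \<and> fst (hd rs) = i")
    case True
    then obtain m rs' where *: "rs = (i, m) # rs'"
      by (cases rs) auto
    show ?thesis
      by (rule exI [of _ "(i, Suc m) # rs'"]) (use rs in \<open>auto simp: * runs_Cons\<close>)
  next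
    case False
    show ?thesis
      by (rule exI [of _ "(i, 1) # rs"]) (use rs False in \<open>auto simp: runs_Cons\<close>)
  qed
qed

lemma run_prod_map: "run_prod Y (map (\<lambda>(i, m). (f i, m)) rs) = run_prod (\<lambda>i m. Y (f i) m) rs"
  by (induction rs) auto

lemma run_prod_cong: "(\<And>i m. (i, m) \<in> set rs \<Longrightarrow> Y i m = Z i m) \<Longrightarrow> run_prod Y rs = run_prod Z rs"
  by (induction rs) auto

lemma runs_map:
  assumes "runs rs" "inj_on f (fst ` set rs)"
  shows "runs (map (\<lambda>(i, m). (f i, m)) rs)"
  using assms
proof (induction rs)
  case (Cons p rs)
  have "runs (map (\<lambda>(i, m). (f i, m)) rs)"
    by (rule Cons.IH) (use Cons.prems in \<open>auto simp: runs_Cons\<close>)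
  moreover have "f (fst p) \<noteq> f (fst (hd rs))" if "rs \<noteq> []"
    using Cons.prems that by (auto simp: runs_Cons inj_on_def)
  ultimately show ?case
    using Cons.prems by (cases p; cases "hd rs") (auto simp: runs_Cons hd_map)
qed (simp add: runs_def)

text \<open>For \<open>i\<close> in \<open>L\<close> this is its position in the increasing
  enumeration, counted from 1; it numbers the blocks attached to the letters.\<close>

definition rank_in :: "'i :: linorder set \<Rightarrow> 'i \<Rightarrow> nat" where
  "rank_in L i = card {j \<in> L. j \<le> i}"

lemma rank_in_less:
  assumes "finite L" "i' \<in> L" "i < i'"
  shows "rank_in L i < rank_in L i'"
  unfolding rank_in_def
proof (rule psubset_card_mono)
  have "i' \<in> {j \<in> L. j \<le> i'} - {j \<in> L. j \<le> i}" "{j \<in> L. j \<le> i} \<subseteq> {j \<in> L. j \<le> i'}"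
    using assms by auto
  then show "{j \<in> L. j \<le> i} \<subset> {j \<in> L. j \<le> i'}"
    by blast
qed (use assms in simp)

lemma rank_in_range: "finite L \<Longrightarrow> i \<in> L \<Longrightarrow> rank_in L i \<in> {1..card L}"
  unfolding rank_in_def
  by (auto simp: Suc_le_eq card_gt_0_iff intro!: card_mono)

lemma rank_in_inj: "finite L \<Longrightarrow> inj_on (rank_in L) L"
  by (rule linorder_inj_onI') (metis rank_in_less less_irrefl)

lemma rank_in_image: "finite L \<Longrightarrow> rank_in L ` L = {1..card L}"
  by (rule card_subset_eq) (auto simp: card_image rank_in_inj dest: rank_in_range)

lemma rank_in_strict_mono:
  assumes "finite L" "strict_mono_on L g" "i \<in> L"
  shows "rank_in (g ` L) (g i) = rank_in L i"
proof -
  have "{j \<in> g ` L. j \<le> g i} = g ` {j \<in> L. j \<le> i}"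
  proof -
    have "g j \<le> g i \<longleftrightarrow> j \<le> i" if "j \<in> L" for j
      using strict_mono_onD [OF assms(2) that assms(3)] strict_mono_onD [OF assms(2,3) that]
      by (cases i j rule: linorder_cases) auto
    then show ?thesis
      by auto
  qed
  moreover have "inj_on g L"
    using assms(2) by (rule strict_mono_on_imp_inj_on)
  ultimately show ?thesis
    unfolding rank_in_def by (simp add: card_image inj_on_subset)
qed

section \<open>Convergence of bounded operators tested on dense sets\<close>

lemma lipschitz_dense_tendsto:
  fixes g :: "'i \<Rightarrow> 'a :: metric_space \<Rightarrow> 'b :: metric_space"
  assumes D: "closure D = UNIV" and L: "0 \<le> L"
    and g: "\<And>i u v. dist (g i u) (g i v) \<le> L * dist u v" and h: "\<And>u v. dist (h u) (h v) \<le> L * dist u v"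
    and lim: "\<And>v. v \<in> D \<Longrightarrow> ((\<lambda>i. g i v) \<longlongrightarrow> h v) F"
  shows "((\<lambda>i. g i v) \<longlongrightarrow> h v) F"
proof (rule tendstoI)
  fix e :: real assume e: "e > 0"
  define d where "d = e / (3 * (L + 1))"
  have d: "d > 0" "L * d \<le> e / 3"
    using e L by (auto simp: d_def field_simps)
  have "v \<in> closure D"
    using D by simp
  then obtain u where u: "u \<in> D" "dist u v < d"
    using d(1) by (meson closure_approachable)
  have "eventually (\<lambda>i. dist (g i u) (h u) < e / 3) F"
    using e by (intro tendstoD [OF lim [OF u(1)]]) simp
  then show "eventually (\<lambda>i. dist (g i v) (h v) < e) F"
  proof (rule eventually_mono)
    fix i assume 1: "dist (g i u) (h u) < e / 3"
    have "L * dist u v \<le> L * d"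
      using u(2) L by (intro mult_left_mono) auto
    then have "dist (g i v) (g i u) \<le> e / 3" "dist (h u) (h v) \<le> e / 3"
      using g [of i v u] h [of u v] d(2) by (auto simp: dist_commute)
    then show "dist (g i v) (h v) < e"
      using 1 dist_triangle [of "g i v" "h v" "g i u"] dist_triangle [of "g i u" "h v" "h u"] by linarith
  qed
qed

lemma dist_bop_le: "(\<And>v. norm (T \<cdot> v) \<le> C * norm v) \<Longrightarrow> dist (T \<cdot> u) (T \<cdot> v) \<le> C * dist u v"
  by (metis bop_diff dist_norm)

lemma strong_dense_tendsto:
  assumes D: "closure D = UNIV" and f: "\<And>i v. norm (f i \<cdot> v) \<le> C * norm v"
    and lim: "\<And>v. v \<in> D \<Longrightarrow> ((\<lambda>i. f i \<cdot> v) \<longlongrightarrow> T \<cdot> v) F"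
  shows "((\<lambda>i. f i \<cdot> v) \<longlongrightarrow> T \<cdot> v) F"
proof (rule lipschitz_dense_tendsto [OF D _ _ _ lim, where L = "max C (opnorm T)"])
  show "dist (f i \<cdot> u) (f i \<cdot> v) \<le> max C (opnorm T) * dist u v" for i u v
    using dist_bop_le [OF f, of i u v] mult_right_mono [of C "max C (opnorm T)" "dist u v"] by simp
  show "dist (T \<cdot> u) (T \<cdot> v) \<le> max C (opnorm T) * dist u v" for u v
    using dist_bop_le [OF opnorm, of T u v] mult_right_mono [of "opnorm T" "max C (opnorm T)" "dist u v"] by simp
qed (auto simp: le_max_iff_disj)

lemma weak_dense_tendsto:
  fixes T :: "'h :: complex_hilbert bop"
  assumes D: "closure D = UNIV" and f: "\<And>i v. norm (f i \<cdot> v) \<le> C * norm v"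
    and lim: "\<And>v w. v \<in> D \<Longrightarrow> w \<in> D \<Longrightarrow> ((\<lambda>i. cinner (f i \<cdot> v) w) \<longlongrightarrow> cinner (T \<cdot> v) w) F"
  shows "((\<lambda>i. cinner (f i \<cdot> v) w) \<longlongrightarrow> cinner (T \<cdot> v) w) F"
proof -
  define M where "M = max C (opnorm T)"
  have M: "0 \<le> M" "norm (f i \<cdot> v) \<le> M * norm v" "norm (T \<cdot> v) \<le> M * norm v" for i v
    using f [of i v] opnorm [of T v] mult_right_mono [of C M "norm v"] mult_right_mono [of "opnorm T" M "norm v"]
    by (auto simp: M_def le_max_iff_disj)
  have bd: "dist (cinner (S \<cdot> u) w) (cinner (S \<cdot> v) w) \<le> M * norm w * dist u v"
    "dist (cinner (S \<cdot> w) u) (cinner (S \<cdot> w) v) \<le> M * norm w * dist u v"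
    if S: "\<And>v. norm (S \<cdot> v) \<le> M * norm v" for S :: "'h bop" and u v w
  proof -
    have "dist (cinner (S \<cdot> u) w) (cinner (S \<cdot> v) w) = cmod (cinner (S \<cdot> (u - v)) w)"
      by (simp add: dist_norm bop_diff cinner_diff_left)
    also have "\<dots> \<le> norm (S \<cdot> (u - v)) * norm w"
      by (rule cmod_cinner_le)
    also have "\<dots> \<le> M * norm (u - v) * norm w"
      by (intro mult_right_mono S) simp
    finally show "dist (cinner (S \<cdot> u) w) (cinner (S \<cdot> v) w) \<le> M * norm w * dist u v"
      by (simp add: dist_norm mult_ac)
    have "dist (cinner (S \<cdot> w) u) (cinner (S \<cdot> w) v) = cmod (cinner (S \<cdot> w) (u - v))"
      by (simp add: dist_norm cinner_diff_right)
    also have "\<dots> \<le> norm (S \<cdot> w) * norm (u - v)"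
      by (rule cmod_cinner_le)
    also have "\<dots> \<le> M * norm w * norm (u - v)"
      by (intro mult_right_mono S) simp
    finally show "dist (cinner (S \<cdot> w) u) (cinner (S \<cdot> w) v) \<le> M * norm w * dist u v"
      by (simp add: dist_norm)
  qed
  have 1: "((\<lambda>i. cinner (f i \<cdot> v) w) \<longlongrightarrow> cinner (T \<cdot> v) w) F" if "w \<in> D" for v w
    by (rule lipschitz_dense_tendsto [OF D, where L = "M * norm w" and g = "\<lambda>i v. cinner (f i \<cdot> v) w"
          and h = "\<lambda>v. cinner (T \<cdot> v) w"])
      (use M bd lim that in auto)
  show ?thesis
    by (rule lipschitz_dense_tendsto [OF D, where L = "M * norm v" and g = "\<lambda>i w. cinner (f i \<cdot> v) w"
          and h = "\<lambda>w. cinner (T \<cdot> v) w"])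
      (use M bd 1 in auto)
qed

text \<open>The bounded \<open>f i\<close> are applied to the fixed vector
  \<open>S \<cdot> v\<close> and to a difference that tends to zero.\<close>

lemma strong_mult_tendsto:
  assumes f: "\<And>i v. norm (f i \<cdot> v) \<le> C * norm v" "0 \<le> C"
    and lim: "((\<lambda>i. f i \<cdot> S \<cdot> v) \<longlongrightarrow> T \<cdot> S \<cdot> v) F" "((\<lambda>i. g i \<cdot> v) \<longlongrightarrow> S \<cdot> v) F"
  shows "((\<lambda>i. f i \<cdot> g i \<cdot> v) \<longlongrightarrow> T \<cdot> S \<cdot> v) F"
proof -
  have "((\<lambda>i. norm (g i \<cdot> v - S \<cdot> v)) \<longlongrightarrow> 0) F"
    using lim(2) by (simp add: tendsto_norm_zero LIM_zero)
  then have "((\<lambda>i. C * norm (g i \<cdot> v - S \<cdot> v)) \<longlongrightarrow> 0) F"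
    by (rule tendsto_mult_right_zero)
  then have "((\<lambda>i. f i \<cdot> (g i \<cdot> v - S \<cdot> v)) \<longlongrightarrow> 0) F"
    by (rule Lim_null_comparison [rotated]) (simp add: f)
  from tendsto_add [OF this lim(1)] show ?thesis
    by (simp add: bop_diff)
qed

lemma norm_bop_power_le:
  assumes "\<And>v. norm (T \<cdot> v) \<le> C * norm v" "0 \<le> C"
  shows "norm (T ^ m \<cdot> v) \<le> C ^ m * norm v"
proof (induction m)
  case (Suc m)
  have "norm (T \<cdot> T ^ m \<cdot> v) \<le> C * norm (T ^ m \<cdot> v)"
    by (rule assms(1))
  also have "\<dots> \<le> C * (C ^ m * norm v)"
    by (intro mult_left_mono Suc assms(2))
  finally show ?case
    by simp
qed simp

lemma word_span_sum:
  assumes "s \<in> word_span x I"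
  obtains n c w where "s = (\<Sum>k<(n::nat). c k *\<^sub>C prod_list (map x (w k)))" "\<And>k. w k \<noteq> []"
    "\<And>k. k < n \<Longrightarrow> set (w k) \<subseteq> I"
proof -
  have "\<exists>n c w. s = (\<Sum>k<(n::nat). c k *\<^sub>C prod_list (map x (w k))) \<and> (\<forall>k. w k \<noteq> []) \<and> (\<forall>k<n. set (w k) \<subseteq> I)"
    using assms
  proof induction
    case zero
    show ?case
      by (rule exI [of _ 0], rule exI, rule exI [of _ "\<lambda>_. [undefined]"]) simp
  next
    case (add s "is" d)
    then obtain n c w where *: "s = (\<Sum>k<(n::nat). c k *\<^sub>C prod_list (map x (w k)))" "\<forall>k. w k \<noteq> []" "\<forall>k<n. set (w k) \<subseteq> I"
      by blast
    have "s = (\<Sum>k<n. (c(n := d)) k *\<^sub>C prod_list (map x ((w(n := is)) k)))"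
      unfolding *(1) by (intro sum.cong) auto
    then show ?case
      using * add.hyps by (intro exI [of _ "Suc n"] exI [of _ "c(n := d)"] exI [of _ "w(n := is)"]) (auto simp: less_Suc_eq)
  qed
  then show thesis
    using that by blast
qed

lemma word_span_subset_alg: "word_span x I \<subseteq> nonunital_algebra hull (x ` I)"
proof
  fix s assume "s \<in> word_span x I"
  then show "s \<in> nonunital_algebra hull (x ` I)"
    by induction (auto intro: nonunital_algebraD [OF nonunital_algebra_hull] word_in_alg)
qed

lemma word_span_mono: "s \<in> word_span x I \<Longrightarrow> I \<subseteq> J \<Longrightarrow> s \<in> word_span x J"
  by (induction rule: word_span.induct) (auto intro: word_span.intros)

text \<open>Only finitely many indices occur in an element, so all sufficiently large ones are fresh
  for it.\<close>

lemma word_span_support: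
  fixes x :: "int \<Rightarrow> 'h :: complex_hilbert bop"
  assumes "s \<in> word_span x I"
  obtains N where "s \<in> word_span x (I \<inter> {..<N})"
proof -
  have "\<exists>N. s \<in> word_span x (I \<inter> {..<N})"
    using assms
  proof induction
    case (add s "is" c)
    then obtain N where N: "s \<in> word_span x (I \<inter> {..<N})"
      by blast
    define M where "M = max N (Max (set is) + 1)"
    have "set is \<subseteq> I \<inter> {..<M}"
      using add.hyps by (auto simp: M_def less_max_iff_disj le_less_trans [OF Max_ge])
    moreover have "s \<in> word_span x (I \<inter> {..<M})"
      by (rule word_span_mono [OF N]) (auto simp: M_def)
    ultimately show ?case
      using add.hyps by (blast intro: word_span.add)
  qed (auto intro: word_span.zero)
  then show thesis
    using that by blast
qed

section \<open>Spreadable sequences and the weak limits of their powers\<close>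

locale spreadable_sequence = gns_sequence A \<phi> \<pi> \<Omega> x
  for A :: "'h :: complex_hilbert bop set" and \<phi> and \<pi> :: "'h bop \<Rightarrow> 'k :: complex_hilbert bop"
    and \<Omega> and x +
  assumes spreadable: "boolean_spreadable_family \<phi> x"
begin

abbreviation W :: "int list \<Rightarrow> 'h bop" where "W is \<equiv> prod_list (map x is)"
abbreviation X :: "int \<Rightarrow> 'k bop" where "X i \<equiv> \<pi> (x i)"

lemma W_in_A [simp]: "W is \<in> A"
  by (induction "is") auto

lemma adj_W: "adj (W is) = W (rev is)"
  by (simp add: adj_prod_list rev_map o_def)

lemma word_span_in_A: "s \<in> word_span x I \<Longrightarrow> s \<in> A"
  using word_span_subset_alg alg_subset_A by blast

text \<open>\<open>B\<close> supplies fresh indices to the right of the word. The index map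
  \<open>c\<close> lists the letters of the word in increasing order and continues with
  \<open>B\<close>, so \<open>spreadable_block_average\<close> applies to the runs renumbered by
  rank.\<close>

lemma run_average:
  fixes B :: "nat \<Rightarrow> int"
  assumes rs: "runs rs" and l: "l > 0" and B: "strict_mono B" "\<And>i. i \<in> fst ` set rs \<Longrightarrow> i < B 0"
  shows "\<phi> (run_prod (\<lambda>i m. x i ^ m) rs) = \<phi> (run_prod (\<lambda>i m. complex_of_real (1 / l) *\<^sub>C
      (\<Sum>t<l. x (B ((rank_in (fst ` set rs) i - 1) * l + t)) ^ m)) rs)"
proof -
  define L where "L = fst ` set rs"
  define h where "h = rank_in L"
  define r where "r = card L"
  have L: "finite L"
    by (simp add: L_def)
  have inj: "inj_on h L" and im: "h ` L = {1..r}"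
    using L by (auto simp: h_def r_def rank_in_inj rank_in_image)
  define a where "a = inv_into L h"
  have a: "a (h i) = i" if "i \<in> L" for i
    using inj that by (simp add: a_def)
  have aL: "a j \<in> L" "h (a j) = j" if "j \<in> {1..r}" for j
    using that im by (auto simp: a_def inv_into_into f_inv_into_f)
  define c where "c m = (if m \<le> r then a m else B (m - r - 1))" for m
  have a_mono: "a j < a j'" if "j \<in> {1..r}" "j' \<in> {1..r}" "j < j'" for j j'
  proof (rule ccontr)
    assume "\<not> a j < a j'"
    then have "a j' < a j \<or> a j' = a j"
      by auto
    then show False
      using rank_in_less [OF L aL(1) [OF that(1)], of "a j'"] aL(2) [OF that(1)] aL(2) [OF that(2)] that(3)
      by (auto simp: h_def)
  qed
  have c: "strict_mono_on {1..r + r * l} c"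
  proof (rule strict_mono_onI)
    fix m m' assume mm: "m \<in> {1..r + r * l}" "m' \<in> {1..r + r * l}" "m < m'"
    consider "m' \<le> r" | "m \<le> r" "m' > r" | "m > r"
      using mm by linarith
    then show "c m < c m'"
    proof cases
      case 2
      have "a m \<in> L"
        using aL(1) 2 mm by auto
      then have "a m < B 0"
        using B(2) by (simp add: L_def)
      also have "B 0 \<le> B (m' - r - 1)"
        using B(1) by (simp add: strict_mono_less_eq)
      finally show ?thesis
        using 2 by (simp add: c_def)
    next
      case 3
      then show ?thesis
        using mm B(1) by (auto simp: c_def strict_mono_less)
    qed (use a_mono mm in \<open>auto simp: c_def\<close>)
  qed
  define rs' where "rs' = map (\<lambda>(i, m). (h i, m)) rs"
  have rs': "runs rs'" "fst ` set rs' \<subseteq> {1..r}"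
  proof -
    show "runs rs'"
      unfolding rs'_def by (rule runs_map [OF rs]) (use inj in \<open>simp add: L_def\<close>)
    have "fst ` set rs' = h ` L"
      by (force simp: rs'_def L_def)
    then show "fst ` set rs' \<subseteq> {1..r}"
      using im by simp
  qed
  have hL: "h i \<in> {1..r}" if "(i, m) \<in> set rs" for i m
    using that im by (force simp: L_def)
  have iL: "i \<in> L" if "(i, m) \<in> set rs" for i m
    using that by (force simp: L_def)
  have "run_prod (\<lambda>i m. x i ^ m) rs = run_prod (\<lambda>j m. x (c j) ^ m) rs'"
    unfolding rs'_def run_prod_map using hL iL by (intro run_prod_cong) (auto simp: c_def a)
  also have "\<phi> \<dots> = \<phi> (run_prod (\<lambda>j m. complex_of_real (1 / l) *\<^sub>C
      (\<Sum>i\<in>{r + (j - 1) * l + 1..r + j * l}. x (c i) ^ m)) rs')"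
    by (rule spreadable_block_average [OF spreadable c l rs'])
  also have "run_prod (\<lambda>j m. complex_of_real (1 / l) *\<^sub>C
      (\<Sum>i\<in>{r + (j - 1) * l + 1..r + j * l}. x (c i) ^ m)) rs' =
    run_prod (\<lambda>i m. complex_of_real (1 / l) *\<^sub>C (\<Sum>t<l. x (B ((h i - 1) * l + t)) ^ m)) rs"
    unfolding rs'_def run_prod_map
  proof (rule run_prod_cong)
    fix i m assume "(i, m) \<in> set rs"
    then have "1 \<le> h i"
      using hL by simp
    then obtain j where j: "h i = Suc j"
      by (cases "h i") auto
    have "(\<Sum>k\<in>{r + (h i - 1) * l + 1..r + h i * l}. x (c k) ^ m) = (\<Sum>t<l. x (c (r + j * l + 1 + t)) ^ m)"
      by (rule sum.reindex_bij_witness [of _ "\<lambda>t. r + j * l + 1 + t" "\<lambda>k. k - (r + j * l + 1)"])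
        (auto simp: j)
    then show "complex_of_real (1 / l) *\<^sub>C (\<Sum>k\<in>{r + (h i - 1) * l + 1..r + h i * l}. x (c k) ^ m) =
      complex_of_real (1 / l) *\<^sub>C (\<Sum>t<l. x (B ((h i - 1) * l + t)) ^ m)"
      by (simp add: j c_def)
  qed
  finally show ?thesis
    by (simp add: h_def L_def)
qed

text \<open>With blocks of length 1, \<open>run_average\<close> moves both words to the same indices
  beyond \<open>N\<close>, since these depend on the ranks of the letters only.\<close>

lemma phi_spread:
  assumes g: "strict_mono_on (set w) g"
  shows "\<phi> (W (map g w)) = \<phi> (W w)"
proof -
  obtain rs where rs: "runs rs" "run_word rs = w" "fst ` set rs = set w"
    using ex_runs [of w] by (elim exE conjE)
  let ?rs = "map (\<lambda>(i, m). (g i, m)) rs"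
  have inj: "inj_on g (fst ` set rs)"
    using g rs(3) by (simp add: strict_mono_on_imp_inj_on)
  have fst': "fst ` set ?rs = g ` set w"
    unfolding rs(3) [symmetric] by force
  have rw: "run_word ?rs = map g w"
    unfolding rs(2) [symmetric] by (induction rs) (auto simp: map_replicate)
  have "finite (set w \<union> g ` set w)"
    by simp
  then obtain N where N: "\<And>i. i \<in> set w \<union> g ` set w \<Longrightarrow> i < N"
    by (metis Max_ge zle_add1_eq_le)
  let ?B = "\<lambda>u. N + int u"
  have B: "strict_mono ?B"
    by (simp add: strict_mono_def)
  have "\<phi> (W w) = \<phi> (run_prod (\<lambda>i m. x (?B (rank_in (set w) i - 1)) ^ m) rs)"
    unfolding rs(2) [symmetric] prod_list_run_word
    using run_average [OF rs(1), of 1 ?B] B N rs by (simp add: scaleC_one)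
  also have "\<dots> = \<phi> (run_prod (\<lambda>i m. x (?B (rank_in (g ` set w) i - 1)) ^ m) ?rs)"
  proof -
    have "rank_in (g ` set w) (g i) = rank_in (set w) i" if "(i, m) \<in> set rs" for i m
      using g rs(3) that by (intro rank_in_strict_mono) force+
    then show ?thesis
      unfolding run_prod_map by (intro arg_cong [where f = \<phi>] run_prod_cong) simp
  qed
  also have "\<dots> = \<phi> (W (map g w))"
    unfolding rw [symmetric] prod_list_run_word
    using run_average [OF runs_map [OF rs(1) inj], of 1 ?B] B N fst' by (simp add: scaleC_one)
  finally show ?thesis
    by simp
qed

lemma cinner_words: "cinner (\<pi> (W u) \<cdot> \<Omega>) (\<pi> (W v) \<cdot> \<Omega>) = \<phi> (W (rev v @ u))"
  by (simp add: phi_eq cinner_adj_left flip: adj_W)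

text \<open>The shift by \<open>n\<close> preserves all inner products of word vectors and turns
  \<open>x n\<close> into \<open>x 0\<close>; the integers as index set make it available. A bound
  uniform in \<open>n\<close> is what limits of powers require.\<close>

lemma X_bound: "norm (X n \<cdot> \<xi>) \<le> opnorm (X 0) * norm \<xi>"
proof -
  have dense: "norm (X n \<cdot> \<pi> s \<cdot> \<Omega>) \<le> opnorm (X 0) * norm (\<pi> s \<cdot> \<Omega>)" if s: "s \<in> alg UNIV" for s
  proof -
    have "s \<in> word_span x UNIV"
      using s alg_subset_word_span by blast
    then obtain N c w where s: "s = (\<Sum>k<(N::nat). c k *\<^sub>C W (w k))"
      by (rule word_span_sum)
    \<comment> \<open>The element \<open>s\<close> multiplied by the word \<open>u\<close> from the
      left, with all letters relabelled by \<open>f\<close>.\<close>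
    define P where "P f u = (\<Sum>k<N. c k *\<^sub>C W (map f (u @ w k)))" for f u
    have PA: "P f u \<in> A" for f u
      unfolding P_def by (intro A_sum A_scale W_in_A)
    have inner: "cinner (\<pi> (P f u) \<cdot> \<Omega>) (\<pi> (P f u) \<cdot> \<Omega>) =
        (\<Sum>k<N. \<Sum>k'<N. c k * cnj (c k') * \<phi> (W (map f (rev (u @ w k') @ (u @ w k)))))" for f u
    proof -
      have *: "\<pi> (P f u) \<cdot> \<Omega> = (\<Sum>k<N. c k *\<^sub>C \<pi> (W (map f (u @ w k))) \<cdot> \<Omega>)"
        unfolding P_def by (simp only: pi_sum A_scale W_in_A pi_scale sum_bop bop_simps)
      show ?thesis
        unfolding * cinner_sum_left unfolding cinner_sum_right
        by (intro sum.cong refl) (simp only: cinner_scaleC_left cinner_scaleC_right cinner_words,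
            simp only: rev_map map_append rev_append append_assoc mult.assoc mult.left_commute)
    qed
    have norm_P: "norm (\<pi> (P f u) \<cdot> \<Omega>) = norm (\<pi> (P id u) \<cdot> \<Omega>)" if f: "strict_mono f" for f u
    proof -
      have "strict_mono_on S f" for S
        using f by (auto simp: strict_mono_on_def strict_mono_def)
      then have "cinner (\<pi> (P f u) \<cdot> \<Omega>) (\<pi> (P f u) \<cdot> \<Omega>) = cinner (\<pi> (P id u) \<cdot> \<Omega>) (\<pi> (P id u) \<cdot> \<Omega>)"
        unfolding inner by (simp only: phi_spread list.map_id id_apply)
      then show ?thesis
        by (simp add: cinner_self flip: of_real_power)
    qed
    let ?f = "\<lambda>i. i - n"
    have f: "strict_mono ?f"
      by (simp add: strict_mono_def)
    have xs: "x n * s = P id [n]" "s = P id []"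
      by (simp_all add: s P_def sum_distrib_left)
    have fP: "P ?f [n] = x 0 * P ?f []"
      by (simp add: P_def sum_distrib_left)
    have "norm (X n \<cdot> \<pi> s \<cdot> \<Omega>) = norm (\<pi> (P id [n]) \<cdot> \<Omega>)"
      using xs PA by (metis pi_mult times_bop.rep_eq xA)
    also have "\<dots> = norm (\<pi> (P ?f [n]) \<cdot> \<Omega>)"
      by (rule norm_P [OF f, symmetric])
    also have "\<dots> = norm (X 0 \<cdot> \<pi> (P ?f []) \<cdot> \<Omega>)"
      by (simp add: fP PA)
    also have "\<dots> \<le> opnorm (X 0) * norm (\<pi> (P ?f []) \<cdot> \<Omega>)"
      by (rule opnorm)
    also have "norm (\<pi> (P ?f []) \<cdot> \<Omega>) = norm (\<pi> s \<cdot> \<Omega>)"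
      unfolding xs(2) by (rule norm_P [OF f])
    finally show ?thesis .
  qed
  have "closed {\<xi>. norm (X n \<cdot> \<xi>) \<le> opnorm (X 0) * norm \<xi>}"
    by (intro closed_Collect_le continuous_intros bounded_linear.continuous_on [OF bounded_linear_bop])
  then have "closure ((\<lambda>b. \<pi> b \<cdot> \<Omega>) ` alg UNIV) \<subseteq> {\<xi>. norm (X n \<cdot> \<xi>) \<le> opnorm (X 0) * norm \<xi>}"
    by (intro closure_minimal) (use dense in auto)
  then show ?thesis
    using alg_cyclic by blast
qed

abbreviation C\<^sub>0 :: real where "C\<^sub>0 \<equiv> opnorm (X 0)"

lemma X_power_bound: "norm (X n ^ m \<cdot> \<xi>) \<le> C\<^sub>0 ^ m * norm \<xi>"
  by (rule norm_bop_power_le [OF X_bound]) simp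

text \<open>Linearity in \<open>a\<close> and \<open>b\<close> reduces this to
  \<open>phi_spread\<close> for words \<open>rev v @ z @ u\<close>, in which \<open>g\<close> fixes
  the letters of \<open>u\<close> and \<open>v\<close>.\<close>

lemma word_span_spread:
  assumes a: "a \<in> word_span x I" and b: "b \<in> word_span x I"
    and g: "strict_mono_on (I \<union> set z) g" "\<And>i. i \<in> I \<Longrightarrow> g i = i"
  shows "cinner (\<pi> (W (map g z)) \<cdot> \<pi> a \<cdot> \<Omega>) (\<pi> b \<cdot> \<Omega>) = cinner (\<pi> (W z) \<cdot> \<pi> a \<cdot> \<Omega>) (\<pi> b \<cdot> \<Omega>)"
  using a
proof induction
  case zero
  then show ?case
    by simp
next
  case (add s u c)
  have "cinner (\<pi> (W (map g z)) \<cdot> \<pi> (W u) \<cdot> \<Omega>) (\<pi> b \<cdot> \<Omega>) = cinner (\<pi> (W z) \<cdot> \<pi> (W u) \<cdot> \<Omega>) (\<pi> b \<cdot> \<Omega>)"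
    using b
  proof induction
    case zero
    then show ?case
      by simp
  next
    case (add s' v d)
    have eq: "cinner (\<pi> (W y) \<cdot> \<pi> (W u) \<cdot> \<Omega>) (\<pi> (W v) \<cdot> \<Omega>) = \<phi> (W (rev v @ y @ u))" for y
      using cinner_words [of "y @ u" v] by simp
    have "map g (rev v @ z @ u) = rev v @ map g z @ u"
      using g(2) \<open>set u \<subseteq> I\<close> \<open>set v \<subseteq> I\<close> by (auto simp: subset_iff intro!: map_idI)
    moreover have "strict_mono_on (set (rev v @ z @ u)) g"
      by (rule monotone_on_subset [OF g(1)]) (use \<open>set u \<subseteq> I\<close> \<open>set v \<subseteq> I\<close> in auto)
    ultimately have "\<phi> (W (rev v @ map g z @ u)) = \<phi> (W (rev v @ z @ u))"
      using phi_spread by metis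
    then have "cinner (\<pi> (W (map g z)) \<cdot> \<pi> (W u) \<cdot> \<Omega>) (\<pi> (W v) \<cdot> \<Omega>) = cinner (\<pi> (W z) \<cdot> \<pi> (W u) \<cdot> \<Omega>) (\<pi> (W v) \<cdot> \<Omega>)"
      unfolding eq .
    moreover have "\<pi> (s' + d *\<^sub>C W v) \<cdot> \<Omega> = \<pi> s' \<cdot> \<Omega> + d *\<^sub>C \<pi> (W v) \<cdot> \<Omega>"
      using word_span_in_A [OF add.hyps(1)] by (simp only: pi_add A_scale W_in_A pi_scale bop_simps)
    ultimately show ?case
      using add.IH by (simp only: cinner_add_right cinner_scaleC_right)
  qed
  moreover have "\<pi> (s + c *\<^sub>C W u) \<cdot> \<Omega> = \<pi> s \<cdot> \<Omega> + c *\<^sub>C \<pi> (W u) \<cdot> \<Omega>"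
    using word_span_in_A [OF add.hyps(1)] by (simp only: pi_add A_scale W_in_A pi_scale bop_simps)
  ultimately show ?case
    using add.IH by (simp only: bop_add bop_scaleC cinner_add_left cinner_scaleC_left)
qed

lemma W_replicate: "W (replicate k i) = x i ^ k"
  by simp

lemma X_power_const:
  assumes "a \<in> word_span x {..<N}" "b \<in> word_span x {..<N}" "N \<le> n" "N \<le> n'"
  shows "cinner (X n ^ k \<cdot> \<pi> a \<cdot> \<Omega>) (\<pi> b \<cdot> \<Omega>) = cinner (X n' ^ k \<cdot> \<pi> a \<cdot> \<Omega>) (\<pi> b \<cdot> \<Omega>)"
proof -
  let ?g = "\<lambda>i. if i < N then i else n'"
  have "strict_mono_on ({..<N} \<union> set (replicate k n)) ?g"
    using assms(3,4) by (auto simp: strict_mono_on_def)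
  from word_span_spread [OF assms(1,2) this] show ?thesis
    using assms(3) by (simp add: W_replicate map_replicate del: map_append)
qed

lemma X_power_const2:
  assumes "a \<in> word_span x {..<N}" "b \<in> word_span x {..<N}" "N \<le> i'" "i' < i" "N \<le> j'" "j' < j"
  shows "cinner (X i ^ k \<cdot> \<pi> a \<cdot> \<Omega>) (X i' ^ k \<cdot> \<pi> b \<cdot> \<Omega>) = cinner (X j ^ k \<cdot> \<pi> a \<cdot> \<Omega>) (X j' ^ k \<cdot> \<pi> b \<cdot> \<Omega>)"
proof -
  let ?g = "\<lambda>t. if t < N then t else if t = i' then j' else j"
  have "strict_mono_on ({..<N} \<union> set (replicate k i' @ replicate k i)) ?g"
    using assms(3-6) by (auto simp: strict_mono_on_def)
  from word_span_spread [OF assms(1,2) this]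
  have "cinner ((X j' ^ k * X j ^ k) \<cdot> \<pi> a \<cdot> \<Omega>) (\<pi> b \<cdot> \<Omega>) = cinner ((X i' ^ k * X i ^ k) \<cdot> \<pi> a \<cdot> \<Omega>) (\<pi> b \<cdot> \<Omega>)"
    using assms(3,4) by (simp add: W_replicate map_replicate)
  moreover have "adj (X t ^ k) = X t ^ k" for t
    by (simp flip: pi_adj)
  ultimately show ?thesis
    by (metis selfadj_cinner times_bop.rep_eq)
qed

text \<open>By \<open>X_bound\<close> and \<open>norm_le_of_pi\<close> the powers are bounded on the
  original space, so they cluster at some \<open>t\<close> in \<open>A\<close>. The coefficients are
  eventually constant by \<open>X_power_const\<close>, which makes the cluster point a genuine
  limit.\<close>

lemma ex_limit_power:
  "\<exists>t\<in>A. \<forall>N. \<forall>a\<in>word_span x {..<N}. \<forall>b\<in>word_span x {..<N}. \<forall>n\<ge>N.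
     cinner (X n ^ k \<cdot> \<pi> a \<cdot> \<Omega>) (\<pi> b \<cdot> \<Omega>) = cinner (\<pi> t \<cdot> \<pi> a \<cdot> \<Omega>) (\<pi> b \<cdot> \<Omega>)"
proof -
  have bound: "norm (x n ^ k \<cdot> v) \<le> (C\<^sub>0 + 1) ^ k * norm v" for n v
    by (rule norm_bop_power_le) (auto intro: norm_le_of_pi X_bound)
  obtain G t where G: "G \<le> sequentially" "G \<noteq> bot" "t \<in> A" and
    lim: "\<And>c d. c \<in> A \<Longrightarrow> d \<in> A \<Longrightarrow> ((\<lambda>n. cinner (\<pi> (x (int n) ^ k) \<cdot> \<pi> c \<cdot> \<Omega>) (\<pi> d \<cdot> \<Omega>)) \<longlongrightarrow>
      cinner (\<pi> t \<cdot> \<pi> c \<cdot> \<Omega>) (\<pi> d \<cdot> \<Omega>)) G"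
    by (rule cluster [of "\<lambda>n. x (int n) ^ k" "(C\<^sub>0 + 1) ^ k"]) (use bound in auto)
  have "cinner (X n ^ k \<cdot> \<pi> a \<cdot> \<Omega>) (\<pi> b \<cdot> \<Omega>) = cinner (\<pi> t \<cdot> \<pi> a \<cdot> \<Omega>) (\<pi> b \<cdot> \<Omega>)"
    if ab: "a \<in> word_span x {..<N}" "b \<in> word_span x {..<N}" and "N \<le> n" for N a b n
  proof (rule tendsto_unique [OF G(2) _ lim])
    have "eventually (\<lambda>m. cinner (X n ^ k \<cdot> \<pi> a \<cdot> \<Omega>) (\<pi> b \<cdot> \<Omega>) = cinner (\<pi> (x (int m) ^ k) \<cdot> \<pi> a \<cdot> \<Omega>) (\<pi> b \<cdot> \<Omega>)) sequentially"
      using eventually_ge_at_top [of "nat N"]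
    proof (rule eventually_mono)
      fix m assume "nat N \<le> m"
      then have "N \<le> int m"
        by simp
      from X_power_const [OF ab \<open>N \<le> n\<close> this, of k]
      show "cinner (X n ^ k \<cdot> \<pi> a \<cdot> \<Omega>) (\<pi> b \<cdot> \<Omega>) = cinner (\<pi> (x (int m) ^ k) \<cdot> \<pi> a \<cdot> \<Omega>) (\<pi> b \<cdot> \<Omega>)"
        by simp
    qed
    then have "(\<lambda>m. cinner (\<pi> (x (int m) ^ k) \<cdot> \<pi> a \<cdot> \<Omega>) (\<pi> b \<cdot> \<Omega>)) \<longlonglongrightarrow> cinner (X n ^ k \<cdot> \<pi> a \<cdot> \<Omega>) (\<pi> b \<cdot> \<Omega>)"
      by (rule Lim_transform_eventually [OF tendsto_const])
    then show "((\<lambda>m. cinner (\<pi> (x (int m) ^ k) \<cdot> \<pi> a \<cdot> \<Omega>) (\<pi> b \<cdot> \<Omega>)) \<longlongrightarrow> cinner (X n ^ k \<cdot> \<pi> a \<cdot> \<Omega>) (\<pi> b \<cdot> \<Omega>)) G"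
      by (rule tendsto_mono [OF G(1)])
  qed (use ab word_span_in_A in auto)
  then show ?thesis
    using G(3) by blast
qed

definition t :: "nat \<Rightarrow> 'h bop" where
  "t k = (SOME t. t \<in> A \<and> (\<forall>N. \<forall>a\<in>word_span x {..<N}. \<forall>b\<in>word_span x {..<N}. \<forall>n\<ge>N.
     cinner (X n ^ k \<cdot> \<pi> a \<cdot> \<Omega>) (\<pi> b \<cdot> \<Omega>) = cinner (\<pi> t \<cdot> \<pi> a \<cdot> \<Omega>) (\<pi> b \<cdot> \<Omega>)))"

abbreviation T :: "nat \<Rightarrow> 'k bop" where "T k \<equiv> \<pi> (t k)"

lemma t_spec: "t k \<in> A \<and> (\<forall>N. \<forall>a\<in>word_span x {..<N}. \<forall>b\<in>word_span x {..<N}. \<forall>n\<ge>N.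
     cinner (X n ^ k \<cdot> \<pi> a \<cdot> \<Omega>) (\<pi> b \<cdot> \<Omega>) = cinner (T k \<cdot> \<pi> a \<cdot> \<Omega>) (\<pi> b \<cdot> \<Omega>))"
  unfolding t_def by (rule someI_ex) (use ex_limit_power [of k] in \<open>simp only: Bex_def\<close>)

lemma t_in_A [simp]: "t k \<in> A"
  using t_spec by (rule conjunct1)

lemma X_power_eq_T:
  assumes "a \<in> word_span x {..<N}" "b \<in> word_span x {..<N}" "N \<le> n"
  shows "cinner (X n ^ k \<cdot> \<pi> a \<cdot> \<Omega>) (\<pi> b \<cdot> \<Omega>) = cinner (T k \<cdot> \<pi> a \<cdot> \<Omega>) (\<pi> b \<cdot> \<Omega>)"
  using t_spec [THEN conjunct2] assms by blast

lemma alg_support: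
  assumes "s \<in> alg I"
  obtains N where "s \<in> word_span x (I \<inter> {..<N})"
  using assms alg_subset_word_span word_span_support by blast

lemma X_power_tendsto_T:
  assumes p: "filterlim p at_top F"
  shows "((\<lambda>i. cinner (X (p i) ^ k \<cdot> \<xi>) \<eta>) \<longlongrightarrow> cinner (T k \<cdot> \<xi>) \<eta>) F"
proof (rule weak_dense_tendsto [OF alg_cyclic X_power_bound])
  fix v w assume "v \<in> (\<lambda>b. \<pi> b \<cdot> \<Omega>) ` alg UNIV" "w \<in> (\<lambda>b. \<pi> b \<cdot> \<Omega>) ` alg UNIV"
  then obtain a b where v: "v = \<pi> a \<cdot> \<Omega>" "a \<in> alg UNIV" and w: "w = \<pi> b \<cdot> \<Omega>" "b \<in> alg UNIV"
    by blast
  obtain N M where "a \<in> word_span x (UNIV \<inter> {..<N})" "b \<in> word_span x (UNIV \<inter> {..<M})"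
    using alg_support [OF v(2)] alg_support [OF w(2)] by metis
  then have ab: "a \<in> word_span x {..<max N M}" "b \<in> word_span x {..<max N M}"
    by (auto elim: word_span_mono)
  have "eventually (\<lambda>i. max N M \<le> p i) F"
    using p by (simp only: filterlim_at_top)
  then have "eventually (\<lambda>i. cinner (T k \<cdot> v) w = cinner (X (p i) ^ k \<cdot> v) w) F"
    by (rule eventually_mono) (simp only: v w X_power_eq_T [OF ab])
  then show "((\<lambda>i. cinner (X (p i) ^ k \<cdot> v) w) \<longlongrightarrow> cinner (T k \<cdot> v) w) F"
    by (rule Lim_transform_eventually [OF tendsto_const])
qed

lemma X_adj: "adj (X i ^ k) = X i ^ k"
  by (simp flip: pi_adj)

lemma int_at_top: "filterlim (\<lambda>n. N + int n) at_top sequentially"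
  unfolding filterlim_at_top
proof
  fix Z
  show "eventually (\<lambda>n. Z \<le> N + int n) sequentially"
    using eventually_ge_at_top [of "nat (Z - N)"] by (rule eventually_mono) linarith
qed

lemma T_adj [simp]: "adj (T k) = T k"
proof (rule adj_eqI)
  fix v w
  have "(\<lambda>n. cinner (X (0 + int n) ^ k \<cdot> v) w) \<longlonglongrightarrow> cinner (T k \<cdot> v) w"
    by (rule X_power_tendsto_T [OF int_at_top])
  moreover have "cinner (X n ^ k \<cdot> v) w = cnj (cinner (X n ^ k \<cdot> w) v)" for n
    using selfadj_cinner [OF X_adj] cinner_commute by metis
  moreover have "(\<lambda>n. cnj (cinner (X (0 + int n) ^ k \<cdot> w) v)) \<longlonglongrightarrow> cnj (cinner (T k \<cdot> w) v)"
    by (intro tendsto_cnj X_power_tendsto_T [OF int_at_top])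
  ultimately have "cinner (T k \<cdot> v) w = cnj (cinner (T k \<cdot> w) v)"
    using LIMSEQ_unique by simp
  then show "cinner (T k \<cdot> v) w = cinner v (T k \<cdot> w)"
    using cinner_commute by metis
qed

subsection \<open>Strong convergence of averages\<close>

text \<open>By spreadability the inner product of \<open>X i ^ k\<close> and \<open>X j ^ k\<close>
  at \<open>\<xi>\<close> is the same for all distinct \<open>i\<close> and \<open>j\<close> beyond
  \<open>N\<close>, up to conjugation. Sending the larger index to infinity, and the smaller one
  afterwards, identifies it as \<open>?c\<close>.\<close>

lemma X_power_T_orthogonal:
  assumes a: "a \<in> word_span x {..<N}" and ij: "N \<le> i" "N \<le> j" "i \<noteq> j"
  defines "\<xi> \<equiv> \<pi> a \<cdot> \<Omega>"
  shows "cinner (X i ^ k \<cdot> \<xi> - T k \<cdot> \<xi>) (X j ^ k \<cdot> \<xi> - T k \<cdot> \<xi>) = 0"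
proof -
  let ?c = "cinner (T k \<cdot> \<xi>) (T k \<cdot> \<xi>)"
  have c: "cnj ?c = ?c"
    by (metis cinner_commute)
  have aA: "a \<in> A"
    by (rule word_span_in_A [OF a])
  \<comment> \<open>The power \<open>X j ^ k\<close> is absorbed into the test vector, beyond whose
    indices \<open>i\<close> lies.\<close>
  have XX: "cinner (X i ^ k \<cdot> \<xi>) (X j ^ k \<cdot> \<xi>) = cinner (T k \<cdot> \<xi>) (X j ^ k \<cdot> \<xi>)" if "N \<le> j" "j < i" for i j
  proof -
    have "x j ^ k * a \<in> word_span x {..<j + 1}"
    proof (cases "k = 0")
      case False
      then show ?thesis
        using word_span_mult [OF word_span_word, of "replicate k j" "{..<j + 1}" a x]
          word_span_mono [OF a, of "{..<j + 1}"] that by (auto simp: W_replicate)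
    qed (use word_span_mono [OF a, of "{..<j + 1}"] that in auto)
    moreover have "a \<in> word_span x {..<j + 1}"
      by (rule word_span_mono [OF a]) (use that in auto)
    ultimately show ?thesis
      using X_power_eq_T [of a "j + 1" "x j ^ k * a" i k] that aA by (simp add: \<xi>_def)
  qed
  have XT: "cinner (T k \<cdot> \<xi>) (X j ^ k \<cdot> \<xi>) = ?c" if j: "N \<le> j" for j
  proof -
    have "cinner (T k \<cdot> \<xi>) (X j ^ k \<cdot> \<xi>) = cinner (T k \<cdot> \<xi>) (X j' ^ k \<cdot> \<xi>)" if "N \<le> j'" for j'
      using XX [of j "j + 1"] XX [of j' "j' + 1"] X_power_const2 [OF a a j _ that, of "j + 1" "j' + 1" k] j that
      by (simp add: \<xi>_def)
    then have "cinner (X (N + int n) ^ k \<cdot> \<xi>) (T k \<cdot> \<xi>) = cinner (X j ^ k \<cdot> \<xi>) (T k \<cdot> \<xi>)" for n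
      using cinner_commute by (metis le_add_same_cancel1 of_nat_0_le_iff)
    then have "cinner (X j ^ k \<cdot> \<xi>) (T k \<cdot> \<xi>) = ?c"
      using X_power_tendsto_T [OF int_at_top [of N], of k \<xi> "T k \<cdot> \<xi>"] by (simp add: LIMSEQ_const_iff)
    then show ?thesis
      by (metis cinner_commute)
  qed
  have TX: "cinner (X j ^ k \<cdot> \<xi>) (T k \<cdot> \<xi>) = ?c" if "N \<le> j" for j
    using XT [OF that] c by (metis cinner_commute)
  have "cinner (X i ^ k \<cdot> \<xi>) (X j ^ k \<cdot> \<xi>) = ?c"
  proof (cases "j < i")
    case True
    then show ?thesis
      using XX XT ij by simp
  next
    case False
    then have "cinner (X j ^ k \<cdot> \<xi>) (X i ^ k \<cdot> \<xi>) = ?c"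
      using XX XT ij by simp
    then show ?thesis
      using c by (metis cinner_commute)
  qed
  then show ?thesis
    using TX XT ij by (simp add: cinner_diff_left cinner_diff_right)
qed

lemma average_bound:
  "norm ((complex_of_real (1 / real l) *\<^sub>C (\<Sum>s<l. X (J s) ^ k)) \<cdot> \<xi>) \<le> C\<^sub>0 ^ k * norm \<xi>"
proof (cases "l = 0")
  case False
  have "norm ((\<Sum>s<l. X (J s) ^ k) \<cdot> \<xi>) \<le> (\<Sum>s<l. C\<^sub>0 ^ k * norm \<xi>)"
    unfolding sum_bop by (intro order_trans [OF norm_sum] sum_mono X_power_bound)
  also have "\<dots> = real l * (C\<^sub>0 ^ k * norm \<xi>)"
    by simp
  finally show ?thesis
    using False by (simp add: norm_scaleC norm_divide divide_le_eq mult_ac)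
qed simp

text \<open>A law of large numbers in Hilbert space: deviations at distinct indices are orthogonal,
  so the squared norm of their mean is at most \<open>D\<^sup>2 / real l\<close>. The indices must
  escape to infinity with \<open>l\<close>, as only those beyond the support of \<open>a\<close> are
  controlled.\<close>

lemma average_tendsto:
  fixes J :: "nat \<Rightarrow> nat \<Rightarrow> int"
  assumes inj: "\<And>l. inj_on (J l) {..<l}" and large: "\<And>l s. M l \<le> J l s" "filterlim M at_top sequentially"
  shows "(\<lambda>l. (complex_of_real (1 / real l) *\<^sub>C (\<Sum>s<l. X (J l s) ^ k)) \<cdot> \<xi>) \<longlonglongrightarrow> T k \<cdot> \<xi>"
proof (rule strong_dense_tendsto [OF alg_cyclic average_bound])
  fix v assume "v \<in> (\<lambda>b. \<pi> b \<cdot> \<Omega>) ` alg UNIV"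
  then obtain a where v: "v = \<pi> a \<cdot> \<Omega>" "a \<in> alg UNIV"
    by blast
  obtain N where "a \<in> word_span x (UNIV \<inter> {..<N})"
    by (rule alg_support [OF v(2)])
  then have a: "a \<in> word_span x {..<N}"
    by simp
  define D where "D = (C\<^sub>0 ^ k + opnorm (T k)) * norm v"
  let ?AV = "\<lambda>l. (complex_of_real (1 / real l) *\<^sub>C (\<Sum>s<l. X (J l s) ^ k)) \<cdot> v"
  have D: "norm (X i ^ k \<cdot> v - T k \<cdot> v) \<le> D" for i
    using norm_triangle_ineq4 [of "X i ^ k \<cdot> v" "T k \<cdot> v"] X_power_bound [of i k v] opnorm [of "T k" v]
    by (simp add: D_def distrib_right)
  have bound: "(norm (?AV l - T k \<cdot> v))\<^sup>2 \<le> D\<^sup>2 / real l" if "N \<le> M l" "l > 0" for l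
  proof -
    let ?d = "\<lambda>s. X (J l s) ^ k \<cdot> v - T k \<cdot> v"
    have "pairwise (\<lambda>i j. orthogonal (?d i) (?d j)) {..<l}"
    proof (clarsimp simp: pairwise_def)
      fix i j assume "i < l" "j < l" "i \<noteq> j"
      then have "J l i \<noteq> J l j"
        using inj [of l] by (auto simp: inj_on_def)
      moreover have "N \<le> J l i" "N \<le> J l j"
        using large(1) [of l] that(1) order_trans by blast+
      ultimately have "cinner (?d i) (?d j) = 0"
        using X_power_T_orthogonal [OF a, of "J l i" "J l j" k] by (simp add: v)
      then show "orthogonal (?d i) (?d j)"
        by (simp add: orthogonal_def flip: Re_cinner)
    qed
    then have "(norm (\<Sum>s<l. ?d s))\<^sup>2 = (\<Sum>s<l. (norm (?d s))\<^sup>2)"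
      by (rule norm_sum_Pythagorean [OF finite_lessThan])
    also have "\<dots> \<le> (\<Sum>s<l. D\<^sup>2)"
      by (intro sum_mono power_mono D) auto
    finally have le: "(norm (\<Sum>s<l. ?d s))\<^sup>2 \<le> real l * D\<^sup>2"
      by simp
    have eq: "T k \<cdot> v = complex_of_real (1 / real l) *\<^sub>C (\<Sum>s<l. T k \<cdot> v)"
    proof -
      have "(\<Sum>s<l. T k \<cdot> v) = complex_of_real (real l) *\<^sub>C T k \<cdot> v"
        using scaleC_sum_left [of "\<lambda>_. 1" "{..<l}" "T k \<cdot> v"] by (simp add: scaleC_one)
      then show ?thesis
        using that(2) by (simp add: scaleC_scaleC scaleC_one)
    qed
    have "?AV l - T k \<cdot> v = complex_of_real (1 / real l) *\<^sub>C (\<Sum>s<l. ?d s)"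
      by (subst eq) (simp add: sum_bop scaleC_diff_right sum_subtractf)
    then have "(norm (?AV l - T k \<cdot> v))\<^sup>2 = (norm (\<Sum>s<l. ?d s))\<^sup>2 / (real l)\<^sup>2"
      by (simp add: norm_scaleC norm_divide power_divide)
    also have "\<dots> \<le> real l * D\<^sup>2 / (real l)\<^sup>2"
      by (intro divide_right_mono le) simp
    also have "\<dots> = D\<^sup>2 / real l"
      using that(2) by (simp add: power2_eq_square)
    finally show ?thesis .
  qed
  have "eventually (\<lambda>l. N \<le> M l) sequentially"
    using large(2) by (simp add: filterlim_at_top)
  then have "eventually (\<lambda>l. norm ((norm (?AV l - T k \<cdot> v))\<^sup>2) \<le> D\<^sup>2 / real l) sequentially"
    using eventually_gt_at_top [of 0] by eventually_elim (use bound in simp)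
  moreover have "(\<lambda>l. D\<^sup>2 / real l) \<longlonglongrightarrow> 0"
    by (intro tendsto_divide_0 [OF tendsto_const] filterlim_at_top_imp_at_infinity filterlim_real_sequentially)
  ultimately have "(\<lambda>l. (norm (?AV l - T k \<cdot> v))\<^sup>2) \<longlonglongrightarrow> 0"
    by (rule Lim_null_comparison)
  then have "(\<lambda>l. sqrt ((norm (?AV l - T k \<cdot> v))\<^sup>2)) \<longlonglongrightarrow> sqrt 0"
    by (rule tendsto_real_sqrt)
  then have "(\<lambda>l. ?AV l - T k \<cdot> v) \<longlonglongrightarrow> 0"
    by (simp add: tendsto_norm_zero_iff)
  then show "?AV \<longlonglongrightarrow> T k \<cdot> v"
    by (rule LIM_zero_cancel)
qed

lemma pi_run_prod: "(\<And>i m. Y i m \<in> A) \<Longrightarrow> \<pi> (run_prod Y rs) = run_prod (\<lambda>i m. \<pi> (Y i m)) rs"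
  by (induction rs) (auto simp: run_prod_in_A)

abbreviation PT :: "nat list \<Rightarrow> 'k bop" where "PT ms \<equiv> prod_list (map T ms)"
abbreviation YX :: "(int \<times> nat) list \<Rightarrow> 'k bop" where "YX rs \<equiv> run_prod (\<lambda>i m. X i ^ m) rs"

text \<open>For every \<open>l\<close> the moment equals that of the block averages by
  \<open>run_average\<close>, and products of the averages converge strongly because the averages
  are uniformly bounded.\<close>

lemma moment:
  assumes rs: "runs rs"
  shows "cinner (YX rs \<cdot> \<Omega>) \<Omega> = cinner (PT (map snd rs) \<cdot> \<Omega>) \<Omega>"
proof -
  let ?h = "rank_in (fst ` set rs)"
  have "finite (fst ` set rs)"
    by simp
  then obtain K where K: "\<And>i. i \<in> fst ` set rs \<Longrightarrow> i < K"
    by (metis Max_ge zle_add1_eq_le)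
  \<comment> \<open>The rank keeps the blocks of different letters apart; the summand
    \<open>int l\<close> drives all indices to infinity, as \<open>average_tendsto\<close>
    requires.\<close>
  define J where "J l i s = K + int l + int ((?h i - 1) * l + s)" for l :: nat and i s
  have const: "\<phi> (run_prod (\<lambda>i m. x i ^ m) rs) = \<phi> (run_prod (\<lambda>i m. complex_of_real (1 / real l) *\<^sub>C (\<Sum>s<l. x (J l i s) ^ m)) rs)"
    if "l > 0" for l
    unfolding J_def
  proof (rule run_average [OF rs that])
    show "strict_mono (\<lambda>u. K + int l + int u)"
      by (simp add: strict_mono_def)
    show "i < K + int l + int 0" if "i \<in> fst ` set rs" for i
      using K [OF that] by simp
  qed
  let ?AV = "\<lambda>l i m. complex_of_real (1 / real l) *\<^sub>C (\<Sum>s<l. X (J l i s) ^ m)"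
  have AVA: "complex_of_real (1 / real l) *\<^sub>C (\<Sum>s<l. x (J l i s) ^ m) \<in> A" for l i m
    by (intro A_scale A_sum A_power xA)
  have phi_AV: "\<phi> (run_prod (\<lambda>i m. complex_of_real (1 / real l) *\<^sub>C (\<Sum>s<l. x (J l i s) ^ m)) rs) =
      cinner (run_prod (?AV l) rs \<cdot> \<Omega>) \<Omega>" for l
    by (subst phi_eq, rule run_prod_in_A, rule AVA, subst pi_run_prod, rule AVA) (simp add: pi_sum)
  have phi_x: "\<phi> (run_prod (\<lambda>i m. x i ^ m) rs) = cinner (YX rs \<cdot> \<Omega>) \<Omega>"
    by (simp add: phi_eq pi_run_prod run_prod_in_A)
  have "(\<lambda>l. run_prod (?AV l) rs \<cdot> \<xi>) \<longlonglongrightarrow> PT (map snd rs) \<cdot> \<xi>" for \<xi> and rs :: "(int \<times> nat) list"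
  proof (induction rs)
    case (Cons p rs)
    obtain i m where p: "p = (i, m)"
      by (cases p)
    have "(\<lambda>l. ?AV l i m \<cdot> run_prod (?AV l) rs \<cdot> \<xi>) \<longlonglongrightarrow> T m \<cdot> PT (map snd rs) \<cdot> \<xi>"
    proof (rule strong_mult_tendsto [OF average_bound _ average_tendsto Cons])
      show "inj_on (J l i) {..<l}" for l
        by (auto simp: inj_on_def J_def)
      show "K + int l \<le> J l i s" for l s
        by (simp add: J_def)
    qed (simp_all add: int_at_top)
    then show ?case
      by (simp add: p)
  qed simp
  then have lim: "(\<lambda>l. cinner (run_prod (?AV l) rs \<cdot> \<Omega>) \<Omega>) \<longlonglongrightarrow> cinner (PT (map snd rs) \<cdot> \<Omega>) \<Omega>"
    by (intro tendsto_cinner tendsto_const)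
  have "eventually (\<lambda>l. cinner (YX rs \<cdot> \<Omega>) \<Omega> = cinner (run_prod (?AV l) rs \<cdot> \<Omega>) \<Omega>) sequentially"
    using eventually_gt_at_top [of 0] by (rule eventually_mono) (simp only: const phi_AV flip: phi_x)
  then have "(\<lambda>l. cinner (run_prod (?AV l) rs \<cdot> \<Omega>) \<Omega>) \<longlonglongrightarrow> cinner (YX rs \<cdot> \<Omega>) \<Omega>"
    by (rule Lim_transform_eventually [OF tendsto_const])
  then show ?thesis
    using lim LIMSEQ_unique by blast
qed

end

text \<open>A pair \<open>(None, m)\<close> stands for the limit \<open>T m\<close> of the powers \<open>X\<^sub>i\<^sup>m\<close>; equal neighbours are allowed for limits.\<close>

definition mixed_runs :: "('i option \<times> nat) list \<Rightarrow> bool" where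
  "mixed_runs rs \<longleftrightarrow> successively (\<lambda>p q. fst p = None \<or> fst p \<noteq> fst q) rs \<and> (\<forall>p\<in>set rs. 0 < snd p)"

definition letter_runs :: "('i \<times> nat) list \<Rightarrow> ('i option \<times> nat) list" where
  "letter_runs rs = map (\<lambda>(i, m). (Some i, m)) rs"

definition limit_runs :: "nat list \<Rightarrow> ('i option \<times> nat) list" where
  "limit_runs ms = map (\<lambda>m. (None, m)) ms"

lemma mixed_runs_append:
  "mixed_runs (u @ v) \<longleftrightarrow> mixed_runs u \<and> mixed_runs v \<and>
    (u = [] \<or> v = [] \<or> fst (last u) = None \<or> fst (last u) \<noteq> fst (hd v))"
  by (auto simp: mixed_runs_def successively_append_iff)

lemma mixed_runs_letter [simp]: "mixed_runs (letter_runs rs) \<longleftrightarrow> runs rs"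
proof -
  have "successively (\<lambda>p q. fst p = None \<or> fst p \<noteq> fst q) (letter_runs rs) \<longleftrightarrow> distinct_adj (map fst rs)"
    by (simp add: letter_runs_def successively_map distinct_adj_def case_prod_beta)
  then show ?thesis
    by (auto simp: mixed_runs_def runs_def letter_runs_def)
qed

lemma mixed_runs_limit [simp]: "mixed_runs (limit_runs ms) \<longleftrightarrow> (\<forall>m\<in>set ms. 0 < m)"
proof -
  have "successively (\<lambda>p q. fst p = None \<or> fst p \<noteq> fst q) (limit_runs ms :: ('i option \<times> nat) list)"
    by (induction ms rule: induct_list012) (auto simp: limit_runs_def)
  then show ?thesis
    by (auto simp: mixed_runs_def limit_runs_def)
qed

lemma runs_rev: "runs rs \<Longrightarrow> runs (rev rs)"
  by (auto simp: runs_def rev_map [symmetric])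

lemma runs_pos: "runs rs \<Longrightarrow> \<forall>m\<in>set (map snd rs). 0 < m"
  by (auto simp: runs_def)

lemma last_limit_runs: "ms \<noteq> [] \<Longrightarrow> fst (last (limit_runs ms)) = None"
  and hd_limit_runs: "ms \<noteq> [] \<Longrightarrow> fst (hd (limit_runs ms)) = None"
  and last_letter_runs: "rs \<noteq> [] \<Longrightarrow> fst (last (letter_runs rs)) = Some (fst (last rs))"
  and hd_letter_runs: "rs \<noteq> [] \<Longrightarrow> fst (hd (letter_runs rs)) = Some (fst (hd rs))"
  by (simp_all add: limit_runs_def letter_runs_def last_map hd_map case_prod_beta)

lemma letter_runs_Nil [simp]: "letter_runs rs = [] \<longleftrightarrow> rs = []" "limit_runs ms = [] \<longleftrightarrow> ms = []"
  by (simp_all add: limit_runs_def letter_runs_def)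

lemma map_snd_runs [simp]: "map snd (letter_runs rs) = map snd rs" "map snd (limit_runs ms) = ms"
  by (auto simp: letter_runs_def limit_runs_def o_def case_prod_beta)

lemma csubspace_hull: "csubspace (csubspace hull S)"
  by (auto simp: hull_def csubspace_def)

lemma csubspace_cinner_eq: "csubspace {\<eta>. cinner a \<eta> = cinner b \<eta>}"
  "csubspace {\<xi>. cinner (A \<cdot> \<xi>) \<eta> = cinner (B \<cdot> \<xi>) \<eta>}"
  by (auto simp: csubspace_def cinner_add_right cinner_scaleC_right bop_add bop_scaleC cinner_add_left cinner_scaleC_left)

lemma closed_cinner_eq: "closed {\<eta>. cinner a \<eta> = cinner b \<eta>}"
  "closed {\<xi>. cinner (A \<cdot> \<xi>) \<eta> = cinner (B \<cdot> \<xi>) \<eta>}"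
proof -
  note right = bounded_linear.continuous_on [OF bounded_bilinear.bounded_linear_right [OF bounded_bilinear_cinner]]
    and left = bounded_linear.continuous_on [OF bounded_bilinear.bounded_linear_left [OF bounded_bilinear_cinner]]
  show "closed {\<eta>. cinner a \<eta> = cinner b \<eta>}"
    by (intro closed_Collect_eq right continuous_on_id)
  show "closed {\<xi>. cinner (A \<cdot> \<xi>) \<eta> = cinner (B \<cdot> \<xi>) \<eta>}"
    by (intro closed_Collect_eq left bounded_linear.continuous_on [OF bounded_linear_bop] continuous_on_id)
qed

lemma cinner_eq_on_closed_span:
  assumes eq: "\<And>v w. v \<in> S \<Longrightarrow> w \<in> S \<Longrightarrow> cinner (A \<cdot> v) w = cinner (B \<cdot> v) w"
    and \<xi>: "\<xi> \<in> closure (csubspace hull S)" and \<eta>: "\<eta> \<in> closure (csubspace hull S)"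
  shows "cinner (A \<cdot> \<xi>) \<eta> = cinner (B \<cdot> \<xi>) \<eta>"
proof -
  have 1: "cinner (A \<cdot> v) \<eta> = cinner (B \<cdot> v) \<eta>" if "v \<in> S" for v
  proof -
    have "closure (csubspace hull S) \<subseteq> {\<eta>. cinner (A \<cdot> v) \<eta> = cinner (B \<cdot> v) \<eta>}"
      by (intro closure_minimal hull_minimal csubspace_cinner_eq closed_cinner_eq) (use eq that in auto)
    then show ?thesis
      using \<eta> by blast
  qed
  have "closure (csubspace hull S) \<subseteq> {\<xi>. cinner (A \<cdot> \<xi>) \<eta> = cinner (B \<cdot> \<xi>) \<eta>}"
    by (intro closure_minimal hull_minimal csubspace_cinner_eq closed_cinner_eq) (use 1 in auto)
  then show ?thesis
    using \<xi> by blast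
qed

context spreadable_sequence
begin

abbreviation YM :: "(int option \<times> nat) list \<Rightarrow> 'k bop" where
  "YM rs \<equiv> run_prod (\<lambda>i m. case i of None \<Rightarrow> T m | Some i \<Rightarrow> X i ^ m) rs"

lemma YM_letter [simp]: "YM (letter_runs rs) = YX rs"
  unfolding letter_runs_def by (induction rs) auto

lemma YM_limit [simp]: "YM (limit_runs ms) = PT ms"
  unfolding limit_runs_def by (induction ms) auto

text \<open>Induction on the number of limits: one \<open>T m\<close> is replaced by the power
  \<open>X i ^ m\<close> at a fresh index, whose moment is constant by the induction hypothesis, and
  \<open>i\<close> is sent to infinity. A fresh power cannot merge with its neighbours, so the list
  remains admissible.\<close>

lemma mixed_moment:
  assumes "mixed_runs rs"
  shows "cinner (YM rs \<cdot> \<Omega>) \<Omega> = cinner (PT (map snd rs) \<cdot> \<Omega>) \<Omega>"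
  using assms
proof (induction "length (filter (\<lambda>p. fst p = None) rs)" arbitrary: rs)
  case 0
  define rs' where "rs' = map (\<lambda>(i, m). (the i, m)) rs"
  have "\<forall>p\<in>set rs. fst p \<noteq> None"
    using 0(1) by (auto simp: filter_empty_conv)
  then have "map ((\<lambda>(i, m). (Some i, m)) \<circ> (\<lambda>(i, m). (the i, m))) rs = map id rs"
    by (intro map_cong) auto
  then have rs: "rs = letter_runs rs'"
    by (simp add: rs'_def letter_runs_def)
  then show ?case
    using moment [of rs'] 0(2) by simp
next
  case (Suc n)
  have "\<exists>p\<in>set rs. fst p = None"
  proof (rule ccontr)
    assume "\<not> ?thesis"
    then have "filter (\<lambda>p. fst p = None) rs = []"
      by (simp add: filter_empty_conv)
    then show False
      using Suc(2) by simp
  qed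
  then obtain p where "p \<in> set rs" "fst p = None"
    by blast
  then obtain u m v where rs: "rs = u @ (None, m) # v"
    by (metis prod.collapse split_list)
  have "finite (the ` fst ` set rs)"
    by simp
  then obtain K where K: "\<And>i. i \<in> the ` fst ` set rs \<Longrightarrow> i < K"
    by (metis Max_ge zle_add1_eq_le)
  define r where "r k = u @ (Some (K + int k), m) # v" for k
  have fresh: "Some (K + int k) \<noteq> fst p" if "p \<in> set rs" for p k
  proof
    assume eq: "Some (K + int k) = fst p"
    have "the (fst p) < K"
      by (rule K) (use that in auto)
    then show False
      using eq [symmetric] by simp
  qed
  have mixed: "mixed_runs (r k)" for k
  proof -
    have "u \<noteq> [] \<Longrightarrow> fst (last u) \<noteq> Some (K + int k)" "v \<noteq> [] \<Longrightarrow> fst (hd v) \<noteq> Some (K + int k)"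
      using fresh [of "last u" k] fresh [of "hd v" k] by (auto simp: rs)
    then show ?thesis
      using Suc.prems mixed_runs_append [of u "(None, m) # v"] mixed_runs_append [of "[(None, m)]" v]
        mixed_runs_append [of u "(Some (K + int k), m) # v"] mixed_runs_append [of "[(Some (K + int k), m)]" v]
      by (auto simp: rs r_def mixed_runs_def)
  qed
  have len: "n = length (filter (\<lambda>p. fst p = None) (r k))" for k
    using Suc(2) by (simp add: rs r_def)
  have const: "cinner (YM (r k) \<cdot> \<Omega>) \<Omega> = cinner (PT (map snd rs) \<cdot> \<Omega>) \<Omega>" for k
    using Suc(1) [OF len mixed, of k] by (simp add: rs r_def)
  have "cinner (X (K + int k) ^ m \<cdot> YM v \<cdot> \<Omega>) (adj (YM u) \<cdot> \<Omega>) = cinner (YM (r k) \<cdot> \<Omega>) \<Omega>" for k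
    by (simp add: r_def cinner_adj_right)
  then have "(\<lambda>k. cinner (YM (r k) \<cdot> \<Omega>) \<Omega>) \<longlonglongrightarrow> cinner (T m \<cdot> YM v \<cdot> \<Omega>) (adj (YM u) \<cdot> \<Omega>)"
    using X_power_tendsto_T [OF int_at_top [of K], of m "YM v \<cdot> \<Omega>" "adj (YM u) \<cdot> \<Omega>"] by simp
  then have "cinner (PT (map snd rs) \<cdot> \<Omega>) \<Omega> = cinner (T m \<cdot> YM v \<cdot> \<Omega>) (adj (YM u) \<cdot> \<Omega>)"
    by (simp add: const LIMSEQ_const_iff)
  then show ?case
    by (simp add: rs cinner_adj_right)
qed

lemma adj_PT: "adj (PT ms) = PT (rev ms)"
  by (simp add: adj_prod_list rev_map o_def)

lemma adj_YX: "adj (YX rs) = YX (rev rs)"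
  by (induction rs) (auto simp: X_adj [of _ 1, simplified])

lemma cinner_YX_PT:
  assumes "runs u" "\<forall>m\<in>set ms. 0 < m" "\<forall>m\<in>set ms'. 0 < m"
  shows "cinner (YX u \<cdot> PT ms \<cdot> \<Omega>) (PT ms' \<cdot> \<Omega>) = cinner (PT (map snd u) \<cdot> PT ms \<cdot> \<Omega>) (PT ms' \<cdot> \<Omega>)"
proof -
  have "mixed_runs (limit_runs (rev ms') @ letter_runs u @ limit_runs ms)"
    using assms by (auto simp: mixed_runs_append last_limit_runs hd_limit_runs last_letter_runs hd_letter_runs)
  from mixed_moment [OF this] show ?thesis
    by (simp add: adj_PT [symmetric] cinner_adj_left)
qed

text \<open>A nonempty \<open>ms\<close> keeps \<open>u\<close> and the reverse of \<open>u'\<close>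
  apart; without it their adjacent runs could have the same index and merge.\<close>

lemma cinner_PT_YX:
  assumes "runs u" "runs u'" "\<forall>m\<in>set ms. 0 < m" "ms \<noteq> []"
  shows "cinner (PT ms \<cdot> YX u \<cdot> \<Omega>) (YX u' \<cdot> \<Omega>) = cinner (PT ms \<cdot> PT (map snd u) \<cdot> \<Omega>) (PT (map snd u') \<cdot> \<Omega>)"
proof -
  have "mixed_runs (letter_runs (rev u') @ limit_runs ms @ letter_runs u)"
    using assms runs_rev [OF assms(2)]
    by (auto simp: mixed_runs_append last_limit_runs hd_limit_runs last_letter_runs hd_letter_runs)
  from mixed_moment [OF this] have "cinner (YX (rev u') \<cdot> PT ms \<cdot> YX u \<cdot> \<Omega>) \<Omega> =
      cinner (PT (rev (map snd u')) \<cdot> PT ms \<cdot> PT (map snd u) \<cdot> \<Omega>) \<Omega>"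
    by (simp add: rev_map)
  then show ?thesis
    by (simp only: adj_PT [symmetric] adj_YX [symmetric] cinner_adj_left)
qed

lemma cinner_YX_YX:
  assumes "runs (rev u' @ v @ u)"
  shows "cinner (YX v \<cdot> YX u \<cdot> \<Omega>) (YX u' \<cdot> \<Omega>) = cinner (PT (map snd v) \<cdot> PT (map snd u) \<cdot> \<Omega>) (PT (map snd u') \<cdot> \<Omega>)"
proof -
  from moment [OF assms] have "cinner (YX (rev u') \<cdot> YX v \<cdot> YX u \<cdot> \<Omega>) \<Omega> =
      cinner (PT (rev (map snd u')) \<cdot> PT (map snd v) \<cdot> PT (map snd u) \<cdot> \<Omega>) \<Omega>"
    by (simp add: rev_map)
  then show ?thesis
    by (simp only: adj_PT [symmetric] adj_YX [symmetric] cinner_adj_left)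
qed

lemma ex_YX:
  assumes "w \<noteq> []"
  obtains u where "runs u" "u \<noteq> []" "\<pi> (W w) = YX u" "fst ` set u = set w"
proof -
  obtain u where u: "runs u" "run_word u = w" "fst ` set u = set w"
    using ex_runs [of w] by (elim exE conjE)
  have "\<pi> (W w) = YX u"
    unfolding u(2) [symmetric] prod_list_run_word by (simp add: pi_run_prod)
  moreover have "u \<noteq> []"
    using u(2) assms by auto
  ultimately show thesis
    using that u by blast
qed

lemma word_span_YX:
  assumes "b \<in> word_span x I"
    and "csubspace S" and "\<And>u. runs u \<Longrightarrow> u \<noteq> [] \<Longrightarrow> fst ` set u \<subseteq> I \<Longrightarrow> YX u \<cdot> \<xi> \<in> S"
  shows "\<pi> b \<cdot> \<xi> \<in> S"
  using assms(1)
proof induction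
  case zero
  then show ?case
    using assms(2) by (simp add: csubspace_def)
next
  case (add s w c)
  obtain u where "runs u" "u \<noteq> []" "\<pi> (W w) = YX u" "fst ` set u = set w"
    by (rule ex_YX [OF add.hyps(2)])
  then have "\<pi> (W w) \<cdot> \<xi> \<in> S"
    using assms(3) add.hyps(3) by simp
  moreover have "\<pi> (s + c *\<^sub>C W w) \<cdot> \<xi> = \<pi> s \<cdot> \<xi> + c *\<^sub>C \<pi> (W w) \<cdot> \<xi>"
    using word_span_in_A [OF add.hyps(1)] by (simp only: pi_add A_scale W_in_A pi_scale bop_simps)
  ultimately show ?case
    using assms(2) add.IH by (simp add: csubspace_def)
qed

lemma words_dense: "closure (csubspace hull {YX u \<cdot> \<Omega> | u. runs u \<and> u \<noteq> []}) = UNIV"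
proof -
  let ?S = "csubspace hull {YX u \<cdot> \<Omega> | u. runs u \<and> u \<noteq> []}"
  have "\<pi> b \<cdot> \<Omega> \<in> ?S" if "b \<in> alg UNIV" for b
  proof (rule word_span_YX [OF _ csubspace_hull])
    show "b \<in> word_span x UNIV"
      using that alg_subset_word_span by blast
    show "YX u \<cdot> \<Omega> \<in> ?S" if "runs u" "u \<noteq> []" for u
      by (rule subsetD [OF hull_subset]) (use that in blast)
  qed
  then have "closure ((\<lambda>b. \<pi> b \<cdot> \<Omega>) ` alg UNIV) \<subseteq> closure ?S"
    by (intro closure_mono) auto
  then show ?thesis
    using alg_cyclic by auto
qed

lemma bop_eq_words:
  assumes "\<And>u u'. runs u \<Longrightarrow> u \<noteq> [] \<Longrightarrow> runs u' \<Longrightarrow> u' \<noteq> [] \<Longrightarrow>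
    cinner (R \<cdot> YX u \<cdot> \<Omega>) (YX u' \<cdot> \<Omega>) = cinner (R' \<cdot> YX u \<cdot> \<Omega>) (YX u' \<cdot> \<Omega>)"
  shows "R = R'"
proof (rule bop_weak_eqI)
  fix v w
  show "cinner (R \<cdot> v) w = cinner (R' \<cdot> v) w"
    by (rule cinner_eq_on_closed_span [where S = "{YX u \<cdot> \<Omega> | u. runs u \<and> u \<noteq> []}"])
      (use assms in \<open>auto simp: words_dense\<close>)
qed

subsection \<open>The projection onto the tail space\<close>

definition tail_vectors :: "'k set" where
  "tail_vectors = {PT ms \<cdot> \<Omega> | ms. \<forall>m\<in>set ms. 0 < m}"

definition tail_space :: "'k set" where
  "tail_space = closure (csubspace hull tail_vectors)"

lemma ex_tail_projection: "\<exists>Q. (\<forall>v. Q \<cdot> v \<in> tail_space) \<and> (\<forall>v\<in>tail_space. Q \<cdot> v = v) \<and> adj Q = Q \<and>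
    (\<forall>v. \<forall>n\<in>tail_space. cinner (v - Q \<cdot> v) n = 0)"
  using orthogonal_projection_exists [OF csubspace_hull [of tail_vectors]]
  unfolding tail_space_def by metis

definition e :: "'k bop" where
  "e = (SOME Q. (\<forall>v. Q \<cdot> v \<in> tail_space) \<and> (\<forall>v\<in>tail_space. Q \<cdot> v = v) \<and> adj Q = Q \<and>
    (\<forall>v. \<forall>n\<in>tail_space. cinner (v - Q \<cdot> v) n = 0))"

lemma e: "e \<cdot> v \<in> tail_space" "v \<in> tail_space \<Longrightarrow> e \<cdot> v = v" "adj e = e"
  using someI_ex [OF ex_tail_projection] unfolding e_def by blast+

lemma e_idem: "e * e = e"
  by (rule bop_eqI) (simp add: e)

lemma PT_tail: "\<forall>m\<in>set ms. 0 < m \<Longrightarrow> PT ms \<cdot> \<Omega> \<in> tail_space"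
  unfolding tail_space_def tail_vectors_def
  by (rule subsetD [OF closure_subset], rule subsetD [OF hull_subset]) blast

lemma e_Omega: "e \<cdot> \<Omega> = \<Omega>"
  using e(2) [OF PT_tail [of "[]"]] by simp

lemma compress_eqI:
  assumes "\<And>ms ms'. \<forall>m\<in>set ms. 0 < m \<Longrightarrow> \<forall>m\<in>set ms'. 0 < m \<Longrightarrow>
    cinner (R \<cdot> PT ms \<cdot> \<Omega>) (PT ms' \<cdot> \<Omega>) = cinner (R' \<cdot> PT ms \<cdot> \<Omega>) (PT ms' \<cdot> \<Omega>)"
  shows "e * R * e = e * R' * e"
proof (rule bop_weak_eqI)
  fix v w
  have "cinner (R \<cdot> e \<cdot> v) (e \<cdot> w) = cinner (R' \<cdot> e \<cdot> v) (e \<cdot> w)"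
  proof (rule cinner_eq_on_closed_span [where S = tail_vectors])
    show "e \<cdot> v \<in> closure (csubspace hull tail_vectors)" "e \<cdot> w \<in> closure (csubspace hull tail_vectors)"
      using e(1) by (simp_all add: tail_space_def)
  qed (use assms in \<open>auto simp: tail_vectors_def\<close>)
  then show "cinner ((e * R * e) \<cdot> v) w = cinner ((e * R' * e) \<cdot> v) w"
    by (simp add: selfadj_cinner [OF e(3)])
qed

lemma compress_YX: "runs u \<Longrightarrow> e * YX u * e = e * PT (map snd u) * e"
  by (rule compress_eqI) (rule cinner_YX_PT)

lemma e_YX_Omega:
  assumes "runs u"
  shows "e \<cdot> YX u \<cdot> \<Omega> = PT (map snd u) \<cdot> \<Omega>"
proof -
  let ?p = "PT (map snd u) \<cdot> \<Omega>"
  have "e \<cdot> YX u \<cdot> e \<cdot> \<Omega> = e \<cdot> PT (map snd u) \<cdot> e \<cdot> \<Omega>"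
    using compress_YX [OF assms] by (metis times_bop.rep_eq)
  then show ?thesis
    using e(2) [OF PT_tail [OF runs_pos [OF assms]]] by (simp add: e_Omega)
qed

text \<open>Between word vectors the moments of \<open>T m\<close> depend on the exponents only, so
  they do not change when a word vector is replaced by its projection, the corresponding vector of
  limits.\<close>

lemma T_e:
  assumes "0 < m"
  shows "T m * e = T m" "e * T m = T m"
proof -
  show "T m * e = T m"
  proof (rule bop_eq_words)
    fix u u' :: "(int \<times> nat) list" assume u: "runs u" "runs u'"
    have "cinner (T m \<cdot> e \<cdot> YX u \<cdot> \<Omega>) (YX u' \<cdot> \<Omega>) = cinner (T m \<cdot> PT (map snd u) \<cdot> \<Omega>) (YX u' \<cdot> \<Omega>)"
      by (simp add: e_YX_Omega [OF u(1)])
    also have "\<dots> = cnj (cinner (YX u' \<cdot> \<Omega>) (PT (m # map snd u) \<cdot> \<Omega>))"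
      by (subst cinner_commute) simp
    also have "cinner (YX u' \<cdot> \<Omega>) (PT (m # map snd u) \<cdot> \<Omega>) = cinner (PT (map snd u') \<cdot> \<Omega>) (PT (m # map snd u) \<cdot> \<Omega>)"
      using cinner_YX_PT [OF u(2), of "[]" "m # map snd u"] runs_pos [OF u(1)] assms by simp
    also have "cnj \<dots> = cinner (T m \<cdot> PT (map snd u) \<cdot> \<Omega>) (PT (map snd u') \<cdot> \<Omega>)"
      by (subst cinner_commute) simp
    also have "\<dots> = cinner (T m \<cdot> YX u \<cdot> \<Omega>) (YX u' \<cdot> \<Omega>)"
      using cinner_PT_YX [OF u, of "[m]"] assms by simp
    finally show "cinner ((T m * e) \<cdot> YX u \<cdot> \<Omega>) (YX u' \<cdot> \<Omega>) = cinner (T m \<cdot> YX u \<cdot> \<Omega>) (YX u' \<cdot> \<Omega>)"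
      by simp
  qed
  then have "adj (T m * e) = adj (T m)"
    by simp
  then show "e * T m = T m"
    by (simp add: e(3))
qed

lemma PT_e:
  assumes "\<forall>m\<in>set ms. 0 < m" "ms \<noteq> []"
  shows "e * PT ms = PT ms" "PT ms * e = PT ms"
proof -
  obtain m ms' where "ms = m # ms'"
    using assms(2) by (cases ms) auto
  then show "e * PT ms = PT ms"
    using T_e(2) assms(1) by (simp flip: mult.assoc)
  obtain ms' m where "ms = ms' @ [m]"
    using assms(2) by (cases ms rule: rev_cases) auto
  then show "PT ms * e = PT ms"
    using T_e(1) assms(1) by (simp add: mult.assoc)
qed

lemma compress_YX_PT: "runs u \<Longrightarrow> u \<noteq> [] \<Longrightarrow> e * YX u * e = PT (map snd u)"
  using compress_YX PT_e [OF runs_pos] by (metis map_is_Nil_conv)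

text \<open>For nonempty parts both sides are the product of the limits of all runs. This
  multiplicativity at a boundary between runs is the germ of boolean independence.\<close>

lemma compress_YX_append:
  assumes "runs (u @ v)"
  shows "e * YX (u @ v) * e = (e * YX u * e) * (e * YX v * e)"
proof (cases "u = [] \<or> v = []")
  case True
  then show ?thesis
    using e_idem by (auto simp: mult.assoc) (metis mult.assoc)
next
  case False
  have "runs u" "runs v"
    using assms by (auto simp: runs_def distinct_adj_append_iff)
  then show ?thesis
    using False compress_YX_PT [OF assms] compress_YX_PT [of u] compress_YX_PT [of v] by simp
qed

abbreviation Cl :: "int \<Rightarrow> 'k bop set" where
  "Cl k \<equiv> weak_operator_topology closure_of (\<pi> ` alg {k..})"

lemma Cl: "0 \<in> Cl k" "a \<in> Cl k \<Longrightarrow> b \<in> Cl k \<Longrightarrow> a + b \<in> Cl k" "a \<in> Cl k \<Longrightarrow> c *\<^sub>C a \<in> Cl k"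
  "a \<in> Cl k \<Longrightarrow> b \<in> Cl k \<Longrightarrow> a * b \<in> Cl k"
  by (rule nonunital_algebraD [OF nonunital_algebra_wot_closure [OF pi_image_algebra [OF nonunital_algebra_hull alg_subset_A]]];
      assumption)+

lemma T_in_Cl:
  assumes "0 < m"
  shows "T m \<in> Cl k"
proof (rule wot_closure_limit [where F = sequentially and f = "\<lambda>n. X (k + int n) ^ m"])
  show "(\<lambda>n. cinner (X (k + int n) ^ m \<cdot> v) w) \<longlonglongrightarrow> cinner (T m \<cdot> v) w" for v w
    by (rule X_power_tendsto_T [OF int_at_top])
  have "W (replicate m (k + int n)) \<in> alg {k..}" for n
    by (rule word_in_alg) (use assms in auto)
  then have "X (k + int n) ^ m \<in> \<pi> ` alg {k..}" for n
    unfolding W_replicate by (intro image_eqI [of _ _ "x (k + int n) ^ m"]) simp_all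
  then show "eventually (\<lambda>n. X (k + int n) ^ m \<in> \<pi> ` alg {k..}) sequentially"
    by simp
qed simp

lemma PT_in_Cl: "ms \<noteq> [] \<Longrightarrow> \<forall>m\<in>set ms. 0 < m \<Longrightarrow> PT ms \<in> Cl k"
  by (induction ms rule: list_nonempty_induct) (auto intro: T_in_Cl Cl(4))

text \<open>A vector killed by all \<open>X n\<close> is killed by the non-unital algebra they
  generate, hence by its weak closure, which contains 1.\<close>

lemma cyclic_separating:
  assumes "\<And>n. X n \<cdot> \<zeta> = 0"
  shows "\<zeta> = 0"
proof -
  have YX: "YX u \<cdot> \<zeta> = 0" if ru: "runs u" and "u \<noteq> []" for u
  proof -
    obtain u' i m where u: "u = u' @ [(i, m)]"
      using \<open>u \<noteq> []\<close> by (metis rev_exhaust prod.collapse)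
    then obtain m' where "m = Suc m'"
      using ru by (cases m) (auto simp: runs_def)
    then have "X i ^ m \<cdot> \<zeta> = (X i ^ m' * X i) \<cdot> \<zeta>"
      by (simp add: power_commutes)
    then show ?thesis
      by (simp add: u assms)
  qed
  have zero: "\<pi> b \<cdot> \<zeta> = 0" if "b \<in> alg UNIV" for b
  proof -
    have "\<pi> b \<cdot> \<zeta> \<in> {0}"
      by (rule word_span_YX [of b UNIV]) (use that alg_subset_word_span YX in \<open>auto simp: csubspace_def\<close>)
    then show ?thesis
      by simp
  qed
  have one: "1 \<in> weak_operator_topology closure_of (\<pi> ` alg UNIV)"
    using one_closure by (simp add: gns_wot_closure_def)
  have "cmod (cinner \<zeta> \<zeta>) \<le> 0"
  proof (rule field_le_epsilon)
    fix d :: real assume "d > 0"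
    obtain B where B: "B \<in> \<pi> ` alg UNIV" "\<And>v w. (v, w) \<in> {(\<zeta>, \<zeta>)} \<Longrightarrow> cmod (cinner ((1 - B) \<cdot> v) w) < d"
      by (rule wot_closure_approx [OF one, of "{(\<zeta>, \<zeta>)}" d]) (use \<open>d > 0\<close> in auto)
    have "B \<cdot> \<zeta> = 0"
      using B(1) zero by auto
    then show "cmod (cinner \<zeta> \<zeta>) \<le> 0 + d"
      using B(2) [of \<zeta> \<zeta>] by simp
  qed
  then show ?thesis
    by (simp add: cinner_self)
qed

text \<open>For every \<open>n\<close>, \<open>T 2\<close> is the compression of
  \<open>X n ^ 2\<close> by \<open>e\<close>, so its coefficient at \<open>\<xi>\<close> is the
  squared norm of \<open>X n \<cdot> e \<cdot> \<xi>\<close>.\<close>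

lemma T2_kernel:
  assumes "T 2 \<cdot> \<xi> = 0"
  shows "e \<cdot> \<xi> = 0"
proof (rule cyclic_separating)
  fix n :: int
  have "runs [(n, 2)]"
    by (simp add: runs_def)
  from compress_YX_PT [OF this] have "e * X n ^ 2 * e = T 2"
    by simp
  then have "cinner ((e * X n ^ 2 * e) \<cdot> \<xi>) \<xi> = 0"
    using assms by simp
  then have "cinner (X n \<cdot> e \<cdot> \<xi>) (X n \<cdot> e \<cdot> \<xi>) = 0"
    by (simp add: selfadj_cinner [OF e(3)] selfadj_cinner [OF X_adj [of n 1, simplified]] power2_eq_square)
  then show "X n \<cdot> e \<cdot> \<xi> = 0"
    by (simp add: cinner_self)
qed

lemma bpos_T2: "bpos (T 2)"
  unfolding bpos_def
proof (intro conjI allI)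
  fix v
  have "(\<lambda>n. Re (cinner (X (0 + int n) ^ 2 \<cdot> v) v)) \<longlonglongrightarrow> Re (cinner (T 2 \<cdot> v) v)"
    by (intro tendsto_Re X_power_tendsto_T [OF int_at_top])
  moreover have "0 \<le> Re (cinner (X n ^ 2 \<cdot> v) v)" for n
    by (simp add: selfadj_cinner [OF X_adj [of n 1, simplified]] power2_eq_square [of "X n"] cinner_self flip: of_real_power)
  ultimately show "0 \<le> Re (cinner (T 2 \<cdot> v) v)"
    by (intro LIMSEQ_le_const) auto
qed simp

text \<open>\<open>e\<close> is the support projection of \<open>T 2\<close>, hence a weak limit of polynomials in \<open>T 2\<close>.\<close>

lemma e_limit: "\<exists>p\<in>A. \<pi> p = e"
proof -
  define c where "c = opnorm (T 2) + 1"
  have c: "c > 0"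
    by (simp add: c_def add_nonneg_pos)
  define s where "s = complex_of_real (1 / c) *\<^sub>C T 2"
  define s' where "s' = complex_of_real (1 / c) *\<^sub>C t 2"
  have s': "s' \<in> A" "\<pi> s' = s"
    by (simp_all add: s_def s'_def)
  have "bpos (1 - s)"
    unfolding bpos_def
  proof (intro conjI allI)
    fix v
    have "Re (cinner (T 2 \<cdot> v) v) \<le> norm (T 2 \<cdot> v) * norm v"
      using cmod_cinner_le complex_Re_le_cmod order_trans by blast
    also have "\<dots> \<le> opnorm (T 2) * norm v * norm v"
      by (intro mult_right_mono opnorm) simp
    also have "\<dots> \<le> c * norm v * norm v"
      by (intro mult_right_mono) (auto simp: c_def)
    finally have "Re (cinner (T 2 \<cdot> v) v) / c \<le> (norm v)\<^sup>2"
      using c by (simp add: divide_le_eq power2_eq_square mult_ac)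
    moreover have "Re (cinner (s \<cdot> v) v) = Re (cinner (T 2 \<cdot> v) v) / c"
      by (simp add: s_def cinner_scaleC_left flip: of_real_divide)
    ultimately show "0 \<le> Re (cinner ((1 - s) \<cdot> v) v)"
      by (simp add: cinner_diff_left cinner_self flip: of_real_power)
  qed (simp add: s_def)
  moreover have "bpos s"
    unfolding s_def using c by (intro bpos_scale bpos_T2) simp
  ultimately have s: "pos_contraction s"
    by (simp add: pos_contraction_def)
  then have s_adj: "adj s = s"
    by (simp add: pos_contraction_def bpos_def)
  \<comment> \<open>The powers of \<open>1 - s\<close> tend to the projection onto the kernel of
    \<open>s\<close>, which will be \<open>1 - e\<close>. They are formed in \<open>A\<close> so
    that the limit can be taken there.\<close>
  define a where "a m = (1 - s') ^ m" for m
  have aA: "a m \<in> A" and pia: "\<pi> (a m) = (1 - s) ^ m" for m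
    by (simp_all add: a_def s')
  have pia_bound: "norm (\<pi> (a m) \<cdot> \<xi>) \<le> 1 * norm \<xi>" for m \<xi>
    using pos_contraction_norm [OF pos_contraction_power(1) [OF s]] by (simp add: pia)
  obtain G b where G: "G \<le> sequentially" "G \<noteq> bot" "b \<in> A" and
    lim: "\<And>c d. c \<in> A \<Longrightarrow> d \<in> A \<Longrightarrow> ((\<lambda>n. cinner (\<pi> (a n) \<cdot> \<pi> c \<cdot> \<Omega>) (\<pi> d \<cdot> \<Omega>)) \<longlongrightarrow>
      cinner (\<pi> b \<cdot> \<pi> c \<cdot> \<Omega>) (\<pi> d \<cdot> \<Omega>)) G"
    \<comment> \<open>\<open>1 + 1\<close> is what \<open>norm_le_of_pi\<close> yields from the
      bound 1 in the GNS space.\<close>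
    by (rule cluster [of a "1 + 1"]) (use aA norm_le_of_pi [OF aA pia_bound] in auto)
  define R where "R = \<pi> b"
  have R: "((\<lambda>m. cinner ((1 - s) ^ m \<cdot> \<xi>) \<eta>) \<longlongrightarrow> cinner (R \<cdot> \<xi>) \<eta>) G" for \<xi> \<eta>
    unfolding R_def pia [symmetric]
    by (rule weak_dense_tendsto [OF cyclic pia_bound]) (use lim in auto)
  have R_adj: "adj R = R"
  proof (rule adj_eqI)
    fix v w
    have "adj ((1 - s) ^ m) = (1 - s) ^ m" for m
      by (simp add: s_adj)
    then have "cinner ((1 - s) ^ m \<cdot> v) w = cnj (cinner ((1 - s) ^ m \<cdot> w) v)" for m
      using selfadj_cinner cinner_commute by metis
    then have "((\<lambda>m. cnj (cinner ((1 - s) ^ m \<cdot> w) v)) \<longlongrightarrow> cinner (R \<cdot> v) w) G"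
      using R [of v w] by simp
    moreover have "((\<lambda>m. cnj (cinner ((1 - s) ^ m \<cdot> w) v)) \<longlongrightarrow> cnj (cinner (R \<cdot> w) v)) G"
      by (intro tendsto_cnj R)
    ultimately have "cinner (R \<cdot> v) w = cnj (cinner (R \<cdot> w) v)"
      using tendsto_unique [OF G(2)] by blast
    then show "cinner (R \<cdot> v) w = cinner v (R \<cdot> w)"
      using cinner_commute by metis
  qed
  \<comment> \<open>By \<open>pos_contraction_Suc_mult_power\<close> the norm of
    \<open>s * (1 - s) ^ m\<close> is at most the inverse of \<open>m + 1\<close>.\<close>
  have sR: "s \<cdot> R \<cdot> \<xi> = 0" for \<xi>
  proof (rule cinner_eqI)
    fix \<eta>
    have le: "norm ((s * (1 - s) ^ m) \<cdot> \<xi>) \<le> norm \<xi> * inverse (real (Suc m))" for m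
    proof -
      have "real (Suc m) * norm ((s * (1 - s) ^ m) \<cdot> \<xi>) \<le> norm \<xi>"
        using pos_contraction_norm [OF pos_contraction_Suc_mult_power [OF s, of m], of \<xi>]
        by (simp add: norm_scaleC del: of_nat_Suc)
      then show ?thesis
        by (simp add: field_simps)
    qed
    have "(\<lambda>m. norm \<xi> * inverse (real (Suc m))) \<longlonglongrightarrow> 0"
      by (rule tendsto_mult_right_zero [OF LIMSEQ_inverse_real_of_nat])
    then have "(\<lambda>m. (s * (1 - s) ^ m) \<cdot> \<xi>) \<longlonglongrightarrow> 0"
      by (rule Lim_null_comparison [OF always_eventually [OF allI [OF le]]])
    then have "(\<lambda>m. cinner ((s * (1 - s) ^ m) \<cdot> \<xi>) \<eta>) \<longlonglongrightarrow> cinner 0 \<eta>"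
      by (intro tendsto_cinner tendsto_const)
    then have "((\<lambda>m. cinner ((1 - s) ^ m \<cdot> \<xi>) (s \<cdot> \<eta>)) \<longlongrightarrow> 0) G"
      using tendsto_mono [OF G(1)] by (simp add: selfadj_cinner [OF s_adj])
    then have "cinner (R \<cdot> \<xi>) (s \<cdot> \<eta>) = 0"
      using tendsto_unique [OF G(2) R] by blast
    then show "cinner (s \<cdot> R \<cdot> \<xi>) \<eta> = cinner 0 \<eta>"
      by (simp add: selfadj_cinner [OF s_adj])
  qed
  have eR: "e * R = 0"
  proof (rule bop_eqI)
    fix \<xi>
    have "complex_of_real c *\<^sub>C s \<cdot> R \<cdot> \<xi> = T 2 \<cdot> R \<cdot> \<xi>"
      using c by (simp add: s_def scaleC_scaleC scaleC_one)
    then show "(e * R) \<cdot> \<xi> = 0 \<cdot> \<xi>"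
      using T2_kernel [of "R \<cdot> \<xi>"] by (simp add: sR)
  qed
  then have "adj (e * R) = 0"
    by simp
  then have Re: "R * e = 0"
    by (simp add: R_adj e(3))
  \<comment> \<open>\<open>s\<close> vanishes on the range of \<open>1 - e\<close>, so every power
    of \<open>1 - s\<close> is the identity there.\<close>
  have "R * (1 - e) = 1 - e"
  proof (rule bop_weak_eqI)
    fix \<xi> \<eta>
    have "s * (1 - e) = 0"
      using T_e(1) [of 2] by (simp add: s_def right_diff_distrib)
    then have "(1 - s) * (1 - e) = 1 - e"
      by (simp add: left_diff_distrib)
    then have "(1 - s) ^ m * (1 - e) = 1 - e" for m
      by (induction m) (simp_all add: mult.assoc)
    then have "cinner ((1 - s) ^ m \<cdot> (1 - e) \<cdot> \<xi>) \<eta> = cinner ((1 - e) \<cdot> \<xi>) \<eta>" for m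
      by (metis times_bop.rep_eq)
    then have "((\<lambda>m. cinner ((1 - e) \<cdot> \<xi>) \<eta>) \<longlongrightarrow> cinner (R \<cdot> (1 - e) \<cdot> \<xi>) \<eta>) G"
      using R [of "(1 - e) \<cdot> \<xi>" \<eta>] by simp
    then show "cinner ((R * (1 - e)) \<cdot> \<xi>) \<eta> = cinner ((1 - e) \<cdot> \<xi>) \<eta>"
      using tendsto_unique [OF G(2) tendsto_const] by fastforce
  qed
  then have "R = 1 - e"
    using Re by (simp add: right_diff_distrib)
  then have "\<pi> (1 - b) = e"
    using G(3) by (simp add: R_def)
  then show ?thesis
    using G(3) by (intro bexI [of _ "1 - b"]) auto
qed

definition p :: "'h bop" where
  "p = (SOME p. p \<in> A \<and> \<pi> p = e)"

lemma p [simp]: "p \<in> A" "\<pi> p = e"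
proof -
  have "p \<in> A \<and> \<pi> p = e"
    unfolding p_def by (rule someI_ex) (use e_limit in \<open>simp only: Bex_def\<close>)
  then show "p \<in> A" "\<pi> p = e"
    by simp_all
qed

text \<open>Compression turns words into products of limits, which lie in every \<open>Cl k\<close>;
  weak continuity of the compression extends this to all of \<open>A\<close>.\<close>

lemma compress_in_Cl:
  assumes "a \<in> A"
  shows "e * \<pi> a * e \<in> Cl k"
proof -
  have cont: "continuous_map weak_operator_topology weak_operator_topology (\<lambda>b. e * b * e)"
    using continuous_map_compose [OF continuous_map_wot_mult_left [of e] continuous_map_wot_mult_right [of e]]
    by (simp add: o_def)
  have "e * \<pi> b * e \<in> Cl k" if "b \<in> alg UNIV" for b
  proof -
    have "b \<in> word_span x UNIV"
      using that alg_subset_word_span by blast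
    then show ?thesis
    proof induction
      case zero
      then show ?case
        using Cl(1) by simp
    next
      case (add s w c)
      obtain u where u: "runs u" "u \<noteq> []" "\<pi> (W w) = YX u"
        by (rule ex_YX [OF add.hyps(2)])
      have "e * \<pi> (s + c *\<^sub>C W w) * e = e * \<pi> s * e + c *\<^sub>C (e * YX u * e)"
        using word_span_in_A [OF add.hyps(1)]
        by (simp only: pi_add A_scale W_in_A pi_scale u(3) distrib_left distrib_right scaleC_mult_left scaleC_mult_right)
      also have "e * YX u * e = PT (map snd u)"
        by (rule compress_YX_PT [OF u(1,2)])
      also have "e * \<pi> s * e + c *\<^sub>C PT (map snd u) \<in> Cl k"
        using runs_pos [OF u(1)] u(2) by (intro Cl add.IH PT_in_Cl) auto
      finally show ?case .
    qed
  qed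
  then have "(\<lambda>b. e * b * e) ` \<pi> ` alg UNIV \<subseteq> Cl k"
    by auto
  then have "weak_operator_topology closure_of ((\<lambda>b. e * b * e) ` \<pi> ` alg UNIV) \<subseteq> Cl k"
    by (rule closure_of_minimal) simp
  moreover have "e * \<pi> a * e \<in> (\<lambda>b. e * b * e) ` (weak_operator_topology closure_of (\<pi> ` alg UNIV))"
    by (rule imageI [OF pi_in_closure [OF assms]])
  ultimately show ?thesis
    using continuous_map_image_closure_subset [OF cont, of "\<pi> ` alg UNIV"] by blast
qed

text \<open>Given test words \<open>u\<close> and \<open>u'\<close>, take \<open>k\<close> beyond
  their indices. Words with letters from \<open>k\<close> on meet them at run boundaries only, so
  the moment is that of the limits and does not change when both word vectors are projected by
  \<open>e\<close>.\<close>

lemma in_Cl_imp_compressed: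
  assumes "\<And>k. k > 0 \<Longrightarrow> R \<in> Cl k"
  shows "R = e * R * e"
proof (rule bop_eq_words)
  fix u u' :: "(int \<times> nat) list" assume u: "runs u" "runs u'"
  let ?v = "YX u \<cdot> \<Omega>" and ?w = "YX u' \<cdot> \<Omega>"
  have "finite (fst ` set u \<union> fst ` set u' \<union> {0})"
    by simp
  then obtain k where k: "\<And>i. i \<in> fst ` set u \<union> fst ` set u' \<union> {0} \<Longrightarrow> i < k"
    by (metis Max_ge zle_add1_eq_le)
  have alg: "cinner (\<pi> b \<cdot> ?v) ?w = cinner (\<pi> b \<cdot> e \<cdot> ?v) (e \<cdot> ?w)" if "b \<in> alg {k..}" for b
  proof -
    have "b \<in> word_span x {k..}"
      using that alg_subset_word_span by blast
    then show ?thesis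
    proof induction
      case (add s w c)
      obtain z where z: "runs z" "z \<noteq> []" "\<pi> (W w) = YX z" "fst ` set z = set w"
        by (rule ex_YX [OF add.hyps(2)])
      have less: "fst q < fst q'" if "q \<in> set u \<union> set u'" "q' \<in> set z" for q q'
      proof -
        have "fst q < k"
          by (rule k) (use that(1) in auto)
        also have "k \<le> fst q'"
          using that(2) z(4) add.hyps(3) by (metis atLeast_iff imageI subsetD)
        finally show ?thesis .
      qed
      have "runs (rev u' @ z @ u)"
        using runs_rev [OF u(2)] u z(1,2) less [of "hd u" "last z"] less [of "hd u'" "hd z"]
        by (auto simp: runs_def distinct_adj_append_iff last_rev last_map hd_map rev_map [symmetric])
      then have "cinner (YX z \<cdot> ?v) ?w = cinner (PT (map snd z) \<cdot> PT (map snd u) \<cdot> \<Omega>) (PT (map snd u') \<cdot> \<Omega>)"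
        by (rule cinner_YX_YX)
      also have "\<dots> = cinner (YX z \<cdot> e \<cdot> ?v) (e \<cdot> ?w)"
        unfolding e_YX_Omega [OF u(1)] e_YX_Omega [OF u(2)]
        by (rule cinner_YX_PT [symmetric]) (use z(1) runs_pos [OF u(1)] runs_pos [OF u(2)] in auto)
      finally have "cinner (YX z \<cdot> ?v) ?w = cinner (YX z \<cdot> e \<cdot> ?v) (e \<cdot> ?w)" .
      moreover have "\<pi> (s + c *\<^sub>C W w) = \<pi> s + c *\<^sub>C YX z"
        using word_span_in_A [OF add.hyps(1)] by (simp only: pi_add A_scale W_in_A pi_scale z(3))
      ultimately show ?case
        using add.IH by (simp add: cinner_add_left cinner_scaleC_left)
    qed simp
  qed
  have "cmod (cinner (R \<cdot> ?v) ?w - cinner (R \<cdot> e \<cdot> ?v) (e \<cdot> ?w)) \<le> 0"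
  proof (rule field_le_epsilon)
    fix d :: real assume "d > 0"
    have "R \<in> Cl k"
      using assms k by simp
    then obtain B where B: "B \<in> \<pi> ` alg {k..}"
      "\<And>v w. (v, w) \<in> {(?v, ?w), (e \<cdot> ?v, e \<cdot> ?w)} \<Longrightarrow> cmod (cinner ((R - B) \<cdot> v) w) < d / 2"
      by (rule wot_closure_approx [of R "\<pi> ` alg {k..}" "{(?v, ?w), (e \<cdot> ?v, e \<cdot> ?w)}" "d / 2"]) (use \<open>d > 0\<close> in auto)
    have "cinner (B \<cdot> ?v) ?w = cinner (B \<cdot> e \<cdot> ?v) (e \<cdot> ?w)"
      using alg B(1) by blast
    then have "cinner (R \<cdot> ?v) ?w - cinner (R \<cdot> e \<cdot> ?v) (e \<cdot> ?w) =
        cinner ((R - B) \<cdot> ?v) ?w - cinner ((R - B) \<cdot> e \<cdot> ?v) (e \<cdot> ?w)"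
      by (simp add: cinner_diff_left)
    also have "cmod \<dots> \<le> cmod (cinner ((R - B) \<cdot> ?v) ?w) + cmod (cinner ((R - B) \<cdot> e \<cdot> ?v) (e \<cdot> ?w))"
      by (rule norm_triangle_ineq4)
    also have "\<dots> \<le> 0 + d"
      using B(2) [of ?v ?w] B(2) [of "e \<cdot> ?v" "e \<cdot> ?w"] by simp
    finally show "cmod (cinner (R \<cdot> ?v) ?w - cinner (R \<cdot> e \<cdot> ?v) (e \<cdot> ?w)) \<le> 0 + d" .
  qed
  then show "cinner (R \<cdot> ?v) ?w = cinner ((e * R * e) \<cdot> ?v) ?w"
    by (simp add: selfadj_cinner [OF e(3)])
qed

end

lemma hd_run_word: "runs rs \<Longrightarrow> rs \<noteq> [] \<Longrightarrow> run_word rs \<noteq> [] \<and> hd (run_word rs) = fst (hd rs)"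
  by (cases rs; cases "snd (hd rs)") (auto simp: runs_Cons)

lemma last_run_word: "runs rs \<Longrightarrow> rs \<noteq> [] \<Longrightarrow> last (run_word rs) = fst (last rs)"
proof (induction rs)
  case (Cons q rs)
  obtain i m where q: "q = (i, m)"
    by (cases q)
  show ?case
  proof (cases "rs = []")
    case True
    then show ?thesis
      using Cons.prems by (simp add: q runs_Cons)
  next
    case False
    then show ?thesis
      using Cons hd_run_word [of rs] by (simp add: q runs_Cons last_append)
  qed
qed simp

section \<open>The tail algebra and its conditional expectation\<close>

context spreadable_sequence
begin

definition tail :: "'h bop set" where
  "tail = tail_algebra A \<pi> x"

lemma tail_iff: "a \<in> tail \<longleftrightarrow> a \<in> A \<and> (\<forall>k>0. \<pi> a \<in> Cl k)"
  by (auto simp: tail_def tail_algebra_def gns_wot_closure_def)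
    (metis greaterThan_iff zero_less_one)

lemma p_idem: "p * p = p"
  by (rule pi_inj) (simp_all add: e_idem)

lemma p_absorb: "p * (p * a) = p * a"
  by (simp add: p_idem flip: mult.assoc)

text \<open>By \<open>in_Cl_imp_compressed\<close>. Hence \<open>p\<close> acts as the unit of the
  tail algebra, which may differ from 1.\<close>

lemma tail_compressed:
  assumes "b \<in> tail"
  shows "p * b = b" "b * p = b"
proof -
  have b: "b \<in> A" "\<pi> b = e * \<pi> b * e"
    using assms in_Cl_imp_compressed by (auto simp: tail_iff)
  have "e * \<pi> b = \<pi> b"
    by (subst (1 2) b(2)) (simp add: e_idem flip: mult.assoc)
  then show "p * b = b"
    using b(1) by (intro pi_inj) simp_all
  have "\<pi> b * e = \<pi> b"
    by (subst (1 2) b(2)) (simp add: e_idem mult.assoc)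
  then show "b * p = b"
    using b(1) by (intro pi_inj) simp_all
qed

lemma tail_in_A: "b \<in> tail \<Longrightarrow> b \<in> A"
  by (simp add: tail_iff)

definition E :: "'h bop \<Rightarrow> 'h bop" where
  "E a = p * a * p"

lemma E_in_tail: "a \<in> A \<Longrightarrow> E a \<in> tail"
  by (simp add: tail_iff E_def compress_in_Cl)

lemma E_tail: "b \<in> tail \<Longrightarrow> E b = b"
  by (simp add: E_def tail_compressed)

lemma E_conditional_expectation: "conditional_expectation A tail E"
  unfolding conditional_expectation_def complex_linear_on_def
proof (intro conjI ballI allI)
  show "E ` A = tail"
    using E_in_tail E_tail tail_in_A by (auto intro: image_eqI [OF sym])
  fix a b1 b2 assume b: "b1 \<in> tail" "b2 \<in> tail"
  have "E (b1 * a * b2) = (p * b1) * a * (b2 * p)"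
    by (simp only: E_def mult.assoc)
  also have "\<dots> = (b1 * p) * a * (p * b2)"
    by (simp only: tail_compressed [OF b(1)] tail_compressed [OF b(2)])
  finally show "E (b1 * a * b2) = b1 * E a * b2"
    by (simp only: E_def mult.assoc)
qed (auto simp: E_def distrib_left distrib_right E_tail [unfolded E_def])

lemma phi_E: "a \<in> A \<Longrightarrow> \<phi> (E a) = \<phi> a"
  by (simp add: E_def phi_eq e_Omega selfadj_cinner [OF e(3)])

lemma compress_power:
  assumes "0 < m"
  shows "p * x i ^ m * p = t m"
proof (rule pi_inj)
  have "runs [(i, m)]"
    using assms by (simp add: runs_def)
  then show "\<pi> (p * x i ^ m * p) = \<pi> (t m)"
    using compress_YX_PT [of "[(i, m)]"] by simp
qed simp_all

text \<open>A boundary between different letters is a boundary between runs, where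
  \<open>compress_YX_append\<close> inserts \<open>e\<close>.\<close>

lemma compress_words:
  assumes "u = [] \<or> v = [] \<or> last u \<noteq> hd v"
  shows "p * W u * W v * p = p * W u * p * W v * p"
proof (rule pi_inj)
  obtain ru where ru: "runs ru" "run_word ru = u" "fst ` set ru = set u"
    using ex_runs [of u] by (elim exE conjE)
  obtain rv where rv: "runs rv" "run_word rv = v" "fst ` set rv = set v"
    using ex_runs [of v] by (elim exE conjE)
  have W: "\<pi> (W u) = YX ru" "\<pi> (W v) = YX rv"
    unfolding ru(2) [symmetric] rv(2) [symmetric] prod_list_run_word by (simp_all add: pi_run_prod)
  have "ru = [] \<or> rv = [] \<or> fst (last ru) \<noteq> fst (hd rv)"
    using assms ru rv last_run_word [OF ru(1)] hd_run_word [OF ru(1)] hd_run_word [OF rv(1)] by auto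
  then have "runs (ru @ rv)"
    using ru(1) rv(1) by (auto simp: runs_def distinct_adj_append_iff last_map hd_map)
  from compress_YX_append [OF this] have "e * YX ru * YX rv * e = e * YX ru * e * (e * YX rv * e)"
    by (simp add: mult.assoc)
  also have "\<dots> = e * YX ru * (e * e) * YX rv * e"
    by (simp only: mult.assoc)
  finally show "\<pi> (p * W u * W v * p) = \<pi> (p * W u * p * W v * p)"
    by (simp add: W e_idem)
qed simp_all

subsection \<open>Words with tail coefficients\<close>

text \<open>Letters of mixed words, which present the monomials of polynomials with tail
  coefficients: \<open>Inl i\<close> is a variable and \<open>Inr b\<close> a coefficient.\<close>

definition mval :: "int + 'h bop \<Rightarrow> 'h bop" where
  "mval l = (case l of Inl i \<Rightarrow> x i | Inr b \<Rightarrow> b)"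

abbreviation mword :: "(int + 'h bop) list \<Rightarrow> 'h bop" where
  "mword ls \<equiv> prod_list (map mval ls)"

definition mletters :: "(int + 'h bop) set" where
  "mletters = range Inl \<union> Inr ` tail"

lemma mval_simps [simp]: "mval (Inl i) = x i" "mval (Inr b) = b"
  by (simp_all add: mval_def)

text \<open>Since \<open>b = b * p\<close> for tail elements, everything up to the last coefficient
  can be split off as \<open>L\<close>, and \<open>u\<close> is the pure word behind it. The last
  clause allows the adjacent letters to be compared when mixed words meet.\<close>

lemma mword_left:
  assumes "set U \<subseteq> mletters"
  shows "\<exists>L u. p * mword U = L * (p * W u) \<and> (u \<noteq> [] \<longrightarrow> U \<noteq> [] \<and> last U = Inl (last u))"
  using assms
proof (induction U rule: rev_induct)
  case Nil
  show ?case
    by (rule exI [of _ p], rule exI [of _ "[]"]) (simp add: p_idem)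
next
  case (snoc l U)
  show ?case
  proof (cases l)
    case (Inl i)
    from snoc obtain L u where "p * mword U = L * (p * W u)"
      by auto
    then have "p * mword (U @ [l]) = L * (p * W (u @ [i]))"
      by (simp add: Inl mult.assoc [symmetric])
    then show ?thesis
      by (intro exI [of _ L] exI [of _ "u @ [i]"]) (simp add: Inl)
  next
    case (Inr b)
    then have "b \<in> tail"
      using snoc.prems by (auto simp: mletters_def)
    then have "p * mword (U @ [l]) = p * mword U * b * (p * W [])"
      by (simp add: Inr mult.assoc tail_compressed)
    then show ?thesis
      by (intro exI [of _ "p * mword U * b"] exI [of _ "[]"]) simp
  qed
qed

lemma mword_right:
  assumes "set V \<subseteq> mletters"
  shows "\<exists>R v. mword V * p = W v * p * R \<and> (v \<noteq> [] \<longrightarrow> V \<noteq> [] \<and> hd V = Inl (hd v))"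
  using assms
proof (induction V)
  case Nil
  show ?case
    by (rule exI [of _ p], rule exI [of _ "[]"]) (simp add: p_idem)
next
  case (Cons l V)
  show ?case
  proof (cases l)
    case (Inl i)
    from Cons obtain R v where "mword V * p = W v * p * R"
      by auto
    then have "mword (l # V) * p = W (i # v) * p * R"
      by (simp add: Inl mult.assoc)
    then show ?thesis
      by (intro exI [of _ R] exI [of _ "i # v"]) (simp add: Inl)
  next
    case (Inr b)
    then have "b \<in> tail"
      using Cons.prems by (auto simp: mletters_def)
    then have "mword (l # V) * p = W [] * p * (b * mword V * p)"
      by (simp add: Inr mult.assoc [symmetric] tail_compressed)
    then show ?thesis
      by (intro exI [of _ "b * mword V * p"] exI [of _ "[]"]) simp
  qed
qed

text \<open>A coefficient next to the cut supplies \<open>p\<close> itself; otherwise pure words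
  with different adjacent letters meet there, and \<open>compress_words\<close> applies.\<close>

lemma compress_mwords:
  assumes "set U \<subseteq> mletters" "set V \<subseteq> mletters"
    and "\<And>i. U \<noteq> [] \<Longrightarrow> V \<noteq> [] \<Longrightarrow> last U = Inl i \<Longrightarrow> hd V \<noteq> Inl i"
  shows "p * mword U * mword V * p = p * mword U * p * mword V * p"
proof -
  obtain L u where L: "p * mword U = L * (p * W u)" "u \<noteq> [] \<longrightarrow> U \<noteq> [] \<and> last U = Inl (last u)"
    using mword_left [OF assms(1)] by (elim exE conjE)
  obtain R v where R: "mword V * p = W v * p * R" "v \<noteq> [] \<longrightarrow> V \<noteq> [] \<and> hd V = Inl (hd v)"
    using mword_right [OF assms(2)] by (elim exE conjE)
  have "u = [] \<or> v = [] \<or> last u \<noteq> hd v"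
    using assms(3) L(2) R(2) by auto
  from compress_words [OF this] have W: "p * W u * W v * p = p * W u * p * W v * p" .
  have "p * mword U * mword V * p = L * (p * W u) * (W v * p * R)"
    unfolding L(1) [symmetric] R(1) [symmetric] by (simp only: mult.assoc)
  also have "\<dots> = L * (p * W u * W v * p) * R"
    by (simp only: mult.assoc)
  also have "\<dots> = (L * (p * W u)) * p * (W v * p * R)"
    unfolding W by (simp only: mult.assoc)
  also have "\<dots> = p * mword U * p * mword V * p"
    unfolding L(1) [symmetric] R(1) [symmetric] by (simp only: mult.assoc)
  finally show ?thesis .
qed

subsection \<open>Identical distribution\<close>

abbreviation scalars :: "'h bop set" where
  "scalars \<equiv> range (\<lambda>c. c *\<^sub>C 1)"

text \<open>The power read so far is accumulated in \<open>k\<close>: a scalar coefficient lets it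
  grow, while a tail coefficient brings in \<open>p\<close> and closes it off as
  \<open>t (Suc k)\<close>, which does not depend on the index.\<close>

lemma compress_monomial_tl:
  assumes "set bs \<subseteq> tail \<union> scalars"
  shows "p * x i ^ k * prod_list (map (\<lambda>b. x i * b) bs) * p = p * x j ^ k * prod_list (map (\<lambda>b. x j * b) bs) * p"
  using assms
proof (induction bs arbitrary: k)
  case Nil
  then show ?case
    by (cases "k = 0") (simp_all add: compress_power)
next
  case (Cons b bs)
  let ?P = "\<lambda>i. prod_list (map (\<lambda>b. x i * b) bs)"
  have IH: "p * x i ^ k * ?P i * p = p * x j ^ k * ?P j * p" for k
    using Cons by simp
  show ?case
  proof (cases "b \<in> tail")
    case True
    have *: "p * x i ^ k * (x i * b * ?P i) * p = (p * x i ^ Suc k * p) * b * (p * x i ^ 0 * ?P i * p)" for i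
    proof -
      have "p * x i ^ k * (x i * b * ?P i) * p = p * x i ^ Suc k * (p * b * p) * ?P i * p"
        by (simp add: power_Suc2 mult.assoc tail_compressed [OF True] del: power_Suc)
      then show ?thesis
        by (simp add: mult.assoc)
    qed
    show ?thesis
      using IH [of 0] by (simp only: list.map prod_list.Cons * compress_power zero_less_Suc)
  next
    case False
    then obtain c where "b = c *\<^sub>C 1"
      using Cons.prems by auto
    then have *: "p * x i ^ k * (x i * b * ?P i) * p = c *\<^sub>C (p * x i ^ Suc k * ?P i * p)" for i
      by (simp add: power_Suc2 mult.assoc del: power_Suc)
    show ?thesis
      by (simp only: list.map prod_list.Cons * IH)
  qed
qed

lemma E_monomial:
  assumes "set bs \<subseteq> tail \<union> scalars" "bs \<noteq> []"
  shows "E (op_monomial_eval bs (x i)) = E (op_monomial_eval bs (x j))"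
proof -
  obtain b bs' where bs: "bs = b # bs'"
    using assms(2) by (cases bs) auto
  let ?P = "\<lambda>i. prod_list (map (\<lambda>b. x i * b) bs')"
  have IH: "p * ?P i * p = p * ?P j * p"
    using compress_monomial_tl [of bs' i 0 j] assms(1) by (simp add: bs)
  show ?thesis
  proof (cases "b \<in> tail")
    case True
    have *: "E (op_monomial_eval bs (x i)) = b * (p * ?P i * p)" for i
      by (simp add: E_def op_monomial_eval_def bs mult.assoc [symmetric] tail_compressed [OF True])
    show ?thesis
      unfolding * IH ..
  next
    case False
    then obtain c where "b = c *\<^sub>C 1"
      using assms(1) by (auto simp: bs)
    then have *: "E (op_monomial_eval bs (x i)) = c *\<^sub>C (p * ?P i * p)" for i
      by (simp add: E_def op_monomial_eval_def bs mult.assoc)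
    show ?thesis
      unfolding * IH ..
  qed
qed

lemma E_op_poly: "E (op_poly_eval q y) = (\<Sum>bs\<in>Poly_Mapping.keys q. Poly_Mapping.lookup q bs *\<^sub>C E (op_monomial_eval bs y))"
  by (simp add: E_def op_poly_eval_def sum_distrib_left sum_distrib_right)

lemma E_identically_distributed: "identically_distributed tail E x"
  unfolding identically_distributed_def
proof (intro allI ballI)
  fix i j q assume q: "q \<in> op_polys0 tail"
  show "E (op_poly_eval q (x i)) = E (op_poly_eval q (x j))"
    unfolding E_op_poly
  proof (intro sum.cong refl)
    fix bs assume "bs \<in> Poly_Mapping.keys q"
    then have "set bs \<subseteq> tail \<union> scalars" "bs \<noteq> []"
      using q by (auto simp: op_polys0_def)
    then show "Poly_Mapping.lookup q bs *\<^sub>C E (op_monomial_eval bs (x i)) = Poly_Mapping.lookup q bs *\<^sub>C E (op_monomial_eval bs (x j))"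
      by (subst E_monomial) auto
  qed
qed

subsection \<open>Boolean independence\<close>

lemma monomial_mword:
  assumes "set bs \<subseteq> tail \<union> scalars"
  shows "\<exists>c V. prod_list (map (\<lambda>b. x i * b) bs) = c *\<^sub>C mword V \<and> set V \<subseteq> insert (Inl i) (Inr ` tail) \<and> (bs \<noteq> [] \<longrightarrow> V \<noteq> [])"
  using assms
proof (induction bs)
  case Nil
  show ?case
    by (rule exI [of _ 1], rule exI [of _ "[]"]) (simp add: scaleC_one)
next
  case (Cons b bs)
  then obtain c V where V: "prod_list (map (\<lambda>b. x i * b) bs) = c *\<^sub>C mword V" "set V \<subseteq> insert (Inl i) (Inr ` tail)"
    by auto
  show ?case
  proof (cases "b \<in> tail")
    case True
    then show ?thesis
      using V by (intro exI [of _ c] exI [of _ "Inl i # Inr b # V"]) (simp add: mult.assoc)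
  next
    case False
    then obtain d where "b = d *\<^sub>C 1"
      using Cons.prems by auto
    then show ?thesis
      using V by (intro exI [of _ "c * d"] exI [of _ "Inl i # V"]) (simp add: scaleC_scaleC mult.commute)
  qed
qed

text \<open>A coefficient list of length at least 2 contains the variable, so \<open>V\<close> is
  nonempty and has ends that \<open>splits_after\<close> can inspect.\<close>

lemma op_monomial_mword:
  assumes "set bs \<subseteq> tail \<union> scalars" "2 \<le> length bs"
  shows "\<exists>c V. op_monomial_eval bs (x i) = c *\<^sub>C mword V \<and> set V \<subseteq> insert (Inl i) (Inr ` tail) \<and> V \<noteq> []"
proof -
  obtain b bs' where bs: "bs = b # bs'" "bs' \<noteq> []"
    using assms(2) by (cases bs) (auto simp: Suc_le_length_iff)
  obtain c V where V: "prod_list (map (\<lambda>b. x i * b) bs') = c *\<^sub>C mword V" "set V \<subseteq> insert (Inl i) (Inr ` tail)" "V \<noteq> []"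
    using monomial_mword [of bs' i] assms(1) bs by auto
  show ?thesis
  proof (cases "b \<in> tail")
    case True
    then show ?thesis
      using V by (intro exI [of _ c] exI [of _ "Inr b # V"]) (simp add: op_monomial_eval_def bs)
  next
    case False
    then obtain d where "b = d *\<^sub>C 1"
      using assms(1) by (auto simp: bs)
    then show ?thesis
      using V by (intro exI [of _ "d * c"] exI [of _ V]) (simp add: op_monomial_eval_def bs scaleC_scaleC mult.commute)
  qed
qed

text \<open>The invariant behind independence: \<open>p\<close> may be inserted before
  \<open>y\<close> after any mixed word that ends in \<open>x i\<close> or in a tail coefficient.
  Quantifying over the whole prefix \<open>U\<close> lets products be built up from the
  right.\<close>

definition splits_after :: "int \<Rightarrow> 'h bop \<Rightarrow> bool" where
  "splits_after i y \<longleftrightarrow> (\<forall>U. set U \<subseteq> mletters \<longrightarrow> U \<noteq> [] \<longrightarrow> last U \<in> insert (Inl i) (Inr ` tail) \<longrightarrow>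
     p * mword U * y * p = p * mword U * p * y * p)"

lemma splits_afterD:
  "splits_after i y \<Longrightarrow> set U \<subseteq> mletters \<Longrightarrow> U \<noteq> [] \<Longrightarrow> last U \<in> insert (Inl i) (Inr ` tail) \<Longrightarrow>
     p * mword U * y * p = p * mword U * p * y * p"
  unfolding splits_after_def by blast

lemma splits_after_one: "splits_after i 1"
  by (simp add: splits_after_def mult.assoc p_idem)

text \<open>The cut before \<open>y\<close> is available behind \<open>U @ V\<close> as well as
  behind \<open>V\<close>. It isolates \<open>V\<close>, so \<open>compress_mwords\<close> can cut
  between \<open>U\<close> and \<open>V\<close>, where the indices differ; the cut before
  \<open>y\<close> is undone afterwards.\<close>

lemma splits_after_monomial:
  assumes y: "splits_after j y" and V: "set V \<subseteq> insert (Inl j) (Inr ` tail)" "V \<noteq> []"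
  shows "p * mword V * y * p = p * mword V * p * y * p"
    and "i \<noteq> j \<Longrightarrow> splits_after i (mword V * y)"
proof -
  have Vm: "set V \<subseteq> mletters"
    using V by (auto simp: mletters_def)
  have lastV: "last V \<in> insert (Inl j) (Inr ` tail)"
    by (rule subsetD [OF V(1) last_in_set [OF V(2)]])
  show 1: "p * mword V * y * p = p * mword V * p * y * p"
    by (rule splits_afterD [OF y Vm V(2) lastV])
  show "splits_after i (mword V * y)" if "i \<noteq> j"
    unfolding splits_after_def
  proof (intro allI impI)
    fix U assume U: "set U \<subseteq> mletters" "U \<noteq> []" "last U \<in> insert (Inl i) (Inr ` tail)"
    have "p * mword (U @ V) * y * p = p * mword (U @ V) * p * y * p"
      by (rule splits_afterD [OF y]) (use U Vm V lastV in auto)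
    then have "p * mword U * (mword V * y) * p = (p * mword U * mword V * p) * y * p"
      by (simp add: mult.assoc)
    also have "p * mword U * mword V * p = p * mword U * p * mword V * p"
    proof (rule compress_mwords [OF U(1) Vm])
      fix i' assume "last U = Inl i'"
      then have "i' = i"
        using U(3) by auto
      then show "hd V \<noteq> Inl i'"
        using subsetD [OF V(1) hd_in_set [OF V(2)]] that by auto
    qed
    also have "(p * mword U * p * mword V * p) * y * p = p * mword U * (p * mword V * p * y * p)"
      by (simp only: mult.assoc)
    also have "\<dots> = p * mword U * (p * mword V * y * p)"
      by (simp only: 1)
    finally show "p * mword U * (mword V * y) * p = p * mword U * p * (mword V * y) * p"
      by (simp only: mult.assoc)
  qed
qed

lemma splits_after_poly:
  assumes y: "splits_after j y" and q: "q \<in> op_polys0 tail"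
  shows "p * op_poly_eval q (x j) * y * p = p * op_poly_eval q (x j) * p * y * p"
    and "i \<noteq> j \<Longrightarrow> splits_after i (op_poly_eval q (x j) * y)"
proof -
  have mono: "\<exists>c V. op_monomial_eval bs (x j) = c *\<^sub>C mword V \<and> set V \<subseteq> insert (Inl j) (Inr ` tail) \<and> V \<noteq> []"
    if "bs \<in> Poly_Mapping.keys q" for bs
    using q that by (intro op_monomial_mword) (auto simp: op_polys0_def)
  have "p * op_monomial_eval bs (x j) * y * p = p * op_monomial_eval bs (x j) * p * y * p"
    if "bs \<in> Poly_Mapping.keys q" for bs
    using mono [OF that] splits_after_monomial(1) [OF y] by fastforce
  then show "p * op_poly_eval q (x j) * y * p = p * op_poly_eval q (x j) * p * y * p"
    by (simp add: op_poly_eval_def sum_distrib_left sum_distrib_right)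
  show "splits_after i (op_poly_eval q (x j) * y)" if "i \<noteq> j"
    unfolding splits_after_def
  proof (intro allI impI)
    fix U assume U: "set U \<subseteq> mletters" "U \<noteq> []" "last U \<in> insert (Inl i) (Inr ` tail)"
    have "p * mword U * (op_monomial_eval bs (x j) * y) * p = p * mword U * p * (op_monomial_eval bs (x j) * y) * p"
      if bs: "bs \<in> Poly_Mapping.keys q" for bs
    proof -
      obtain c V where V: "op_monomial_eval bs (x j) = c *\<^sub>C mword V" "set V \<subseteq> insert (Inl j) (Inr ` tail)" "V \<noteq> []"
        using mono [OF bs] by (elim exE conjE)
      show ?thesis
        using splits_afterD [OF splits_after_monomial(2) [OF y V(2,3) \<open>i \<noteq> j\<close>] U] by (simp add: V(1))
    qed
    then show "p * mword U * (op_poly_eval q (x j) * y) * p = p * mword U * p * (op_poly_eval q (x j) * y) * p"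
      by (simp add: op_poly_eval_def sum_distrib_left sum_distrib_right)
  qed
qed

lemma E_boolean_independent: "boolean_independent tail E x"
  unfolding boolean_independent_def
proof (intro allI impI)
  fix ps and "is" :: "int list"
  assume *: "length ps = length is \<and> is \<noteq> [] \<and> distinct_adj is \<and> set ps \<subseteq> op_polys0 tail"
  let ?y = "\<lambda>ps is. prod_list (map2 (\<lambda>p i. op_poly_eval p (x i)) ps is)"
  let ?z = "\<lambda>ps is. prod_list (map2 (\<lambda>p i. E (op_poly_eval p (x i))) ps is)"
  have pE: "p * E a = E a" "E a * p = E a" for a
    by (simp_all add: E_def mult.assoc p_idem p_absorb)
  \<comment> \<open>One induction gives both claims: the product splits after any index other than
    its leading one, and its compression factorizes. The outer \<open>p\<close> are kept because
    \<open>?z\<close> of the empty list is 1.\<close>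
  have main: "(\<forall>i. is = [] \<or> i \<noteq> hd is \<longrightarrow> splits_after i (?y ps is)) \<and> p * ?y ps is * p = p * ?z ps is * p"
    if "length ps = length is" "distinct_adj is" "set ps \<subseteq> op_polys0 tail"
    for ps and "is" :: "int list"
    using that
  proof (induction ps "is" rule: list_induct2)
    case Nil
    then show ?case
      by (simp add: splits_after_one)
  next
    case (Cons q ps i "is")
    have d: "distinct_adj is" "is = [] \<or> i \<noteq> hd is"
      using Cons.prems(1) by (cases "is"; auto)+
    have q: "q \<in> op_polys0 tail"
      using Cons.prems by simp
    have y: "splits_after i (?y ps is)" and eq: "p * ?y ps is * p = p * ?z ps is * p"
      using Cons.IH [OF d(1)] d(2) Cons.prems(2) by auto
    have "p * ?y (q # ps) (i # is) * p = p * op_poly_eval q (x i) * ?y ps is * p"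
      by (simp add: mult.assoc)
    also have "\<dots> = p * op_poly_eval q (x i) * p * ?y ps is * p"
      by (rule splits_after_poly(1) [OF y q])
    also have "\<dots> = E (op_poly_eval q (x i)) * (p * ?y ps is * p)"
      by (simp add: E_def mult.assoc p_absorb)
    also have "\<dots> = E (op_poly_eval q (x i)) * p * ?z ps is * p"
      unfolding eq by (simp only: mult.assoc)
    also have "\<dots> = p * ?z (q # ps) (i # is) * p"
      by (simp add: pE mult.assoc [symmetric])
    finally show ?case
      using splits_after_poly(2) [OF y q] by auto
  qed
  have "?z ps is * p = ?z ps is" if "length ps = length is" "is \<noteq> []" for ps and "is" :: "int list"
    using that
  proof (induction ps "is" rule: list_induct2)
    case (Cons q ps i "is")
    then show ?case
      by (cases "is = []") (auto simp: pE mult.assoc)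
  qed simp
  moreover have "p * ?z ps is = ?z ps is"
    using * by (cases ps; cases "is") (auto simp: pE mult.assoc [symmetric])
  ultimately have "p * ?z ps is * p = ?z ps is"
    using * by simp
  then show "E (?y ps is) = ?z ps is"
    using main * by (simp add: E_def [of "?y ps is"])
qed

end

section \<open>Boolean cumulants\<close>

text \<open>The moment of the word \<open>w\<close> under \<open>E\<close> for a boolean
  independent, identically distributed sequence whose \<open>m\<close>-th moment is
  \<open>\<tau> m\<close>: one factor for each maximal run.\<close>

function run_moment :: "(nat \<Rightarrow> 'b :: monoid_mult) \<Rightarrow> 'i list \<Rightarrow> 'b" where
  "run_moment \<tau> [] = 1"
| "run_moment \<tau> (i # w) = \<tau> (Suc (length (takeWhile ((=) i) w))) * run_moment \<tau> (dropWhile ((=) i) w)"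
  by pat_completeness auto
termination
  by (relation "Wellfounded.measure (\<lambda>(\<tau>, w). length w)") (auto simp: le_imp_less_Suc length_dropWhile_le)

lemma run_moment_replicate:
  assumes "v = [] \<or> hd v \<noteq> i"
  shows "run_moment \<tau> (replicate (Suc m) i @ v) = \<tau> (Suc m) * run_moment \<tau> v"
proof -
  have "takeWhile ((=) i) (replicate m i @ v) = replicate m i" "dropWhile ((=) i) (replicate m i @ v) = v"
    using assms by (induction m; cases v; auto)+
  then show ?thesis
    by simp
qed

lemma run_moment_run_word: "runs rs \<Longrightarrow> run_moment \<tau> (run_word rs) = prod_list (map \<tau> (map snd rs))"
proof (induction rs)
  case (Cons q rs)
  obtain i m where q: "q = (i, m)"
    by (cases q)
  then obtain m' where m: "m = Suc m'"
    using Cons.prems by (cases m) (auto simp: runs_Cons)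
  have "run_word rs = [] \<or> hd (run_word rs) \<noteq> i"
    using Cons.prems hd_run_word [of rs] by (cases "rs = []") (auto simp: runs_Cons q)
  from run_moment_replicate [OF this, of \<tau> m'] show ?case
    using Cons by (simp add: q m runs_Cons)
qed simp

text \<open>Operator valued boolean cumulants, solved from the moment recursion:
  \<open>\<tau> l\<close> is the sum of \<open>bcumulant \<tau> j * \<tau> (l - j)\<close> over
  \<open>j\<close> from 1 to \<open>l\<close>, with 1 in place of \<open>\<tau> 0\<close>.\<close>

function bcumulant :: "(nat \<Rightarrow> 'b :: {ring, monoid_mult}) \<Rightarrow> nat \<Rightarrow> 'b" where
  "bcumulant \<tau> l = \<tau> l - (\<Sum>j\<in>{1..<l}. bcumulant \<tau> j * \<tau> (l - j))"
  by pat_completeness auto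
termination
  by (relation "Wellfounded.measure snd") auto

declare bcumulant.simps [simp del]

text \<open>The exceptional summand stands in for \<open>\<tau> 0\<close>, which in the application
  is \<open>E\<close> of 1 and may differ from 1.\<close>

lemma moment_bcumulant:
  assumes "m > 0"
  shows "\<tau> m = (\<Sum>l=1..m. bcumulant \<tau> l * (if l = m then 1 else \<tau> (m - l)))"
proof -
  have "{1..m} = insert m {1..<m}"
    using assms by auto
  then have "(\<Sum>l=1..m. bcumulant \<tau> l * (if l = m then 1 else \<tau> (m - l))) =
      bcumulant \<tau> m + (\<Sum>l\<in>{1..<m}. bcumulant \<tau> l * \<tau> (m - l))"
    by simp
  then show ?thesis
    using bcumulant.simps [of \<tau> m] by simp
qed

lemma run_decomposition:
  assumes "w \<noteq> []"
  obtains r v where "w = replicate (Suc r) (hd w) @ v" "v = [] \<or> hd v \<noteq> hd w"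
proof -
  obtain i u where w: "w = i # u"
    using assms by (cases w) auto
  have "takeWhile ((=) i) u = replicate (length (takeWhile ((=) i) u)) i"
    by (rule replicate_length_same [symmetric]) (auto dest: set_takeWhileD)
  then have "u = replicate (length (takeWhile ((=) i) u)) i @ dropWhile ((=) i) u"
    by (metis takeWhile_dropWhile_id)
  then have "w = replicate (Suc (length (takeWhile ((=) i) u))) (hd w) @ dropWhile ((=) i) u"
    by (simp add: w)
  moreover have "dropWhile ((=) i) u = [] \<or> hd (dropWhile ((=) i) u) \<noteq> hd w"
    using hd_dropWhile [of "(=) i" u] unfolding w list.sel by metis
  ultimately show thesis
    by (rule that)
qed

text \<open>As \<open>v\<close> begins with another letter, a constant prefix of positive length
  cannot cross the end of the leading run unless that run is empty.\<close>

lemma take_replicate_append: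
  assumes "v = [] \<or> hd v \<noteq> a" "l \<in> {1..length (replicate r a @ v)}"
  shows "take l (replicate r a @ v) = replicate l i \<longleftrightarrow> (i = a \<and> l \<le> r \<or> r = 0 \<and> take l v = replicate l i)"
proof (cases "l \<le> r")
  case True
  have "replicate l a = replicate l i \<longleftrightarrow> i = a"
    using assms(2) by (cases l) auto
  then show ?thesis
    using True assms(2) by (auto simp: min_def)
next
  case False
  then have "v \<noteq> []"
    using assms(2) by auto
  then obtain c v' where v: "v = c # v'" "c \<noteq> a"
    using assms(1) by (cases v) auto
  obtain d where d: "l - r = Suc d"
    using False by (cases "l - r") auto
  then have l: "l = r + Suc d"
    by simp
  have "replicate l i = replicate r i @ replicate (Suc d) i"
    unfolding l by (rule replicate_add)
  then have "take l (replicate r a @ v) = replicate l i \<longleftrightarrow>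
      replicate r a = replicate r i \<and> c # take d v' = i # replicate d i"
    using False by (simp add: v d min_def)
  also have "\<dots> \<longleftrightarrow> r = 0 \<and> take l v = replicate l i"
    using v(2) by (cases r) (auto simp: v(1) l)
  finally show ?thesis
    using False by auto
qed

text \<open>The sum ranges over the first blocks of the interval partitions on whose blocks \<open>w\<close> is constant.\<close>

lemma run_moment_recursion:
  assumes w: "w \<noteq> []" and J: "finite J" "set w \<subseteq> J"
  shows "run_moment \<tau> w = (\<Sum>l=1..length w. \<Sum>i\<in>J. if take l w = replicate l i
    then bcumulant \<tau> l * run_moment \<tau> (drop l w) else 0)"
proof -
  obtain r v where rv: "w = replicate (Suc r) (hd w) @ v" "v = [] \<or> hd v \<noteq> hd w"
    by (rule run_decomposition [OF w])
  define a where "a = hd w"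
  have w': "w = replicate (Suc r) a @ v" and v: "v = [] \<or> hd v \<noteq> a"
    using rv by (simp_all only: a_def)
  have aJ: "a \<in> J"
    using w J(2) by (auto simp: a_def)
  have len: "length w = Suc r + length v"
    by (subst w') simp
  \<comment> \<open>A constant prefix lies inside the leading run, so only the letter
    \<open>a\<close> and lengths up to \<open>Suc r\<close> contribute.\<close>
  have inner: "(\<Sum>i\<in>J. if take l w = replicate l i then bcumulant \<tau> l * run_moment \<tau> (drop l w) else 0) =
      (if l \<le> Suc r then bcumulant \<tau> l * run_moment \<tau> (drop l w) else 0)" if l: "l \<in> {1..length w}" for l
  proof -
    have "take l w = replicate l i \<longleftrightarrow> i = a \<and> l \<le> Suc r" for i
      using take_replicate_append [OF v, of l "Suc r" i] l unfolding w' by simp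
    then have "(\<Sum>i\<in>J. if take l w = replicate l i then bcumulant \<tau> l * run_moment \<tau> (drop l w) else 0) =
        (\<Sum>i\<in>J. if i = a then (if l \<le> Suc r then bcumulant \<tau> l * run_moment \<tau> (drop l w) else 0) else 0)"
      by (intro sum.cong) auto
    then show ?thesis
      using J(1) aJ by simp
  qed
  have drop: "run_moment \<tau> (drop l w) = (if l = Suc r then 1 else \<tau> (Suc r - l)) * run_moment \<tau> v" if "l \<le> Suc r" for l
  proof -
    have "drop l w = replicate (Suc r - l) a @ v"
      using that unfolding w' by (simp only: drop_append drop_replicate length_replicate) simp
    moreover have "run_moment \<tau> (replicate m a @ v) = (if m = 0 then 1 else \<tau> m) * run_moment \<tau> v" for m
      using run_moment_replicate [OF v, of \<tau> "m - 1"] by (cases m) auto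
    ultimately show ?thesis
      using that by auto
  qed
  have "(\<Sum>l=1..length w. \<Sum>i\<in>J. if take l w = replicate l i then bcumulant \<tau> l * run_moment \<tau> (drop l w) else 0) =
      (\<Sum>l=1..length w. if l \<le> Suc r then bcumulant \<tau> l * run_moment \<tau> (drop l w) else 0)"
    using inner by (intro sum.cong) auto
  also have "\<dots> = (\<Sum>l=1..Suc r. bcumulant \<tau> l * run_moment \<tau> (drop l w))"
    using len by (intro sum.mono_neutral_cong_right) auto
  also have "\<dots> = (\<Sum>l=1..Suc r. bcumulant \<tau> l * (if l = Suc r then 1 else \<tau> (Suc r - l)) * run_moment \<tau> v)"
    by (intro sum.cong refl) (simp only: drop atLeastAtMost_iff mult.assoc)
  also have "\<dots> = \<tau> (Suc r) * run_moment \<tau> v"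
    unfolding sum_distrib_right [symmetric] using moment_bcumulant [of "Suc r" \<tau>] by simp
  also have "\<dots> = run_moment \<tau> w"
    unfolding w' by (simp only: run_moment_replicate [OF v])
  finally show ?thesis
    by simp
qed

section \<open>Congruence modulo a seminorm\<close>

lemma nc_vars_add: "nc_vars (p + q) \<subseteq> nc_vars p \<union> nc_vars q"
  using keys_add [of p q] by (auto simp: nc_vars_def)

lemma nc_vars_mult: "nc_vars (p * q) \<subseteq> nc_vars p \<union> nc_vars (q :: ('v, 'c :: semiring_0) ncpoly)"
proof
  fix v assume "v \<in> nc_vars (p * q)"
  then obtain w where "w \<in> Poly_Mapping.keys (p * q)" "v \<in> set (letters w)"
    by (auto simp: nc_vars_def)
  moreover then obtain a b where "a \<in> Poly_Mapping.keys p" "b \<in> Poly_Mapping.keys q" "w = a + b"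
    using keys_mult [of p q] by blast
  ultimately show "v \<in> nc_vars p \<union> nc_vars q"
    by (auto simp: nc_vars_def plus_word_def)
qed

lemma free_star_algebra_add [simp]: "a \<in> free_star_algebra G \<Longrightarrow> b \<in> free_star_algebra G \<Longrightarrow> a + b \<in> free_star_algebra G"
  unfolding free_star_algebra_def using nc_vars_add [of a b] by blast

lemma free_star_algebra_mult [simp]: "a \<in> free_star_algebra G \<Longrightarrow> b \<in> free_star_algebra G \<Longrightarrow> a * b \<in> free_star_algebra G"
  unfolding free_star_algebra_def using nc_vars_mult [of a b] by blast

lemma free_star_algebra_const [simp]: "nc_const c \<in> free_star_algebra G"
  by (cases "c = 0") (auto simp: free_star_algebra_def nc_vars_def nc_const_def zero_word_def)

lemma free_star_algebra_zero [simp]: "0 \<in> free_star_algebra G"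
  using free_star_algebra_const [of 0 G] by simp

lemma free_star_algebra_one [simp]: "1 \<in> free_star_algebra G"
  using free_star_algebra_const [of 1 G] by simp

lemma nc_const_uminus_one: "nc_const (- 1) * a = (- a :: ('v, 'c :: ring_1) ncpoly)"
proof -
  have "nc_const (- 1 :: 'c) = (- 1 :: ('v, 'c) ncpoly)"
    by (simp add: nc_const_def single_uminus)
  then show ?thesis
    by simp
qed

lemma free_star_algebra_minus [simp]: "a \<in> free_star_algebra G \<Longrightarrow> - a \<in> free_star_algebra G"
  using free_star_algebra_mult [OF free_star_algebra_const [of "- 1" G], of a] by (simp add: nc_const_uminus_one)

lemma free_star_algebra_diff [simp]: "a \<in> free_star_algebra G \<Longrightarrow> b \<in> free_star_algebra G \<Longrightarrow> a - b \<in> free_star_algebra G"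
  using free_star_algebra_add [of a G "- b"] by simp

lemma free_star_algebra_gen [simp]: "g \<in> G \<Longrightarrow> gen g \<in> free_star_algebra G"
  by (auto simp: free_star_algebra_def nc_vars_def gen_def)

lemma free_star_algebra_star_gen [simp]: "g \<in> G \<Longrightarrow> star (gen g) \<in> free_star_algebra G"
  by (auto simp: free_star_algebra_def nc_vars_def gen_def star_def)

lemma free_star_algebra_sum [simp]: "(\<And>i. i \<in> I \<Longrightarrow> f i \<in> free_star_algebra G) \<Longrightarrow> (\<Sum>i\<in>I. f i) \<in> free_star_algebra G"
  by (induction I rule: infinite_finite_induct) auto

locale star_seminorm =
  fixes G :: "'g set" and q :: "'g star_poly \<Rightarrow> real"
  assumes q: "C_star_seminorm G q"
begin

abbreviation "F \<equiv> free_star_algebra G"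

lemma q_nonneg: "a \<in> F \<Longrightarrow> 0 \<le> q a"
  and q_scale: "a \<in> F \<Longrightarrow> q (nc_const c * a) = cmod c * q a"
  and q_star: "a \<in> F \<Longrightarrow> q (star a * a) = (q a)\<^sup>2"
  and q_add: "a \<in> F \<Longrightarrow> b \<in> F \<Longrightarrow> q (a + b) \<le> q a + q b"
  and q_mult: "a \<in> F \<Longrightarrow> b \<in> F \<Longrightarrow> q (a * b) \<le> q a * q b"
  using q by (auto simp: C_star_seminorm_def)

lemma q_zero: "q 0 = 0"
  using q_scale [of 0 0] by simp

lemma q_minus: "a \<in> F \<Longrightarrow> q (- a) = q a"
  using q_scale [of a "- 1"] by (simp add: nc_const_uminus_one)

text \<open>Equality modulo the null space of one seminorm; membership in \<open>F\<close> is built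
  in because the seminorm axioms hold there. By \<open>universal_C_star_eq_iff\<close> equality in
  the universal algebra may be checked for one admissible seminorm at a time.\<close>

definition eqv :: "'g star_poly \<Rightarrow> 'g star_poly \<Rightarrow> bool" (infix "\<simeq>" 50) where
  "a \<simeq> b \<longleftrightarrow> a \<in> F \<and> b \<in> F \<and> q (a - b) = 0"

lemma eqv_refl: "a \<in> F \<Longrightarrow> a \<simeq> a"
  by (simp add: eqv_def q_zero)

lemma eqv_sym: "a \<simeq> b \<Longrightarrow> b \<simeq> a"
  using q_minus [of "a - b"] by (simp add: eqv_def)

lemma null_add: "a \<in> F \<Longrightarrow> b \<in> F \<Longrightarrow> q a = 0 \<Longrightarrow> q b = 0 \<Longrightarrow> q (a + b) = 0"
  using q_add [of a b] q_nonneg [of "a + b"] by simp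

lemma null_mult: "a \<in> F \<Longrightarrow> b \<in> F \<Longrightarrow> q a = 0 \<or> q b = 0 \<Longrightarrow> q (a * b) = 0"
  using q_mult [of a b] q_nonneg [of "a * b"] by auto

lemma eqv_add: "a \<simeq> a' \<Longrightarrow> b \<simeq> b' \<Longrightarrow> a + b \<simeq> a' + b'"
  using null_add [of "a - a'" "b - b'"] by (simp add: eqv_def algebra_simps)

lemma eqv_trans [trans]: "a \<simeq> b \<Longrightarrow> b \<simeq> c \<Longrightarrow> a \<simeq> c"
  using null_add [of "a - b" "b - c"] by (simp add: eqv_def)

lemma eqv_mult:
  assumes "a \<simeq> a'" "b \<simeq> b'"
  shows "a * b \<simeq> a' * b'"
proof -
  have "q (a * (b - b') + (a - a') * b') = 0"
    using assms by (intro null_add null_mult) (auto simp: eqv_def)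
  then show ?thesis
    using assms by (simp add: eqv_def algebra_simps)
qed

lemma eqv_sum: "(\<And>i. i \<in> I \<Longrightarrow> f i \<simeq> g i) \<Longrightarrow> (\<Sum>i\<in>I. f i) \<simeq> (\<Sum>i\<in>I. g i)"
  by (induction I rule: infinite_finite_induct) (auto intro: eqv_add eqv_refl)

end

lemma coaction_word_cong:
  assumes "\<And>v. length v = length js \<Longrightarrow> set v \<subseteq> {1..n} \<Longrightarrow> \<psi> v = \<psi>' v"
  shows "coaction_word n \<psi> js = coaction_word n \<psi>' js"
  using assms
proof (induction js arbitrary: \<psi> \<psi>')
  case (Cons j js)
  have "coaction_word n (\<lambda>w. \<psi> (i # w)) js = coaction_word n (\<lambda>w. \<psi>' (i # w)) js" if "i \<in> {1..n}" for i
    using that by (intro Cons.IH Cons.prems) auto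
  then show ?case
    by simp
qed simp

lemma coaction_word_zero: "coaction_word n (\<lambda>v. 0) js = 0"
  by (induction js) auto

lemma coaction_word_add: "coaction_word n (\<lambda>v. \<psi> v + \<psi>' v) js = coaction_word n \<psi> js + coaction_word n \<psi>' js"
  by (induction js arbitrary: \<psi> \<psi>') (auto simp: nc_const_add distrib_left sum.distrib)

lemma coaction_word_sum: "coaction_word n (\<lambda>v. \<Sum>i\<in>I. \<psi> i v) js = (\<Sum>i\<in>I. coaction_word n (\<psi> i) js)"
  by (induction I rule: infinite_finite_induct) (auto simp: coaction_word_zero coaction_word_add)

text \<open>The functional vanishes unless the first \<open>l\<close> chosen indices all equal
  \<open>i\<close>, so a single term survives from the sums over these letters.\<close>

lemma coaction_word_block:
  assumes "i \<in> {1..n}" "l \<le> length js"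
  shows "coaction_word n (\<lambda>v. if take l v = replicate l i then \<theta> (drop l v) else 0) js =
    prod_list (map (u_gen i) (take l js)) * coaction_word n \<theta> (drop l js)"
  using assms(2)
proof (induction l arbitrary: js)
  case (Suc l)
  then obtain j js' where js: "js = j # js'"
    by (cases js) auto
  have "coaction_word n (\<lambda>v. if take (Suc l) (i' # v) = replicate (Suc l) i then \<theta> (drop (Suc l) (i' # v)) else 0) js' =
      (if i' = i then prod_list (map (u_gen i) (take l js')) * coaction_word n \<theta> (drop l js') else 0)" for i'
    using Suc by (simp add: js coaction_word_zero cong: if_cong)
  then have "coaction_word n (\<lambda>v. if take (Suc l) v = replicate (Suc l) i then \<theta> (drop (Suc l) v) else 0) js =
      (\<Sum>i'=1..n. if i' = i then u_gen i j * (prod_list (map (u_gen i) (take l js')) * coaction_word n \<theta> (drop l js')) else 0)"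
    unfolding js coaction_word.simps by (intro sum.cong refl) auto
  also have "\<dots> = u_gen i j * (prod_list (map (u_gen i) (take l js')) * coaction_word n \<theta> (drop l js'))"
    using assms(1) by simp
  finally show ?case
    by (simp add: js mult.assoc)
qed simp

lemma P_gen_in_F [simp]: "P_gen \<in> free_star_algebra (Bi_generators n k)"
  by (simp add: Bi_generators_def)

lemma u_gen_in_F [simp]: "i \<in> {1..n} \<Longrightarrow> j \<in> {1..k} \<Longrightarrow> u_gen i j \<in> free_star_algebra (Bi_generators n k)"
  by (simp add: Bi_generators_def)

lemma coaction_word_in_F: "set js \<subseteq> {1..k} \<Longrightarrow> coaction_word n \<psi> js \<in> free_star_algebra (Bi_generators n k)"
  by (induction js arbitrary: \<psi>) (auto intro!: free_star_algebra_sum)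

locale Bi_seminorm = star_seminorm "Bi_generators n k" q for n k q +
  assumes rel: "\<And>r. r \<in> Bi_relations n k \<Longrightarrow> q r = 0"
begin

notation eqv (infix "\<simeq>" 50)

lemma gen_idem: "g \<in> Bi_generators n k \<Longrightarrow> gen g * gen g \<simeq> gen g"
  unfolding eqv_def by (auto intro!: rel simp: Bi_relations_def)

lemma sum_u_P:
  assumes "j \<in> {1..k}"
  shows "(\<Sum>i=1..n. u_gen i j) * P_gen \<simeq> P_gen"
proof -
  have "(\<Sum>i=1..n. u_gen i j) * P_gen \<in> F"
    using assms by (intro free_star_algebra_mult free_star_algebra_sum u_gen_in_F P_gen_in_F)
  then show ?thesis
    unfolding eqv_def using assms by (intro conjI P_gen_in_F rel) (auto simp: Bi_relations_def)
qed

text \<open>For \<open>j < j'\<close> this is the order relation with equal row indices. In the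
  other case the adjoint of the product has that form, and the identity \<open>q_star\<close>
  recovers the product from its adjoint.\<close>

lemma u_orthogonal:
  assumes i: "i \<in> {1..n}" and j: "j \<in> {1..k}" "j' \<in> {1..k}" "j \<noteq> j'"
  shows "u_gen i j * u_gen i j' \<simeq> 0"
proof -
  have less: "u_gen i j * u_gen i j' \<simeq> 0" if "j < j'" "j \<in> {1..k}" "j' \<in> {1..k}" for j j'
  proof -
    have "u_gen i j * u_gen i j' \<in> Bi_relations n k"
      unfolding Bi_relations_def using i that by blast
    then show ?thesis
      using i that rel by (simp add: eqv_def)
  qed
  show ?thesis
  proof (cases "j < j'")
    case False
    then have "j' < j"
      using j by simp
    let ?y = "u_gen i j * u_gen i j'"
    have y: "?y \<in> F"
      using i j by simp
    have star_gen: "star (gen g) \<simeq> gen g" if "g \<in> Bi_generators n k" for g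
      unfolding eqv_def using that by (auto intro!: rel simp: Bi_relations_def)
    have "star ?y = star (u_gen i j') * star (u_gen i j)"
      by (simp add: star_def gen_def mult_single plus_word_def)
    also have "\<dots> \<simeq> u_gen i j' * u_gen i j"
      using i j by (intro eqv_mult star_gen) (auto simp: Bi_generators_def)
    also have "\<dots> \<simeq> 0"
      by (rule less [OF \<open>j' < j\<close> j(2,1)])
    finally have "star ?y \<simeq> 0" .
    then have "(q ?y)\<^sup>2 = 0"
      unfolding q_star [OF y, symmetric] by (intro null_mult) (use y in \<open>auto simp: eqv_def\<close>)
    then show ?thesis
      using y by (simp add: eqv_def)
  qed (use less j in blast)
qed

lemma u_prod_in_F: "i \<in> {1..n} \<Longrightarrow> set js \<subseteq> {1..k} \<Longrightarrow> prod_list (map (u_gen i) js) \<in> F"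
  by (induction js) auto

lemma u_prod_replicate:
  assumes "i \<in> {1..n}" "j \<in> {1..k}"
  shows "prod_list (map (u_gen i) (replicate (Suc l) j)) \<simeq> u_gen i j"
proof (induction l)
  case 0
  then show ?case
    using assms by (simp add: eqv_refl)
next
  case (Suc l)
  have "u_gen i j * prod_list (map (u_gen i) (replicate (Suc l) j)) \<simeq> u_gen i j * u_gen i j"
    using assms by (intro eqv_mult Suc eqv_refl) simp
  also have "\<dots> \<simeq> u_gen i j"
    using assms by (intro gen_idem) (auto simp: Bi_generators_def)
  finally show ?case
    by simp
qed

lemma u_prod_nonconstant:
  assumes i: "i \<in> {1..n}" and js: "set js \<subseteq> {1..k}" "js \<noteq> []" "js \<noteq> replicate (length js) (hd js)"
  shows "prod_list (map (u_gen i) js) \<simeq> 0"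
  using js
proof (induction js rule: induct_list012)
  case (3 j j' js)
  show ?case
  proof (cases "j = j'")
    case True
    have "prod_list (map (u_gen i) (j' # js)) \<simeq> 0"
      using 3 True by simp
    then have "u_gen i j * prod_list (map (u_gen i) (j' # js)) \<simeq> u_gen i j * 0"
      using i 3(3) by (intro eqv_mult eqv_refl) simp
    then show ?thesis
      by simp
  next
    case False
    have "(u_gen i j * u_gen i j') * prod_list (map (u_gen i) js) \<simeq> 0 * prod_list (map (u_gen i) js)"
      using i 3(3) False by (intro eqv_mult eqv_refl u_orthogonal u_prod_in_F) auto
    then show ?thesis
      by (simp add: mult.assoc)
  qed
qed auto

text \<open>Along a row, a product over a constant word is a single projection, and any other
  product vanishes by \<open>u_orthogonal\<close>. The result is written as a sum over
  \<open>j\<close> to match the shape of \<open>run_moment_recursion\<close>.\<close>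

lemma u_prod_sum:
  assumes js: "set js \<subseteq> {1..k}" "js \<noteq> []"
  shows "(\<Sum>i=1..n. prod_list (map (u_gen i) js)) * P_gen \<simeq>
    (\<Sum>j=1..k. if js = replicate (length js) j then P_gen else 0)"
proof (cases "js = replicate (length js) (hd js)")
  case True
  have hd: "hd js \<in> {1..k}"
    using js hd_in_set by blast
  obtain l where l: "length js = Suc l"
    using js(2) by (cases js) auto
  have "(\<Sum>i=1..n. prod_list (map (u_gen i) js)) \<simeq> (\<Sum>i=1..n. u_gen i (hd js))"
  proof (rule eqv_sum)
    fix i assume "i \<in> {1..n}"
    from u_prod_replicate [OF this hd, of l] show "prod_list (map (u_gen i) js) \<simeq> u_gen i (hd js)"
      by (simp only: True [unfolded l, symmetric])
  qed
  then have "(\<Sum>i=1..n. prod_list (map (u_gen i) js)) * P_gen \<simeq> (\<Sum>i=1..n. u_gen i (hd js)) * P_gen"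
    by (intro eqv_mult eqv_refl) simp_all
  also have "\<dots> \<simeq> P_gen"
    by (rule sum_u_P [OF hd])
  finally have "(\<Sum>i=1..n. prod_list (map (u_gen i) js)) * P_gen \<simeq> P_gen" .
  moreover have "(\<Sum>j=1..k. if js = replicate (length js) j then P_gen else 0) = P_gen"
  proof -
    have "js = replicate (length js) j \<longleftrightarrow> j = hd js" for j
      using True l by (metis hd_replicate nat.distinct(1))
    then have "(\<Sum>j=1..k. if js = replicate (length js) j then P_gen else 0) = (\<Sum>j=1..k. if j = hd js then P_gen else 0)"
      by simp
    then show ?thesis
      using hd by simp
  qed
  ultimately show ?thesis
    by simp
next
  case False
  have "js \<noteq> replicate (length js) j" for j
    using False js(2) by (metis hd_replicate length_0_conv)
  then have "(\<Sum>j=1..k. if js = replicate (length js) j then P_gen else 0) = 0 * P_gen"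
    by simp
  moreover have "(\<Sum>i=1..n. prod_list (map (u_gen i) js)) \<simeq> (\<Sum>i=1..n. 0)"
    by (rule eqv_sum) (rule u_prod_nonconstant [OF _ js False])
  then have "(\<Sum>i=1..n. prod_list (map (u_gen i) js)) * P_gen \<simeq> 0 * P_gen"
    by (intro eqv_mult eqv_refl) simp_all
  ultimately show ?thesis
    by simp
qed

end

context gns_space
begin

lemma bcumulant_in_A [simp]: "(\<And>m. \<tau> m \<in> A) \<Longrightarrow> bcumulant \<tau> l \<in> A"
proof (induction l rule: less_induct)
  case (less l)
  then show ?case
    by (subst bcumulant.simps) (intro A_diff A_sum A_mult; simp)
qed

lemma run_moment_in_A [simp]: "(\<And>m. \<tau> m \<in> A) \<Longrightarrow> run_moment \<tau> w \<in> A"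
  by (induction \<tau> w rule: run_moment.induct) auto

lemma phi_run_moment_recursion:
  assumes \<tau>: "\<And>m. \<tau> m \<in> A" and b: "b \<in> A" and w: "w \<noteq> []" "finite J" "set w \<subseteq> J"
  shows "\<phi> (b * run_moment \<tau> w) = (\<Sum>l=1..length w. \<Sum>i\<in>J. if take l w = replicate l i
    then \<phi> (b * bcumulant \<tau> l * run_moment \<tau> (drop l w)) else 0)"
proof -
  have if_eq: "b * (if P then c else 0) = (if P then b * c else 0)" "\<phi> (if P then c else 0) = (if P then \<phi> c else 0)" for P c
    using phi_scale [of 0 0] by simp_all
  have "\<phi> (b * run_moment \<tau> w) = \<phi> (\<Sum>l=1..length w. \<Sum>i\<in>J. if take l w = replicate l i
    then b * bcumulant \<tau> l * run_moment \<tau> (drop l w) else 0)"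
    unfolding run_moment_recursion [OF w] by (simp only: sum_distrib_left if_eq mult.assoc)
  also have "\<dots> = (\<Sum>l=1..length w. \<Sum>i\<in>J. \<phi> (if take l w = replicate l i
    then b * bcumulant \<tau> l * run_moment \<tau> (drop l w) else 0))"
    using \<tau> b by (subst phi_sum; (intro A_sum sum.cong refl phi_sum)?) simp_all
  finally show ?thesis
    by (simp only: if_eq)
qed

text \<open>Induction on the length of \<open>js\<close>. The recursion splits off a first block,
  whose cumulant joins \<open>b\<close>; the induction hypothesis collapses the coaction of the rest
  to a scalar times \<open>P_gen\<close>, and \<open>u_prod_sum\<close> collapses the block.\<close>

lemma coaction_run_moment:
  assumes "Bi_seminorm n k q" and \<tau>: "\<And>m. \<tau> m \<in> A" and b: "b \<in> A" and js: "set js \<subseteq> {1..k}"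
  shows "star_seminorm.eqv (Bi_generators n k) q (coaction_word n (\<lambda>v. \<phi> (b * run_moment \<tau> v)) js * P_gen)
    (nc_const (\<phi> (b * run_moment \<tau> js)) * P_gen)"
proof -
  interpret Bi_seminorm n k q
    by fact
  show ?thesis
    using b js
  proof (induction "length js" arbitrary: js b rule: less_induct)
    case less
    show ?case
    proof (cases "js = []")
      case True
      then show ?thesis
        by (simp add: eqv_refl)
    next
      case False
      define \<theta> where "\<theta> l v = \<phi> (b * bcumulant \<tau> l * run_moment \<tau> v)" for l and v :: "nat list"
      let ?U = "\<lambda>l i. prod_list (map (u_gen i) (take l js))"
      have take_drop: "set (take l js) \<subseteq> {1..k}" "set (drop l js) \<subseteq> {1..k}" for l
        using less.prems(2) set_take_subset [of l js] set_drop_subset [of l js] by blast+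
      have "coaction_word n (\<lambda>v. \<phi> (b * run_moment \<tau> v)) js =
          coaction_word n (\<lambda>v. \<Sum>l=1..length js. \<Sum>i=1..n. if take l v = replicate l i then \<theta> l (drop l v) else 0) js"
      proof (rule coaction_word_cong)
        fix v assume v: "length v = length js" "set v \<subseteq> {1..n}"
        then have "v \<noteq> []"
          using False by auto
        from phi_run_moment_recursion [OF \<tau> less.prems(1) this finite_atLeastAtMost v(2)]
        show "\<phi> (b * run_moment \<tau> v) = (\<Sum>l=1..length js. \<Sum>i=1..n. if take l v = replicate l i then \<theta> l (drop l v) else 0)"
          by (simp only: \<theta>_def v(1))
      qed
      also have "\<dots> = (\<Sum>l=1..length js. \<Sum>i=1..n. ?U l i * coaction_word n (\<theta> l) (drop l js))"
        unfolding coaction_word_sum by (intro sum.cong refl coaction_word_block) auto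
      finally have "coaction_word n (\<lambda>v. \<phi> (b * run_moment \<tau> v)) js * P_gen =
          (\<Sum>l=1..length js. \<Sum>i=1..n. ?U l i * (coaction_word n (\<theta> l) (drop l js) * P_gen))"
        by (simp only: sum_distrib_right mult.assoc)
      also have "\<dots> \<simeq> (\<Sum>l=1..length js. \<Sum>i=1..n. ?U l i * (nc_const (\<theta> l (drop l js)) * P_gen))"
      proof (rule eqv_sum, rule eqv_sum, rule eqv_mult)
        fix l i assume l: "l \<in> {1..length js}" and i: "i \<in> {1..n}"
        show "?U l i \<simeq> ?U l i"
          using i take_drop by (intro eqv_refl u_prod_in_F)
        have "length (drop l js) < length js"
          using l by auto
        then show "coaction_word n (\<theta> l) (drop l js) * P_gen \<simeq> nc_const (\<theta> l (drop l js)) * P_gen"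
          unfolding \<theta>_def using less.prems \<tau> take_drop by (intro less.hyps) simp_all
      qed
      also have "(\<Sum>l=1..length js. \<Sum>i=1..n. ?U l i * (nc_const (\<theta> l (drop l js)) * P_gen)) =
          (\<Sum>l=1..length js. nc_const (\<theta> l (drop l js)) * ((\<Sum>i=1..n. ?U l i) * P_gen))"
        unfolding sum_distrib_left sum_distrib_right
        by (simp only: nc_const_left_commute mult.assoc)
      also have "\<dots> \<simeq> (\<Sum>l=1..length js. nc_const (\<theta> l (drop l js)) *
          (\<Sum>j=1..k. if take l js = replicate l j then P_gen else 0))"
      proof (rule eqv_sum, rule eqv_mult [OF eqv_refl [OF free_star_algebra_const]])
        fix l assume l: "l \<in> {1..length js}"
        then have "take l js \<noteq> []" "length (take l js) = l"
          using False by auto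
        then show "(\<Sum>i=1..n. ?U l i) * P_gen \<simeq> (\<Sum>j=1..k. if take l js = replicate l j then P_gen else 0)"
          using u_prod_sum [OF take_drop(1) [of l]] by simp
      qed
      \<comment> \<open>The same recursion, now for \<open>js\<close> with letters up to
        \<open>k\<close>, read from right to left.\<close>
      also have "\<dots> = nc_const (\<phi> (b * run_moment \<tau> js)) * P_gen"
        unfolding phi_run_moment_recursion [OF \<tau> less.prems(1) False finite_atLeastAtMost less.prems(2)]
          nc_const_sum sum_distrib_left sum_distrib_right \<theta>_def
        by (intro sum.cong refl) simp
      finally show ?thesis .
    qed
  qed
qed

lemma joint_distribution_expand:
  assumes "\<And>i. y i \<in> A"
  shows "joint_distribution \<phi> y p =
    (\<Sum>w\<in>Poly_Mapping.keys p. Poly_Mapping.lookup p w * \<phi> (prod_list (map y (letters w))))"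
proof -
  have "prod_list (map y v) \<in> A" for v
    using assms by (intro A_prod_list) auto
  then show ?thesis
    by (simp add: joint_distribution_def nc_eval_def phi_sum phi_scale)
qed

text \<open>For each monomial \<open>coaction_run_moment\<close> evaluates the coaction on
  \<open>P_gen\<close>, and the left factor \<open>P_gen\<close> is absorbed by idempotence.\<close>

lemma Bi_spreadable_run_moment:
  assumes y: "\<And>i. y i \<in> A" and \<tau>: "\<And>m. \<tau> m \<in> A" and "k \<le> n"
    and moments: "\<And>v. set v \<subseteq> {1..n} \<Longrightarrow> \<phi> (prod_list (map y v)) = \<phi> (run_moment \<tau> v)"
  shows "Bi_spreadable \<phi> n k y"
  unfolding Bi_spreadable_def Bi_eq_def
proof (intro allI impI)
  fix p :: "(nat, complex) ncpoly" assume "nc_vars p \<subseteq> {1..k}"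
  then have vars: "set (letters w) \<subseteq> {1..k}" if "w \<in> Poly_Mapping.keys p" for w
    using that by (auto simp: nc_vars_def)
  let ?C = "\<lambda>w. coaction_word n (\<lambda>v. \<phi> (1 * run_moment \<tau> v)) (letters w)"
  let ?c = "Poly_Mapping.lookup p"
  have "slice (joint_distribution \<phi> y) (Bi_coaction n p) = (\<Sum>w\<in>Poly_Mapping.keys p. nc_const (?c w) * ?C w)"
    unfolding slice_coaction joint_distribution_word
    by (intro sum.cong refl arg_cong2 [where f = times] coaction_word_cong) (simp add: moments)
  then have "P_gen * slice (joint_distribution \<phi> y) (Bi_coaction n p) * P_gen =
      (\<Sum>w\<in>Poly_Mapping.keys p. P_gen * (nc_const (?c w) * ?C w) * P_gen)"
    by (simp only: sum_distrib_left sum_distrib_right)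
  also have "\<dots> = (\<Sum>w\<in>Poly_Mapping.keys p. nc_const (?c w) * (P_gen * (?C w * P_gen)))"
    by (simp only: nc_const_left_commute mult.assoc)
  finally have R: "P_gen * slice (joint_distribution \<phi> y) (Bi_coaction n p) * P_gen =
    (\<Sum>w\<in>Poly_Mapping.keys p. nc_const (?c w) * (P_gen * (?C w * P_gen)))" .
  have "joint_distribution \<phi> y p = (\<Sum>w\<in>Poly_Mapping.keys p. ?c w * \<phi> (1 * run_moment \<tau> (letters w)))"
    unfolding joint_distribution_expand [OF y]
  proof (intro sum.cong refl)
    fix w assume "w \<in> Poly_Mapping.keys p"
    then have "set (letters w) \<subseteq> {1..n}"
      using vars [of w] \<open>k \<le> n\<close> by auto
    then show "?c w * \<phi> (prod_list (map y (letters w))) = ?c w * \<phi> (1 * run_moment \<tau> (letters w))"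
      by (simp add: moments)
  qed
  then have L: "nc_const (joint_distribution \<phi> y p) * P_gen =
      (\<Sum>w\<in>Poly_Mapping.keys p. nc_const (?c w) * (nc_const (\<phi> (1 * run_moment \<tau> (letters w))) * P_gen))"
    by (simp only: nc_const_sum nc_const_mult sum_distrib_right mult.assoc)
  show "universal_C_star_eq (Bi_generators n k) (Bi_relations n k) (nc_const (joint_distribution \<phi> y p) * P_gen)
      (P_gen * slice (joint_distribution \<phi> y) (Bi_coaction n p) * P_gen)"
    unfolding L R
  proof (subst universal_C_star_eq_iff)
    show "(\<Sum>w\<in>Poly_Mapping.keys p. nc_const (?c w) * (nc_const (\<phi> (1 * run_moment \<tau> (letters w))) * P_gen)) -
        (\<Sum>w\<in>Poly_Mapping.keys p. nc_const (?c w) * (P_gen * (?C w * P_gen))) \<in> free_star_algebra (Bi_generators n k)"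
      by (intro free_star_algebra_diff free_star_algebra_sum free_star_algebra_mult free_star_algebra_const P_gen_in_F coaction_word_in_F vars)
    show "\<forall>q. C_star_seminorm (Bi_generators n k) q \<and> (\<forall>r\<in>Bi_relations n k. q r = 0) \<longrightarrow>
      q ((\<Sum>w\<in>Poly_Mapping.keys p. nc_const (?c w) * (nc_const (\<phi> (1 * run_moment \<tau> (letters w))) * P_gen)) -
        (\<Sum>w\<in>Poly_Mapping.keys p. nc_const (?c w) * (P_gen * (?C w * P_gen)))) = 0"
    proof (intro allI impI)
      fix q assume "C_star_seminorm (Bi_generators n k) q \<and> (\<forall>r\<in>Bi_relations n k. q r = 0)"
      then interpret Bi_seminorm n k q
        by unfold_locales auto
      have "(\<Sum>w\<in>Poly_Mapping.keys p. nc_const (?c w) * (nc_const (\<phi> (1 * run_moment \<tau> (letters w))) * P_gen)) \<simeq>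
        (\<Sum>w\<in>Poly_Mapping.keys p. nc_const (?c w) * (P_gen * (?C w * P_gen)))"
      proof (rule eqv_sum, rule eqv_mult [OF eqv_refl [OF free_star_algebra_const]])
        fix w assume w: "w \<in> Poly_Mapping.keys p"
        let ?d = "nc_const (\<phi> (1 * run_moment \<tau> (letters w)))"
        have "P_gen * (?C w * P_gen) \<simeq> P_gen * (?d * P_gen)"
          by (rule eqv_mult [OF eqv_refl [OF P_gen_in_F] coaction_run_moment [OF Bi_seminorm_axioms \<tau> A_one vars [OF w]]])
        also have "P_gen * (?d * P_gen) = ?d * (P_gen * P_gen)"
          by (simp only: nc_const_left_commute)
        also have "\<dots> \<simeq> ?d * P_gen"
          by (intro eqv_mult eqv_refl free_star_algebra_const gen_idem) (simp add: Bi_generators_def)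
        finally show "?d * P_gen \<simeq> P_gen * (?C w * P_gen)"
          by (rule eqv_sym)
      qed
      then show "q ((\<Sum>w\<in>Poly_Mapping.keys p. nc_const (?c w) * (nc_const (\<phi> (1 * run_moment \<tau> (letters w))) * P_gen)) -
        (\<Sum>w\<in>Poly_Mapping.keys p. nc_const (?c w) * (P_gen * (?C w * P_gen)))) = 0"
        by (simp only: eqv_def)
    qed
  qed
qed

end

section \<open>From boolean independence back to spreadability\<close>

lemma E_run_prod:
  fixes x :: "'i \<Rightarrow> 'h :: complex_hilbert bop"
  assumes "identically_distributed B E x" "boolean_independent B E x" and rs: "runs rs" "rs \<noteq> []"
  shows "E (run_prod (\<lambda>i m. x i ^ m) rs) = prod_list (map (\<lambda>m. E (x i0 ^ m)) (map snd rs))"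
proof -
  \<comment> \<open>The monomial \<open>X ^ m\<close> has \<open>m + 1\<close> coefficients equal to
    1; they enter as scalars, since 1 need not lie in \<open>B\<close>.\<close>
  define mono where "mono m = (Poly_Mapping.single (replicate (Suc m) 1) 1 :: 'h bop op_poly)" for m
  have mono_eval: "op_poly_eval (mono m) y = y ^ m" for m y
    by (simp add: mono_def op_poly_eval_def op_monomial_eval_def scaleC_one)
  have "(1 :: 'h bop) \<in> range (\<lambda>c. c *\<^sub>C 1)"
    by (rule range_eqI [of _ _ 1]) (simp add: scaleC_one)
  then have mono_in: "mono m \<in> op_polys0 B" if "m > 0" for m
    using that by (auto simp: mono_def op_polys0_def)
  have map2: "map2 f (map g rs) (map h rs) = map (\<lambda>r. f (g r) (h r)) rs" for f :: "'b \<Rightarrow> 'c \<Rightarrow> 'h bop" and g h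
    by (induction rs) auto
  have m: "0 < m" if "(i, m) \<in> set rs" for i m
    using rs(1) that by (auto simp: runs_def)
  have "E (prod_list (map2 (\<lambda>p i. op_poly_eval p (x i)) (map (\<lambda>r. mono (snd r)) rs) (map fst rs))) =
      prod_list (map2 (\<lambda>p i. E (op_poly_eval p (x i))) (map (\<lambda>r. mono (snd r)) rs) (map fst rs))"
  proof (rule assms(2) [unfolded boolean_independent_def, rule_format], intro conjI)
    show "distinct_adj (map fst rs)"
      using rs(1) by (simp add: runs_def)
    show "set (map (\<lambda>r. mono (snd r)) rs) \<subseteq> op_polys0 B"
      using m mono_in by auto
  qed (use rs(2) in simp_all)
  then have "E (run_prod (\<lambda>i m. x i ^ m) rs) = prod_list (map (\<lambda>r. E (x (fst r) ^ snd r)) rs)"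
    unfolding map2 mono_eval by (simp add: run_prod_def case_prod_beta')
  moreover have "E (x i ^ m) = E (x i0 ^ m)" if "(i, m) \<in> set rs" for i m
    using assms(1) mono_in [OF m [OF that]] by (metis identically_distributed_def mono_eval)
  ultimately show ?thesis
    by (simp add: case_prod_beta' cong: map_cong)
qed

context gns_sequence
begin

text \<open>\<open>E\<close> evaluates a word run by run with \<open>\<tau> m = E (x 0 ^ m)\<close>,
  and \<open>\<phi>\<close> is preserved, so all moments have the form that
  \<open>Bi_spreadable_run_moment\<close> asks for. Injectivity of the index map keeps distinct runs
  distinct.\<close>

lemma spreadable_if_boolean_independent:
  assumes "B \<subseteq> A" "E ` A = B" and phi_E: "\<And>a. a \<in> A \<Longrightarrow> \<phi> (E a) = \<phi> a"
    and id: "identically_distributed B E x" and ind: "boolean_independent B E x"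
  shows "boolean_spreadable_family \<phi> x"
  unfolding boolean_spreadable_family_def boolean_spreadable_def
proof (intro allI impI)
  fix n k and i :: "nat \<Rightarrow> int" assume i: "strict_mono_on {1..n} i" and k: "1 \<le> k \<and> k < (n :: nat)"
  let ?\<tau> = "\<lambda>m. E (x 0 ^ m)"
  have \<tau>: "?\<tau> m \<in> A" for m
    using assms(1,2) by auto
  show "Bi_spreadable \<phi> n k (\<lambda>m. x (i m))"
  proof (rule Bi_spreadable_run_moment [OF xA \<tau>])
    fix v :: "nat list" assume v: "set v \<subseteq> {1..n}"
    show "\<phi> (prod_list (map (\<lambda>m. x (i m)) v)) = \<phi> (run_moment ?\<tau> v)"
    proof (cases "v = []")
      case False
      obtain rs where rs: "runs rs" "run_word rs = v" "fst ` set rs = set v"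
        using ex_runs [of v] by (elim exE conjE)
      let ?rs = "map (\<lambda>(j, m). (i j, m)) rs"
      have ne: "?rs \<noteq> []"
        using False rs(2) by auto
      have "inj_on i (fst ` set rs)"
        unfolding rs(3) using i v by (meson inj_on_subset strict_mono_on_imp_inj_on)
      then have runs: "runs ?rs"
        by (rule runs_map [OF rs(1)])
      have "prod_list (map (\<lambda>m. x (i m)) v) = run_prod (\<lambda>j m. x j ^ m) ?rs"
        unfolding rs(2) [symmetric] prod_list_run_word by (simp add: run_prod_def case_prod_beta' comp_def)
      moreover have "run_prod (\<lambda>j m. x j ^ m) ?rs \<in> A"
        by (rule run_prod_in_A) simp
      ultimately have "\<phi> (prod_list (map (\<lambda>m. x (i m)) v)) = \<phi> (E (run_prod (\<lambda>j m. x j ^ m) ?rs))"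
        by (simp only: phi_E)
      also have "E (run_prod (\<lambda>j m. x j ^ m) ?rs) = prod_list (map ?\<tau> (map snd ?rs))"
        by (rule E_run_prod [OF id ind runs ne])
      also have "map snd ?rs = map snd rs"
        by auto
      also have "prod_list (map ?\<tau> (map snd rs)) = run_moment ?\<tau> v"
        unfolding rs(2) [symmetric] by (rule run_moment_run_word [OF rs(1), symmetric])
      finally show ?thesis .
    qed simp
  qed (use k in simp)
qed

end

theorem theorem1p3:
  fixes A :: "'h :: complex_hilbert bop set" and \<phi> :: "'h bop \<Rightarrow> complex"
    and \<pi> :: "'h bop \<Rightarrow> 'k :: complex_hilbert bop" and \<Omega> :: 'k
    and x :: "int \<Rightarrow> 'h bop"
  assumes "nondegenerate_W_prob_space A \<phi>"
    and "gns_representation A \<phi> \<pi> \<Omega>"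
    and "\<And>i. x i \<in> A" and "\<And>i. adj (x i) = x i"
    and "von_neumann_algebra hull (range x) = A"
    and "1 \<in> gns_wot_closure A \<pi> (nonunital_algebra hull (range x))"
  shows "boolean_spreadable_family \<phi> x \<longleftrightarrow>
    (\<exists>E. conditional_expectation A (tail_algebra A \<pi> x) E \<and> (\<forall>a\<in>A. \<phi> (E a) = \<phi> a) \<and>
       identically_distributed (tail_algebra A \<pi> x) E x \<and>
       boolean_independent (tail_algebra A \<pi> x) E x)"
proof
  interpret gns_sequence A \<phi> \<pi> \<Omega> x
    by unfold_locales (fact assms)+
  {
    assume "boolean_spreadable_family \<phi> x"
    then interpret spreadable_sequence A \<phi> \<pi> \<Omega> x
      by unfold_locales
    show "\<exists>E. conditional_expectation A (tail_algebra A \<pi> x) E \<and> (\<forall>a\<in>A. \<phi> (E a) = \<phi> a) \<and>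
        identically_distributed (tail_algebra A \<pi> x) E x \<and> boolean_independent (tail_algebra A \<pi> x) E x"
      using E_conditional_expectation phi_E E_identically_distributed E_boolean_independent
      unfolding tail_def by blast
  }
  {
    assume "\<exists>E. conditional_expectation A (tail_algebra A \<pi> x) E \<and> (\<forall>a\<in>A. \<phi> (E a) = \<phi> a) \<and>
        identically_distributed (tail_algebra A \<pi> x) E x \<and> boolean_independent (tail_algebra A \<pi> x) E x"
    then obtain E where "conditional_expectation A (tail_algebra A \<pi> x) E" "\<And>a. a \<in> A \<Longrightarrow> \<phi> (E a) = \<phi> a"
        "identically_distributed (tail_algebra A \<pi> x) E x" "boolean_independent (tail_algebra A \<pi> x) E x"
      by blast
    moreover have "tail_algebra A \<pi> x \<subseteq> A"
      unfolding tail_algebra_def gns_wot_closure_def by (rule INF_lower2 [of 1]) auto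
    ultimately show "boolean_spreadable_family \<phi> x"
      using spreadable_if_boolean_independent [of "tail_algebra A \<pi> x" E] by (simp add: conditional_expectation_def)
  }
qed

end
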